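(* Let $(c_1,c_2)$ satisfy $-1.25<c_1<0$, $0<c_2<1.25$, $-c_1+2c_2<2$ and $$-c_1+6c_2-4>(-c_1+2c_2-1)^4 .$$ Consider the system for $u=(u_1,u_2):\mathbb R\to\mathbb R^8\oplus\mathbb R^8$ with parameter $\alpha\in(0,\infty)$, $$\frac{d}{dx}u(x)=\begin{bmatrix}u_2(x)\\ c_1u_1(x)+q(u_1(x))+c_2Bu_1(x)+\int_{-\infty}^\infty u_1(x-y)k_\alpha(y)\,dy\end{bmatrix},\qquad k_\alpha(y)=\frac1{\sqrt{2\pi\alpha^2}}e^{-\frac{y^2}{2\alpha^2}},$$ where $B$ is the $8\times8$ cube coupling matrix and $q$ is as in the context. Then: (i) $(\alpha_o,0)$, where $\alpha_o=\sqrt{-2\ln(-c_1+2c_2-1)}$, is a bifurcation point of $2\pi$-periodic solutions to this system; (ii) there exist at least: - 3 bifurcating branches with symmetry at least $(D_4\,{}^{\mathbb Z_1}\!\times_{D_4}D_4)$, - 6 bifurcating branches with symmetry at least $(D_2\,{}^{D_1}\!\times_{\mathbb Z_2}D_2)$, and - 3 bifurcating branches with symmetry at least $(D_4\,{}^{\mathbb Z_4}\!\times_{\mathbb Z_2}D_2)$.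
   Context: **Nonlinearity.** $q:\mathbb R\to\mathbb R$ is continuous, $q(0)=0$, differentiable at $0$ with $q'(0)=0$, and acts on $\mathbb R^8$ componentwise. **Coupling matrix.** The indices $1,\dots,8$ are the vertices of a cube, with edges $12,23,34,41,56,67,78,85,15,26,37,48$; $B$ has diagonal entries $-3$, entries $1$ for pairs of adjacent vertices, and $0$ otherwise. **Symmetry.** $\Gamma=S_4$ is the group of orientation-preserving symmetries of the cube, acting on $\mathbb R^8$ by permuting the vertices (diagonally on $\mathbb R^8\oplus\mathbb R^8$). $G=S_4\times O(2)$ acts on $\mathscr W=H^1(S^1;\mathbb R^8\oplus\mathbb R^8)$, $S^1=\mathbb R/2\pi\mathbb Z$, by $(\gamma u)(t)=\gamma u(t)$, $(e^{i\theta}u)(t)=u(t+\theta)$, $(\kappa u)(t)=(u_1(-t),-u_2(-t))$, where $\kappa\in O(2)$ is the reflection. **Subgroup notation.** For $H\le S_4$ and $K\le O(2)$ with epimorphisms $\varphi:H\to L$, $\psi:K\to L$, $\ker\varphi=Z_H$, the class $(H\,{}^{Z_H}\!\times_LK)$ is the conjugacy class in $G$ of $\{(h,k)\in H\times K:\varphi(h)=\psi(k)\}$. In $O(2)$, $D_n$ is the dihedral group of order $2n$ generated by rotation by $2\pi/n$ and $\kappa$. When $K=D_{2n}$ and $L=\mathbb Z_2$ one has $\ker\psi=D_n$; when $K=D_{4n}$ and $L=D_4$ one has $\ker\psi=\mathbb Z_n$ ($n=1$ in the claim). In $S_4$ (up to conjugacy): $\mathbb Z_1$ is trivial, $D_1$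 is generated by a transposition, $\mathbb Z_4$ by a 4-cycle, $D_2$ is the non-normal Klein four-group (generated by two disjoint transpositions), $D_4$ is the dihedral group of order 8 (a Sylow 2-subgroup). These data determine the three conjugacy classes in the claim uniquely. **Bifurcation.** Write $\mathfrak S\subset\mathbb R\times\mathscr W$ for the set of $(\alpha,u)$ with $u$ a $2\pi$-periodic solution of the system for parameter value $\alpha$. Let $\Omega=\{(\alpha,u)\in\mathbb R\times\mathscr W:|\alpha-\alpha_o|<\rho,\ \|u\|<r\}$, with $\rho,r>0$ such that $\alpha_o$ is the only $\alpha\in[\alpha_o-\rho,\alpha_o+\rho]$ for which the linearization of the system at $0$ has a nonzero solution of the form $e^{ikx}v$, $k\in\{1,2,\dots\}$, and such that the system has no solution $u\in\mathscr W$, $0<\|u\|\le r$, for $|\alpha-\alpha_o|=\rho$. A branch (of nontrivial $2\pi$-periodic solutions) bifurcating from $(\alpha_o,0)$ is a compact connected component $\mathscr C$ of $\overline{\{(\alpha,u)\in\Omega\cap\mathfrak S:u\neq0\}}$ containing $(\alpha_o,0)$ and containing nontrivial functions $u\ne0$; $(\alpha_o,0)$ is a bifurcation point if such a branch exists. A branch has symmetry at least $(H)$ if $\mathscr C\subset\mathbb R\times\mathscr W^{H'}$ for some $H'\in(H)$, where $\mathscr W^{H'}$ is the set of $H'$-fixed points.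
   Formalization: Only one component can contain (α_o,0), so several branches as defined cannot exist; in (ii) a branch with symmetry at least (H) is a component of the closure of the nontrivial solutions in R×W^{H'} for some H' in (H), and branches are counted up to the O(2)-action. *)

theory Defs
  imports
    "HOL-Probability.Probability"
    "HOL-Algebra.Elementary_Groups"
    "HOL-Algebra.Generated_Groups"
    "HOL-Algebra.Sym_Groups"
begin

section \<open>The Sobolev space of periodic functions\<close>

text \<open>
  Elements of $H^1(S^1;V)$ are represented by their continuous representatives: $2\pi$-periodic
  functions on the real line that are locally absolutely continuous with locally square integrable
  (weak) derivative.
\<close>

definition has_L2_deriv :: "(real \<Rightarrow> 'a::euclidean_space) \<Rightarrow> (real \<Rightarrow> 'a) \<Rightarrow> bool" where
  "has_L2_deriv u v \<longleftrightarrow>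
     v \<in> borel_measurable borel \<and>
     (\<forall>a b. set_integrable lborel {a..b} (\<lambda>t. (norm (v t))\<^sup>2)) \<and>
     (\<forall>a b. a \<le> b \<longrightarrow> u b - u a = (LBINT t:{a..b}. v t))"

lemma has_L2_deriv_integrable:
  assumes "has_L2_deriv u v" shows "set_integrable lborel {a..b} v"
proof -
  have m: "v \<in> borel_measurable borel" and i: "set_integrable lborel {a..b} (\<lambda>t. (norm (v t))\<^sup>2)"
    using assms by (auto simp: has_L2_deriv_def)
  have c: "set_integrable lborel {a..b} (\<lambda>t. 1::real)"
    by (simp add: set_integrable_def integrable_indicator_iff emeasure_lborel_Icc_eq)
  have "set_integrable lborel {a..b} (\<lambda>t. (norm (v t))\<^sup>2 + 1)"
    using i c by (rule set_integral_add)
  then show ?thesis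
    unfolding set_integrable_def
  proof (rule Bochner_Integration.integrable_bound)
    show "(\<lambda>x. indicat_real {a..b} x *\<^sub>R v x) \<in> borel_measurable lborel" using m by measurable
    have "norm (v x) \<le> (norm (v x))\<^sup>2 + 1" for x
      using sum_power2_ge_zero[of "norm (v x) - 1" 0] by (simp add: power2_eq_square algebra_simps)
         (smt (verit) mult_nonneg_nonneg norm_ge_zero)
    then show "AE x in lborel. norm (indicat_real {a..b} x *\<^sub>R v x) \<le> norm (indicat_real {a..b} x *\<^sub>R ((norm (v x))\<^sup>2 + 1))"
      by (auto simp: indicator_def)
  qed
qed

lemma has_L2_deriv_add:
  assumes "has_L2_deriv u v" "has_L2_deriv u' v'"
  shows "has_L2_deriv (\<lambda>t. u t + u' t) (\<lambda>t. v t + v' t)"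
  unfolding has_L2_deriv_def
proof (intro conjI allI impI)
  have m: "v \<in> borel_measurable borel" "v' \<in> borel_measurable borel"
    using assms by (auto simp: has_L2_deriv_def)
  then show "(\<lambda>t. v t + v' t) \<in> borel_measurable borel" by measurable
  fix a b :: real
  have "set_integrable lborel {a..b} (\<lambda>t. 2 * (norm (v t))\<^sup>2 + 2 * (norm (v' t))\<^sup>2)"
    using assms by (intro set_integral_add set_integrable_mult_right) (auto simp: has_L2_deriv_def)
  then show "set_integrable lborel {a..b} (\<lambda>t. (norm (v t + v' t))\<^sup>2)"
    unfolding set_integrable_def
  proof (rule Bochner_Integration.integrable_bound)
    show "(\<lambda>x. indicat_real {a..b} x *\<^sub>R (norm (v x + v' x))\<^sup>2) \<in> borel_measurable lborel" using m by measurable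
    have "(norm (v x + v' x))\<^sup>2 \<le> 2 * (norm (v x))\<^sup>2 + 2 * (norm (v' x))\<^sup>2" for x
    proof -
      have "(norm (v x + v' x))\<^sup>2 \<le> (norm (v x) + norm (v' x))\<^sup>2"
        by (simp add: norm_triangle_ineq power_mono)
      also have "\<dots> \<le> 2 * (norm (v x))\<^sup>2 + 2 * (norm (v' x))\<^sup>2"
        using zero_le_power2[of "norm (v x) - norm (v' x)"] by (simp add: power2_eq_square algebra_simps)
      finally show ?thesis .
    qed
    then show "AE x in lborel. norm (indicat_real {a..b} x *\<^sub>R (norm (v x + v' x))\<^sup>2)
        \<le> norm (indicat_real {a..b} x *\<^sub>R (2 * (norm (v x))\<^sup>2 + 2 * (norm (v' x))\<^sup>2))"
      by (auto simp: indicator_def)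
  qed
  assume "a \<le> b"
  then show "u b + u' b - (u a + u' a) = (LBINT t:{a..b}. v t + v' t)"
    using assms set_integral_add(2)[OF has_L2_deriv_integrable[OF assms(1)] has_L2_deriv_integrable[OF assms(2)], of a b]
    by (auto simp: has_L2_deriv_def algebra_simps)
qed

lemma has_L2_deriv_linear:
  fixes f :: "'a::euclidean_space \<Rightarrow> 'b::euclidean_space"
  assumes "linear f" "has_L2_deriv u v"
  shows "has_L2_deriv (\<lambda>t. f (u t)) (\<lambda>t. f (v t))"
proof -
  interpret f: bounded_linear f using assms(1) by (simp add: linear_conv_bounded_linear)
  obtain K where K: "\<And>x. norm (f x) \<le> norm x * K" using f.bounded by blast
  have [measurable]: "f \<in> borel_measurable borel"
    using linear_continuous_on[OF f.bounded_linear_axioms] by (rule borel_measurable_continuous_onI)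
  have m[measurable]: "v \<in> borel_measurable borel" using assms by (auto simp: has_L2_deriv_def)
  show ?thesis unfolding has_L2_deriv_def
  proof (intro conjI allI impI)
    show "(\<lambda>t. f (v t)) \<in> borel_measurable borel" by measurable
    fix a b :: real
    have "set_integrable lborel {a..b} (\<lambda>t. K\<^sup>2 * (norm (v t))\<^sup>2)"
      using assms by (intro set_integrable_mult_right) (auto simp: has_L2_deriv_def)
    then show "set_integrable lborel {a..b} (\<lambda>t. (norm (f (v t)))\<^sup>2)"
      unfolding set_integrable_def
    proof (rule Bochner_Integration.integrable_bound)
      show "(\<lambda>x. indicat_real {a..b} x *\<^sub>R (norm (f (v x)))\<^sup>2) \<in> borel_measurable lborel" by measurable
      have "(norm (f (v x)))\<^sup>2 \<le> K\<^sup>2 * (norm (v x))\<^sup>2" for x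
        using power_mono[OF K[of "v x"] norm_ge_zero, of 2] by (simp add: power_mult_distrib mult.commute)
      then show "AE x in lborel. norm (indicat_real {a..b} x *\<^sub>R (norm (f (v x)))\<^sup>2)
          \<le> norm (indicat_real {a..b} x *\<^sub>R (K\<^sup>2 * (norm (v x))\<^sup>2))"
        by (auto simp: indicator_def)
    qed
    assume "a \<le> b"
    then have "u b - u a = (LBINT t:{a..b}. v t)" using assms by (auto simp: has_L2_deriv_def)
    then have "f (u b) - f (u a) = f (LBINT t:{a..b}. v t)" by (simp add: f.diff[symmetric])
    also have "\<dots> = (LBINT t:{a..b}. f (v t))"
      using has_L2_deriv_integrable[OF assms(2), of a b]
      by (simp add: set_lebesgue_integral_def set_integrable_def f.scaleR[symmetric] integral_bounded_linear[OF f.bounded_linear_axioms])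
    finally show "f (u b) - f (u a) = (LBINT t:{a..b}. f (v t))" .
  qed
qed

lemma has_L2_deriv_scaleR:
  assumes "has_L2_deriv u v"
  shows "has_L2_deriv (\<lambda>t. c *\<^sub>R u t) (\<lambda>t. c *\<^sub>R v t)"
  by (rule has_L2_deriv_linear[OF _ assms]) (simp add: linear_scale_self)

lemma has_L2_deriv_const: "has_L2_deriv (\<lambda>_. c) (\<lambda>_. 0)"
  by (auto simp: has_L2_deriv_def set_integrable_def set_lebesgue_integral_def)

lemma has_L2_deriv_shift:
  assumes "has_L2_deriv u v"
  shows "has_L2_deriv (\<lambda>t. u (t + s)) (\<lambda>t. v (t + s))"
proof -
  have m[measurable]: "v \<in> borel_measurable borel" using assms by (auto simp: has_L2_deriv_def)
  show ?thesis unfolding has_L2_deriv_def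
  proof (intro conjI allI impI)
    show "(\<lambda>t. v (t + s)) \<in> borel_measurable borel" by measurable
    fix a b :: real
    have ind: "indicat_real {a+s..b+s} (x + s) = indicator {a..b} x" for x by (auto simp: indicator_def)
    have "set_integrable lborel {a+s..b+s} (\<lambda>t. (norm (v t))\<^sup>2)" using assms by (auto simp: has_L2_deriv_def)
    then show "set_integrable lborel {a..b} (\<lambda>t. (norm (v (t + s)))\<^sup>2)"
      using lborel_integrable_real_affine_iff[of 1 "\<lambda>t. indicator {a+s..b+s} t *\<^sub>R (norm (v t))\<^sup>2" s]
      by (simp add: set_integrable_def ind add.commute)
    assume "a \<le> b"
    then have "u (b+s) - u (a+s) = (LBINT t:{a+s..b+s}. v t)" using assms by (auto simp: has_L2_deriv_def)
    also have "\<dots> = (LBINT t:{a..b}. v (t + s))"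
      using lborel_integral_real_affine[of 1 "\<lambda>t. indicator {a+s..b+s} t *\<^sub>R v t" s]
      by (simp add: set_lebesgue_integral_def ind add.commute)
    finally show "u (b+s) - u (a+s) = (LBINT t:{a..b}. v (t + s))" .
  qed
qed

lemma has_L2_deriv_reflect:
  assumes "has_L2_deriv u v"
  shows "has_L2_deriv (\<lambda>t. u (- t)) (\<lambda>t. - v (- t))"
proof -
  have m[measurable]: "v \<in> borel_measurable borel" using assms by (auto simp: has_L2_deriv_def)
  show ?thesis unfolding has_L2_deriv_def
  proof (intro conjI allI impI)
    show "(\<lambda>t. - v (- t)) \<in> borel_measurable borel" by measurable
    fix a b :: real
    have ind: "indicat_real {-b..-a} (- x) = indicator {a..b} x" for x by (auto simp: indicator_def)
    have "set_integrable lborel {-b..-a} (\<lambda>t. (norm (v t))\<^sup>2)" using assms by (auto simp: has_L2_deriv_def)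
    then show "set_integrable lborel {a..b} (\<lambda>t. (norm (- v (- t)))\<^sup>2)"
      using lborel_integrable_real_affine_iff[of "-1" "\<lambda>t. indicator {-b..-a} t *\<^sub>R (norm (v t))\<^sup>2" 0]
      by (simp add: set_integrable_def ind)
    assume "a \<le> b"
    then have "u (-a) - u (-b) = (LBINT t:{-b..-a}. v t)" using assms by (auto simp: has_L2_deriv_def)
    also have "\<dots> = (LBINT t:{a..b}. v (- t))"
      using lborel_integral_real_affine[of "-1" "\<lambda>t. indicator {-b..-a} t *\<^sub>R v t" 0]
      by (simp add: set_lebesgue_integral_def ind)
    finally show "u (-b) - u (-a) = (LBINT t:{a..b}. - v (- t))" 
      by (simp add: set_lebesgue_integral_def algebra_simps)
  qed
qed

lemma AE_eq_0_if_interval_integrals_0: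
  fixes f :: "real \<Rightarrow> 'a::euclidean_space"
  assumes int: "\<And>a b. set_integrable lborel {a..b} f"
    and zero: "\<And>a b. a \<le> b \<Longrightarrow> (LBINT t:{a..b}. f t) = 0"
  shows "AE t in lborel. f t = 0"
proof -
  have z: "AE t in lborel. indicat_real {-real n..real n} t *\<^sub>R f t = 0" for n :: nat
  proof (rule sigma_finite_measure.density_zero[OF sigma_finite_lborel])
    let ?g = "\<lambda>t. indicat_real {-real n..real n} t *\<^sub>R f t"
    show i: "integrable lborel ?g" using int by (simp add: set_integrable_def)
    fix A :: "real set" assume "A \<in> sets lborel"
    then have "A \<in> sets borel" by simp
    then show "set_lebesgue_integral lborel A ?g = 0"
    proof (induction rule: borel_set_induct)
      case empty
      show ?case by (simp add: set_lebesgue_integral_def)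
    next
      case (interval a b)
      have "indicat_real {a..b} t *\<^sub>R ?g t = indicat_real {max a (- real n)..min b (real n)} t *\<^sub>R f t" for t
        by (auto simp: indicator_def)
      then have "set_lebesgue_integral lborel {a..b} ?g = (LBINT t:{max a (- real n)..min b (real n)}. f t)"
        unfolding set_lebesgue_integral_def by (simp only:)
      also have "\<dots> = 0"
        using zero by (cases "max a (- real n) \<le> min b (real n)") (simp_all add: set_lebesgue_integral_def)
      finally show ?case .
    next
      case (compl A)
      have tot: "integral\<^sup>L lborel ?g = 0"
        using zero[of "- real n" "real n"] by (simp add: set_lebesgue_integral_def)
      have "indicat_real (- A) t *\<^sub>R ?g t = ?g t - indicat_real A t *\<^sub>R ?g t" for t
        by (auto simp: indicator_def)
      then have "set_lebesgue_integral lborel (- A) ?g = (LBINT t. ?g t - indicat_real A t *\<^sub>R ?g t)"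
        by (simp add: set_lebesgue_integral_def)
      also have "\<dots> = (LBINT t. ?g t) - (LBINT t. indicat_real A t *\<^sub>R ?g t)"
        using i integrable_mult_indicator[OF _ i, of A] compl.hyps
        by (intro Bochner_Integration.integral_diff) auto
      also have "\<dots> = 0"
        using tot compl.IH by (simp add: set_lebesgue_integral_def)
      finally show ?case .
    next
      case (union F)
      have "set_integrable lborel (\<Union>i. F i) ?g"
        unfolding set_integrable_def using union by (intro integrable_mult_indicator[OF _ i]) auto
      then have "set_lebesgue_integral lborel (\<Union>i. F i) ?g = (\<Sum>i. set_lebesgue_integral lborel (F i) ?g)"
        using union by (intro lebesgue_integral_countable_add) (auto simp: disjoint_family_on_def)
      then show ?case using union by simp
    qed
  qed
  have "AE t in lborel. \<forall>n. indicat_real {-real n..real n} t *\<^sub>R f t = 0"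
    by (simp only: AE_all_countable z HOL.simp_thms)
  then show ?thesis
  proof eventually_elim
    case (elim t)
    obtain n :: nat where "\<bar>t\<bar> \<le> real n" using real_arch_simple by blast
    with elim[rule_format, of n] show ?case by (auto simp: indicator_def abs_le_iff split: if_splits)
  qed
qed

lemma has_L2_deriv_unique:
  assumes "has_L2_deriv u v" "has_L2_deriv u w"
  shows "AE t in lborel. v t = w t"
proof -
  have "AE t in lborel. v t - w t = 0"
  proof (rule AE_eq_0_if_interval_integrals_0)
    fix a b :: real
    note i = has_L2_deriv_integrable[OF assms(1), of a b] has_L2_deriv_integrable[OF assms(2), of a b]
    show "set_integrable lborel {a..b} (\<lambda>t. v t - w t)" using i by (rule set_integral_diff)
    assume "a \<le> b"
    then show "(LBINT t:{a..b}. v t - w t) = 0"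
      using assms set_integral_diff(2)[OF i] by (simp add: has_L2_deriv_def)
  qed
  then show ?thesis by simp
qed

lemma has_L2_deriv_continuous:
  assumes "has_L2_deriv u v"
  shows "continuous_on S u"
proof -
  have "continuous_on {-r..r} u" for r :: real
  proof -
    have "v integrable_on {-r..r}"
      by (rule set_borel_integral_eq_integral(1)[OF has_L2_deriv_integrable[OF assms]])
    then have c: "continuous_on {-r..r} (\<lambda>t. u (-r) + integral {-r..t} v)"
      by (intro continuous_intros indefinite_integral_continuous_1)
    have "u t = u (-r) + integral {-r..t} v" if "t \<in> {-r..r}" for t
    proof -
      have "u t - u (-r) = (LBINT s:{-r..t}. v s)" using assms that by (auto simp: has_L2_deriv_def)
      also have "\<dots> = integral {-r..t} v"
        by (rule set_borel_integral_eq_integral(2)[OF has_L2_deriv_integrable[OF assms]])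
      finally show ?thesis by (simp only: diff_eq_eq add.commute)
    qed
    then show ?thesis by (rule continuous_on_eq[OF c sym])
  qed
  then have c: "continuous_on {-r<..<r} u" for r :: real
    by (meson continuous_on_subset greaterThanLessThan_subseteq_atLeastAtMost_iff order_refl)
  have "isCont u t" for t :: real
  proof -
    have "t \<in> {-(\<bar>t\<bar> + 1)<..<\<bar>t\<bar> + 1}" by auto
    then show ?thesis using c[of "\<bar>t\<bar> + 1"] by (simp add: continuous_on_eq_continuous_at)
  qed
  then show ?thesis by (simp add: continuous_at_imp_continuous_on)
qed

lemma has_L2_deriv_inner_integrable:
  assumes "has_L2_deriv u v" "has_L2_deriv u' v'"
  shows "set_integrable lborel {a..b} (\<lambda>t. u t \<bullet> u' t + v t \<bullet> v' t)"
proof (rule set_integral_add(1))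
  have "continuous_on {a..b} (\<lambda>t. u t \<bullet> u' t)"
    by (intro continuous_on_inner has_L2_deriv_continuous[OF assms(1)] has_L2_deriv_continuous[OF assms(2)])
  then show "set_integrable lborel {a..b} (\<lambda>t. u t \<bullet> u' t)"
    unfolding set_integrable_def by (intro borel_integrable_compact) auto
  have m: "v \<in> borel_measurable borel" "v' \<in> borel_measurable borel"
    using assms by (auto simp: has_L2_deriv_def)
  have "set_integrable lborel {a..b} (\<lambda>t. (norm (v t))\<^sup>2 + (norm (v' t))\<^sup>2)"
    using assms by (intro set_integral_add) (auto simp: has_L2_deriv_def)
  then show "set_integrable lborel {a..b} (\<lambda>t. v t \<bullet> v' t)"
    unfolding set_integrable_def
  proof (rule Bochner_Integration.integrable_bound)
    show "(\<lambda>x. indicat_real {a..b} x *\<^sub>R (v x \<bullet> v' x)) \<in> borel_measurable lborel" using m by measurable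
    have "\<bar>v x \<bullet> v' x\<bar> \<le> (norm (v x))\<^sup>2 + (norm (v' x))\<^sup>2" for x
    proof -
      have "\<bar>v x \<bullet> v' x\<bar> \<le> norm (v x) * norm (v' x)" by (rule Cauchy_Schwarz_ineq2)
      also have "\<dots> \<le> (norm (v x))\<^sup>2 + (norm (v' x))\<^sup>2"
        using sum_squares_bound[of "norm (v x)" "norm (v' x)"]
          mult_nonneg_nonneg[OF norm_ge_zero[of "v x"] norm_ge_zero[of "v' x"]] by linarith
      finally show ?thesis .
    qed
    then show "AE x in lborel. norm (indicat_real {a..b} x *\<^sub>R (v x \<bullet> v' x))
        \<le> norm (indicat_real {a..b} x *\<^sub>R ((norm (v x))\<^sup>2 + (norm (v' x))\<^sup>2))"
      by (auto simp: indicator_def)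
  qed
qed

lemma has_L2_deriv_diff:
  assumes "has_L2_deriv u v" "has_L2_deriv u' v'"
  shows "has_L2_deriv (\<lambda>t. u t - u' t) (\<lambda>t. v t - v' t)"
  using has_L2_deriv_add[OF assms(1) has_L2_deriv_scaleR[OF assms(2), of "-1"]] by simp

lemma has_L2_deriv_minus: "has_L2_deriv u v \<Longrightarrow> has_L2_deriv (\<lambda>t. - u t) (\<lambda>t. - v t)"
  using has_L2_deriv_scaleR[of u v "-1"] by simp

typedef (overloaded) 'a h1 =
  "{u :: real \<Rightarrow> 'a::euclidean_space. (\<forall>t. u (t + 2 * pi) = u t) \<and> (\<exists>v. has_L2_deriv u v)}"
  morphisms h1_fun Abs_h1
  by (rule exI[of _ "\<lambda>_. 0"]) (auto intro: has_L2_deriv_const)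

setup_lifting type_definition_h1

lemma h1_fun_periodic: "h1_fun u (t + 2 * pi) = h1_fun u t"
  using h1_fun[of u] by simp

text \<open>The weak derivative is determined up to a null set.\<close>

definition h1_deriv :: "'a::euclidean_space h1 \<Rightarrow> real \<Rightarrow> 'a" where
  "h1_deriv u = (SOME v. has_L2_deriv (h1_fun u) v)"

lemma has_L2_deriv_h1: "has_L2_deriv (h1_fun u) (h1_deriv u)"
proof -
  have "\<exists>v. has_L2_deriv (h1_fun u) v" using h1_fun[of u] by simp
  then show ?thesis unfolding h1_deriv_def by (rule someI_ex)
qed

lemma h1_deriv_AE: "has_L2_deriv (h1_fun u) v \<Longrightarrow> AE t in lborel. h1_deriv u t = v t"
  by (rule has_L2_deriv_unique[OF has_L2_deriv_h1])

instantiation h1 :: (euclidean_space) real_vector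
begin

lift_definition zero_h1 :: "'a h1" is "\<lambda>_. 0"
  by (auto intro: has_L2_deriv_const)

lift_definition plus_h1 :: "'a h1 \<Rightarrow> 'a h1 \<Rightarrow> 'a h1" is "\<lambda>u w t. u t + w t"
  by (elim conjE exE, intro conjI exI, simp, erule (1) has_L2_deriv_add)

lift_definition uminus_h1 :: "'a h1 \<Rightarrow> 'a h1" is "\<lambda>u t. - u t"
  by (elim conjE exE, intro conjI exI, simp, erule has_L2_deriv_minus)

lift_definition minus_h1 :: "'a h1 \<Rightarrow> 'a h1 \<Rightarrow> 'a h1" is "\<lambda>u w t. u t - w t"
  by (elim conjE exE, intro conjI exI, simp, erule (1) has_L2_deriv_diff)

lift_definition scaleR_h1 :: "real \<Rightarrow> 'a h1 \<Rightarrow> 'a h1" is "\<lambda>c u t. c *\<^sub>R u t"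
  by (elim conjE exE, intro conjI exI, simp, erule has_L2_deriv_scaleR)

instance
proof
  fix u v w :: "'a h1" and a b :: real
  show "u + v + w = u + (v + w)" by transfer (simp add: add.assoc)
  show "u + v = v + u" by transfer (simp add: add.commute)
  show "0 + u = u" by transfer simp
  show "- u + u = 0" by transfer simp
  show "u - v = u + - v" by transfer simp
  show "a *\<^sub>R (u + v) = a *\<^sub>R u + a *\<^sub>R v" by transfer (simp add: scaleR_add_right)
  show "(a + b) *\<^sub>R u = a *\<^sub>R u + b *\<^sub>R u" by transfer (simp add: scaleR_add_left)
  show "a *\<^sub>R b *\<^sub>R u = (a * b) *\<^sub>R u" by transfer simp
  show "1 *\<^sub>R u = u" by transfer simp
qed

end

instantiation h1 :: (euclidean_space) real_inner
begin

definition inner_h1 :: "'a h1 \<Rightarrow> 'a h1 \<Rightarrow> real" where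
  "u \<bullet> w = (LBINT t:{0..2 * pi}. h1_fun u t \<bullet> h1_fun w t + h1_deriv u t \<bullet> h1_deriv w t)" for u :: "'a h1"

definition norm_h1 :: "'a h1 \<Rightarrow> real" where "norm u = sqrt (u \<bullet> u)" for u :: "'a h1"

definition dist_h1 :: "'a h1 \<Rightarrow> 'a h1 \<Rightarrow> real" where "dist u w = norm (u - w)" for u :: "'a h1"

definition sgn_h1 :: "'a h1 \<Rightarrow> 'a h1" where "sgn u = u /\<^sub>R norm u" for u :: "'a h1"

definition uniformity_h1 :: "('a h1 \<times> 'a h1) filter" where
  "uniformity_h1 = (INF e\<in>{0 <..}. principal {(x, y). dist x y < e})"

definition open_h1 :: "'a h1 set \<Rightarrow> bool" where
  "open_h1 U \<longleftrightarrow> (\<forall>x\<in>U. eventually (\<lambda>(x', y). x' = x \<longrightarrow> y \<in> U) uniformity)"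

instance
proof
  fix u v w :: "'a h1" and a :: real and U :: "'a h1 set"
  show "dist u v = norm (u - v)" by (rule dist_h1_def)
  show "sgn u = u /\<^sub>R norm u" by (rule sgn_h1_def)
  show "uniformity = (INF e\<in>{0 <..}. principal {(x, y :: 'a h1). dist x y < e})" by (rule uniformity_h1_def)
  show "open U \<longleftrightarrow> (\<forall>x\<in>U. eventually (\<lambda>(x', y). x' = x \<longrightarrow> y \<in> U) uniformity)" by (rule open_h1_def)
  show "norm u = sqrt (u \<bullet> u)" by (rule norm_h1_def)
  show "u \<bullet> v = v \<bullet> u" by (simp add: inner_h1_def inner_commute)
  have int: "integrable lborel (\<lambda>t. indicat_real {0..2 * pi} t *\<^sub>R (h1_fun x t \<bullet> h1_fun y t + h1_deriv x t \<bullet> h1_deriv y t))"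
    for x y :: "'a h1"
    using has_L2_deriv_inner_integrable[OF has_L2_deriv_h1 has_L2_deriv_h1] by (simp add: set_integrable_def)
  have meas[measurable]: "h1_deriv x \<in> borel_measurable borel" "h1_fun x \<in> borel_measurable borel" for x :: "'a h1"
    using has_L2_deriv_h1[of x] by (auto simp: has_L2_deriv_def
      intro!: borel_measurable_continuous_onI has_L2_deriv_continuous[OF has_L2_deriv_h1])
  have add: "h1_fun (u + v) t = h1_fun u t + h1_fun v t" for t by transfer simp
  have "AE t in lborel. h1_deriv (u + v) t = h1_deriv u t + h1_deriv v t"
    by (rule h1_deriv_AE) (use has_L2_deriv_add[OF has_L2_deriv_h1[of u] has_L2_deriv_h1[of v]] in \<open>simp add: plus_h1.rep_eq\<close>)
  then have "(u + v) \<bullet> w = (LBINT t. indicat_real {0..2 * pi} t *\<^sub>R (h1_fun u t \<bullet> h1_fun w t + h1_deriv u t \<bullet> h1_deriv w t)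
       + indicat_real {0..2 * pi} t *\<^sub>R (h1_fun v t \<bullet> h1_fun w t + h1_deriv v t \<bullet> h1_deriv w t))"
    unfolding inner_h1_def set_lebesgue_integral_def
    by (intro integral_cong_AE) (auto simp: add inner_add_left algebra_simps)
  also have "\<dots> = u \<bullet> w + v \<bullet> w"
    unfolding inner_h1_def set_lebesgue_integral_def by (intro Bochner_Integration.integral_add int)
  finally show "(u + v) \<bullet> w = u \<bullet> w + v \<bullet> w" .
  have sc: "h1_fun (a *\<^sub>R u) t = a *\<^sub>R h1_fun u t" for t by transfer simp
  have "AE t in lborel. h1_deriv (a *\<^sub>R u) t = a *\<^sub>R h1_deriv u t"
    by (rule h1_deriv_AE) (use has_L2_deriv_scaleR[OF has_L2_deriv_h1[of u]] in \<open>simp add: scaleR_h1.rep_eq\<close>)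
  then have "(a *\<^sub>R u) \<bullet> v = (LBINT t. a * (indicat_real {0..2 * pi} t *\<^sub>R (h1_fun u t \<bullet> h1_fun v t + h1_deriv u t \<bullet> h1_deriv v t)))"
    unfolding inner_h1_def set_lebesgue_integral_def
    by (intro integral_cong_AE) (auto simp: sc algebra_simps)
  also have "\<dots> = a * (u \<bullet> v)"
    unfolding inner_h1_def set_lebesgue_integral_def by simp
  finally show "(a *\<^sub>R u) \<bullet> v = a * (u \<bullet> v)" .
  show nonneg: "0 \<le> u \<bullet> u"
    unfolding inner_h1_def set_lebesgue_integral_def by (intro integral_nonneg_AE) auto
  show "u \<bullet> u = 0 \<longleftrightarrow> u = 0"
  proof
    assume "u \<bullet> u = 0"
    then have "AE t in lborel. indicat_real {0..2 * pi} t *\<^sub>R (h1_fun u t \<bullet> h1_fun u t + h1_deriv u t \<bullet> h1_deriv u t) = 0"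
      unfolding inner_h1_def set_lebesgue_integral_def
      by (subst (asm) integral_nonneg_eq_0_iff_AE[OF int]) auto
    then have ae: "AE t in lborel. t \<in> {0..2 * pi} \<longrightarrow> h1_fun u t = 0"
      by eventually_elim (auto simp: indicator_def add_nonneg_eq_0_iff)
    have fin: "h1_fun u t = 0" if t: "t \<in> {0..<2 * pi}" for t
    proof (rule ccontr)
      assume nz: "h1_fun u t \<noteq> 0"
      have "continuous_on UNIV (h1_fun u)" by (rule has_L2_deriv_continuous[OF has_L2_deriv_h1])
      then have "open (h1_fun u -` (- {0}))" by (intro open_vimage) auto
      moreover have "t \<in> h1_fun u -` (- {0})" using nz by simp
      ultimately obtain e where e: "e > 0" "ball t e \<subseteq> h1_fun u -` (- {0})"
        by (meson openE)
      define d where "d = min e (2 * pi - t)"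
      have d: "d > 0" "{t<..<t+d} \<subseteq> {0..2 * pi}" "{t<..<t+d} \<subseteq> ball t e"
        using e t by (auto simp: d_def dist_real_def)
      from ae have "AE s in lborel. s \<notin> {t<..<t+d}"
        by eventually_elim (use d e in blast)
      then have "emeasure lborel {t<..<t+d} = 0"
        by (subst (asm) AE_iff_null_sets[symmetric]) auto
      then show False using d(1) by simp
    qed
    have per: "h1_fun u (t + 2 * pi * real n) = h1_fun u t" for t and n :: nat
    proof (induction n)
      case (Suc n)
      then show ?case
        using h1_fun_periodic[of u "t + 2 * pi * real n"] by (simp add: algebra_simps)
    qed simp
    have "h1_fun u t = 0" for t
    proof -
      define k where "k = \<lfloor>t / (2 * pi)\<rfloor>"
      define s where "s = t - 2 * pi * k"
      have "of_int k \<le> t / (2 * pi)" "t / (2 * pi) < of_int k + 1" by (auto simp: k_def)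
      then have "s \<in> {0..<2 * pi}" by (auto simp: s_def field_simps)
      then have s: "h1_fun u s = 0" by (rule fin)
      show ?thesis
      proof (cases "k \<ge> 0")
        case True
        then have "t = s + 2 * pi * real (nat k)" by (simp add: s_def)
        then show ?thesis using per s by metis
      next
        case False
        then have "s = t + 2 * pi * real (nat (- k))" by (simp add: s_def)
        then show ?thesis using per s by metis
      qed
    qed
    then have "h1_fun u = h1_fun 0" by (auto simp: zero_h1.rep_eq)
    then show "u = 0" by (simp add: h1_fun_inject)
  next
    assume u: "u = 0"
    have "AE t in lborel. h1_deriv u t = 0"
      by (rule h1_deriv_AE) (simp add: u zero_h1.rep_eq has_L2_deriv_const)
    then have "AE t in lborel. indicat_real {0..2 * pi} t *\<^sub>R (h1_fun u t \<bullet> h1_fun u t + h1_deriv u t \<bullet> h1_deriv u t) = 0"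
      by eventually_elim (simp add: u zero_h1.rep_eq)
    then show "u \<bullet> u = 0"
      unfolding inner_h1_def set_lebesgue_integral_def by (rule integral_eq_zero_AE)
  qed
qed

end


section \<open>The cube and the system\<close>

text \<open>
  The vertices are the elements of the eight-element type \<^typ>\<open>8\<close>, whose numeral \<open>8\<close> is
  the same element as \<open>0\<close>.
\<close>

definition cube_edges :: "(8 \<times> 8) set" where
  "cube_edges = {(1,2), (2,3), (3,4), (4,1), (5,6), (6,7), (7,8), (8,5), (1,5), (2,6), (3,7), (4,8)}"

text \<open>
  The coupling matrix and the system are stated over a field that will be \<^typ>\<open>real\<close> or, for the
  linearization, \<^typ>\<open>complex\<close>.
\<close>

definition cube_coupling :: "'b::comm_ring_1 ^ 8 ^ 8" where
  "cube_coupling = (\<chi> i j. if i = j then -3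
     else if (i, j) \<in> cube_edges \<or> (j, i) \<in> cube_edges then 1 else 0)"

text \<open>The kernel $k_\alpha$ is the normal density with mean \<open>0\<close> and standard deviation \<open>\<alpha>\<close>.\<close>

definition system_rhs ::
  "real \<Rightarrow> real \<Rightarrow> ('b::{real_normed_field, euclidean_space} \<Rightarrow> 'b) \<Rightarrow> real \<Rightarrow>
     (real \<Rightarrow> ('b ^ 8) \<times> ('b ^ 8)) \<Rightarrow> real \<Rightarrow> ('b ^ 8) \<times> ('b ^ 8)" where
  "system_rhs c1 c2 q \<alpha> u x =
     (snd (u x),
      c1 *\<^sub>R fst (u x) + (\<chi> i. q (fst (u x) $ i)) + c2 *\<^sub>R (cube_coupling *v fst (u x))
        + (LBINT y. normal_density 0 \<alpha> y *\<^sub>R fst (u (x - y))))"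

definition is_solution ::
  "real \<Rightarrow> real \<Rightarrow> ('b::{real_normed_field, euclidean_space} \<Rightarrow> 'b) \<Rightarrow> real \<Rightarrow>
     (real \<Rightarrow> ('b ^ 8) \<times> ('b ^ 8)) \<Rightarrow> bool" where
  "is_solution c1 c2 q \<alpha> u \<longleftrightarrow>
     (\<forall>x. (u has_vector_derivative system_rhs c1 c2 q \<alpha> u x) (at x))"

type_synonym W = "((real ^ 8) \<times> (real ^ 8)) h1"

definition solutions :: "real \<Rightarrow> real \<Rightarrow> (real \<Rightarrow> real) \<Rightarrow> (real \<times> W) set" where
  "solutions c1 c2 q = {(\<alpha>, u). 0 < \<alpha> \<and> is_solution c1 c2 q \<alpha> (h1_fun u)}"

text \<open>
  As \<open>q(0) = q'(0) = 0\<close>, the linearization at \<open>0\<close> is the system with \<open>q\<close> replaced by \<open>0\<close>.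
\<close>

definition critical :: "real \<Rightarrow> real \<Rightarrow> real \<Rightarrow> bool" where
  "critical c1 c2 \<alpha> \<longleftrightarrow> (\<exists>k::nat. \<exists>v :: (complex ^ 8) \<times> (complex ^ 8). 1 \<le> k \<and> v \<noteq> 0 \<and>
     is_solution c1 c2 (\<lambda>_. 0) \<alpha>
       (\<lambda>x. (exp (\<i> * of_nat k * of_real x) *s fst v, exp (\<i> * of_nat k * of_real x) *s snd v)))"


section \<open>The symmetry group and its action\<close>

text \<open>
  Coordinates of the vertices of a cube centred at the origin with the edges listed in
  \<^const>\<open>cube_edges\<close>.
\<close>

definition cube_vertex :: "8 \<Rightarrow> real ^ 3" where
  "cube_vertex i = vector [if i \<in> {2, 3, 6, 7} then 1 else -1,
                           if i \<in> {3, 4, 7, 8} then 1 else -1,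
                           if i \<in> {5, 6, 7, 8} then 1 else -1]"

definition cube_group :: "(8 \<Rightarrow> 8) monoid" where
  "cube_group =
     \<lparr>carrier = {\<gamma>. \<exists>A. rotation_matrix A \<and> (\<forall>i. A *v cube_vertex i = cube_vertex (\<gamma> i))},
      mult = (\<circ>), one = id\<rparr>"

definition O2 :: "(real ^ 2 ^ 2) monoid" where
  "O2 = \<lparr>carrier = {A. orthogonal_matrix A}, mult = (**), one = mat 1\<rparr>"

definition rot2 :: "real \<Rightarrow> real ^ 2 ^ 2" where
  "rot2 \<theta> = vector [vector [cos \<theta>, - sin \<theta>], vector [sin \<theta>, cos \<theta>]]"

definition refl2 :: "real ^ 2 ^ 2" where
  "refl2 = vector [vector [1, 0], vector [0, -1]]"

abbreviation S4xO2 :: "((8 \<Rightarrow> 8) \<times> (real ^ 2 ^ 2)) monoid" where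
  "S4xO2 \<equiv> cube_group \<times>\<times> O2"

text \<open>
  Both \<open>rot2 \<theta>\<close> and \<open>rot2 \<theta> ** refl2\<close> have first column \<open>(cos \<theta>, sin \<theta>)\<close>; they act as
  $e^{i\theta}$ and $e^{i\theta}\kappa$.
\<close>

definition angle2 :: "real ^ 2 ^ 2 \<Rightarrow> real" where
  "angle2 A = Arg (Complex (A $ 1 $ 1) (A $ 2 $ 1))"

definition circle_act :: "real ^ 2 ^ 2 \<Rightarrow> (real \<Rightarrow> (real ^ 8) \<times> (real ^ 8)) \<Rightarrow> real \<Rightarrow> (real ^ 8) \<times> (real ^ 8)" where
  "circle_act A u t = (let s = t + angle2 A in
     if det A = 1 then u s else (fst (u (- s)), - snd (u (- s))))"

definition permute_vertices :: "(8 \<Rightarrow> 8) \<Rightarrow> real ^ 8 \<Rightarrow> real ^ 8" where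
  "permute_vertices \<gamma> x = (\<chi> i. x $ inv_into UNIV \<gamma> i)"

lift_definition act :: "(8 \<Rightarrow> 8) \<times> (real ^ 2 ^ 2) \<Rightarrow> W \<Rightarrow> W" is
  "\<lambda>g u t. map_prod (permute_vertices (fst g)) (permute_vertices (fst g)) (circle_act (snd g) u t)"
proof -
  fix g :: "(8 \<Rightarrow> 8) \<times> (real ^ 2 ^ 2)" and u :: "real \<Rightarrow> (real ^ 8) \<times> (real ^ 8)"
  let ?P = "map_prod (permute_vertices (fst g)) (permute_vertices (fst g))"
  let ?K = "\<lambda>w :: (real ^ 8) \<times> (real ^ 8). (fst w, - snd w)"
  assume u: "(\<forall>t. u (t + 2 * pi) = u t) \<and> (\<exists>v. has_L2_deriv u v)"
  then obtain v where v: "has_L2_deriv u v" by blast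
  have "linear ?P"
    by (rule linearI) (auto simp: permute_vertices_def vec_eq_iff)
  moreover have "linear ?K"
    by (rule linearI) auto
  ultimately have lin: "linear ?P" "linear ?K" by blast+
  let ?s = "angle2 (snd g)"
  have "\<exists>w. has_L2_deriv (circle_act (snd g) u) w"
  proof (cases "det (snd g) = 1")
    case True
    then have "circle_act (snd g) u = (\<lambda>t. u (t + ?s))" by (simp add: circle_act_def Let_def fun_eq_iff)
    then show ?thesis using has_L2_deriv_shift[OF v, of ?s] by auto
  next
    case False
    then have "circle_act (snd g) u = (\<lambda>t. ?K (u (- (t + ?s))))" by (simp add: circle_act_def Let_def fun_eq_iff)
    then show ?thesis
      using has_L2_deriv_linear[OF lin(2) has_L2_deriv_shift[OF has_L2_deriv_reflect[OF v], of ?s]] by (intro exI) simp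
  qed
  then have "\<exists>w. has_L2_deriv (\<lambda>t. ?P (circle_act (snd g) u t)) w"
    using has_L2_deriv_linear[OF lin(1)] by fast
  moreover have "circle_act (snd g) u (t + 2 * pi) = circle_act (snd g) u t" for t
  proof -
    have "u (t + 2 * pi + angle2 (snd g)) = u (t + angle2 (snd g))"
      using u[THEN conjunct1, rule_format, of "t + angle2 (snd g)"] by (simp add: algebra_simps)
    moreover have "u (- (t + 2 * pi + angle2 (snd g))) = u (- (t + angle2 (snd g)))"
      using u[THEN conjunct1, rule_format, of "- (t + 2 * pi + angle2 (snd g))"] by (simp add: algebra_simps)
    ultimately show ?thesis by (simp add: circle_act_def Let_def)
  qed
  ultimately show "(\<forall>t. ?P (circle_act (snd g) u (t + 2 * pi)) = ?P (circle_act (snd g) u t)) \<and>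
      (\<exists>w. has_L2_deriv (\<lambda>t. ?P (circle_act (snd g) u t)) w)"
    by simp
qed

definition fixed_points :: "((8 \<Rightarrow> 8) \<times> (real ^ 2 ^ 2)) set \<Rightarrow> W set" where
  "fixed_points H = {u. \<forall>g\<in>H. act g u = u}"


section \<open>Amalgamated subgroups\<close>

text \<open>
  The identification of \<^const>\<open>cube_group\<close> with $S_4$ is given by the action on the four space
  diagonals, the \<open>n\<close>-th of which is the one through vertex \<open>n\<close>.
\<close>

definition cube_diagonal :: "nat \<Rightarrow> 8 set" where
  "cube_diagonal n = {i. cube_vertex i = cube_vertex (of_nat n) \<or> cube_vertex i = - cube_vertex (of_nat n)}"

definition cube_subgroup :: "(nat \<Rightarrow> nat) set \<Rightarrow> (8 \<Rightarrow> 8) set" where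
  "cube_subgroup P = {\<gamma> \<in> carrier cube_group.
     \<exists>\<sigma> \<in> generate (sym_group 4) P. \<forall>n\<in>{1..4}. \<gamma> ` cube_diagonal n = cube_diagonal (\<sigma> n)}"

definition "S4_Z1 = cube_subgroup {}"
definition "S4_D1 = cube_subgroup {Transposition.transpose 1 2}"
definition "S4_Z4 = cube_subgroup {cycle_of_list [1, 2, 3, 4]}"
definition "S4_D2 = cube_subgroup {Transposition.transpose 1 2, Transposition.transpose 3 4}"
definition "S4_D4 = cube_subgroup {cycle_of_list [1, 2, 3, 4], Transposition.transpose 1 3}"

definition O2_Z :: "nat \<Rightarrow> (real ^ 2 ^ 2) set" where
  "O2_Z n = generate O2 {rot2 (2 * pi / real n)}"

definition O2_D :: "nat \<Rightarrow> (real ^ 2 ^ 2) set" where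
  "O2_D n = generate O2 {rot2 (2 * pi / real n), refl2}"

text \<open>
  The subgroups of $S_4 \times O(2)$ in the conjugacy class $(H\,{}^{Z}\!\times_L K)$, where \<open>N\<close> is the
  kernel of the epimorphism from \<open>K\<close>.
\<close>

definition amalgamated_class ::
  "(8 \<Rightarrow> 8) set \<Rightarrow> (8 \<Rightarrow> 8) set \<Rightarrow> 'l monoid \<Rightarrow> (real ^ 2 ^ 2) set \<Rightarrow> (real ^ 2 ^ 2) set \<Rightarrow>
     ((8 \<Rightarrow> 8) \<times> (real ^ 2 ^ 2)) set set" where
  "amalgamated_class H Z L K N =
     {g <#\<^bsub>S4xO2\<^esub> {(h, k) \<in> H \<times> K. \<phi> h = \<psi> k} #>\<^bsub>S4xO2\<^esub> inv\<^bsub>S4xO2\<^esub> g | g \<phi> \<psi>.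
        g \<in> carrier S4xO2 \<and>
        \<phi> \<in> epi (cube_group\<lparr>carrier := H\<rparr>) L \<and> kernel (cube_group\<lparr>carrier := H\<rparr>) L \<phi> = Z \<and>
        \<psi> \<in> epi (O2\<lparr>carrier := K\<rparr>) L \<and> kernel (O2\<lparr>carrier := K\<rparr>) L \<psi> = N}"


section \<open>Branches\<close>

definition bif_nbhd :: "real \<Rightarrow> real \<Rightarrow> real \<Rightarrow> (real \<times> W) set" where
  "bif_nbhd \<alpha>o \<rho> r = {(\<alpha>, u). \<bar>\<alpha> - \<alpha>o\<bar> < \<rho> \<and> norm u < r}"

text \<open>
  The condition \<open>\<rho> < \<alpha>o\<close> keeps the parameters in $(0,\infty)$.
\<close>

definition admissible :: "real \<Rightarrow> real \<Rightarrow> (real \<Rightarrow> real) \<Rightarrow> real \<Rightarrow> real \<Rightarrow> real \<Rightarrow> bool" where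
  "admissible c1 c2 q \<alpha>o \<rho> r \<longleftrightarrow> 0 < \<rho> \<and> \<rho> < \<alpha>o \<and> 0 < r \<and>
     (\<forall>\<alpha>\<in>{\<alpha>o - \<rho>..\<alpha>o + \<rho>}. critical c1 c2 \<alpha> \<longleftrightarrow> \<alpha> = \<alpha>o) \<and>
     (\<forall>\<alpha> u. \<bar>\<alpha> - \<alpha>o\<bar> = \<rho> \<and> (\<alpha>, u) \<in> solutions c1 c2 q \<longrightarrow> \<not> (0 < norm u \<and> norm u \<le> r))"

text \<open>
  A branch is taken within a subspace \<open>F\<close> of \<^typ>\<open>W\<close>, with \<open>F = UNIV\<close> for branches without
  prescribed symmetry. The component must be formed inside the fixed-point space: the set of all
  nontrivial solutions has only one component through \<open>(\<alpha>o, 0)\<close>.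
\<close>

definition is_branch ::
  "real \<Rightarrow> real \<Rightarrow> (real \<Rightarrow> real) \<Rightarrow> real \<Rightarrow> real \<Rightarrow> real \<Rightarrow> W set \<Rightarrow> (real \<times> W) set \<Rightarrow> bool" where
  "is_branch c1 c2 q \<alpha>o \<rho> r F C \<longleftrightarrow>
     compact C \<and>
     C \<in> components (closure {(\<alpha>, u) \<in> bif_nbhd \<alpha>o \<rho> r \<inter> solutions c1 c2 q. u \<noteq> 0 \<and> u \<in> F}) \<and>
     (\<alpha>o, 0) \<in> C \<and> (\<exists>(\<alpha>, u) \<in> C. u \<noteq> 0)"

definition bifurcation_point :: "real \<Rightarrow> real \<Rightarrow> (real \<Rightarrow> real) \<Rightarrow> real \<Rightarrow> real \<Rightarrow> real \<Rightarrow> bool" where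
  "bifurcation_point c1 c2 q \<alpha>o \<rho> r \<longleftrightarrow> (\<exists>C. is_branch c1 c2 q \<alpha>o \<rho> r UNIV C)"

text \<open>
  Branches are counted up to the action of \<open>O(2)\<close>: translating a branch of nonconstant solutions
  in \<open>t\<close> always yields further branches, with symmetry in the same conjugacy class.
\<close>

definition at_least_branches ::
  "real \<Rightarrow> real \<Rightarrow> (real \<Rightarrow> real) \<Rightarrow> real \<Rightarrow> real \<Rightarrow> real \<Rightarrow>
     nat \<Rightarrow> ((8 \<Rightarrow> 8) \<times> (real ^ 2 ^ 2)) set set \<Rightarrow> bool" where
  "at_least_branches c1 c2 q \<alpha>o \<rho> r n \<H> \<longleftrightarrow>
     (\<exists>C :: nat \<Rightarrow> (real \<times> W) set.
        (\<forall>i<n. \<exists>H\<in>\<H>. is_branch c1 c2 q \<alpha>o \<rho> r (fixed_points H) (C i)) \<and>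
        (\<forall>i<n. \<forall>j<n. i \<noteq> j \<longrightarrow>
           \<not> (\<exists>A\<in>carrier O2. C j = map_prod id (act (id, A)) ` C i)))"


end

theory Submission
  imports Defs "HOL-Complex_Analysis.Great_Picard"
begin

text \<open>
  Eliminating the second component turns the system into a second order equation. Its linearization
  at \<open>0\<close> is diagonalized by Fourier modes and the eigenspaces of the coupling matrix, and at \<open>\<alpha>o\<close> its
  kernel consists of the functions \<open>t \<mapsto> (v\<^sub>i \<bullet> (cos t a - sin t b))\<^sub>i\<close> with \<open>a, b \<in> \<real>\<^sup>3\<close>, where the
  \<open>v\<^sub>i\<close> are the vertices of the cube; the hypotheses on \<open>c1\<close> and \<open>c2\<close> exclude all other modes. For each
  of the twelve subgroups the fixed part of this kernel is a line. Lyapunov-Schmidt reduction in the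
  fixed-point space therefore leads to a family of fixed point problems on a compact convex set,
  parametrized by the amplitude, and the solution set of such a family contains a continuum that
  joins amplitude \<open>0\<close> to a positive amplitude (Schauder's theorem and the Leray-Schauder-Browder
  argument); this gives the branch. Branches with different tangent lines are told apart by
  normalizing solutions that tend to \<open>0\<close>.
\<close>

text \<open>Since \<open>q\<close> is merely continuous, with a derivative only at \<open>0\<close>,
  the implicit function theorem does not apply and the branches have to come from compactness.
  Writing a solution as \<open>\<epsilon> (e + z)\<close>, where \<open>e\<close> spans the fixed
  line of the kernel, turns the nonlinearity into \<open>q(\<epsilon> r) / \<epsilon>\<close>, which
  extends continuously by \<open>0\<close> to \<open>\<epsilon> = 0\<close> because
  \<open>q'(0) = 0\<close>. The parameter \<alpha> becomes an unknown next to \<open>z\<close>: on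
  the fixed line the kernel equation is a single scalar equation, and the critical symbol
  \<open>exp(-\<alpha>^2/2) - s\<close>, with \<open>s = -c1 + 2 c2 - 1\<close>, is strictly
  monotone in positive \<alpha>, so that equation can be solved for \<alpha>. At amplitude
  \<open>0\<close> the resulting map is constant, which gives the unique fixed point where the
  continuum starts. The formula for \<open>\<alpha>o\<close> is the zero of this symbol. The
  convolution multiplies frequency \<open>k\<close> by \<open>exp(-(\<alpha> k)^2/2)\<close>, which
  at \<open>\<alpha>o\<close> is \<open>s\<close> for \<open>k = 1\<close> and \<open>s^4\<close>
  for \<open>k = 2\<close>; this is the source of the fourth power in the hypotheses.\<close>

section \<open>Brouwer and Schauder fixed points, and continua of fixed points\<close>

text \<open>Schauder's argument needs a cube whose dimension is the size of a finite net, hence a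
  variable \<open>n\<close>; the cube is therefore placed in \<open>nat \<Rightarrow> real\<close>
  with the coordinates from \<open>n\<close> on equal to \<open>0\<close>. Kuhn's lemma on the grid
  of mesh \<open>1 / Suc p\<close> yields cells that contain, for every coordinate, a corner pushed
  up and a corner pushed down by \<open>f\<close>. A limit point of these cells is fixed.\<close>

lemma brouwer_nat_cube:
  fixes f :: "(nat \<Rightarrow> real) \<Rightarrow> nat \<Rightarrow> real" and n :: nat
  defines "Q \<equiv> {x. \<forall>i. 0 \<le> x i \<and> x i \<le> (if i < n then 1 else 0)}"
  assumes cont: "continuous_on Q f" and into: "f ` Q \<subseteq> Q"
  obtains x where "x \<in> Q" "f x = x"
proof -
  have "Q = (\<Pi>\<^sub>E i\<in>UNIV. {0..if i < n then 1 else 0})"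
    by (auto simp: Q_def PiE_def Pi_def)
  then have "compact Q"
    by (metis compactin_PiE compactin_euclidean_iff compact_Icc euclidean_product_topology)
  \<comment> \<open>Label \<open>0\<close> records that \<open>f\<close> does not lower coordinate
    \<open>i\<close>, label \<open>1\<close> that it does not raise it. The two faces are labelled
    separately because Kuhn's lemma prescribes the labels there; both choices are consistent since
    \<open>f\<close> maps the cube to itself.\<close>
  define label :: "(nat \<Rightarrow> real) \<Rightarrow> nat \<Rightarrow> nat"
    where "label x i = (if x i = 0 then 0 else if x i = 1 then 1 else if x i \<le> f x i then 0 else 1)" for x i
  have fQ: "0 \<le> f x i" "f x i \<le> (if i < n then 1 else 0)" if "x \<in> Q" for x i
    using into that by (auto simp: Q_def image_subset_iff)
  have lab0: "x i \<le> f x i" if "x \<in> Q" "label x i = 0" for x i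
    using that fQ(1)[OF that(1), of i] by (auto simp: label_def split: if_splits)
  have lab1: "f x i \<le> x i" if "x \<in> Q" "label x i \<noteq> 0" "i < n" for x i
    using that fQ(2)[OF that(1), of i] by (auto simp: label_def split: if_splits)
  define pt :: "nat \<Rightarrow> (nat \<Rightarrow> nat) \<Rightarrow> nat \<Rightarrow> real"
    where "pt p q j = (if j < n then real (q j) / real p else 0)" for p q j
  have ptQ: "pt (Suc p) q \<in> Q" if "\<forall>i<n. q i \<le> Suc p" for p q
    using that by (auto simp: Q_def pt_def divide_le_eq_1)
  have ex_q: "\<exists>q. (\<forall>i<n. q i < Suc p) \<and> (\<forall>i<n. \<exists>r s. (\<forall>j<n. q j \<le> r j \<and> r j \<le> q j + 1) \<and>
      (\<forall>j<n. q j \<le> s j \<and> s j \<le> q j + 1) \<and> label (pt (Suc p) r) i \<noteq> label (pt (Suc p) s) i)" for p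
  proof -
    have l: "0 < Suc p" "\<forall>x. (\<forall>i<n. x i \<le> Suc p) \<longrightarrow> (\<forall>i<n. label (pt (Suc p) x) i = 0 \<or> label (pt (Suc p) x) i = 1)"
      "\<forall>x. (\<forall>i<n. x i \<le> Suc p) \<longrightarrow> (\<forall>i<n. x i = 0 \<longrightarrow> label (pt (Suc p) x) i = 0)"
      "\<forall>x. (\<forall>i<n. x i \<le> Suc p) \<longrightarrow> (\<forall>i<n. x i = Suc p \<longrightarrow> label (pt (Suc p) x) i = 1)"
      by (auto simp: label_def pt_def)
    show ?thesis
      by (rule kuhn_lemma[OF l], rule exI, rule conjI) assumption+
  qed
  define q where "q p = (SOME q. (\<forall>i<n. q i < Suc p) \<and> (\<forall>i<n. \<exists>r s. (\<forall>j<n. q j \<le> r j \<and> r j \<le> q j + 1) \<and>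
      (\<forall>j<n. q j \<le> s j \<and> s j \<le> q j + 1) \<and> label (pt (Suc p) r) i \<noteq> label (pt (Suc p) s) i))" for p
  have q: "q p i < Suc p" and lab: "\<exists>r s. (\<forall>j<n. q p j \<le> r j \<and> r j \<le> q p j + 1) \<and>
      (\<forall>j<n. q p j \<le> s j \<and> s j \<le> q p j + 1) \<and> label (pt (Suc p) r) i \<noteq> label (pt (Suc p) s) i"
    if "i < n" for p i
    using someI_ex[OF ex_q[of p]] that unfolding q_def by blast+
  have ex: "\<exists>r. (\<forall>j<n. q p j \<le> r j \<and> r j \<le> q p j + 1) \<and> label (pt (Suc p) r) i = 0"
    "\<exists>s. (\<forall>j<n. q p j \<le> s j \<and> s j \<le> q p j + 1) \<and> label (pt (Suc p) s) i \<noteq> 0" if "i < n" for p i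
  proof -
    have 01: "label x i = 0 \<or> label x i = 1" for x by (simp add: label_def)
    obtain r s where rs: "\<forall>j<n. q p j \<le> r j \<and> r j \<le> q p j + 1" "\<forall>j<n. q p j \<le> s j \<and> s j \<le> q p j + 1"
        "label (pt (Suc p) r) i \<noteq> label (pt (Suc p) s) i"
      using lab[OF \<open>i < n\<close>, of p] by blast
    from rs(3) consider "label (pt (Suc p) r) i = 0" "label (pt (Suc p) s) i \<noteq> 0" |
        "label (pt (Suc p) s) i = 0" "label (pt (Suc p) r) i \<noteq> 0"
      using 01[of "pt (Suc p) r"] 01[of "pt (Suc p) s"] by auto
    then show "\<exists>r. (\<forall>j<n. q p j \<le> r j \<and> r j \<le> q p j + 1) \<and> label (pt (Suc p) r) i = 0"
        "\<exists>s. (\<forall>j<n. q p j \<le> s j \<and> s j \<le> q p j + 1) \<and> label (pt (Suc p) s) i \<noteq> 0"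
      using rs(1,2) by (cases; blast)+
  qed
  define r s where
    "r p i = (SOME r. (\<forall>j<n. q p j \<le> r j \<and> r j \<le> q p j + 1) \<and> label (pt (Suc p) r) i = 0)" and
    "s p i = (SOME s. (\<forall>j<n. q p j \<le> s j \<and> s j \<le> q p j + 1) \<and> label (pt (Suc p) s) i \<noteq> 0)" for p i
  have r: "q p j \<le> r p i j \<and> r p i j \<le> q p j + 1" and lr: "label (pt (Suc p) (r p i)) i = 0"
    if "i < n" "j < n" for p i j
    using someI_ex[OF ex(1)[OF \<open>i < n\<close>, of p]] that by (auto simp: r_def)
  have s: "q p j \<le> s p i j \<and> s p i j \<le> q p j + 1" and ls: "label (pt (Suc p) (s p i)) i \<noteq> 0"
    if "i < n" "j < n" for p i j
    using someI_ex[OF ex(2)[OF \<open>i < n\<close>, of p]] that by (auto simp: s_def)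
  have "pt (Suc p) (q p) \<in> Q" for p
    by (rule ptQ) (use q in \<open>auto intro: less_imp_le\<close>)
  then obtain z k where "z \<in> Q" and k: "strict_mono k" and z: "(\<lambda>m. pt (Suc (k m)) (q (k m))) \<longlonglongrightarrow> z"
    using seq_compactE[OF compact_imp_seq_compact[OF \<open>compact Q\<close>], of "\<lambda>p. pt (Suc p) (q p)"]
    by (auto simp: o_def)
  \<comment> \<open>Corners of the selected cells differ from the lower corner by at most one mesh
    width, so every selection of corners has the same limit \<open>z\<close>.\<close>
  have lim: "(\<lambda>m. pt (Suc (k m)) (w m)) \<longlonglongrightarrow> z"
    if w: "\<And>m j. j < n \<Longrightarrow> q (k m) j \<le> w m j \<and> w m j \<le> q (k m) j + 1" for w
  proof -
    have "(\<lambda>m. pt (Suc (k m)) (w m) j) \<longlonglongrightarrow> z j" for j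
    proof -
      have zj: "(\<lambda>m. pt (Suc (k m)) (q (k m)) j) \<longlonglongrightarrow> z j"
        using z by (rule continuous_on_tendsto_compose[OF continuous_on_product_coordinates[of j]]) auto
      have inv: "(\<lambda>m. 1 / real (Suc (k m))) \<longlonglongrightarrow> 0"
        using LIMSEQ_subseq_LIMSEQ[OF LIMSEQ_inverse_real_of_nat k] by (simp add: o_def inverse_eq_divide)
      have "pt (Suc (k m)) (q (k m)) j \<le> pt (Suc (k m)) (w m) j"
          "pt (Suc (k m)) (w m) j \<le> pt (Suc (k m)) (q (k m)) j + 1 / real (Suc (k m))" for m
        using w[of j m] by (auto simp: pt_def add_divide_distrib[symmetric] intro!: divide_right_mono)
      then show ?thesis
        by (intro real_tendsto_sandwich[OF always_eventually always_eventually zj tendsto_add[OF zj inv, simplified]]) auto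
    qed
    then have "limitin (product_topology (\<lambda>i. euclideanreal) UNIV) (\<lambda>m. pt (Suc (k m)) (w m)) z sequentially"
      by (simp add: limitin_componentwise)
    then show ?thesis by (simp add: euclidean_product_topology)
  qed
  have "f z i = z i" for i
  proof (cases "i < n")
    case False
    moreover have "0 \<le> z i \<and> z i \<le> (if i < n then 1 else 0)" using \<open>z \<in> Q\<close> unfolding Q_def by blast
    ultimately show ?thesis using fQ[OF \<open>z \<in> Q\<close>, of i] False by (auto split: if_splits)
  next
    case True
    have inQ: "pt (Suc (k m)) (r (k m) i) \<in> Q" "pt (Suc (k m)) (s (k m) i) \<in> Q" for m
    proof -
      have "r (k m) i j \<le> Suc (k m)" "s (k m) i j \<le> Suc (k m)" if "j < n" for j
        using r[OF True that, of "k m"] s[OF True that, of "k m"] q[OF that, of "k m"] by linarith+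
      then show "pt (Suc (k m)) (r (k m) i) \<in> Q" "pt (Suc (k m)) (s (k m) i) \<in> Q"
        by (auto intro!: ptQ)
    qed
    have conv: "(\<lambda>m. f (v m) i) \<longlonglongrightarrow> f z i" "(\<lambda>m. v m i) \<longlonglongrightarrow> z i" if "\<And>m. v m \<in> Q" "v \<longlonglongrightarrow> z" for v
    proof -
      have "(\<lambda>m. f (v m)) \<longlonglongrightarrow> f z"
        by (rule continuous_on_tendsto_compose[OF cont that(2) \<open>z \<in> Q\<close>]) (use that in simp)
      then show "(\<lambda>m. f (v m) i) \<longlonglongrightarrow> f z i" "(\<lambda>m. v m i) \<longlonglongrightarrow> z i"
        using that(2) continuous_on_tendsto_compose[OF continuous_on_product_coordinates[of i]] by auto
    qed
    have "z i \<le> f z i"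
      by (rule LIMSEQ_le[OF conv(2)[OF inQ(1) lim] conv(1)[OF inQ(1) lim]])
        (use r[OF True] lab0[OF inQ(1) lr[OF True True]] in auto)
    moreover have "f z i \<le> z i"
      by (rule LIMSEQ_le[OF conv(1)[OF inQ(2) lim] conv(2)[OF inQ(2) lim]])
        (use s[OF True] lab1[OF inQ(2) ls[OF True True] True] in auto)
    ultimately show ?thesis by simp
  qed
  with \<open>z \<in> Q\<close> that show thesis by blast
qed

text \<open>Otherwise \<open>f\<close> moves every point of \<open>K\<close> by at least some
  \<open>d > 0\<close>. Take a finite \<open>d\<close>-net \<open>b\<close>, send \<open>f x\<close>
  to the weights \<open>m i\<close> of the nearby net points, and apply Brouwer to the weights: this
  produces a point \<open>p a\<close> that \<open>f\<close> moves by less than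
  \<open>d\<close>.\<close>

theorem schauder_fixpoint:
  fixes f :: "'a::real_normed_vector \<Rightarrow> 'a"
  assumes "compact K" "convex K" "K \<noteq> {}" and cont: "continuous_on K f" and into: "f ` K \<subseteq> K"
  obtains x where "x \<in> K" "f x = x"
proof -
  have "\<exists>x\<in>K. f x = x"
  proof (rule ccontr)
    assume "\<not> ?thesis"
    then have nz: "\<And>x. x \<in> K \<Longrightarrow> f x - x \<noteq> 0" by auto
    have "continuous_on K (\<lambda>x. norm (f x - x))" by (intro continuous_intros cont)
    from continuous_attains_inf[OF \<open>compact K\<close> \<open>K \<noteq> {}\<close> this]
    obtain x0 where x0: "x0 \<in> K" "\<And>x. x \<in> K \<Longrightarrow> norm (f x0 - x0) \<le> norm (f x - x)" by blast
    define d where "d = norm (f x0 - x0)"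
    have "d > 0" using nz[OF x0(1)] by (simp add: d_def)
    obtain N where N: "finite N" "N \<subseteq> K" "K \<subseteq> (\<Union>x\<in>N. ball x d)"
    proof (rule compactE_image[OF \<open>compact K\<close>, of K "\<lambda>x. ball x d"])
      show "K \<subseteq> (\<Union>x\<in>K. ball x d)" using \<open>d > 0\<close> by auto
    qed (use that in auto)
    have "N \<noteq> {}" using N \<open>K \<noteq> {}\<close> by auto
    define n where "n = card N"
    obtain b where b: "bij_betw b {..<n} N"
      using ex_bij_betw_nat_finite[OF N(1)] by (auto simp: n_def lessThan_atLeast0)
    have "n > 0" using N(1) \<open>N \<noteq> {}\<close> by (auto simp: n_def card_gt_0_iff)
    have bK: "b i \<in> K" if "i < n" for i using b that N(2) by (auto simp: bij_betw_def)
    define m where "m i y = max 0 (d - norm (y - b i))" for i y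
    have m0: "m i y \<ge> 0" for i y by (simp add: m_def)
    have msum: "(\<Sum>i<n. m i y) > 0" if y: "y \<in> K" for y
    proof -
      obtain i where "i < n" "y \<in> ball (b i) d" using N(3) y b by (auto simp: bij_betw_def)
      then have "m i y > 0" by (simp add: m_def dist_norm norm_minus_commute)
      with \<open>i < n\<close> m0 show ?thesis by (intro sum_pos2[of _ i]) auto
    qed
    have sum_in_K: "(\<Sum>i<n. c i *\<^sub>R b i) \<in> K" if "\<And>i. i < n \<Longrightarrow> c i \<ge> 0" "(\<Sum>i<n. c i) = 1" for c
      using that by (intro convex_sum \<open>convex K\<close> bK) auto
    define Q where "Q = {x::nat \<Rightarrow> real. \<forall>i. 0 \<le> x i \<and> x i \<le> (if i < n then 1 else 0)}"
    define tot where "tot a = (\<Sum>i<n. a i)" for a :: "nat \<Rightarrow> real"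
    \<comment> \<open>Defined on the whole cube and not only on the simplex: missing mass is put on
      \<open>b 0\<close>, excess mass is normalized away. At the Brouwer fixed point the weights sum
      to \<open>1\<close>, so neither correction is active there.\<close>
    define p where "p a = (1 / max 1 (tot a)) *\<^sub>R ((\<Sum>i<n. a i *\<^sub>R b i) + max 0 (1 - tot a) *\<^sub>R b 0)" for a
    have pK: "p a \<in> K" if a: "a \<in> Q" for a
    proof -
      define c where "c i = (1 / max 1 (tot a)) * (a i + (if i = 0 then max 0 (1 - tot a) else 0))" for i
      have "p a = (\<Sum>i<n. c i *\<^sub>R b i)"
        using \<open>n > 0\<close>
        by (simp add: p_def c_def scaleR_add_left scaleR_add_right sum.distrib scaleR_sum_right distrib_left
          if_distrib[of "\<lambda>x. _ * x"] if_distrib[of "\<lambda>x. x *\<^sub>R _"] cong: if_cong)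
      moreover have "(\<Sum>i<n. c i) = 1"
        using \<open>n > 0\<close>
        by (simp add: c_def sum.distrib flip: sum_distrib_left) (auto simp: max_def tot_def sum.distrib simp flip: sum_divide_distrib)
      ultimately show ?thesis
        using a sum_in_K[of c] by (auto simp: Q_def c_def)
    qed
    define g where "g a i = (if i < n then m i (f (p a)) / (\<Sum>j<n. m j (f (p a))) else 0)" for a i
    have fp: "f (p a) \<in> K" if "a \<in> Q" for a using into pK[OF that] by blast
    have "continuous_on Q p"
      unfolding p_def tot_def[abs_def]
      by (intro continuous_intros continuous_on_subset[OF continuous_on_product_coordinates]) auto
    then have cfp: "continuous_on Q (\<lambda>a. f (p a))"
      by (rule continuous_on_compose2[OF cont]) (use pK in blast)
    have "continuous_on Q (\<lambda>a. g a i)" for i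
    proof (cases "i < n")
      case True
      have *: "(\<Sum>j<n. max 0 (d - norm (f (p a) - b j))) \<noteq> 0" if "a \<in> Q" for a
        using msum[OF fp[OF that]] by (simp add: m_def)
      show ?thesis
        using True unfolding g_def m_def by (auto intro!: continuous_intros cfp *)
    qed (simp add: g_def)
    then have gc: "continuous_on Q g" by (rule continuous_on_coordinatewise_then_product)
    have "g ` Q \<subseteq> Q"
    proof safe
      fix a assume "a \<in> Q"
      then have pos: "(\<Sum>j<n. m j (f (p a))) > 0" by (rule msum[OF fp])
      have "m i (f (p a)) \<le> (\<Sum>j<n. m j (f (p a)))" if "i < n" for i
        using that m0 by (intro member_le_sum) auto
      then show "g a \<in> Q" using pos m0 by (auto simp: Q_def g_def less_imp_le)
    qed
    with gc obtain a where a: "a \<in> Q" "g a = a"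
      unfolding Q_def by (rule brouwer_nat_cube)
    define y where "y = f (p a)"
    have pos: "(\<Sum>j<n. m j y) > 0" using msum[OF fp[OF a(1)]] by (simp add: y_def)
    have ai: "a i = m i y / (\<Sum>j<n. m j y)" if "i < n" for i
      using that fun_cong[OF a(2), of i] by (simp add: g_def y_def)
    have tot1: "tot a = 1"
      using pos by (simp add: tot_def ai flip: sum_divide_distrib)
    have "y - p a = (\<Sum>i<n. a i *\<^sub>R (y - b i))"
      using tot1 by (simp add: p_def tot_def scaleR_diff_right sum_subtractf flip: scaleR_sum_left)
    then have "norm (y - p a) \<le> (\<Sum>i<n. a i * norm (y - b i))"
      using a(1) by (auto intro!: order_trans[OF norm_sum] sum_mono simp: Q_def)
    \<comment> \<open>A weight \<open>a i\<close> is positive only if \<open>f (p a)\<close> lies at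
      distance less than \<open>d\<close> from \<open>b i\<close>; some weight is positive because
      they sum to \<open>1\<close>.\<close>
    also have "\<dots> < (\<Sum>i<n. a i * d)"
    proof (rule sum_strict_mono_ex1)
      have le: "a i * norm (y - b i) \<le> a i * d" and less: "a i > 0 \<Longrightarrow> a i * norm (y - b i) < a i * d" if "i < n" for i
      proof -
        have "a i = 0 \<or> a i > 0 \<and> norm (y - b i) < d"
          using ai[OF that] pos by (auto simp: m_def)
        then show "a i * norm (y - b i) \<le> a i * d" "a i > 0 \<Longrightarrow> a i * norm (y - b i) < a i * d"
          by auto
      qed
      show "\<forall>i\<in>{..<n}. a i * norm (y - b i) \<le> a i * d" using le by simp
      have "\<exists>i<n. a i > 0"
      proof (rule ccontr)
        assume "\<not> ?thesis"
        then have "tot a \<le> 0" by (auto simp: tot_def not_less not_le intro!: sum_nonpos dest: leD)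
        with tot1 show False by simp
      qed
      then show "\<exists>i\<in>{..<n}. a i * norm (y - b i) < a i * d" using less by blast
    qed simp
    also have "\<dots> = d" using tot1 by (simp add: tot_def flip: sum_distrib_right)
    finally show False using x0(2)[OF pK[OF a(1)]] by (simp add: d_def y_def)
  qed
  then show thesis using that by blast
qed

text \<open>
  If the fixed points at \<open>t = 0\<close> and \<open>t = 1\<close> were separated by a clopen splitting \<open>A \<union> B\<close>, the map
  \<open>(t, x) \<mapsto> (\<tau>, f (t, x))\<close>, with \<open>\<tau> = 1\<close> on \<open>A\<close> and \<open>\<tau> = 0\<close> on \<open>B\<close>, would have no fixed point.
\<close>

theorem fixpoint_continuum:
  fixes f :: "real \<times> 'a::real_normed_vector \<Rightarrow> 'a"
  assumes K: "compact K" "convex K" and cont: "continuous_on ({0..1} \<times> K) f" and into: "f ` ({0..1} \<times> K) \<subseteq> K"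
    and p: "p \<in> K" "\<And>x. x \<in> K \<Longrightarrow> f (0, x) = x \<longleftrightarrow> x = p"
  obtains C where "C \<subseteq> {(t, x) \<in> {0..1} \<times> K. f (t, x) = x}" "compact C" "connected C" "(0, p) \<in> C"
    "\<exists>x. (1, x) \<in> C"
proof -
  define S where "S = {(t, x) \<in> {0..1} \<times> K. f (t, x) = x}"
  have cK: "compact ({0..1::real} \<times> K)" by (simp add: compact_Times K(1))
  have "closedin (top_of_set ({0..1} \<times> K)) (({0..1} \<times> K) \<inter> (\<lambda>z. f z - snd z) -` {0})"
    by (intro continuous_closedin_preimage continuous_intros cont)
  moreover have S_eq: "S = ({0..1} \<times> K) \<inter> (\<lambda>z. f z - snd z) -` {0}" by (auto simp: S_def)
  ultimately have "compact S" using cK closedin_compact by metis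
  have pS: "(0, p) \<in> S" using p by (auto simp: S_def)
  define C where "C = connected_component_set S (0, p)"
  have "\<exists>x. (1, x) \<in> C"
  proof (rule ccontr)
    assume no: "\<not> ?thesis"
    let ?X = "top_of_set S"
    have "compact_space ?X" "Hausdorff_space ?X"
      using \<open>compact S\<close> by (auto simp: compact_space_subtopology Hausdorff_space_subtopology)
    \<comment> \<open>In a compact Hausdorff space connected components are intersections of clopen
      sets, so each solution at \<open>t = 1\<close> outside \<open>C\<close> is separated from
      \<open>(0, p)\<close> by a clopen set.\<close>
    then have q: "quasi_component_of ?X (0, p) = connected_component_of ?X (0, p)"
      by (intro quasi_eq_connected_component_of) auto
    have "\<exists>T. (0, p) \<in> T \<and> closedin ?X T \<and> openin ?X T \<and> y \<notin> T" if "y \<in> S" "fst y = 1" for y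
    proof -
      have "\<not> connected_component_of ?X (0, p) y"
        using no that by (cases y) (auto simp: C_def connected_component_of_def connected_component_def connectedin_subtopology)
      then show ?thesis using that pS unfolding q[symmetric] quasi_component_of by auto
    qed
    then obtain T where T: "\<And>y. \<lbrakk>y \<in> S; fst y = 1\<rbrakk> \<Longrightarrow> (0, p) \<in> T y \<and> closedin ?X (T y) \<and> openin ?X (T y) \<and> y \<notin> T y"
      by metis
    define S1 where "S1 = {y \<in> S. fst y = 1}"
    have "closedin ?X (S \<inter> fst -` {1})"
      by (intro continuous_closedin_preimage continuous_intros)
    moreover have "S \<inter> fst -` {1} = S1" by (auto simp: S1_def)
    ultimately have "compact S1" using closedin_compact[OF \<open>compact S\<close>] by simp
    have "\<exists>U. open U \<and> S - T y = S \<inter> U" if "y \<in> S1" for y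
    proof -
      have "openin ?X (S - T y)" using T[of y] that by (intro openin_diff) (auto simp: S1_def)
      then show ?thesis by (simp only: openin_open)
    qed
    then obtain U where "\<forall>y\<in>S1. open (U y) \<and> S - T y = S \<inter> U y"
      using bchoice[of S1 "\<lambda>y U. open U \<and> S - T y = S \<inter> U"] by blast
    then have U: "open (U y)" "S - T y = S \<inter> U y" if "y \<in> S1" for y
      using that by auto
    \<comment> \<open>By compactness of the solutions at \<open>t = 1\<close>, finitely many of
      these clopen sets suffice, and their intersection \<open>A\<close> contains no solution at
      \<open>t = 1\<close>.\<close>
    obtain I where I: "I \<subseteq> S1" "finite I" "S1 \<subseteq> (\<Union>y\<in>I. U y)"
    proof (rule compactE_image[OF \<open>compact S1\<close>, of S1 U])
      show "S1 \<subseteq> \<Union> (U ` S1)"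
      proof
        fix y assume y: "y \<in> S1"
        then have "y \<in> S - T y" using T by (simp add: S1_def)
        with y show "y \<in> \<Union> (U ` S1)" using U(2)[OF y] by blast
      qed
    qed (use U(1) in auto)
    define A where "A = S \<inter> (\<Inter>y\<in>I. T y)"
    define B where "B = S \<inter> (\<Union>y\<in>I. U y)"
    have UT: "x \<in> U y \<longleftrightarrow> x \<notin> T y" if "y \<in> I" "x \<in> S" for x y
      using U(2)[of y] that I(1) by blast
    have AB: "A \<union> B = S" "A \<inter> B = {}" using UT by (auto simp: A_def B_def)
    have "openin ?X B" unfolding B_def using U I by (intro openin_open_Int open_UN) auto
    moreover have "S - A = B" "S - B = A" using AB by auto
    moreover have "B = (\<Union>y\<in>I. S - T y)" using UT by (auto simp: B_def)
    moreover have "closedin ?X (\<Union>y\<in>I. S - T y)"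
      using I T by (intro closedin_Union) (auto simp: S1_def intro!: closedin_diff)
    ultimately have "closedin ?X A" "closedin ?X B"
      by (auto simp: closedin_def A_def)
    then have cAB: "closed A" "closed B"
      using \<open>compact S\<close> closedin_compact compact_imp_closed by blast+
    have pA: "(0, p) \<in> A" using T I pS by (auto simp: A_def S1_def)
    have B1: "y \<in> B" if "y \<in> S" "fst y = 1" for y
      using I(3) that by (auto simp: S1_def B_def)
    show False
    \<comment> \<open>If \<open>B\<close> is empty there is no fixed point at \<open>t = 1\<close>
      at all, against Schauder for \<open>f (1, _)\<close>. The case is separate because
      \<open>infdist\<close> to the empty set does not separate.\<close>
    proof (cases "B = {}")
      case True
      have "\<exists>x\<in>K. f (1, x) = x"
      proof (rule schauder_fixpoint[OF K, of "\<lambda>x. f (1, x)"])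
        show "continuous_on K (\<lambda>x. f (1, x))"
          by (rule continuous_on_compose2[OF cont]) (auto intro!: continuous_intros)
      qed (use p into in auto)
      then show False using B1 True by (force simp: S_def)
    next
      case False
      have Ane: "A \<noteq> {}" using pA by auto
      define \<tau> where "\<tau> z = infdist z B / (infdist z A + infdist z B)" for z
      have sep: "infdist z A + infdist z B > 0" for z
        using in_closed_iff_infdist_zero[OF cAB(1) Ane, of z] in_closed_iff_infdist_zero[OF cAB(2) False, of z]
          AB(2) infdist_nonneg[of z A] infdist_nonneg[of z B]
        by (metis add_nonneg_eq_0_iff add_nonneg_nonneg disjoint_iff order_less_le)
      have \<tau>01: "0 \<le> \<tau> z" "\<tau> z \<le> 1" for z
        using sep[of z] infdist_nonneg[of z A] infdist_nonneg[of z B] by (auto simp: \<tau>_def field_simps)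
      have \<tau>A: "\<tau> z = 1" if "z \<in> A" for z
        using that sep[of z] by (simp add: \<tau>_def)
      have \<tau>B: "\<tau> z = 0" if "z \<in> B" for z
        using that by (simp add: \<tau>_def)
      have "continuous_on UNIV \<tau>"
        unfolding \<tau>_def using sep by (intro continuous_intros) (metis less_irrefl)+
      then have c\<tau>: "continuous_on ({0..1} \<times> K) \<tau>" by (rule continuous_on_subset) simp
      obtain z where z: "z \<in> {0..1} \<times> K" "(\<tau> z, f z) = z"
      proof (rule schauder_fixpoint[OF cK, of "\<lambda>z. (\<tau> z, f z)"])
        show "convex ({0..1::real} \<times> K)" using K by (intro convex_Times) auto
        show "continuous_on ({0..1} \<times> K) (\<lambda>z. (\<tau> z, f z))" by (intro continuous_intros c\<tau> cont)
      qed (use p into \<tau>01 in auto)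
      then obtain t x where tx: "z = (t, x)" "\<tau> z = t" "f z = x" by (cases z) auto
      then have "z \<in> S" using z by (auto simp: S_def)
      then consider "z \<in> A" | "z \<in> B" using AB by blast
      then show False
      proof cases
        case 1
        then have "fst z = 1" using \<tau>A tx by auto
        then show False using B1 \<open>z \<in> S\<close> 1 AB by blast
      next
        case 2
        then have "t = 0" using \<tau>B tx by auto
        then have "x = p" using \<open>z \<in> S\<close> tx p(2) by (auto simp: S_def)
        then show False using pA 2 AB tx \<open>t = 0\<close> by auto
      qed
    qed
  qed
  moreover have "compact C"
    unfolding C_def by (rule closedin_compact[OF \<open>compact S\<close> closedin_connected_component])
  moreover have "C \<subseteq> S" "connected C" "(0, p) \<in> C"
    using pS by (auto simp: C_def connected_component_subset connected_component_refl)
  ultimately show thesis using that by (auto simp: S_def)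
qed

subsection \<open>Harmonics of periodic functions\<close>

definition cper :: "(real \<Rightarrow> 'a::euclidean_space) \<Rightarrow> bool" where
  "cper f \<longleftrightarrow> continuous_on UNIV f \<and> (\<forall>t. f (t + 2 * pi) = f t)"

lemma cperI: "continuous_on UNIV f \<Longrightarrow> (\<And>t. f (t + 2 * pi) = f t) \<Longrightarrow> cper f"
  by (simp add: cper_def)

lemma cper_cont: "cper f \<Longrightarrow> continuous_on S f"
  by (auto simp: cper_def intro: continuous_on_subset)

lemma cper_cont_comp:
  assumes "cper f" "continuous_on S g" shows "continuous_on S (\<lambda>x. f (g x))"
  by (rule continuous_on_compose2[OF cper_cont[OF assms(1), of UNIV] assms(2)]) simp

lemma cper_add: "cper f \<Longrightarrow> cper g \<Longrightarrow> cper (\<lambda>t. f t + g t)"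
  and cper_diff: "cper f \<Longrightarrow> cper g \<Longrightarrow> cper (\<lambda>t. f t - g t)"
  and cper_scaleR: "cper f \<Longrightarrow> cper (\<lambda>t. c *\<^sub>R f t)"
  and cper_const: "cper (\<lambda>_. v)"
  by (auto simp: cper_def intro!: continuous_intros)

lemma cper_linear: "bounded_linear h \<Longrightarrow> cper f \<Longrightarrow> cper (\<lambda>t. h (f t))"
  by (auto simp: cper_def bounded_linear.continuous_on)

lemma cper_sum: "(\<And>i. i \<in> I \<Longrightarrow> cper (f i)) \<Longrightarrow> cper (\<lambda>t. \<Sum>i\<in>I. f i t)"
  by (auto simp: cper_def intro!: continuous_intros sum.cong)

lemma cper_int: 
  assumes "cper f" shows "f (t + 2 * pi * of_int n) = f t"
proof -
  have nat: "f (t + 2 * pi * real m) = f t" for t and m :: nat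
  proof (induction m)
    case (Suc m)
    have "f (t + 2 * pi * real m + 2 * pi) = f (t + 2 * pi * real m)" using assms by (simp add: cper_def)
    then show ?case using Suc by (simp add: algebra_simps)
  qed simp
  show ?thesis
  proof (cases "n \<ge> 0")
    case True
    then show ?thesis using nat[of t "nat n"] by simp
  next
    case False
    then show ?thesis using nat[of "t + 2 * pi * of_int n" "nat (- n)"] by simp
  qed
qed

text \<open>This lets a periodic function be read as a function on the unit circle through
  \<open>Arg\<close>, whatever branch of the argument is taken.\<close>

lemma cper_cis_cong:
  assumes "cper f" "cis a = cis b" shows "f a = f b"
proof -
  from assms(2) have "sin a = sin b \<and> cos a = cos b" by (simp add: cis.ctr complex_eq_iff)
  then obtain n :: int where "a = b + 2 * pi * of_int n" 
    using sin_cos_eq_iff[of a b] by auto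
  then show ?thesis using cper_int[OF assms(1), of b n] by simp
qed

lemma reduce_mod_2pi: obtains n :: int where "t + 2 * pi * of_int n \<in> {0..2 * pi}"
proof
  have "of_int \<lfloor>t / (2 * pi)\<rfloor> \<le> t / (2 * pi)" "t / (2 * pi) < of_int \<lfloor>t / (2 * pi)\<rfloor> + 1" by linarith+
  then have "of_int \<lfloor>t / (2 * pi)\<rfloor> * (2 * pi) \<le> t" "t < (of_int \<lfloor>t / (2 * pi)\<rfloor> + 1) * (2 * pi)"
    by (simp_all only: pos_le_divide_eq pos_divide_less_eq pi_gt_zero mult_pos_pos zero_less_numeral)
  then show "t + 2 * pi * of_int (- \<lfloor>t / (2 * pi)\<rfloor>) \<in> {0..2 * pi}"
    by (simp add: algebra_simps)
qed

lemma cper_bounded: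
  assumes "cper f" obtains M where "\<And>t. norm (f t) \<le> M" "M > 0"
proof -
  have "compact (f ` {0..2 * pi})" by (intro compact_continuous_image cper_cont[OF assms]) simp
  then obtain M where M: "M > 0" "\<And>t. t \<in> {0..2 * pi} \<Longrightarrow> norm (f t) \<le> M"
    using compact_imp_bounded bounded_pos by (metis imageI)
  have "norm (f t) \<le> M" for t
  proof -
    obtain n where "t + 2 * pi * of_int n \<in> {0..2 * pi}" by (rule reduce_mod_2pi)
    then show ?thesis using M(2) cper_int[OF assms, of t n] by metis
  qed
  with M that show thesis by blast
qed

lemma periodic_integral_shift:
  fixes f :: "real \<Rightarrow> 'a::euclidean_space"
  assumes f: "cper f"
  shows "integral {0..2 * pi} (\<lambda>s. f (s + a)) = integral {0..2 * pi} f"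
proof -
  have int: "f integrable_on {c..d}" for c d by (rule integrable_continuous_real[OF cper_cont[OF f]])
  have sh: "integral {0..2 * pi} (\<lambda>s. f (s + a)) = integral {a..a + 2 * pi} f" for a
    using integral_shift[where a = 0 and b = "2 * pi" and f = f and c = a] cper_cont[OF f] by (simp add: o_def add.commute)
  have pos: "integral {b..b + 2 * pi} f = integral {0..2 * pi} f" if "0 \<le> b" "b \<le> 2 * pi" for b
  proof -
    have "integral {b..b + 2 * pi} f = integral {b..2 * pi} f + integral {2 * pi..b + 2 * pi} f"
      using that int by (intro Henstock_Kurzweil_Integration.integral_combine[symmetric]) auto
    also have "integral {2 * pi..b + 2 * pi} f = integral {0..b} (\<lambda>s. f (s + 2 * pi))"
      using integral_shift[where a = 0 and b = b and f = f and c = "2 * pi"] cper_cont[OF f] by (simp add: o_def add.commute)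
    also have "\<dots> = integral {0..b} f" using f by (simp add: cper_def)
    also have "integral {b..2 * pi} f + integral {0..b} f = integral {0..2 * pi} f"
      using that int by (subst add.commute, intro Henstock_Kurzweil_Integration.integral_combine) auto
    finally show ?thesis .
  qed
  obtain n where n: "a + 2 * pi * of_int n \<in> {0..2 * pi}" by (rule reduce_mod_2pi)
  have "(\<lambda>s. f (s + a)) = (\<lambda>s. f (s + (a + 2 * pi * of_int n)))"
    using cper_int[OF f] by (metis add.assoc)
  then show ?thesis using sh[of "a + 2 * pi * of_int n"] pos n by simp
qed

lemma cos_sin_nat_periodic:
  "cos (real k * (t + 2 * pi)) = cos (real k * t)" "sin (real k * (t + 2 * pi)) = sin (real k * t)"
  "cos (real k * (2 * pi)) = 1" "sin (real k * (2 * pi)) = 0"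
  using cos.plus_of_nat[of "real k * t" k] sin.plus_of_nat[of "real k * t" k]
    cos.plus_of_nat[of "0::real" k] sin.plus_of_nat[of "0::real" k] by (simp_all add: algebra_simps)

lemma cos_sin_nat_periodic_diff:
  "cos (real k * (t + 2 * pi - a)) = cos (real k * (t - a))" "sin (real k * (t + 2 * pi - a)) = sin (real k * (t - a))"
  using cos_sin_nat_periodic(1,2)[of k "t - a"] by (simp_all add: algebra_simps)

definition fcos :: "nat \<Rightarrow> (real \<Rightarrow> 'a::euclidean_space) \<Rightarrow> 'a" where
  "fcos k f = integral {0..2 * pi} (\<lambda>s. cos (real k * s) *\<^sub>R f s)"

definition fsin :: "nat \<Rightarrow> (real \<Rightarrow> 'a::euclidean_space) \<Rightarrow> 'a" where
  "fsin k f = integral {0..2 * pi} (\<lambda>s. sin (real k * s) *\<^sub>R f s)"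

text \<open>The projection onto frequency \<open>k\<close>, kept as a function of \<open>t\<close>
  instead of a pair of coefficients: in this form it commutes with linear maps, translations and
  reflections, and works for values in any Euclidean space. The factor differs at
  \<open>k = 0\<close> because \<open>cos 0\<close> has twice the mean square of the other
  modes.\<close>

definition harmonic :: "nat \<Rightarrow> (real \<Rightarrow> 'a::euclidean_space) \<Rightarrow> real \<Rightarrow> 'a" where
  "harmonic k f t = (if k = 0 then 1 / (2 * pi) else 1 / pi) *\<^sub>R
     (cos (real k * t) *\<^sub>R fcos k f + sin (real k * t) *\<^sub>R fsin k f)"

lemma fcs_integrable:
  assumes "cper f"
  shows "(\<lambda>s. cos (real k * s) *\<^sub>R f s) integrable_on {a..b}" "(\<lambda>s. sin (real k * s) *\<^sub>R f s) integrable_on {a..b}"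
  by (intro integrable_continuous_real continuous_intros cper_cont[OF assms])+

lemma fcs_add:
  assumes "cper f" "cper g"
  shows "fcos k (\<lambda>t. f t + g t) = fcos k f + fcos k g" "fsin k (\<lambda>t. f t + g t) = fsin k f + fsin k g"
  using fcs_integrable[OF assms(1)] fcs_integrable[OF assms(2)]
  by (simp_all add: fcos_def fsin_def scaleR_add_right Henstock_Kurzweil_Integration.integral_add)

lemma fcs_linear:
  assumes "bounded_linear h" "cper f"
  shows "fcos k (\<lambda>t. h (f t)) = h (fcos k f)" "fsin k (\<lambda>t. h (f t)) = h (fsin k f)"
proof -
  interpret h: bounded_linear h by fact
  show "fcos k (\<lambda>t. h (f t)) = h (fcos k f)" "fsin k (\<lambda>t. h (f t)) = h (fsin k f)"
    using integral_linear[OF fcs_integrable(1)[OF assms(2)] assms(1), of 0 "2 * pi" k]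
      integral_linear[OF fcs_integrable(2)[OF assms(2)] assms(1), of 0 "2 * pi" k]
    by (simp_all add: fcos_def fsin_def o_def h.scaleR)
qed

lemma harmonic_add: "cper f \<Longrightarrow> cper g \<Longrightarrow> harmonic k (\<lambda>t. f t + g t) t = harmonic k f t + harmonic k g t"
  by (simp add: harmonic_def fcs_add scaleR_add_right)

lemma harmonic_linear: 
  assumes "bounded_linear h" "cper f" shows "harmonic k (\<lambda>t. h (f t)) t = h (harmonic k f t)"
proof -
  interpret h: bounded_linear h by fact
  show ?thesis by (simp add: harmonic_def fcs_linear[OF assms] h.scaleR h.add)
qed

lemma harmonic_scaleR: "cper f \<Longrightarrow> harmonic k (\<lambda>t. c *\<^sub>R f t) t = c *\<^sub>R harmonic k f t"
  by (rule harmonic_linear[OF bounded_linear_scaleR_right])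

lemma harmonic_diff: "cper f \<Longrightarrow> cper g \<Longrightarrow> harmonic k (\<lambda>t. f t - g t) t = harmonic k f t - harmonic k g t"
  using harmonic_add[of f "\<lambda>t. (-1) *\<^sub>R g t" k t] harmonic_scaleR[of g k "-1" t] cper_scaleR[of g "-1"] by simp

lemma harmonic_sum: "finite I \<Longrightarrow> (\<And>i. i \<in> I \<Longrightarrow> cper (f i)) \<Longrightarrow> harmonic k (\<lambda>t. \<Sum>i\<in>I. f i t) t = (\<Sum>i\<in>I. harmonic k (f i) t)"
proof (induction I rule: finite_induct)
  case empty
  show ?case by (simp add: harmonic_def fcos_def fsin_def)
next
  case (insert i I)
  then show ?case by (simp add: harmonic_add cper_sum)
qed

lemma harmonic_cper: "cper (harmonic k f)"
proof (rule cperI)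
  show "continuous_on UNIV (harmonic k f)" unfolding harmonic_def[abs_def] by (intro continuous_intros)
  fix t
  show "harmonic k f (t + 2 * pi) = harmonic k f t" by (simp add: harmonic_def cos_sin_nat_periodic)
qed

lemma norm_fcs_le:
  assumes "cper f" "\<And>t. norm (f t) \<le> M"
  shows "norm (fcos k f) \<le> 2 * pi * M" "norm (fsin k f) \<le> 2 * pi * M"
proof -
  have "M \<ge> 0" using assms(2)[of 0] norm_ge_zero order_trans by blast
  have *: "norm (cos x *\<^sub>R f s) \<le> M" "norm (sin x *\<^sub>R f s) \<le> M" for x s
    using mult_mono[of "\<bar>cos x\<bar>" 1 "norm (f s)" M] mult_mono[of "\<bar>sin x\<bar>" 1 "norm (f s)" M] assms(2) by auto
  have "norm (fcos k f) \<le> M * (2 * pi - 0)" "norm (fsin k f) \<le> M * (2 * pi - 0)" unfolding fcos_def fsin_def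
    by (rule integral_bound; auto intro!: continuous_intros cper_cont[OF assms(1)] * simp del: norm_scaleR)+
  then show "norm (fcos k f) \<le> 2 * pi * M" "norm (fsin k f) \<le> 2 * pi * M" by (simp_all add: mult_ac)
qed

text \<open>Each coefficient is at most \<open>2 pi M\<close> and the prefactor is at most
  \<open>1 / pi\<close>. The constant \<open>4\<close> is crude but the same for all frequencies, as
  the Weierstrass test for multipliers requires.\<close>

lemma norm_harmonic_le:
  assumes "cper f" "\<And>t. norm (f t) \<le> M"
  shows "norm (harmonic k f t) \<le> 4 * M"
proof -
  have "norm (cos (real k * t) *\<^sub>R fcos k f + sin (real k * t) *\<^sub>R fsin k f) \<le> norm (fcos k f) + norm (fsin k f)"
    by (rule norm_triangle_le) (simp add: add_mono mult_left_le_one_le abs_cos_le_one)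
  also have "\<dots> \<le> 4 * pi * M" using norm_fcs_le[OF assms, of k] by simp
  finally have *: "norm (cos (real k * t) *\<^sub>R fcos k f + sin (real k * t) *\<^sub>R fsin k f) \<le> 4 * pi * M" .
  have "norm (harmonic k f t) \<le> (1 / pi) * norm (cos (real k * t) *\<^sub>R fcos k f + sin (real k * t) *\<^sub>R fsin k f)"
    unfolding harmonic_def norm_scaleR by (intro mult_right_mono) (auto simp: field_simps)
  also have "\<dots> \<le> (1 / pi) * (4 * pi * M)" using * by (intro mult_left_mono) auto
  finally show ?thesis by simp
qed

lemma fcs_shift:
  assumes f: "cper f"
  shows "fcos k (\<lambda>s. f (s + a)) = cos (real k * a) *\<^sub>R fcos k f + sin (real k * a) *\<^sub>R fsin k f" (is ?c)
    and "fsin k (\<lambda>s. f (s + a)) = cos (real k * a) *\<^sub>R fsin k f - sin (real k * a) *\<^sub>R fcos k f" (is ?s)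
proof -
  have cs: "cper (\<lambda>s. cos (real k * (s - a)) *\<^sub>R f s)" "cper (\<lambda>s. sin (real k * (s - a)) *\<^sub>R f s)"
    using f by (auto intro!: cperI continuous_intros cper_cont[OF f] simp: cper_def cos_sin_nat_periodic_diff)
  show ?c
  proof -
    have "fcos k (\<lambda>s. f (s + a)) = integral {0..2 * pi} (\<lambda>s. cos (real k * (s - a)) *\<^sub>R f s)"
      using periodic_integral_shift[OF cs(1), of a] by (simp add: fcos_def)
    also have "\<dots> = integral {0..2 * pi} (\<lambda>s. cos (real k * a) *\<^sub>R (cos (real k * s) *\<^sub>R f s) + sin (real k * a) *\<^sub>R (sin (real k * s) *\<^sub>R f s))"
      by (simp add: right_diff_distrib cos_diff algebra_simps)
    also have "\<dots> = cos (real k * a) *\<^sub>R fcos k f + sin (real k * a) *\<^sub>R fsin k f"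
      unfolding fcos_def fsin_def
      by (subst Henstock_Kurzweil_Integration.integral_add)
        (use fcs_integrable[OF f] in \<open>auto intro!: integrable_cmul simp del: scaleR_scaleR\<close>)
    finally show ?thesis .
  qed
  show ?s
  proof -
    have "fsin k (\<lambda>s. f (s + a)) = integral {0..2 * pi} (\<lambda>s. sin (real k * (s - a)) *\<^sub>R f s)"
      using periodic_integral_shift[OF cs(2), of a] by (simp add: fsin_def)
    also have "\<dots> = integral {0..2 * pi} (\<lambda>s. cos (real k * a) *\<^sub>R (sin (real k * s) *\<^sub>R f s) - sin (real k * a) *\<^sub>R (cos (real k * s) *\<^sub>R f s))"
      by (simp add: right_diff_distrib sin_diff algebra_simps)
    also have "\<dots> = cos (real k * a) *\<^sub>R fsin k f - sin (real k * a) *\<^sub>R fcos k f"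
      unfolding fcos_def fsin_def
      by (subst Henstock_Kurzweil_Integration.integral_diff)
        (use fcs_integrable[OF f] in \<open>auto intro!: integrable_cmul simp del: scaleR_scaleR\<close>)
    finally show ?thesis .
  qed
qed

lemma harmonic_shift: "cper f \<Longrightarrow> harmonic k (\<lambda>s. f (s + a)) t = harmonic k f (t + a)"
  by (simp add: harmonic_def fcs_shift distrib_left cos_add sin_add algebra_simps)

lemma harmonic_reflect:
  assumes f: "cper f" shows "harmonic k (\<lambda>s. f (- s)) t = harmonic k f (- t)"
proof -
  have per: "cper (\<lambda>s. cos (real k * s) *\<^sub>R f s)" "cper (\<lambda>s. sin (real k * s) *\<^sub>R f s)"
    using f by (auto intro!: cperI continuous_intros cper_cont[OF f] simp: cper_def cos_sin_nat_periodic)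
  have refl: "integral {0..2 * pi} (\<lambda>s. g (- s)) = integral {0..2 * pi} g" if g: "cper g" for g :: "real \<Rightarrow> 'a"
  proof -
    have "integral {0..2 * pi} g = integral {- (2 * pi).. 0} (\<lambda>s. g (- s))"
      using Henstock_Kurzweil_Integration.integral_reflect_real[of "2 * pi" 0 g] by simp
    also have "\<dots> = integral {0..2 * pi} (\<lambda>s. g (- (s - 2 * pi)))"
    proof -
      have "continuous_on {- (2 * pi)..0} (\<lambda>s. g (- s))" by (intro cper_cont_comp[OF g] continuous_intros)
      then show ?thesis
        using integral_shift[where a = 0 and b = "2 * pi" and f = "\<lambda>s. g (- s)" and c = "- (2 * pi)"] by (simp add: o_def)
    qed
    also have "(\<lambda>s. g (- (s - 2 * pi))) = (\<lambda>s. g (- s))"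
    proof
      show "g (- (s - 2 * pi)) = g (- s)" for s
        using g[unfolded cper_def, THEN conjunct2, rule_format, of "- s"] by (simp add: algebra_simps)
    qed
    finally show ?thesis by simp
  qed
  have "fcos k (\<lambda>s. f (- s)) = fcos k f" using refl[OF per(1)] by (simp add: fcos_def)
  moreover have "fsin k (\<lambda>s. f (- s)) = - fsin k f"
  proof -
    have "- integral {0..2 * pi} (\<lambda>s. sin (real k * s) *\<^sub>R f (- s)) = fsin k f"
      using refl[OF per(2)] by (simp add: fsin_def)
    then show ?thesis unfolding fsin_def[of k "\<lambda>s. f (- s)"] by (metis minus_minus)
  qed
  ultimately show ?thesis by (simp add: harmonic_def)
qed

text \<open>Both derivatives are carried explicitly, so that an equation is expressed by putting its
  right-hand side in the place of the second derivative.\<close>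

definition C2per :: "(real \<Rightarrow> 'a::euclidean_space) \<Rightarrow> (real \<Rightarrow> 'a) \<Rightarrow> (real \<Rightarrow> 'a) \<Rightarrow> bool" where
  "C2per y y' y'' \<longleftrightarrow> cper y \<and> cper y' \<and> cper y'' \<and>
     (\<forall>t. (y has_vector_derivative y' t) (at t)) \<and> (\<forall>t. (y' has_vector_derivative y'' t) (at t))"

text \<open>Two integrations by parts at once: \<open>cos (k s) y' + k sin (k s) y\<close> is
  periodic with derivative \<open>cos (k s) (y'' + k^2 y)\<close>, and
  \<open>sin (k s) y' - k cos (k s) y\<close> serves for the sine coefficient.\<close>

lemma harmonic_second_deriv:
  assumes "C2per y y' y''"
  shows "harmonic k y'' t = - ((real k)\<^sup>2 *\<^sub>R harmonic k y t)"
proof -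
  have c: "cper y" "cper y'" "cper y''" and d: "\<And>t. (y has_vector_derivative y' t) (at t)"
    "\<And>t. (y' has_vector_derivative y'' t) (at t)" using assms by (auto simp: C2per_def)
  have per: "y (2 * pi) = y 0" "y' (2 * pi) = y' 0" using c by (auto simp: cper_def dest: spec[of _ 0])
  note kp = cos_sin_nat_periodic(3,4)[of k]
  note [derivative_intros] = has_vector_derivative_at_within[OF d(1)] has_vector_derivative_at_within[OF d(2)]
  have "((\<lambda>s. cos (real k * s) *\<^sub>R y'' s + (real k)\<^sup>2 *\<^sub>R (cos (real k * s) *\<^sub>R y s)) has_integral
      ((cos (real k * (2 * pi)) *\<^sub>R y' (2 * pi) + (real k * sin (real k * (2 * pi))) *\<^sub>R y (2 * pi)) -
       (cos (real k * 0) *\<^sub>R y' 0 + (real k * sin (real k * 0)) *\<^sub>R y 0))) {0..2 * pi}"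
    by (rule fundamental_theorem_of_calculus)
      (auto intro!: derivative_eq_intros simp: algebra_simps power2_eq_square)
  moreover have "((\<lambda>s. cos (real k * s) *\<^sub>R y'' s + (real k)\<^sup>2 *\<^sub>R (cos (real k * s) *\<^sub>R y s)) has_integral
      (fcos k y'' + (real k)\<^sup>2 *\<^sub>R fcos k y)) {0..2 * pi}"
    unfolding fcos_def by (intro has_integral_add has_integral_cmul integrable_integral fcs_integrable c)
  ultimately have fcos0: "fcos k y'' + (real k)\<^sup>2 *\<^sub>R fcos k y = 0"
    by (auto simp: kp per dest: has_integral_unique)
  have "((\<lambda>s. sin (real k * s) *\<^sub>R y'' s + (real k)\<^sup>2 *\<^sub>R (sin (real k * s) *\<^sub>R y s)) has_integral
      ((sin (real k * (2 * pi)) *\<^sub>R y' (2 * pi) - (real k * cos (real k * (2 * pi))) *\<^sub>R y (2 * pi)) -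
       (sin (real k * 0) *\<^sub>R y' 0 - (real k * cos (real k * 0)) *\<^sub>R y 0))) {0..2 * pi}"
    by (rule fundamental_theorem_of_calculus)
      (auto intro!: derivative_eq_intros simp: algebra_simps power2_eq_square)
  moreover have "((\<lambda>s. sin (real k * s) *\<^sub>R y'' s + (real k)\<^sup>2 *\<^sub>R (sin (real k * s) *\<^sub>R y s)) has_integral
      (fsin k y'' + (real k)\<^sup>2 *\<^sub>R fsin k y)) {0..2 * pi}"
    unfolding fsin_def by (intro has_integral_add has_integral_cmul integrable_integral fcs_integrable c)
  ultimately have fsin0: "fsin k y'' + (real k)\<^sup>2 *\<^sub>R fsin k y = 0"
    by (auto simp: kp per dest: has_integral_unique)
  from fcos0 fsin0 have "fcos k y'' = - ((real k)\<^sup>2 *\<^sub>R fcos k y)" "fsin k y'' = - ((real k)\<^sup>2 *\<^sub>R fsin k y)"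
    by (simp_all add: eq_neg_iff_add_eq_0)
  then show ?thesis by (simp add: harmonic_def algebra_simps)
qed

lemma harmonic_C2per:
  "C2per (harmonic k f) (\<lambda>t. (if k = 0 then 1 / (2 * pi) else 1 / pi) *\<^sub>R
      ((real k * cos (real k * t)) *\<^sub>R fsin k f - (real k * sin (real k * t)) *\<^sub>R fcos k f))
    (\<lambda>t. - ((real k)\<^sup>2 *\<^sub>R harmonic k f t))"
  unfolding C2per_def
proof (intro conjI allI)
  show "cper (harmonic k f)" by (rule harmonic_cper)
  then show "cper (\<lambda>t. - ((real k)\<^sup>2 *\<^sub>R harmonic k f t))" using cper_scaleR[of "harmonic k f" "- ((real k)\<^sup>2)"] by simp
  show "cper (\<lambda>t. (if k = 0 then 1 / (2 * pi) else 1 / pi) *\<^sub>R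
      ((real k * cos (real k * t)) *\<^sub>R fsin k f - (real k * sin (real k * t)) *\<^sub>R fcos k f))"
    by (auto intro!: cperI continuous_intros simp: cos_sin_nat_periodic)
  fix t
  show "(harmonic k f has_vector_derivative (if k = 0 then 1 / (2 * pi) else 1 / pi) *\<^sub>R
      ((real k * cos (real k * t)) *\<^sub>R fsin k f - (real k * sin (real k * t)) *\<^sub>R fcos k f)) (at t)"
    unfolding harmonic_def[abs_def] by (auto intro!: derivative_eq_intros simp: algebra_simps)
  show "((\<lambda>t. (if k = 0 then 1 / (2 * pi) else 1 / pi) *\<^sub>R
      ((real k * cos (real k * t)) *\<^sub>R fsin k f - (real k * sin (real k * t)) *\<^sub>R fcos k f)) has_vector_derivative
      - ((real k)\<^sup>2 *\<^sub>R harmonic k f t)) (at t)"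
    unfolding harmonic_def by (auto intro!: derivative_eq_intros simp: algebra_simps power2_eq_square)
qed

text \<open>Orthogonality without product integrals: \<open>harmonic k f\<close> is an eigenfunction
  of the second derivative for \<open>-k^2\<close>, while its \<open>j\<close>-th harmonic is
  multiplied by \<open>-j^2\<close>.\<close>

lemma harmonic_harmonic_neq: assumes "j \<noteq> k" shows "harmonic j (harmonic k f) t = 0"
proof -
  have "- ((real j)\<^sup>2 *\<^sub>R harmonic j (harmonic k f) t) = harmonic j (\<lambda>t. (- ((real k)\<^sup>2)) *\<^sub>R harmonic k f t) t"
    using harmonic_second_deriv[OF harmonic_C2per, of j k f t] by simp
  also have "\<dots> = (- ((real k)\<^sup>2)) *\<^sub>R harmonic j (harmonic k f) t"
    by (rule harmonic_scaleR[OF harmonic_cper])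
  finally show ?thesis using assms by (auto simp: power2_eq_iff_nonneg)
qed

lemma harmonic_harmonic_same: "harmonic k (harmonic k f) t = harmonic k f t"
proof (cases "k = 0")
  case True
  then show ?thesis by (simp add: harmonic_def fcos_def fsin_def)
next
  case False
  note kp = cos_sin_nat_periodic(3,4)[of k]
  have cc: "((\<lambda>s. cos (real k * s) * cos (real k * s)) has_integral pi) {0..2 * pi}"
  proof -
    have "((\<lambda>s. cos (real k * s) * cos (real k * s)) has_integral
       (2 * pi / 2 + sin (real k * (2 * pi)) * cos (real k * (2 * pi)) / (2 * real k)) -
       (0 / 2 + sin (real k * 0) * cos (real k * 0) / (2 * real k))) {0..2 * pi}"
    proof (rule fundamental_theorem_of_calculus)
      fix s
      have *: "c * c + d * d = 1 \<Longrightarrow> real k * (real k * 2) = real k * (real k * (2 * (c * c))) + real k * (real k * (2 * (d * d)))"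
        for c d :: real by algebra
      show "((\<lambda>s. s / 2 + sin (real k * s) * cos (real k * s) / (2 * real k)) has_vector_derivative
          cos (real k * s) * cos (real k * s)) (at s within {0..2 * pi})"
        using False by (auto intro!: derivative_eq_intros * simp flip: has_real_derivative_iff_has_vector_derivative
          simp: field_simps power2_eq_square)
    qed simp
    then show ?thesis by (simp add: kp)
  qed
  have sc: "((\<lambda>s. sin (real k * s) * cos (real k * s)) has_integral 0) {0..2 * pi}"
  proof -
    have "((\<lambda>s. sin (real k * s) * cos (real k * s)) has_integral
       ((sin (real k * (2 * pi)))\<^sup>2 / (2 * real k)) - ((sin (real k * 0))\<^sup>2 / (2 * real k))) {0..2 * pi}"
    proof (rule fundamental_theorem_of_calculus)
      fix s
      show "((\<lambda>s. (sin (real k * s))\<^sup>2 / (2 * real k)) has_vector_derivative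
          sin (real k * s) * cos (real k * s)) (at s within {0..2 * pi})"
        using False by (auto intro!: derivative_eq_intros simp flip: has_real_derivative_iff_has_vector_derivative
          simp: field_simps power2_eq_square)
    qed simp
    then show ?thesis by (simp add: kp)
  qed
  have ss: "((\<lambda>s. sin (real k * s) * sin (real k * s)) has_integral pi) {0..2 * pi}"
  proof -
    have "((\<lambda>s. 1 - cos (real k * s) * cos (real k * s)) has_integral (1 * (2 * pi - 0) - pi)) {0..2 * pi}"
      using has_integral_diff[OF has_integral_const_real[of "1::real" 0 "2 * pi"] cc] by simp
    moreover have "1 - cos x * cos x = sin x * sin x" for x :: real
      using sin_squared_eq[of x] by (simp add: power2_eq_square)
    ultimately show ?thesis by simp
  qed
  have "fcos k (harmonic k f) = fcos k f" 
  proof -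
    have "((\<lambda>s. (1 / pi) *\<^sub>R ((cos (real k * s) * cos (real k * s)) *\<^sub>R fcos k f + (sin (real k * s) * cos (real k * s)) *\<^sub>R fsin k f))
       has_integral (1 / pi) *\<^sub>R (pi *\<^sub>R fcos k f + 0 *\<^sub>R fsin k f)) {0..2 * pi}"
      by (intro has_integral_cmul has_integral_add has_integral_scaleR_left cc sc)
    then have "((\<lambda>s. cos (real k * s) *\<^sub>R harmonic k f s) has_integral fcos k f) {0..2 * pi}"
      using False by (simp add: harmonic_def algebra_simps)
    then show ?thesis by (simp add: fcos_def[of k "harmonic k f"] integral_unique)
  qed
  moreover have "fsin k (harmonic k f) = fsin k f" 
  proof -
    have "((\<lambda>s. (1 / pi) *\<^sub>R ((sin (real k * s) * cos (real k * s)) *\<^sub>R fcos k f + (sin (real k * s) * sin (real k * s)) *\<^sub>R fsin k f))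
       has_integral (1 / pi) *\<^sub>R (0 *\<^sub>R fcos k f + pi *\<^sub>R fsin k f)) {0..2 * pi}"
      by (intro has_integral_cmul has_integral_add has_integral_scaleR_left ss sc)
    then have "((\<lambda>s. sin (real k * s) *\<^sub>R harmonic k f s) has_integral fsin k f) {0..2 * pi}"
      using False by (simp add: harmonic_def algebra_simps)
    then show ?thesis by (simp add: fsin_def[of k "harmonic k f"] integral_unique)
  qed
  ultimately show ?thesis by (simp add: harmonic_def)
qed

section \<open>Density of trigonometric polynomials and uniqueness of Fourier expansions\<close>

text \<open>Integer frequencies are allowed because the product-to-sum formulas produce differences
  \<open>k - j\<close> of either sign.\<close>

inductive trig_poly :: "(real \<Rightarrow> real) \<Rightarrow> bool" where
  cos: "trig_poly (\<lambda>s. cos (of_int k * s))"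
| sin: "trig_poly (\<lambda>s. sin (of_int k * s))"
| cmul: "trig_poly p \<Longrightarrow> trig_poly (\<lambda>s. c * p s)"
| add: "trig_poly p \<Longrightarrow> trig_poly r \<Longrightarrow> trig_poly (\<lambda>s. p s + r s)"

lemma trig_poly_mult:
  assumes "trig_poly p" "trig_poly r" shows "trig_poly (\<lambda>s. p s * r s)"
  using assms
proof (induction p arbitrary: r rule: trig_poly.induct)
  case (cos k)
  then show ?case
  proof (induction r rule: trig_poly.induct)
    case (cos j)
    have "trig_poly (\<lambda>s. (1/2) * (cos (of_int (k - j) * s) + cos (of_int (k + j) * s)))"
      by (intro trig_poly.intros)
    then show ?case by (simp add: cos_times_cos left_diff_distrib distrib_right)
  next
    case (sin j)
    have "trig_poly (\<lambda>s. (1/2) * (sin (of_int (k + j) * s) + (-1) * sin (of_int (k - j) * s)))"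
      by (intro trig_poly.intros)
    then show ?case by (simp add: cos_times_sin left_diff_distrib distrib_right)
  next
    case (cmul p c)
    then show ?case using trig_poly.cmul[OF cmul.IH, of c] by (simp add: mult.left_commute)
  next
    case (add p r)
    then show ?case using trig_poly.add[OF add.IH] by (simp add: distrib_left)
  qed
next
  case (sin k)
  then show ?case
  proof (induction r rule: trig_poly.induct)
    case (cos j)
    have "trig_poly (\<lambda>s. (1/2) * (sin (of_int (k + j) * s) + sin (of_int (k - j) * s)))"
      by (intro trig_poly.intros)
    then show ?case by (simp add: sin_times_cos left_diff_distrib distrib_right)
  next
    case (sin j)
    have "trig_poly (\<lambda>s. (1/2) * (cos (of_int (k - j) * s) + (-1) * cos (of_int (k + j) * s)))"
      by (intro trig_poly.intros)
    then show ?case by (simp add: sin_times_sin left_diff_distrib distrib_right)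
  next
    case (cmul p c)
    then show ?case using trig_poly.cmul[OF cmul.IH, of c] by (simp add: mult.left_commute)
  next
    case (add p r)
    then show ?case using trig_poly.add[OF add.IH] by (simp add: distrib_left)
  qed
next
  case (cmul p c)
  then show ?case using trig_poly.cmul[OF cmul.IH, of r c] by (simp add: mult.assoc)
next
  case (add p q)
  then show ?case using trig_poly.add[OF add.IH(1)[of r] add.IH(2)[of r]] by (simp add: distrib_right)
qed

lemma trig_poly_continuous: "trig_poly p \<Longrightarrow> continuous_on S p"
  by (induction rule: trig_poly.induct) (auto intro!: continuous_intros)

lemma trig_poly_polynomial:
  fixes g :: "complex \<Rightarrow> real"
  assumes "real_polynomial_function g" shows "trig_poly (\<lambda>s. g (cis s))"
  using assms
proof (induction rule: real_polynomial_function.induct)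
  case (linear f)
  interpret f: bounded_linear f by fact
  have "f (cis s) = f 1 * cos (of_int 1 * s) + f \<i> * sin (of_int 1 * s)" for s
  proof -
    have "cis s = cos s *\<^sub>R 1 + sin s *\<^sub>R \<i>" by (simp add: complex_eq_iff)
    then have "f (cis s) = f (cos s *\<^sub>R 1) + f (sin s *\<^sub>R \<i>)" by (simp only: f.add)
    then show ?thesis by (simp only: f.scaleR) simp
  qed
  moreover have "trig_poly (\<lambda>s. f 1 * cos (of_int 1 * s) + f \<i> * sin (of_int 1 * s))"
    by (intro trig_poly.intros)
  ultimately show ?case by simp
next
  case (const c)
  have "trig_poly (\<lambda>s. c * cos (of_int 0 * s))" by (intro trig_poly.intros)
  then show ?case by simp
qed (auto intro: trig_poly.intros trig_poly_mult)

text \<open>Stone-Weierstrass on the unit circle, applied to \<open>f (Arg z)\<close>. On the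
  negative real axis, where \<open>Arg\<close> jumps, the continuous branch
  \<open>Arg (- z) + pi\<close> replaces it; the value of \<open>f\<close> is unchanged by
  periodicity.\<close>

lemma trig_poly_dense:
  fixes f :: "real \<Rightarrow> real"
  assumes f: "cper f" and "e > 0"
  obtains p where "trig_poly p" "\<And>s. \<bar>f s - p s\<bar> < e"
proof -
  have eq: "f (Arg z) = f s" if "z = cis s" for z s
    by (rule cper_cis_cong[OF f]) (simp add: that cis_Arg)
  have "continuous_on (sphere 0 1) (\<lambda>z. f (Arg z))"
  proof (rule continuous_at_imp_continuous_on, safe)
    fix z :: complex assume z: "z \<in> sphere 0 1"
    have fc: "continuous (at x) f" for x using f by (simp add: cper_def continuous_on_eq_continuous_at)
    show "continuous (at z) (\<lambda>z. f (Arg z))"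
    proof (cases "z \<in> \<real>\<^sub>\<le>\<^sub>0")
      case False
      then show ?thesis by (intro continuous_within_compose3[OF _ continuous_at_Arg]) (auto intro: continuous_at_imp_continuous_within fc)
    next
      case True
      then have "- z \<notin> \<real>\<^sub>\<le>\<^sub>0" using z by (auto simp: complex_nonpos_Reals_iff complex_eq_iff cmod_def)
      then have "isCont (\<lambda>z. Arg (- z) + pi) z"
        by (intro continuous_intros isCont_o2[OF _ continuous_at_Arg]) auto
      then have "isCont (\<lambda>z. f (Arg (- z) + pi)) z" by (rule isCont_o2[OF _ fc])
      moreover have "\<forall>\<^sub>F w in nhds z. f (Arg (- w) + pi) = f (Arg w)"
      proof -
        have "z \<noteq> 0" using z by auto
        then have "\<forall>\<^sub>F w in nhds z. w \<noteq> 0" by (rule t1_space_nhds)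
        then show ?thesis
        proof eventually_elim
          case (elim w)
          have "cis (Arg (- w) + pi) = cis (Arg w)"
            using elim by (simp add: cis_mult[symmetric] cis_Arg sgn_minus)
          then show ?case by (rule cper_cis_cong[OF f])
        qed
      qed
      ultimately show ?thesis by (simp add: isCont_cong)
    qed
  qed
  then obtain g where g: "real_polynomial_function g" "\<And>z. z \<in> sphere 0 1 \<Longrightarrow> \<bar>f (Arg z) - g z\<bar> < e"
    using Stone_Weierstrass_real_polynomial_function[OF compact_sphere _ \<open>e > 0\<close>] by blast
  show thesis
  proof
    show "trig_poly (\<lambda>s. g (cis s))" using g(1) by (rule trig_poly_polynomial)
    show "\<bar>f s - g (cis s)\<bar> < e" for s using g(2)[of "cis s"] eq[OF refl] by simp
  qed
qed

text \<open>A scalar \<open>g\<close> without harmonics is orthogonal to every trigonometric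
  polynomial \<open>p\<close>, so the integral of \<open>g^2\<close> equals that of
  \<open>(g - p) g\<close> and is arbitrarily small. Vector values are reduced to their
  coordinates.\<close>

theorem harmonic_unique:
  fixes f :: "real \<Rightarrow> 'a::euclidean_space"
  assumes f: "cper f" and 0: "\<And>k t. harmonic k f t = 0"
  shows "f t = 0"
proof -
  have real: "g t = 0" if g: "cper g" and 0: "\<And>k t. harmonic k g t = 0" for g :: "real \<Rightarrow> real" and t
  proof -
    have k: "fcos k g = 0 \<and> fsin k g = 0" for k
    proof (cases "k = 0")
      case True
      then show ?thesis using 0[of 0 0] by (simp add: harmonic_def fsin_def)
    next
      case False
      then have "fcos k g = 0" "fsin k g = 0" using 0[of k 0] 0[of k "pi / (2 * real k)"] by (simp_all add: harmonic_def)
      then show ?thesis by simp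
    qed
    have int: "(\<lambda>s. p s * g s) integrable_on {0..2 * pi}" if "trig_poly p" for p
      by (intro integrable_continuous_real continuous_intros trig_poly_continuous that cper_cont[OF g])
    have zero: "integral {0..2 * pi} (\<lambda>s. p s * g s) = 0" if "trig_poly p" for p
      using that
    proof (induction rule: trig_poly.induct)
      case (cos k)
      have "cos (of_int k * s) = cos (real (nat \<bar>k\<bar>) * s)" for s by (cases "k \<ge> 0") auto
      then show ?case using k[of "nat \<bar>k\<bar>"] by (simp add: fcos_def)
    next
      case (sin k)
      have "sin (of_int k * s) = sgn (of_int k) * sin (real (nat \<bar>k\<bar>) * s)" for s by (cases "k \<ge> 0"; cases "k = 0") auto
      then show ?case using k[of "nat \<bar>k\<bar>"] by (simp add: fsin_def mult.assoc)
    next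
      case (cmul p c)
      then show ?case by (simp add: mult.assoc)
    next
      case (add p r)
      then show ?case using int by (simp add: distrib_right Henstock_Kurzweil_Integration.integral_add)
    qed
    obtain M where M: "\<And>t. norm (g t) \<le> M" "M > 0" using cper_bounded[OF g] by blast
    have igg: "(\<lambda>s. g s * g s) integrable_on {0..2 * pi}"
      by (intro integrable_continuous_real continuous_intros cper_cont[OF g])
    have "integral {0..2 * pi} (\<lambda>s. g s * g s) \<le> e" if "e > 0" for e
    proof -
      \<comment> \<open>Chosen so that integrating the bound \<open>d * M\<close> over a period
        gives exactly \<open>e\<close>.\<close>
      define d where "d = e / (2 * pi * M)"
      have "d > 0" using that M by (simp add: d_def)
      then obtain p where p: "trig_poly p" "\<And>s. \<bar>g s - p s\<bar> < d" using trig_poly_dense[OF g] by blast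
      have "integral {0..2 * pi} (\<lambda>s. g s * g s) = integral {0..2 * pi} (\<lambda>s. g s * g s) - integral {0..2 * pi} (\<lambda>s. p s * g s)"
        using zero[OF p(1)] by simp
      also have "\<dots> = integral {0..2 * pi} (\<lambda>s. (g s - p s) * g s)"
        using igg int[OF p(1)] by (simp add: left_diff_distrib Henstock_Kurzweil_Integration.integral_diff)
      also have "\<dots> \<le> integral {0..2 * pi} (\<lambda>s. d * M)"
      proof (rule integral_le)
        show "(\<lambda>s. (g s - p s) * g s) integrable_on {0..2 * pi}"
          using igg int[OF p(1)] by (simp add: left_diff_distrib integrable_diff)
        fix s
        have "\<bar>(g s - p s) * g s\<bar> \<le> d * M" unfolding abs_mult
          using p(2)[of s] M(1)[of s] \<open>d > 0\<close> by (intro mult_mono) auto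
        then show "(g s - p s) * g s \<le> d * M" by simp
      qed (rule integrable_const_ivl)
      also have "\<dots> = e" using M by (simp add: d_def)
      finally show ?thesis .
    qed
    then have "integral {0..2 * pi} (\<lambda>s. g s * g s) \<le> 0" by (rule field_le_epsilon[where y = 0, simplified])
    then have "integral {0..2 * pi} (\<lambda>s. g s * g s) = 0"
      by (intro antisym integral_nonneg igg) auto
    moreover have "(integral {0..2 * pi} (\<lambda>s. g s * g s) = 0) = (\<forall>s\<in>{0..2 * pi}. g s * g s = 0)"
      by (rule integral_eq_0_iff) (auto intro!: continuous_intros cper_cont[OF g])
    moreover obtain n where n: "t + 2 * pi * of_int n \<in> {0..2 * pi}" by (rule reduce_mod_2pi)
    ultimately have "g (t + 2 * pi * of_int n) = 0" by simp
    then show ?thesis using cper_int[OF g] by simp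
  qed
  have "f t \<bullet> b = 0" if "b \<in> Basis" for b
  proof (rule real[of "\<lambda>t. f t \<bullet> b"])
    show "cper (\<lambda>t. f t \<bullet> b)" by (rule cper_linear[OF bounded_linear_inner_left f])
    show "harmonic k (\<lambda>t. f t \<bullet> b) t = 0" for k t
      using harmonic_linear[OF bounded_linear_inner_left f, of k b t] 0 by simp
  qed
  then show ?thesis by (simp add: euclidean_eq_iff[of "f t"])
qed

lemma harmonic_eqI:
  assumes "cper f" "cper g" "\<And>k t. harmonic k f t = harmonic k g t"
  shows "f = g"
  using harmonic_unique[OF cper_diff[OF assms(1,2)]] assms by (auto simp: harmonic_diff fun_eq_iff)

section \<open>Antiderivatives, and second derivatives recovered from Fourier data\<close>

text \<open>The witness is the signed integral from \<open>0\<close>: an integral over an interval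
  with reversed end points is \<open>0\<close>, so one of the two terms always vanishes. Near a
  given point it differs by a constant from the integral that starts at \<open>-R\<close>.\<close>

lemma continuous_antiderivative:
  fixes g :: "real \<Rightarrow> 'a::euclidean_space"
  assumes g: "continuous_on UNIV g"
  obtains G where "\<And>t. (G has_vector_derivative g t) (at t)"
proof
  fix t :: real
  define R where "R = \<bar>t\<bar> + 1"
  have int: "g integrable_on {a..b}" for a b
    by (rule integrable_continuous_real[OF continuous_on_subset[OF g]]) simp
  have eq: "integral {0..s} g - integral {s..0} g = integral {-R..s} g - integral {-R..0} g" if "s \<in> {-R<..<R}" for s
  proof (cases "s \<ge> 0")
    case True
    then show ?thesis
      using Henstock_Kurzweil_Integration.integral_combine[of "-R" 0 s g] int that by (cases "s = 0") (auto simp: eq_diff_eq add.commute)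
  next
    case False
    then show ?thesis
      using int that by (auto simp: Henstock_Kurzweil_Integration.integral_combine[of "-R" s 0 g, symmetric])
  qed
  have t: "t \<in> {-R<..<R}" by (auto simp: R_def)
  have "((\<lambda>u. integral {-R..u} g) has_vector_derivative g t) (at t within {-R..R})"
    using t by (intro integral_has_vector_derivative continuous_on_subset[OF g]) auto
  then have "((\<lambda>u. integral {-R..u} g) has_vector_derivative g t) (at t within {-R<..<R})"
    by (rule has_vector_derivative_within_subset) auto
  then have "((\<lambda>u. integral {-R..u} g - integral {-R..0} g) has_vector_derivative g t) (at t within {-R<..<R})"
    by (auto intro!: derivative_eq_intros)
  then have "((\<lambda>s. integral {0..s} g - integral {s..0} g) has_vector_derivative g t) (at t within {-R<..<R})"
    by (rule has_vector_derivative_transform[OF t, rotated]) (rule eq)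
  then show "((\<lambda>s. integral {0..s} g - integral {s..0} g) has_vector_derivative g t) (at t)"
    using t by (simp add: at_within_open[of t "{-R<..<R}"])
qed

lemma has_vector_derivative_constant:
  assumes "\<And>t. (f has_vector_derivative 0) (at t)"
  shows "f a = (f b :: 'a::euclidean_space)"
  using has_vector_derivative_zero_constant[of UNIV f] assms by (metis UNIV_I convex_UNIV)

lemma periodic_antiderivative:
  fixes g :: "real \<Rightarrow> 'a::euclidean_space"
  assumes g: "cper g" and 0: "integral {0..2 * pi} g = 0"
  obtains G where "cper G" "\<And>t. (G has_vector_derivative g t) (at t)"
proof -
  obtain G where G: "\<And>t. (G has_vector_derivative g t) (at t)"
    using continuous_antiderivative[OF cper_cont[OF g]] by blast
  have sh: "((\<lambda>t. G (t + 2 * pi)) has_vector_derivative g t) (at t)" for t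
  proof -
    have "((\<lambda>t. t + 2 * pi) has_vector_derivative 1) (at t)" by (auto intro!: derivative_eq_intros)
    from vector_diff_chain_at[OF this G[of "t + 2 * pi"]] show ?thesis using g by (simp add: cper_def o_def)
  qed
  have "((\<lambda>t. G (t + 2 * pi) - G t) has_vector_derivative 0) (at t)" for t
    using has_vector_derivative_diff[OF sh G, of t] by simp
  then have c: "G (t + 2 * pi) - G t = G (0 + 2 * pi) - G 0" for t
    by (rule has_vector_derivative_constant)
  have "(g has_integral (G (2 * pi) - G 0)) {0..2 * pi}"
    by (rule fundamental_theorem_of_calculus) (auto intro: has_vector_derivative_at_within G)
  then have "G (2 * pi) = G 0" using 0 by (simp add: integral_unique)
  then have "\<And>t. G (t + 2 * pi) = G t" using c by simp
  moreover have "continuous_on UNIV G"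
    using G by (auto intro!: continuous_at_imp_continuous_on has_vector_derivative_continuous)
  ultimately show thesis using that G by (blast intro: cperI)
qed

lemma fcos_0: "fcos 0 f = integral {0..2 * pi} f"
  by (simp add: fcos_def)

text \<open>A regularity statement: a continuous function that satisfies \<open>y'' = g\<close>
  formally, harmonic by harmonic, is twice differentiable. Integrating \<open>g\<close> twice gives
  a genuine solution, whose difference from \<open>y\<close> has only the harmonic \<open>0\<close>
  and is therefore constant.\<close>

theorem C2per_from_harmonics:
  fixes y g :: "real \<Rightarrow> 'a::euclidean_space"
  assumes y: "cper y" and g: "cper g" and h: "\<And>k t. harmonic k g t = - ((real k)\<^sup>2 *\<^sub>R harmonic k y t)"
  obtains y' where "C2per y y' g"
proof -
  have "integral {0..2 * pi} g = 0" using h[of 0 0] by (simp add: harmonic_def fcos_0)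
  then obtain G1 where G1: "cper G1" "\<And>t. (G1 has_vector_derivative g t) (at t)"
    using periodic_antiderivative[OF g] by blast
  \<comment> \<open>Subtracting the mean makes the second antiderivative periodic as well.\<close>
  define c where "c = (1 / (2 * pi)) *\<^sub>R integral {0..2 * pi} G1"
  have G1c: "cper (\<lambda>t. G1 t - c)" by (intro cper_diff G1 cper_const)
  have "G1 integrable_on {0..2 * pi}" by (rule integrable_continuous_real[OF cper_cont[OF G1(1)]])
  then have "integral {0..2 * pi} (\<lambda>t. G1 t - c) = 0"
    by (subst Henstock_Kurzweil_Integration.integral_diff) (auto simp: c_def)
  then obtain G2 where G2: "cper G2" "\<And>t. (G2 has_vector_derivative (G1 t - c)) (at t)"
    using periodic_antiderivative[OF G1c] by blast
  have dG1: "((\<lambda>t. G1 t - c) has_vector_derivative g t) (at t)" for t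
    using has_vector_derivative_diff[OF G1(2)[of t] has_vector_derivative_const[of c "at t"]] by simp
  have C: "C2per G2 (\<lambda>t. G1 t - c) g" by (simp add: C2per_def G2 G1c g dG1)
  define d where "d = (\<lambda>t. y t - G2 t)"
  have cd: "cper d" unfolding d_def by (intro cper_diff y G2)
  have hd: "harmonic k d t = 0" if "k \<noteq> 0" for k t
    using harmonic_second_deriv[OF C, of k t] h[of k t] that by (simp add: d_def harmonic_diff y G2)
  have deq: "d = harmonic 0 d"
    by (rule harmonic_eqI[OF cd harmonic_cper])
      (metis harmonic_harmonic_same harmonic_harmonic_neq hd)
  have yG: "y t = G2 t + harmonic 0 d 0" for t
    using fun_cong[OF deq, of t] by (simp add: d_def harmonic_def algebra_simps)
  have "(y has_vector_derivative (G1 t - c)) (at t)" for t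
    using has_vector_derivative_add[OF G2(2)[of t] has_vector_derivative_const[of "harmonic 0 d 0" "at t"]]
    by (simp flip: yG)
  then have "C2per y (\<lambda>t. G1 t - c) g" using C y by (simp add: C2per_def)
  then show thesis by (rule that)
qed

lemma norm_diff_le_if_deriv_bounded:
  fixes y :: "real \<Rightarrow> 'a::euclidean_space"
  assumes d: "\<And>t. (y has_vector_derivative y' t) (at t)" and M: "\<And>t. norm (y' t) \<le> M"
  shows "norm (y t - y s) \<le> M * \<bar>t - s\<bar>"
proof -
  have *: "norm (y t - y s) \<le> M * (t - s)" if "s \<le> t" for s t
  proof -
    have "(y' has_integral (y t - y s)) (cbox s t)"
      using fundamental_theorem_of_calculus[of s t y y'] that by (auto intro: has_vector_derivative_at_within d)
    then show ?thesis
      using has_integral_bound[of M y' "y t - y s" s t] M that order_trans[OF norm_ge_zero M] by auto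
  qed
  show ?thesis using *[of s t] *[of t s] by (cases "s \<le> t") (auto simp: norm_minus_commute abs_if)
qed

text \<open>The derivative of a periodic function has mean zero, so \<open>y' s\<close> is the
  average over a period of the differences \<open>y' s - y' r\<close>, each of norm at most
  \<open>2 pi M\<close>.\<close>

lemma C2per_deriv_bound:
  assumes C: "C2per y y' y''" and M: "\<And>t. norm (y'' t) \<le> M"
  shows "norm (y' t) \<le> 2 * pi * M"
proof -
  have c: "cper y" "cper y'" and d: "\<And>t. (y has_vector_derivative y' t) (at t)"
    "\<And>t. (y' has_vector_derivative y'' t) (at t)" using C by (auto simp: C2per_def)
  have M0: "M \<ge> 0" using M[of 0] norm_ge_zero order_trans by blast
  have "(y' has_integral (y (2 * pi) - y 0)) {0..2 * pi}"
    by (rule fundamental_theorem_of_calculus) (auto intro: has_vector_derivative_at_within d)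
  moreover have "y (2 * pi) = y 0" using c(1) by (auto simp: cper_def dest: spec[of _ 0])
  ultimately have i0: "(y' has_integral 0) {0..2 * pi}" by simp
  have b: "norm (y' s) \<le> 2 * pi * M" if s: "s \<in> {0..2 * pi}" for s
  proof -
    have "((\<lambda>r. y' s - y' r) has_integral (2 * pi - 0) *\<^sub>R y' s - 0) (cbox 0 (2 * pi))"
      using has_integral_diff[OF has_integral_const_real[of "y' s" 0 "2 * pi"] i0] by simp
    moreover have "norm (y' s - y' r) \<le> 2 * pi * M" if "r \<in> cbox 0 (2 * pi)" for r
    proof -
      have "norm (y' s - y' r) \<le> M * \<bar>s - r\<bar>" by (rule norm_diff_le_if_deriv_bounded[OF d(2) M])
      also have "\<dots> \<le> M * (2 * pi)" using s that M0 by (intro mult_left_mono) auto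
      finally show ?thesis by (simp add: mult_ac)
    qed
    ultimately have "norm ((2 * pi - 0) *\<^sub>R y' s - 0) \<le> 2 * pi * M * Henstock_Kurzweil_Integration.content (cbox 0 (2 * pi))"
      using M0 by (intro has_integral_bound) auto
    then show ?thesis by (simp add: mult_ac)
  qed
  obtain n where n: "t + 2 * pi * of_int n \<in> {0..2 * pi}" by (rule reduce_mod_2pi)
  then show ?thesis using b[OF n] cper_int[OF c(2), of t n] by simp
qed

lemma cper_uniform_limit:
  assumes "\<And>n. cper (f n)" "uniform_limit UNIV f g sequentially"
  shows "cper g"
proof (rule cperI)
  show "continuous_on UNIV g"
    by (rule uniform_limit_theorem[OF always_eventually assms(2)]) (use assms(1) in \<open>auto intro: cper_cont\<close>)
  fix t
  have "(\<lambda>n. f n s) \<longlonglongrightarrow> g s" for s by (rule tendsto_uniform_limitI[OF assms(2)]) simp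
  from this[of "t + 2 * pi"] this[of t] show "g (t + 2 * pi) = g t"
    using assms(1) by (auto simp: cper_def intro: LIMSEQ_unique)
qed

lemma harmonic_uniform_limit:
  assumes f: "\<And>n. cper (f n)" and l: "uniform_limit UNIV f g sequentially"
  shows "(\<lambda>n. harmonic k (f n) t) \<longlonglongrightarrow> harmonic k g t"
proof (rule LIMSEQ_I)
  fix e :: real assume "e > 0"
  have g: "cper g" by (rule cper_uniform_limit[OF f l])
  from l \<open>e > 0\<close> have "\<forall>\<^sub>F n in sequentially. \<forall>s. dist (f n s) (g s) < e / 8"
    using uniform_limitD[OF l, of "e / 8"] by simp
  then obtain N where N: "\<And>n s. n \<ge> N \<Longrightarrow> dist (f n s) (g s) < e / 8"
    by (auto simp: eventually_sequentially)
  have "norm (harmonic k (f n) t - harmonic k g t) < e" if "n \<ge> N" for n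
  proof -
    have "norm (harmonic k (\<lambda>s. f n s - g s) t) \<le> 4 * (e / 8)"
      using N[OF that] by (intro norm_harmonic_le cper_diff f g) (auto simp: dist_norm less_imp_le)
    then show ?thesis using \<open>e > 0\<close> by (simp add: harmonic_diff f g)
  qed
  then show "\<exists>N. \<forall>n\<ge>N. norm (harmonic k (f n) t - harmonic k g t) < e" by blast
qed

subsection \<open>Fourier multipliers\<close>

text \<open>Absolutely summable weights are enough for uniform convergence, since all harmonics of
  \<open>f\<close> share one bound. The weights used later are inverses of the symbol and decay like
  \<open>1 / k^2\<close>, so everything can be done with continuous functions.\<close>

definition fmult :: "(nat \<Rightarrow> real) \<Rightarrow> (real \<Rightarrow> 'a::euclidean_space) \<Rightarrow> real \<Rightarrow> 'a" where
  "fmult w f t = (\<Sum>k. w k *\<^sub>R harmonic k f t)"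

context
  fixes w :: "nat \<Rightarrow> real" and f :: "real \<Rightarrow> 'a::euclidean_space"
  assumes w: "summable (\<lambda>k. \<bar>w k\<bar>)" and f: "cper f"
begin

lemma fmult_summable: "summable (\<lambda>k. w k *\<^sub>R harmonic k f t)"
proof -
  obtain M where M: "\<And>t. norm (f t) \<le> M" using cper_bounded[OF f] by blast
  show ?thesis
  proof (rule summable_comparison_test'[OF summable_mult2[OF w, of "4 * M"]])
    show "norm (w k *\<^sub>R harmonic k f t) \<le> \<bar>w k\<bar> * (4 * M)" for k
      by (auto intro: mult_left_mono norm_harmonic_le[OF f M])
  qed
qed

lemma fmult_uniform_limit: "uniform_limit UNIV (\<lambda>n t. \<Sum>k<n. w k *\<^sub>R harmonic k f t) (fmult w f) sequentially"
proof -
  obtain M where M: "\<And>t. norm (f t) \<le> M" using cper_bounded[OF f] by blast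
  show ?thesis unfolding fmult_def[abs_def]
  proof (rule Weierstrass_m_test)
    show "norm (w k *\<^sub>R harmonic k f t) \<le> \<bar>w k\<bar> * (4 * M)" for k t
      by (auto intro: mult_left_mono norm_harmonic_le[OF f M])
    show "summable (\<lambda>k. \<bar>w k\<bar> * (4 * M))" by (intro summable_mult2 w)
  qed
qed

lemma fmult_partial_cper: "cper (\<lambda>t. \<Sum>k<n. w k *\<^sub>R harmonic k f t)"
  by (intro cper_sum cper_scaleR harmonic_cper)

lemma fmult_cper: "cper (fmult w f)"
  by (rule cper_uniform_limit[OF fmult_partial_cper fmult_uniform_limit])

lemma harmonic_fmult: "harmonic j (fmult w f) t = w j *\<^sub>R harmonic j f t"
proof -
  have part: "harmonic j (\<lambda>t. \<Sum>k<n. w k *\<^sub>R harmonic k f t) t = w j *\<^sub>R harmonic j f t" if "n > j" for n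
  proof -
    have "harmonic j (\<lambda>t. \<Sum>k<n. w k *\<^sub>R harmonic k f t) t = (\<Sum>k<n. w k *\<^sub>R harmonic j (harmonic k f) t)"
      by (subst harmonic_sum) (auto intro!: sum.cong cper_scaleR harmonic_cper harmonic_scaleR)
    also have "\<dots> = (\<Sum>k<n. if k = j then w k *\<^sub>R harmonic j f t else 0)"
      by (rule sum.cong) (auto simp: harmonic_harmonic_same harmonic_harmonic_neq)
    also have "\<dots> = w j *\<^sub>R harmonic j f t" using that by simp
    finally show ?thesis .
  qed
  have "(\<lambda>n. harmonic j (\<lambda>t. \<Sum>k<n. w k *\<^sub>R harmonic k f t) t) \<longlonglongrightarrow> harmonic j (fmult w f) t"
    by (rule harmonic_uniform_limit[OF fmult_partial_cper fmult_uniform_limit])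
  moreover have "(\<lambda>n. harmonic j (\<lambda>t. \<Sum>k<n. w k *\<^sub>R harmonic k f t) t) \<longlonglongrightarrow> w j *\<^sub>R harmonic j f t"
    using part by (intro tendsto_eventually) (auto simp: eventually_sequentially intro!: exI[of _ "Suc j"])
  ultimately show ?thesis by (rule LIMSEQ_unique)
qed

lemma norm_fmult_le:
  assumes M: "\<And>t. norm (f t) \<le> M"
  shows "norm (fmult w f t) \<le> 4 * M * (\<Sum>k. \<bar>w k\<bar>)"
proof -
  have le: "norm (w k *\<^sub>R harmonic k f t) \<le> 4 * M * \<bar>w k\<bar>" for k
    using mult_left_mono[OF norm_harmonic_le[OF f M], of "\<bar>w k\<bar>" k t] by (simp add: mult_ac)
  have sm: "summable (\<lambda>k. norm (w k *\<^sub>R harmonic k f t))"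
    by (rule summable_comparison_test'[OF summable_mult[OF w, of "4 * M"]]) (use le in auto)
  then have "norm (fmult w f t) \<le> (\<Sum>k. norm (w k *\<^sub>R harmonic k f t))"
    unfolding fmult_def by (rule summable_norm)
  also have "\<dots> \<le> (\<Sum>k. 4 * M * \<bar>w k\<bar>)"
    by (rule suminf_le[OF le sm summable_mult[OF w]])
  also have "\<dots> = 4 * M * (\<Sum>k. \<bar>w k\<bar>)" by (rule suminf_mult[OF w])
  finally show ?thesis .
qed

end

subsection \<open>Convolution with a Gaussian\<close>

text \<open>The width is moved from the kernel into the argument of \<open>f\<close>. The density
  then does not depend on \<alpha>, and continuity in \<alpha> reduces to continuity of
  \<open>f\<close>.\<close>

definition gconv :: "real \<Rightarrow> (real \<Rightarrow> 'a::euclidean_space) \<Rightarrow> real \<Rightarrow> 'a" where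
  "gconv \<alpha> f x = (LBINT y. std_normal_density y *\<^sub>R f (x - \<alpha> * y))"

lemma normal_conv_eq_gconv:
  assumes "\<alpha> > 0"
  shows "(LBINT y. normal_density 0 \<alpha> y *\<^sub>R f (x - y)) = gconv \<alpha> f x"
proof -
  have "(LBINT y. normal_density 0 \<alpha> y *\<^sub>R f (x - y))
      = \<bar>\<alpha>\<bar> *\<^sub>R (LBINT y. normal_density 0 \<alpha> (0 + \<alpha> * y) *\<^sub>R f (x - (0 + \<alpha> * y)))"
    by (rule lborel_integral_real_affine) (use assms in simp)
  also have "\<dots> = (LBINT y. (\<bar>\<alpha>\<bar> * normal_density 0 \<alpha> (\<alpha> * y)) *\<^sub>R f (x - \<alpha> * y))"
    by (simp flip: integral_scaleR_right)
  also have "(\<lambda>y. \<bar>\<alpha>\<bar> * normal_density 0 \<alpha> (\<alpha> * y)) = std_normal_density"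
    using assms by (auto simp: fun_eq_iff normal_density_def real_sqrt_mult field_simps power_mult_distrib)
  finally show ?thesis by (simp add: gconv_def)
qed

lemma std_normal_scaleR_bound:
  assumes "\<And>t. norm (f t) \<le> M" shows "norm (std_normal_density y *\<^sub>R f z) \<le> M * std_normal_density y"
  using mult_left_mono[OF assms, of "std_normal_density y" z] by (simp add: mult.commute)

lemma gconv_integrable:
  assumes f: "cper f" shows "integrable lborel (\<lambda>y. std_normal_density y *\<^sub>R f (x - \<alpha> * y))"
proof -
  obtain M where M: "\<And>t. norm (f t) \<le> M" "M > 0" using cper_bounded[OF f] by blast
  have [measurable]: "f \<in> borel_measurable borel" by (rule borel_measurable_continuous_onI[OF cper_cont[OF f]])
  show ?thesis
  proof (rule Bochner_Integration.integrable_bound)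
    show "integrable lborel (\<lambda>y. M * std_normal_density y)"
      by (intro integrable_mult_right integrable_normal_density) simp
    show "AE y in lborel. norm (std_normal_density y *\<^sub>R f (x - \<alpha> * y)) \<le> norm (M * std_normal_density y)"
      using M(2) std_normal_scaleR_bound[OF M(1)] by (intro AE_I2) (simp add: abs_mult)
  qed measurable
qed

lemma integral_std_normal_mult: "(LBINT y. M * std_normal_density y) = M"
  using integral_normal_density[of 1 0] by simp

lemma norm_gconv_le:
  assumes f: "cper f" and M: "\<And>t. norm (f t) \<le> M"
  shows "norm (gconv \<alpha> f x) \<le> M"
proof -
  have "norm (gconv \<alpha> f x) \<le> (LBINT y. M * std_normal_density y)"
    unfolding gconv_def
  proof (rule Bochner_Integration.integral_norm_bound_integral[OF gconv_integrable[OF f]])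
    show "integrable lborel (\<lambda>y. M * std_normal_density y)"
      by (intro integrable_mult_right integrable_normal_density) simp
    show "norm (std_normal_density y *\<^sub>R f (x - \<alpha> * y)) \<le> M * std_normal_density y" for y
      by (rule std_normal_scaleR_bound[OF M])
  qed
  then show ?thesis by (simp only: integral_std_normal_mult)
qed

lemma gconv_add: "cper f \<Longrightarrow> cper g \<Longrightarrow> gconv \<alpha> (\<lambda>t. f t + g t) x = gconv \<alpha> f x + gconv \<alpha> g x"
  unfolding gconv_def by (simp add: scaleR_add_right Bochner_Integration.integral_add[OF gconv_integrable gconv_integrable])

lemma gconv_diff: "cper f \<Longrightarrow> cper g \<Longrightarrow> gconv \<alpha> (\<lambda>t. f t - g t) x = gconv \<alpha> f x - gconv \<alpha> g x"
  unfolding gconv_def by (simp add: scaleR_diff_right Bochner_Integration.integral_diff[OF gconv_integrable gconv_integrable])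

lemma gconv_linear:
  assumes "bounded_linear h" "cper f" shows "gconv \<alpha> (\<lambda>t. h (f t)) x = h (gconv \<alpha> f x)"
proof -
  interpret h: bounded_linear h by fact
  show ?thesis unfolding gconv_def
    using integral_bounded_linear[OF assms(1) gconv_integrable[OF assms(2), of x \<alpha>]] by (simp add: h.scaleR)
qed

lemma gconv_shift: "gconv \<alpha> (\<lambda>s. f (s + a)) x = gconv \<alpha> f (x + a)"
  by (simp add: gconv_def algebra_simps)

lemma gconv_cper:
  assumes f: "cper f" shows "cper (gconv \<alpha> f)"
proof (rule cperI)
  obtain M where M: "\<And>t. norm (f t) \<le> M" "M > 0" using cper_bounded[OF f] by blast
  have [measurable]: "f \<in> borel_measurable borel" by (rule borel_measurable_continuous_onI[OF cper_cont[OF f]])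
  show "continuous_on UNIV (gconv \<alpha> f)"
  proof (rule continuous_at_imp_continuous_on, rule ballI)
    fix x
    show "isCont (gconv \<alpha> f) x" unfolding continuous_at_sequentially
    proof (intro allI impI)
      fix X assume X: "X \<longlonglongrightarrow> x"
      have "(\<lambda>n. LBINT y. std_normal_density y *\<^sub>R f (X n - \<alpha> * y)) \<longlonglongrightarrow> (LBINT y. std_normal_density y *\<^sub>R f (x - \<alpha> * y))"
      proof (rule integral_dominated_convergence)
        show "integrable lborel (\<lambda>y. M * std_normal_density y)"
          by (intro integrable_mult_right integrable_normal_density) simp
        show "AE y in lborel. (\<lambda>n. std_normal_density y *\<^sub>R f (X n - \<alpha> * y)) \<longlonglongrightarrow> std_normal_density y *\<^sub>R f (x - \<alpha> * y)"
          by (intro AE_I2 tendsto_intros continuous_on_tendsto_compose[OF cper_cont[OF f, of UNIV]] X) auto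
        show "AE y in lborel. norm (std_normal_density y *\<^sub>R f (X n - \<alpha> * y)) \<le> M * std_normal_density y" for n
          by (intro AE_I2 std_normal_scaleR_bound[OF M(1)])
      qed measurable
      then show "(gconv \<alpha> f \<circ> X) \<longlonglongrightarrow> gconv \<alpha> f x" by (simp add: gconv_def o_def)
    qed
  qed
  show "gconv \<alpha> f (t + 2 * pi) = gconv \<alpha> f t" for t
    using f by (simp flip: gconv_shift add: cper_def)
qed

text \<open>Real and imaginary part of the characteristic function of the standard normal
  distribution.\<close>

lemma std_normal_cos_sin:
  "(LBINT y. std_normal_density y * cos (r * y)) = exp (- r\<^sup>2 / 2)" (is ?c)
  "(LBINT y. std_normal_density y * sin (r * y)) = 0" (is ?s)
  "integrable lborel (\<lambda>y. std_normal_density y * cos (r * y))"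
  "integrable lborel (\<lambda>y. std_normal_density y * sin (r * y))"
proof -
  show i: "integrable lborel (\<lambda>y. std_normal_density y * cos (r * y))" "integrable lborel (\<lambda>y. std_normal_density y * sin (r * y))"
    by (rule Bochner_Integration.integrable_bound[OF integrable_normal_density[of 1 0]];
      auto intro!: AE_I2 simp: abs_mult mult_left_le)+
  have "char std_normal_distribution r = (LBINT y. std_normal_density y *\<^sub>R iexp (r * y))"
    unfolding char_def by (subst integral_density) auto
  also have "\<dots> = (LBINT y. complex_of_real (std_normal_density y * cos (r * y)) + \<i> * complex_of_real (std_normal_density y * sin (r * y)))"
    by (intro Bochner_Integration.integral_cong refl) (simp add: complex_eq_iff Re_exp Im_exp)
  also have "\<dots> = complex_of_real (LBINT y. std_normal_density y * cos (r * y)) + \<i> * complex_of_real (LBINT y. std_normal_density y * sin (r * y))"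
    using i by (subst Bochner_Integration.integral_add) (auto simp del: of_real_mult)
  finally have "complex_of_real (LBINT y. std_normal_density y * cos (r * y)) + \<i> * complex_of_real (LBINT y. std_normal_density y * sin (r * y))
      = complex_of_real (exp (- r\<^sup>2 / 2))"
    by (simp add: char_std_normal_distribution)
  then show ?c ?s by (auto simp: complex_eq_iff)
qed

lemma gconv_fubini:
  assumes f: "cper f" and w: "continuous_on UNIV (w :: real \<Rightarrow> real)"
  shows "integral {0..2 * pi} (\<lambda>s. w s *\<^sub>R gconv \<alpha> f s)
      = (LBINT y. std_normal_density y *\<^sub>R integral {0..2 * pi} (\<lambda>s. w s *\<^sub>R f (s + - (\<alpha> * y))))"
proof -
  obtain M where M: "\<And>t. norm (f t) \<le> M" "M > 0" using cper_bounded[OF f] by blast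
  have "compact (w ` {0..2 * pi})" by (intro compact_continuous_image continuous_on_subset[OF w]) auto
  then obtain W where W: "W > 0" "\<And>s. s \<in> {0..2 * pi} \<Longrightarrow> \<bar>w s\<bar> \<le> W"
    using compact_imp_bounded bounded_pos by (metis imageI real_norm_def)
  have [measurable]: "f \<in> borel_measurable borel" "w \<in> borel_measurable borel"
    by (auto intro: borel_measurable_continuous_onI cper_cont[OF f] w)
  define F where "F s y = indicat_real {0..2 * pi} s *\<^sub>R (w s *\<^sub>R (std_normal_density y *\<^sub>R f (s + - (\<alpha> * y))))" for s y
  have int: "integrable (lborel \<Otimes>\<^sub>M lborel) (case_prod F)"
  proof (rule Bochner_Integration.integrable_bound)
    show "integrable (lborel \<Otimes>\<^sub>M lborel) (\<lambda>(s, y). (indicat_real {0..2 * pi} s * (W * M)) * std_normal_density y)"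
    proof (rule lborel_pair.Fubini_integrable)
      have "integrable lborel (\<lambda>s. indicat_real {0..2 * pi} s * (W * M))" by simp
      then show "integrable lborel (\<lambda>x. LBINT y. norm (case (x, y) of (s, y) \<Rightarrow> indicat_real {0..2 * pi} s * (W * M) * std_normal_density y))"
        using W M integral_normal_density[of 1 0] by (simp add: abs_mult)
    qed (use integrable_normal_density[of 1 0] in auto)
    show "AE x in lborel \<Otimes>\<^sub>M lborel. norm (case x of (s, y) \<Rightarrow> F s y)
        \<le> norm (case x of (s, y) \<Rightarrow> indicat_real {0..2 * pi} s * (W * M) * std_normal_density y)"
    proof (intro AE_I2, clarify)
      fix s y :: real
      have "\<bar>w s\<bar> * (std_normal_density y * norm (f (s + - (\<alpha> * y)))) \<le> W * (std_normal_density y * M)" if "s \<in> {0..2 * pi}"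
        using W M that by (intro mult_mono) auto
      then show "norm (F s y) \<le> norm (indicat_real {0..2 * pi} s * (W * M) * std_normal_density y)"
        using W M by (auto simp: F_def indicator_def abs_mult mult_ac)
    qed
  qed (unfold F_def, measurable)
  have wc: "continuous_on S w" for S by (rule continuous_on_subset[OF w]) simp
  have set: "integral {0..2 * pi} g = (LBINT s. indicat_real {0..2 * pi} s *\<^sub>R g s)" if "continuous_on {0..2 * pi} g" for g :: "real \<Rightarrow> 'a"
    using set_borel_integral_eq_integral(2)[OF borel_integrable_atLeastAtMost'[OF that]] by (simp add: set_lebesgue_integral_def)
  have inner: "(LBINT y. F s y) = indicat_real {0..2 * pi} s *\<^sub>R (w s *\<^sub>R gconv \<alpha> f s)" for s
    unfolding F_def gconv_def by (simp flip: integral_scaleR_right add: mult_ac)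
  have "integral {0..2 * pi} (\<lambda>s. w s *\<^sub>R gconv \<alpha> f s) = (LBINT s. (LBINT y. F s y))"
    unfolding inner
    by (rule set) (intro continuous_on_scaleR wc cper_cont[OF gconv_cper[OF f]])
  also have "\<dots> = (LBINT y. (LBINT s. F s y))" by (rule lborel_pair.Fubini_integral[OF int, symmetric])
  also have "\<dots> = (LBINT y. std_normal_density y *\<^sub>R integral {0..2 * pi} (\<lambda>s. w s *\<^sub>R f (s + - (\<alpha> * y))))"
  proof (intro Bochner_Integration.integral_cong refl)
    fix y
    have "(LBINT s. F s y) = (LBINT s. std_normal_density y *\<^sub>R (indicat_real {0..2 * pi} s *\<^sub>R (w s *\<^sub>R f (s + - (\<alpha> * y)))))"
      by (simp add: F_def mult_ac)
    also have "\<dots> = std_normal_density y *\<^sub>R integral {0..2 * pi} (\<lambda>s. w s *\<^sub>R f (s + - (\<alpha> * y)))"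
      by (subst set) (auto intro!: continuous_intros wc cper_cont_comp[OF f] simp flip: integral_scaleR_right)
    finally show "(LBINT s. F s y) = std_normal_density y *\<^sub>R integral {0..2 * pi} (\<lambda>s. w s *\<^sub>R f (s + - (\<alpha> * y)))" .
  qed
  finally show ?thesis .
qed

text \<open>A translation by \<open>- \<alpha> y\<close> rotates the pair of Fourier coefficients by
  the angle \<open>\<alpha> k y\<close>. Averaging over the Gaussian turns the cosine into
  \<open>exp (- (\<alpha> k)^2 / 2)\<close> and removes the sine.\<close>

lemma harmonic_gconv:
  assumes f: "cper f" shows "harmonic k (gconv \<alpha> f) t = exp (- (\<alpha> * real k)\<^sup>2 / 2) *\<^sub>R harmonic k f t"
proof -
  note i = std_normal_cos_sin(3,4)[of "\<alpha> * real k"] and v = std_normal_cos_sin(1,2)[of "\<alpha> * real k"]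
  have gen: "(LBINT y. std_normal_density y *\<^sub>R (cos (\<alpha> * real k * y) *\<^sub>R a + sin (\<alpha> * real k * y) *\<^sub>R b)) = exp (- (\<alpha> * real k)\<^sup>2 / 2) *\<^sub>R a"
    for a b :: 'a
  proof -
    have "(LBINT y. std_normal_density y *\<^sub>R (cos (\<alpha> * real k * y) *\<^sub>R a + sin (\<alpha> * real k * y) *\<^sub>R b))
       = (LBINT y. (std_normal_density y * cos (\<alpha> * real k * y)) *\<^sub>R a + (std_normal_density y * sin (\<alpha> * real k * y)) *\<^sub>R b)"
      by (simp add: scaleR_add_right)
    also have "\<dots> = (LBINT y. std_normal_density y * cos (\<alpha> * real k * y)) *\<^sub>R a + (LBINT y. std_normal_density y * sin (\<alpha> * real k * y)) *\<^sub>R b"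
      using i by (subst Bochner_Integration.integral_add) auto
    finally show ?thesis using v by simp
  qed
  have "fcos k (gconv \<alpha> f) = exp (- (\<alpha> * real k)\<^sup>2 / 2) *\<^sub>R fcos k f"
  proof -
    have "fcos k (gconv \<alpha> f) = (LBINT y. std_normal_density y *\<^sub>R fcos k (\<lambda>s. f (s + - (\<alpha> * y))))"
      unfolding fcos_def by (rule gconv_fubini[OF f]) (auto intro!: continuous_intros)
    also have "\<dots> = (LBINT y. std_normal_density y *\<^sub>R (cos (\<alpha> * real k * y) *\<^sub>R fcos k f + sin (\<alpha> * real k * y) *\<^sub>R (- fsin k f)))"
      by (simp only: fcs_shift[OF f]) (simp add: mult_ac)
    finally show ?thesis by (simp only: gen)
  qed
  moreover have "fsin k (gconv \<alpha> f) = exp (- (\<alpha> * real k)\<^sup>2 / 2) *\<^sub>R fsin k f"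
  proof -
    have "fsin k (gconv \<alpha> f) = (LBINT y. std_normal_density y *\<^sub>R fsin k (\<lambda>s. f (s + - (\<alpha> * y))))"
      unfolding fsin_def by (rule gconv_fubini[OF f]) (auto intro!: continuous_intros)
    also have "\<dots> = (LBINT y. std_normal_density y *\<^sub>R (cos (\<alpha> * real k * y) *\<^sub>R fsin k f + sin (\<alpha> * real k * y) *\<^sub>R fcos k f))"
      by (simp only: fcs_shift[OF f]) (simp add: mult_ac)
    finally show ?thesis by (simp only: gen)
  qed
  ultimately show ?thesis by (simp add: harmonic_def algebra_simps)
qed

text \<open>The difference is at most \<open>L |\<alpha> - \<beta>|\<close> times the mean of
  \<open>|y|\<close>. Bounding \<open>|y|\<close> by \<open>1 + y^2\<close> gives the constant
  \<open>2\<close>, since the standard normal has variance \<open>1\<close>.\<close>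

lemma gconv_lipschitz_parameter:
  assumes f: "cper f" and L: "\<And>s t. norm (f s - f t) \<le> L * \<bar>s - t\<bar>"
  shows "norm (gconv \<alpha> f x - gconv \<beta> f x) \<le> 2 * L * \<bar>\<alpha> - \<beta>\<bar>"
proof -
  have L0: "L \<ge> 0" using order_trans[OF norm_ge_zero L[of 1 0]] by simp
  have i2: "integrable lborel (\<lambda>y. std_normal_density y * y\<^sup>2)" and v2: "(LBINT y. std_normal_density y * y\<^sup>2) = 1"
    using integrable_normal_moment[of 1 0 2] integral_std_normal_moment_even[of 1] by simp_all
  have ib: "integrable lborel (\<lambda>y. L * \<bar>\<alpha> - \<beta>\<bar> * (std_normal_density y + std_normal_density y * y\<^sup>2))"
    by (intro integrable_mult_right Bochner_Integration.integrable_add i2 integrable_normal_density) simp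
  have "norm (gconv \<alpha> f x - gconv \<beta> f x) = norm (LBINT y. std_normal_density y *\<^sub>R f (x - \<alpha> * y) - std_normal_density y *\<^sub>R f (x - \<beta> * y))"
    unfolding gconv_def by (subst Bochner_Integration.integral_diff[OF gconv_integrable[OF f] gconv_integrable[OF f]]) simp
  also have "\<dots> \<le> (LBINT y. L * \<bar>\<alpha> - \<beta>\<bar> * (std_normal_density y + std_normal_density y * y\<^sup>2))"
  proof (rule Bochner_Integration.integral_norm_bound_integral[OF _ ib])
    show "integrable lborel (\<lambda>y. std_normal_density y *\<^sub>R f (x - \<alpha> * y) - std_normal_density y *\<^sub>R f (x - \<beta> * y))"
      by (intro Bochner_Integration.integrable_diff gconv_integrable f)
    fix y :: real
    have "2 * \<bar>y\<bar> \<le> 1 + y\<^sup>2" using zero_le_power2[of "\<bar>y\<bar> - 1"] by (simp add: power2_diff)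
    then have y: "\<bar>y\<bar> \<le> 1 + y\<^sup>2" using abs_ge_zero[of y] by linarith
    have "norm (f (x - \<alpha> * y) - f (x - \<beta> * y)) \<le> L * \<bar>(x - \<alpha> * y) - (x - \<beta> * y)\<bar>" by (rule L)
    also have "\<dots> = L * (\<bar>\<alpha> - \<beta>\<bar> * \<bar>y\<bar>)" by (simp add: abs_mult[symmetric] algebra_simps abs_minus_commute)
    also have "\<dots> \<le> L * (\<bar>\<alpha> - \<beta>\<bar> * (1 + y\<^sup>2))" using L0 y by (intro mult_left_mono) auto
    finally have "std_normal_density y * norm (f (x - \<alpha> * y) - f (x - \<beta> * y)) \<le> std_normal_density y * (L * (\<bar>\<alpha> - \<beta>\<bar> * (1 + y\<^sup>2)))"
      by (rule mult_left_mono) simp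
    also have "\<dots> = L * \<bar>\<alpha> - \<beta>\<bar> * (std_normal_density y + std_normal_density y * y\<^sup>2)"
      by (simp add: algebra_simps)
    finally show "norm (std_normal_density y *\<^sub>R f (x - \<alpha> * y) - std_normal_density y *\<^sub>R f (x - \<beta> * y))
        \<le> L * \<bar>\<alpha> - \<beta>\<bar> * (std_normal_density y + std_normal_density y * y\<^sup>2)"
      by (simp flip: scaleR_diff_right)
  qed
  also have "\<dots> = L * \<bar>\<alpha> - \<beta>\<bar> * 2"
    using i2 v2 integral_normal_density[of 1 0] integrable_normal_density[of 1 0] by simp
  finally show ?thesis by simp
qed

subsection \<open>The spectral decomposition of the coupling matrix\<close>

lemma exhaust_8:
  fixes x :: 8
  shows "x = 1 \<or> x = 2 \<or> x = 3 \<or> x = 4 \<or> x = 5 \<or> x = 6 \<or> x = 7 \<or> x = 8"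
proof (induct x)
  case (of_int z)
  then have "0 \<le> z" and "z < 8" by simp_all
  then have "z = 0 \<or> z = 1 \<or> z = 2 \<or> z = 3 \<or> z = 4 \<or> z = 5 \<or> z = 6 \<or> z = 7" by arith
  then show ?case by auto
qed

lemma UNIV_8: "UNIV = {1, 2, 3, 4, 5, 6, 7, 8 :: 8}"
  using exhaust_8 by auto

lemma forall_8: "(\<forall>i :: 8. P i) \<longleftrightarrow> P 1 \<and> P 2 \<and> P 3 \<and> P 4 \<and> P 5 \<and> P 6 \<and> P 7 \<and> P 8"
  by (metis exhaust_8)

lemma sum_8: "sum f (UNIV :: 8 set) = f 1 + f 2 + f 3 + f 4 + f 5 + f 6 + f 7 + f 8"
  unfolding UNIV_8 by (simp add: add.assoc)

lemma cube_vertex_simps: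
  "cube_vertex 1 = vector [-1, -1, -1]" "cube_vertex 2 = vector [1, -1, -1]"
  "cube_vertex 3 = vector [1, 1, -1]" "cube_vertex 4 = vector [-1, 1, -1]"
  "cube_vertex 5 = vector [-1, -1, 1]" "cube_vertex 6 = vector [1, -1, 1]"
  "cube_vertex 7 = vector [1, 1, 1]" "cube_vertex 8 = vector [-1, 1, 1]"
  by (simp_all add: cube_vertex_def)

text \<open>Its value is \<open>3 - 2 d\<close> for vertices at graph distance \<open>d\<close>. The
  coupling matrix and its spectral projections are functions of this one quantity, which makes their
  invariance under rotations immediate.\<close>

definition cube_dot :: "8 \<Rightarrow> 8 \<Rightarrow> real" where
  "cube_dot i j = cube_vertex i \<bullet> cube_vertex j"

lemma inner_real3: "x \<bullet> y = x $ 1 * y $ 1 + x $ 2 * y $ 2 + x $ 3 * y $ 3" for x y :: "real ^ 3"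
  by (simp add: inner_vec_def sum_3)

text \<open>
  With \<open>d = V\<^sub>i \<bullet> V\<^sub>j\<close>, the projection onto the eigenspace of the eigenvalue \<open>- 2 l\<close> is the matrix whose entries
  are an eighth of the sum over all \<open>l\<close>-element \<open>S\<close> of the products of the coordinates of \<open>V\<^sub>i\<close> and \<open>V\<^sub>j\<close> in \<open>S\<close>.
\<close>

definition proj_entry :: "nat \<Rightarrow> real \<Rightarrow> real" where
  "proj_entry l d = (if l = 0 then 1 else if l = 1 then d else if l = 2 then (d\<^sup>2 - 3) / 2 else (d ^ 3 - 7 * d) / 6) / 8"

definition eig_proj :: "nat \<Rightarrow> real ^ 8 ^ 8" where
  "eig_proj l = (\<chi> i j. proj_entry l (cube_dot i j))"

lemma cube_dot_sym: "cube_dot i j = cube_dot j i"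
  by (simp add: cube_dot_def inner_commute)

lemma cube_dot_values: "\<forall>i j. cube_dot i j \<in> {-3, -1, 1, 3}"
  unfolding forall_8 by (simp add: cube_dot_def inner_real3 cube_vertex_simps)

lemma cube_dot_eq_3: "\<forall>i j. cube_dot i j = 3 \<longleftrightarrow> i = j"
  unfolding forall_8 by (simp add: cube_dot_def inner_real3 cube_vertex_simps)

lemma cube_dot_eq_1: "\<forall>i j. cube_dot i j = 1 \<longleftrightarrow> (i, j) \<in> cube_edges \<or> (j, i) \<in> cube_edges"
  unfolding forall_8 by (simp add: cube_dot_def inner_real3 cube_vertex_simps cube_edges_def)

lemma cube_coupling_entry:
  "cube_coupling $ i $ j = (if cube_dot i j = 3 then -3 else if cube_dot i j = 1 then 1 else 0 :: real)"
  by (simp add: cube_coupling_def cube_dot_eq_3 cube_dot_eq_1)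

lemma eig_proj_sum: "(\<Sum>l<4. eig_proj l) = mat 1"
proof -
  have "(\<Sum>l<4. proj_entry l (cube_dot i j)) = (if i = j then 1 else 0)" for i j
  proof -
    have "(\<Sum>l<4. proj_entry l d) = (if d = 3 then 1 else 0)" if "d \<in> {-3, -1, 1, 3}" for d
      using that by (auto simp: proj_entry_def eval_nat_numeral)
    then show ?thesis using cube_dot_values cube_dot_eq_3 by simp
  qed
  then show ?thesis by (simp add: vec_eq_iff eig_proj_def mat_def)
qed

lemma cube_coordinates: "\<forall>i. cube_vertex i $ a \<in> {-1, 1}"
  using exhaust_3[of a] unfolding forall_8 by (auto simp: cube_vertex_simps)

text \<open>The neighbours of a vertex arise by changing the sign of one coordinate, so the coupling
  matrix is the sum of the three sign changes minus three times the identity.\<close>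

lemma coupling_neighbours:
  fixes g :: "real \<Rightarrow> real \<Rightarrow> real \<Rightarrow> real"
  shows "\<forall>i. (\<Sum>k\<in>UNIV. cube_coupling $ i $ k * g (cube_vertex k $ 1) (cube_vertex k $ 2) (cube_vertex k $ 3)) =
     g (- (cube_vertex i $ 1)) (cube_vertex i $ 2) (cube_vertex i $ 3) +
     g (cube_vertex i $ 1) (- (cube_vertex i $ 2)) (cube_vertex i $ 3) +
     g (cube_vertex i $ 1) (cube_vertex i $ 2) (- (cube_vertex i $ 3)) -
     3 * g (cube_vertex i $ 1) (cube_vertex i $ 2) (cube_vertex i $ 3)"
  unfolding forall_8 sum_8 by (simp add: cube_coupling_def cube_edges_def cube_vertex_simps)

text \<open>With \<open>s a\<close> the product of the \<open>a\<close>-th coordinates, the entry is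
  an eighth of the elementary symmetric polynomial of degree \<open>l\<close> in \<open>s 1\<close>,
  \<open>s 2\<close>, \<open>s 3\<close>. Of the three sign changes, \<open>l\<close> negate a given
  monomial and \<open>3 - l\<close> keep it; the eigenvalue is \<open>(3 - 2 l) - 3\<close>.\<close>

lemma coupling_eig_proj: "cube_coupling ** eig_proj l = (- 2 * real l) *\<^sub>R eig_proj l" if "l < 4"
proof -
  have "(\<Sum>k\<in>UNIV. cube_coupling $ i $ k * proj_entry l (cube_dot k j)) = - 2 * real l * proj_entry l (cube_dot i j)" for i j
  proof -
    define s where "s a = cube_vertex i $ a * cube_vertex j $ a" for a
    have s: "s a \<in> {-1, 1}" for a
      using cube_coordinates[rule_format, of i a] cube_coordinates[rule_format, of j a] by (auto simp: s_def)
    have "(\<Sum>k\<in>UNIV. cube_coupling $ i $ k * proj_entry l (cube_dot k j)) =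
        proj_entry l (- s 1 + s 2 + s 3) + proj_entry l (s 1 - s 2 + s 3) + proj_entry l (s 1 + s 2 - s 3) - 3 * proj_entry l (s 1 + s 2 + s 3)"
      using coupling_neighbours[rule_format, of i "\<lambda>a b c. proj_entry l (a * cube_vertex j $ 1 + b * cube_vertex j $ 2 + c * cube_vertex j $ 3)"]
      by (simp add: cube_dot_def inner_real3 s_def)
    moreover have "cube_dot i j = s 1 + s 2 + s 3" by (simp add: cube_dot_def inner_real3 s_def)
    moreover have "proj_entry l (- a + b + c) + proj_entry l (a - b + c) + proj_entry l (a + b - c) - 3 * proj_entry l (a + b + c)
        = - 2 * real l * proj_entry l (a + b + c)" if "a \<in> {-1, 1}" "b \<in> {-1, 1}" "c \<in> {-1, 1}" for a b c
    proof -
      from \<open>l < 4\<close> have "l = 0 \<or> l = 1 \<or> l = 2 \<or> l = 3" by linarith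
      then show ?thesis using that by (elim disjE insertE emptyE) (simp_all add: proj_entry_def)
    qed
    ultimately show ?thesis using s by simp
  qed
  then show ?thesis by (simp add: vec_eq_iff matrix_matrix_mult_def eig_proj_def)
qed

lemma coupling_transpose: "transpose cube_coupling = (cube_coupling :: real ^ 8 ^ 8)"
  by (simp add: transpose_def vec_eq_iff cube_coupling_entry cube_dot_sym)

lemma eig_proj_transpose: "transpose (eig_proj l) = eig_proj l"
  by (simp add: transpose_def vec_eq_iff eig_proj_def cube_dot_sym)

lemma eig_proj_coupling: "eig_proj l ** cube_coupling = (- 2 * real l) *\<^sub>R eig_proj l" if "l < 4"
proof -
  have "eig_proj l ** cube_coupling = transpose (cube_coupling ** eig_proj l)"
    by (simp add: matrix_transpose_mul coupling_transpose eig_proj_transpose)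
  also have "\<dots> = (- 2 * real l) *\<^sub>R transpose (eig_proj l)"
    by (simp add: coupling_eig_proj[OF that] transpose_def vec_eq_iff)
  finally show ?thesis by (simp add: eig_proj_transpose)
qed

lemma coupling_eig_vec: "l < 4 \<Longrightarrow> cube_coupling *v (eig_proj l *v x) = (- 2 * real l) *\<^sub>R (eig_proj l *v x)"
  and eig_vec_coupling: "l < 4 \<Longrightarrow> eig_proj l *v (cube_coupling *v x) = (- 2 * real l) *\<^sub>R (eig_proj l *v x)"
  by (simp_all only: matrix_vector_mul_assoc coupling_eig_proj eig_proj_coupling scaleR_matrix_vector_assoc)

lemma eig_proj_orthogonal:
  assumes "j < 4" "l < 4" "j \<noteq> l" shows "eig_proj j *v (eig_proj l *v x) = 0"
proof -
  have "(- 2 * real l) *\<^sub>R (eig_proj j *v (eig_proj l *v x)) = eig_proj j *v (cube_coupling *v (eig_proj l *v x))"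
    by (simp only: coupling_eig_vec[OF assms(2)] matrix_vector_mult_scaleR)
  also have "\<dots> = (- 2 * real j) *\<^sub>R (eig_proj j *v (eig_proj l *v x))"
    by (rule eig_vec_coupling[OF assms(1)])
  finally show ?thesis using assms(3) by auto
qed

lemma eig_decomp: "(\<Sum>l<4. eig_proj l *v x) = x"
proof -
  have "(\<Sum>l<4. eig_proj l *v x) = (\<Sum>l<4. eig_proj l) *v x"
    by (simp add: eval_nat_numeral matrix_vector_mult_add_rdistrib)
  then show ?thesis by (simp add: eig_proj_sum)
qed

lemma eig_proj_idem: "l < 4 \<Longrightarrow> eig_proj l *v (eig_proj l *v x) = eig_proj l *v x"
proof -
  assume l: "l < 4"
  have "eig_proj l *v x = eig_proj l *v (\<Sum>j<4. eig_proj j *v x)" by (simp only: eig_decomp)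
  also have "\<dots> = (\<Sum>j<4. eig_proj l *v (eig_proj j *v x))"
    by (simp add: linear_sum[OF matrix_vector_mul_linear])
  also have "\<dots> = (\<Sum>j<4. if j = l then eig_proj l *v (eig_proj l *v x) else 0)"
    using l by (intro sum.cong) (auto simp: eig_proj_orthogonal)
  finally show ?thesis using l by simp
qed

text \<open>Restrictions of linear functionals to the vertices. They form the eigenspace of the
  coupling matrix for \<open>-2\<close> and identify it with the natural representation of the
  rotation group on \<open>real ^ 3\<close>.\<close>

definition vertex_fun :: "real ^ 3 \<Rightarrow> real ^ 8" where
  "vertex_fun a = (\<chi> i. cube_vertex i \<bullet> a)"

lemma vertex_fun_linear: "linear vertex_fun"
  by (rule linearI) (simp_all add: vertex_fun_def vec_eq_iff inner_add_right)

text \<open>The vertices form a tight frame. This recovers \<open>a\<close> from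
  \<open>vertex_fun a\<close> and exhibits \<open>eig_proj 1\<close> as a projection onto the range
  of \<open>vertex_fun\<close>.\<close>

lemma vertex_frame: "(\<Sum>j\<in>UNIV. (cube_vertex j \<bullet> a) *\<^sub>R cube_vertex j) = 8 *\<^sub>R a"
  by (simp add: vec_eq_iff forall_3 sum_8 inner_real3 cube_vertex_simps)

lemma eig_proj_1: "eig_proj 1 *v x = vertex_fun ((1 / 8) *\<^sub>R (\<Sum>j\<in>UNIV. x $ j *\<^sub>R cube_vertex j))"
  by (simp add: eig_proj_def vertex_fun_def vec_eq_iff matrix_vector_mult_def proj_entry_def cube_dot_def
    inner_sum_right sum_divide_distrib mult.commute)

lemma eig_proj_1_vertex_fun: "eig_proj 1 *v vertex_fun a = vertex_fun a"
  unfolding eig_proj_1 by (simp add: vertex_fun_def[of a] vertex_frame)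

lemma vertex_fun_inj: "vertex_fun a = vertex_fun b \<longleftrightarrow> a = b"
proof
  assume "vertex_fun a = vertex_fun b"
  then have eq: "cube_vertex i \<bullet> a = cube_vertex i \<bullet> b" for i by (simp add: vertex_fun_def vec_eq_iff)
  have "8 *\<^sub>R a = 8 *\<^sub>R b" unfolding vertex_frame[symmetric] by (simp only: eq)
  then show "a = b" by simp
qed simp

subsection \<open>The linearized system\<close>

lemma mv_bounded_linear: "bounded_linear (\<lambda>x. (A :: real ^ 8 ^ 8) *v x)"
  by (simp add: linear_conv_bounded_linear[symmetric] matrix_vector_mul_linear)

text \<open>The Fourier symbol of \<open>- x'' + linrhs x\<close> on frequency \<open>k\<close> and
  the \<open>l\<close>-th eigenspace of the coupling matrix, whose eigenvalue is
  \<open>- 2 l\<close>. The mode \<open>(k, l)\<close> lies in the kernel exactly when it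
  vanishes.\<close>

definition symb :: "real \<Rightarrow> real \<Rightarrow> nat \<Rightarrow> nat \<Rightarrow> real \<Rightarrow> real" where
  "symb c1 c2 k l \<alpha> = (real k)\<^sup>2 + c1 - 2 * real l * c2 + exp (- (\<alpha> * real k)\<^sup>2 / 2)"

definition linrhs :: "real \<Rightarrow> real \<Rightarrow> real \<Rightarrow> (real \<Rightarrow> real ^ 8) \<Rightarrow> real \<Rightarrow> real ^ 8" where
  "linrhs c1 c2 \<alpha> x t = c1 *\<^sub>R x t + c2 *\<^sub>R (cube_coupling *v x t) + gconv \<alpha> x t"

lemma linrhs_cper: "cper x \<Longrightarrow> cper (linrhs c1 c2 \<alpha> x)"
  unfolding linrhs_def[abs_def] by (intro cper_add cper_scaleR cper_linear[OF mv_bounded_linear] gconv_cper)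

lemma eig_harmonic_linrhs:
  assumes x: "cper x" and l: "l < 4"
  shows "eig_proj l *v harmonic k (linrhs c1 c2 \<alpha> x) t
    = (symb c1 c2 k l \<alpha> - (real k)\<^sup>2) *\<^sub>R (eig_proj l *v harmonic k x t)"
proof -
  have "harmonic k (linrhs c1 c2 \<alpha> x) t = c1 *\<^sub>R harmonic k x t + c2 *\<^sub>R (cube_coupling *v harmonic k x t)
      + exp (- (\<alpha> * real k)\<^sup>2 / 2) *\<^sub>R harmonic k x t"
    unfolding linrhs_def[abs_def]
    by (simp add: harmonic_add harmonic_scaleR harmonic_linear[OF mv_bounded_linear x] harmonic_gconv x
      cper_add cper_scaleR cper_linear[OF mv_bounded_linear x] gconv_cper)
  then show ?thesis
    by (simp add: matrix_vector_right_distrib matrix_vector_mult_scaleR eig_vec_coupling[OF l] symb_def algebra_simps)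
qed

lemma solution_harmonics:
  assumes C: "C2per x x' (\<lambda>t. linrhs c1 c2 \<alpha> x t + f t)" and f: "cper f" and l: "l < 4"
  shows "symb c1 c2 k l \<alpha> *\<^sub>R (eig_proj l *v harmonic k x t) = - (eig_proj l *v harmonic k f t)"
proof -
  have x: "cper x" using C by (simp add: C2per_def)
  have "- ((real k)\<^sup>2 *\<^sub>R harmonic k x t) = harmonic k (linrhs c1 c2 \<alpha> x) t + harmonic k f t"
    using harmonic_second_deriv[OF C, of k t] by (simp add: harmonic_add linrhs_cper x f)
  then have "eig_proj l *v ((- ((real k)\<^sup>2)) *\<^sub>R harmonic k x t) = eig_proj l *v harmonic k (linrhs c1 c2 \<alpha> x) t + eig_proj l *v harmonic k f t"
    by (simp add: matrix_vector_right_distrib)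
  then show ?thesis
    unfolding matrix_vector_mult_scaleR eig_harmonic_linrhs[OF x l] by (simp add: algebra_simps eq_neg_iff_add_eq_0)
qed

lemma eq_zero_if_eig_harmonics_zero:
  assumes "cper x" "\<And>k l t. l < 4 \<Longrightarrow> eig_proj l *v harmonic k x t = 0"
  shows "x t = 0"
proof (rule harmonic_unique[OF assms(1)])
  show "harmonic k x t = 0" for k t
    using eig_decomp[of "harmonic k x t"] assms(2) by simp
qed

section \<open>Projection to the critical mode\<close>

definition kerproj :: "(real \<Rightarrow> real ^ 8) \<Rightarrow> real \<Rightarrow> real ^ 8" where
  "kerproj x t = eig_proj 1 *v harmonic 1 x t"

lemma kerproj_cper: "cper (kerproj x)"
  unfolding kerproj_def[abs_def] by (rule cper_linear[OF mv_bounded_linear harmonic_cper])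

lemma harmonic_kerproj: "harmonic k (kerproj x) t = (if k = 1 then kerproj x t else 0)"
  unfolding kerproj_def[abs_def]
  by (simp add: harmonic_linear[OF mv_bounded_linear harmonic_cper] harmonic_harmonic_same harmonic_harmonic_neq)

lemma kerproj_idem: "kerproj (kerproj x) = kerproj x"
  by (rule ext) (simp add: kerproj_def[of "kerproj x"] harmonic_kerproj, simp add: kerproj_def eig_proj_idem)

lemma eq_kerproj_if_eig_harmonics_zero:
  assumes "cper x" "\<And>k l t. l < 4 \<Longrightarrow> (k, l) \<noteq> (1, 1) \<Longrightarrow> eig_proj l *v harmonic k x t = 0"
  shows "x = kerproj x"
proof (rule harmonic_eqI[OF assms(1) kerproj_cper])
  fix k t
  have "harmonic k x t = (\<Sum>l<4. eig_proj l *v harmonic k x t)" by (simp add: eig_decomp)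
  also have "\<dots> = (\<Sum>l<(4::nat). if l = 1 then (if k = 1 then kerproj x t else 0) else 0)"
    by (rule sum.cong) (auto simp: kerproj_def assms(2))
  also have "\<dots> = harmonic k (kerproj x) t" by (simp add: harmonic_kerproj)
  finally show "harmonic k x t = harmonic k (kerproj x) t" .
qed

lemma kerproj_form:
  obtains a b where "kerproj x = (\<lambda>t. vertex_fun (cos t *\<^sub>R a + sin t *\<^sub>R b))"
proof -
  \<comment> \<open>The factor \<open>1 / 8\<close> comes from \<open>eig_proj_1\<close> and
    \<open>1 / pi\<close> from the normalization of the first harmonic.\<close>
  let ?p = "\<lambda>x :: real ^ 8. (1 / (8 * pi)) *\<^sub>R (\<Sum>j\<in>UNIV. x $ j *\<^sub>R cube_vertex j)"
  have "kerproj x t = vertex_fun (cos t *\<^sub>R ?p (fcos 1 x) + sin t *\<^sub>R ?p (fsin 1 x))" for t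
    unfolding kerproj_def eig_proj_1 harmonic_def
    by (rule arg_cong[of _ _ vertex_fun])
      (simp add: sum.distrib scaleR_sum_right scaleR_add_left scaleR_add_right mult_ac)
  then show thesis by (intro that ext)
qed

text \<open>Such a function satisfies \<open>y'' = - y\<close>, so its harmonics are annihilated by
  \<open>k^2 - 1\<close> and only \<open>k = 1\<close> survives.\<close>

lemma harmonic_1_cos_sin: 
  "harmonic 1 (\<lambda>t. cos t *\<^sub>R a + sin t *\<^sub>R b) t = cos t *\<^sub>R a + sin t *\<^sub>R (b :: 'a::euclidean_space)"
proof -
  let ?y = "\<lambda>t. cos t *\<^sub>R a + sin t *\<^sub>R b"
  have y: "cper ?y" by (rule cperI) (auto intro!: continuous_intros)
  have C: "C2per ?y (\<lambda>t. cos t *\<^sub>R b - sin t *\<^sub>R a) (\<lambda>t. - ?y t)"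
    unfolding C2per_def using y cper_scaleR[OF y, of "-1"]
    by (auto intro!: derivative_eq_intros cperI continuous_intros)
  have h: "harmonic k ?y t = 0" if "k \<noteq> 1" for k t
  proof -
    have "- harmonic k ?y t = - ((real k)\<^sup>2 *\<^sub>R harmonic k ?y t)"
      using harmonic_second_deriv[OF C, of k t] harmonic_scaleR[OF y, of k "-1" t] by simp
    then have "((real k)\<^sup>2 - 1) *\<^sub>R harmonic k ?y t = 0" by (simp add: scaleR_diff_left)
    moreover have "(real k)\<^sup>2 - 1 \<noteq> 0" using that by (auto simp: power2_eq_1_iff)
    ultimately show ?thesis by simp
  qed
  have "?y = harmonic 1 ?y"
  proof (rule harmonic_eqI[OF y harmonic_cper])
    show "harmonic k ?y t = harmonic k (harmonic 1 ?y) t" for k t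
      by (cases "k = 1") (simp_all add: harmonic_harmonic_same h harmonic_harmonic_neq del: One_nat_def)
  qed
  from fun_cong[OF this, of t] show ?thesis by simp
qed

lemma kerproj_vertex_fun:
  "kerproj (\<lambda>t. vertex_fun (cos t *\<^sub>R a + sin t *\<^sub>R b)) = (\<lambda>t. vertex_fun (cos t *\<^sub>R a + sin t *\<^sub>R b))"
proof
  fix t
  have bl: "bounded_linear vertex_fun" by (simp add: linear_conv_bounded_linear[symmetric] vertex_fun_linear)
  have y: "cper (\<lambda>t. cos t *\<^sub>R a + sin t *\<^sub>R b)" by (rule cperI) (auto intro!: continuous_intros)
  show "kerproj (\<lambda>t. vertex_fun (cos t *\<^sub>R a + sin t *\<^sub>R b)) t = vertex_fun (cos t *\<^sub>R a + sin t *\<^sub>R b)"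
    by (simp only: kerproj_def harmonic_linear[OF bl y] harmonic_1_cos_sin eig_proj_1_vertex_fun)
qed

section \<open>Inversion of the linearization off the critical mode\<close>

lemma summable_inverse_1_plus_square: "summable (\<lambda>k. 1 / (1 + (real k)\<^sup>2))"
proof (rule summable_comparison_test')
  show "summable (\<lambda>k. inverse ((real k)\<^sup>2))" by (rule inverse_power_summable) simp
  fix k :: nat assume "k \<ge> 1"
  then show "norm (1 / (1 + (real k)\<^sup>2)) \<le> inverse ((real k)\<^sup>2)"
    by (simp add: inverse_eq_divide frac_le)
qed

text \<open>The minus sign is that of \<open>solution_harmonics\<close>. The value \<open>0\<close>
  at the critical mode makes the solution free of kernel components, and avoids the division by a
  symbol that vanishes at \<open>\<alpha>o\<close>.\<close>

definition solweight :: "real \<Rightarrow> real \<Rightarrow> real \<Rightarrow> nat \<Rightarrow> nat \<Rightarrow> real" where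
  "solweight c1 c2 \<alpha> l k = (if k = 1 \<and> l = 1 then 0 else - 1 / symb c1 c2 k l \<alpha>)"

definition solop :: "real \<Rightarrow> real \<Rightarrow> real \<Rightarrow> (real \<Rightarrow> real ^ 8) \<Rightarrow> real \<Rightarrow> real ^ 8" where
  "solop c1 c2 \<alpha> f t = (\<Sum>l<4. fmult (solweight c1 c2 \<alpha> l) (\<lambda>s. eig_proj l *v f s) t)"

text \<open>The growth in \<open>k\<close> makes the inverse symbols summable. Since \<kappa> is a
  separate argument, one constant can serve all parameters near \<open>\<alpha>o\<close>, and the
  estimates become uniform in \<alpha>.\<close>

definition elliptic :: "real \<Rightarrow> real \<Rightarrow> real \<Rightarrow> real \<Rightarrow> bool" where
  "elliptic c1 c2 \<kappa> \<alpha> \<longleftrightarrow> \<kappa> > 0 \<and> (\<forall>k l. l < 4 \<and> (k, l) \<noteq> (1, 1) \<longrightarrow> \<bar>symb c1 c2 k l \<alpha>\<bar> \<ge> \<kappa> * (1 + (real k)\<^sup>2))"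

lemma elliptic_symb_nonzero:
  assumes "elliptic c1 c2 \<kappa> \<alpha>" "l < 4" "(k, l) \<noteq> (1, 1)" shows "symb c1 c2 k l \<alpha> \<noteq> 0"
proof -
  have "0 < \<kappa> * (1 + (real k)\<^sup>2)" using assms(1) by (auto simp: elliptic_def intro!: mult_pos_pos add_pos_nonneg)
  moreover have "\<kappa> * (1 + (real k)\<^sup>2) \<le> \<bar>symb c1 c2 k l \<alpha>\<bar>" using assms by (simp add: elliptic_def)
  ultimately show ?thesis by auto
qed

lemma solweight_bound:
  assumes "elliptic c1 c2 \<kappa> \<alpha>" "l < 4"
  shows "\<bar>solweight c1 c2 \<alpha> l k\<bar> \<le> (1 / \<kappa>) * (1 / (1 + (real k)\<^sup>2))"
proof (cases "(k, l) = (1, 1)")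
  case False
  then have "\<kappa> * (1 + (real k)\<^sup>2) \<le> \<bar>symb c1 c2 k l \<alpha>\<bar>" "\<kappa> > 0" using assms by (auto simp: elliptic_def)
  moreover have "0 < \<kappa> * (1 + (real k)\<^sup>2)" using \<open>\<kappa> > 0\<close> by (auto intro!: mult_pos_pos add_pos_nonneg)
  ultimately have "1 / \<bar>symb c1 c2 k l \<alpha>\<bar> \<le> 1 / (\<kappa> * (1 + (real k)\<^sup>2))" by (intro divide_left_mono) auto
  then show ?thesis using False by (auto simp: solweight_def)
qed (use assms in \<open>auto simp: solweight_def elliptic_def\<close>)

lemma solweight_summable:
  assumes "elliptic c1 c2 \<kappa> \<alpha>" "l < 4"
  shows "summable (\<lambda>k. \<bar>solweight c1 c2 \<alpha> l k\<bar>)"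
  by (rule summable_comparison_test'[OF summable_mult[OF summable_inverse_1_plus_square, of "1 / \<kappa>"]])
    (use solweight_bound[OF assms] in auto)

context
  fixes c1 c2 \<kappa> \<alpha> :: real and f :: "real \<Rightarrow> real ^ 8"
  assumes ell: "elliptic c1 c2 \<kappa> \<alpha>" and f: "cper f"
begin

lemma solop_cper: "cper (solop c1 c2 \<alpha> f)"
  unfolding solop_def[abs_def]
  by (intro cper_sum fmult_cper solweight_summable[OF ell] cper_linear[OF mv_bounded_linear f]) auto

lemma harmonic_solop:
  "harmonic k (solop c1 c2 \<alpha> f) t = (\<Sum>l<4. solweight c1 c2 \<alpha> l k *\<^sub>R (eig_proj l *v harmonic k f t))"
  unfolding solop_def[abs_def]
  by (subst harmonic_sum)
    (auto intro!: sum.cong fmult_cper solweight_summable[OF ell] cper_linear[OF mv_bounded_linear f]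
      simp: harmonic_fmult[OF solweight_summable[OF ell] cper_linear[OF mv_bounded_linear f]] harmonic_linear[OF mv_bounded_linear f])

lemma eig_harmonic_solop:
  assumes "l < 4"
  shows "eig_proj l *v harmonic k (solop c1 c2 \<alpha> f) t = solweight c1 c2 \<alpha> l k *\<^sub>R (eig_proj l *v harmonic k f t)"
proof -
  have "eig_proj l *v harmonic k (solop c1 c2 \<alpha> f) t
      = (\<Sum>j<4. solweight c1 c2 \<alpha> j k *\<^sub>R (eig_proj l *v (eig_proj j *v harmonic k f t)))"
    by (simp add: harmonic_solop linear_sum[OF matrix_vector_mul_linear] matrix_vector_mult_scaleR)
  also have "\<dots> = (\<Sum>j<4. if j = l then solweight c1 c2 \<alpha> l k *\<^sub>R (eig_proj l *v harmonic k f t) else 0)"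
    using assms by (intro sum.cong) (auto simp: eig_proj_orthogonal eig_proj_idem)
  finally show ?thesis using assms by simp
qed

lemma kerproj_solop: "kerproj (solop c1 c2 \<alpha> f) = (\<lambda>_. 0)"
  by (rule ext) (simp add: kerproj_def eig_harmonic_solop[of 1, simplified] solweight_def)

text \<open>The equation is checked on each harmonic and each eigenspace, where it is scalar; at the
  critical mode both the weight and the component of \<open>f - kerproj f\<close> vanish.
  Differentiability comes from \<open>C2per_from_harmonics\<close>.\<close>

theorem solop_solves:
  obtains w' where "C2per (solop c1 c2 \<alpha> f) w' (\<lambda>t. linrhs c1 c2 \<alpha> (solop c1 c2 \<alpha> f) t + (f t - kerproj f t))"
proof (rule C2per_from_harmonics[OF solop_cper])
  let ?w = "solop c1 c2 \<alpha> f"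
  have fk: "cper (\<lambda>t. f t - kerproj f t)" by (intro cper_diff f kerproj_cper)
  show "cper (\<lambda>t. linrhs c1 c2 \<alpha> ?w t + (f t - kerproj f t))"
    by (intro cper_add linrhs_cper solop_cper fk)
  fix k t
  have eig: "eig_proj l *v harmonic k (\<lambda>t. linrhs c1 c2 \<alpha> ?w t + (f t - kerproj f t)) t
      = eig_proj l *v (- ((real k)\<^sup>2 *\<^sub>R harmonic k ?w t))" if l: "l < 4" for l
  proof -
    let ?h = "eig_proj l *v harmonic k f t"
    have ker: "eig_proj l *v harmonic k (kerproj f) t = (if k = 1 \<and> l = 1 then ?h else 0)"
      using eig_proj_orthogonal[OF l, of 1] eig_proj_idem[of 1] by (auto simp: harmonic_kerproj kerproj_def)
    have "eig_proj l *v harmonic k (\<lambda>t. linrhs c1 c2 \<alpha> ?w t + (f t - kerproj f t)) t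
      = (symb c1 c2 k l \<alpha> - (real k)\<^sup>2) *\<^sub>R (solweight c1 c2 \<alpha> l k *\<^sub>R ?h) + (?h - (if k = 1 \<and> l = 1 then ?h else 0))"
      by (simp add: harmonic_add harmonic_diff linrhs_cper solop_cper f fk kerproj_cper matrix_vector_right_distrib
        matrix_vector_mult_diff_distrib eig_harmonic_linrhs[OF solop_cper l] eig_harmonic_solop[OF l] ker)
    also have "\<dots> = - ((real k)\<^sup>2 *\<^sub>R (solweight c1 c2 \<alpha> l k *\<^sub>R ?h))"
      using elliptic_symb_nonzero[OF ell l, of k] by (auto simp: solweight_def algebra_simps)
    finally show ?thesis
      by (simp add: eig_harmonic_solop[OF l] matrix_vector_mult_scaleR linear_neg[OF matrix_vector_mul_linear])
  qed
  show "harmonic k (\<lambda>t. linrhs c1 c2 \<alpha> ?w t + (f t - kerproj f t)) t = - ((real k)\<^sup>2 *\<^sub>R harmonic k ?w t)"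
  proof -
    have "(\<Sum>l<4. eig_proj l *v harmonic k (\<lambda>t. linrhs c1 c2 \<alpha> ?w t + (f t - kerproj f t)) t)
        = (\<Sum>l<4. eig_proj l *v (- ((real k)\<^sup>2 *\<^sub>R harmonic k ?w t)))"
      by (rule sum.cong) (simp_all only: lessThan_iff eig)
    then show ?thesis by (simp only: eig_decomp)
  qed
qed

end

lemma fmult_diff_weight:
  assumes "summable (\<lambda>k. \<bar>w k\<bar>)" "summable (\<lambda>k. \<bar>v k\<bar>)" "cper f"
  shows "fmult w f t - fmult v f t = fmult (\<lambda>k. w k - v k) f t"
  unfolding fmult_def using fmult_summable[OF assms(1,3)] fmult_summable[OF assms(2,3)]
  by (subst suminf_diff) (simp_all add: scaleR_diff_left)

lemma fmult_diff:
  assumes "summable (\<lambda>k. \<bar>w k\<bar>)" "cper f" "cper g"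
  shows "fmult w f t - fmult w g t = fmult w (\<lambda>s. f s - g s) t"
  unfolding fmult_def using fmult_summable[OF assms(1,2)] fmult_summable[OF assms(1,3)]
  by (subst suminf_diff) (simp_all add: scaleR_diff_right harmonic_diff assms)

lemma matrix_bound: 
  obtains B :: real where "B > 0" "\<And>x :: real ^ 8. norm ((A :: real ^ 8 ^ 8) *v x) \<le> B * norm x"
  using bounded_linear.pos_bounded[OF mv_bounded_linear[of A]] by (metis mult.commute)

lemma eig_proj_bound:
  obtains B :: real where "B > 0" "\<And>l x. l < 4 \<Longrightarrow> norm (eig_proj l *v x) \<le> B * norm x"
proof -
  have "\<exists>b>0. \<forall>x. norm (eig_proj l *v x) \<le> b * norm x" for l
    using matrix_bound[of "eig_proj l"] by metis
  then obtain b where b: "\<And>l. b l > 0" "\<And>l x. norm (eig_proj l *v x) \<le> b l * norm x" by metis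
  show thesis
  proof
    show "0 < 1 + (\<Sum>l<4. b l)" using b(1) by (intro add_pos_nonneg sum_nonneg) (auto intro: less_imp_le)
    fix l :: nat and x :: "real ^ 8" assume "l < 4"
    then have "b l \<le> (\<Sum>l<4. b l)" using b(1) by (intro member_le_sum) (auto intro: less_imp_le)
    then show "norm (eig_proj l *v x) \<le> (1 + (\<Sum>l<4. b l)) * norm x"
      using b(2)[of l x] mult_right_mono[of "b l" "1 + (\<Sum>l<4. b l)" "norm x"] by simp
  qed
qed

text \<open>The constant does not depend on \<alpha> because the Gaussian has total mass
  \<open>1\<close>; this is the final summand \<open>1\<close>.\<close>

lemma linrhs_bound:
  obtains C where "C > 0" "\<And>\<alpha> x M t. cper x \<Longrightarrow> (\<And>s. norm (x s) \<le> M) \<Longrightarrow> norm (linrhs c1 c2 \<alpha> x t) \<le> C * M"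
proof -
  obtain B where B: "B > 0" "\<And>x :: real ^ 8. norm (cube_coupling *v x) \<le> B * norm x" by (rule matrix_bound) auto
  show thesis
  proof
    show "0 < \<bar>c1\<bar> + \<bar>c2\<bar> * B + 1" using B(1) by (intro add_nonneg_pos) auto
    fix \<alpha> M t and x :: "real \<Rightarrow> real ^ 8" assume x: "cper x" "\<And>s. norm (x s) \<le> M"
    have "norm (c2 *\<^sub>R (cube_coupling *v x t)) \<le> \<bar>c2\<bar> * (B * M)"
      using B x(2)[of t] by (auto intro!: mult_left_mono order_trans[OF B(2)])
    moreover have "norm (c1 *\<^sub>R x t) \<le> \<bar>c1\<bar> * M" using x(2)[of t] by (auto intro: mult_left_mono)
    moreover have "norm (linrhs c1 c2 \<alpha> x t)
        \<le> norm (c1 *\<^sub>R x t) + norm (c2 *\<^sub>R (cube_coupling *v x t)) + norm (gconv \<alpha> x t)"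
      unfolding linrhs_def by (intro norm_triangle_le add_right_mono norm_triangle_ineq)
    moreover have "norm (gconv \<alpha> x t) \<le> M" by (rule norm_gconv_le[OF x])
    moreover have "(\<bar>c1\<bar> + \<bar>c2\<bar> * B + 1) * M = \<bar>c1\<bar> * M + \<bar>c2\<bar> * (B * M) + M" by (simp add: algebra_simps)
    ultimately show "norm (linrhs c1 c2 \<alpha> x t) \<le> (\<bar>c1\<bar> + \<bar>c2\<bar> * B + 1) * M" by linarith
  qed
qed

text \<open>In \<open>1 / n - 1 / m\<close> the numerator is of order \<open>k^2\<close>, since
  \<open>exp (- x)\<close> is 1-Lipschitz for nonnegative \<open>x\<close>, and the denominator is
  of order \<open>k^4\<close>. The quotient keeps the summable decay
  \<open>1 / (1 + k^2)\<close>.\<close>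

lemma solweight_diff:
  assumes \<alpha>: "elliptic c1 c2 \<kappa> \<alpha>" and \<beta>: "elliptic c1 c2 \<kappa> \<beta>" and l: "l < 4"
  shows "\<bar>solweight c1 c2 \<alpha> l k - solweight c1 c2 \<beta> l k\<bar> \<le> (\<bar>\<alpha>\<^sup>2 - \<beta>\<^sup>2\<bar> / \<kappa>\<^sup>2) * (1 / (1 + (real k)\<^sup>2))"
proof (cases "(k, l) = (1, 1)")
  case False
  define m where "m = symb c1 c2 k l \<alpha>"
  define n where "n = symb c1 c2 k l \<beta>"
  define K where "K = 1 + (real k)\<^sup>2"
  have K: "K > 0" by (auto simp: K_def intro!: add_pos_nonneg)
  have \<kappa>: "\<kappa> > 0" and m: "\<kappa> * K \<le> \<bar>m\<bar>" and n: "\<kappa> * K \<le> \<bar>n\<bar>"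
    using False assms by (auto simp: elliptic_def m_def n_def K_def)
  have nz: "m \<noteq> 0" "n \<noteq> 0" using m n mult_pos_pos[OF \<kappa> K] by (metis abs_zero not_le)+
  have exp_lip: "\<bar>exp (- a) - exp (- b)\<bar> \<le> \<bar>a - b\<bar>" if "a \<ge> 0" "b \<ge> 0" for a b :: real
  proof -
    have *: "exp (- a) - exp (- b) \<le> b - a" if "0 \<le> a" "a \<le> b" for a b :: real
    proof -
      have "1 - exp (- (b - a)) \<le> b - a" using exp_ge_add_one_self[of "- (b - a)"] by linarith
      then have "exp (- a) * (1 - exp (- (b - a))) \<le> 1 * (b - a)"
        using that by (intro mult_mono) auto
      then show ?thesis by (simp add: algebra_simps flip: exp_add)
    qed
    show ?thesis using that *[of a b] *[of b a] by (cases "a \<le> b") auto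
  qed
  have "\<bar>m - n\<bar> = \<bar>exp (- ((\<alpha> * real k)\<^sup>2 / 2)) - exp (- ((\<beta> * real k)\<^sup>2 / 2))\<bar>" by (simp add: m_def n_def symb_def)
  also have "\<dots> \<le> \<bar>(\<alpha> * real k)\<^sup>2 / 2 - (\<beta> * real k)\<^sup>2 / 2\<bar>" by (rule exp_lip) auto
  also have "\<dots> = \<bar>\<alpha>\<^sup>2 - \<beta>\<^sup>2\<bar> * ((real k)\<^sup>2 / 2)"
  proof -
    have "(\<alpha> * real k)\<^sup>2 / 2 - (\<beta> * real k)\<^sup>2 / 2 = (\<alpha>\<^sup>2 - \<beta>\<^sup>2) * ((real k)\<^sup>2 / 2)"
      by (simp add: power_mult_distrib field_simps)
    then show ?thesis by (simp only: abs_mult) simp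
  qed
  also have "\<dots> \<le> \<bar>\<alpha>\<^sup>2 - \<beta>\<^sup>2\<bar> * K" by (intro mult_left_mono) (auto simp: K_def)
  finally have mn: "\<bar>m - n\<bar> \<le> \<bar>\<alpha>\<^sup>2 - \<beta>\<^sup>2\<bar> * K" .
  have "\<bar>solweight c1 c2 \<alpha> l k - solweight c1 c2 \<beta> l k\<bar> = \<bar>m - n\<bar> / (\<bar>m\<bar> * \<bar>n\<bar>)"
    using nz False by (auto simp: solweight_def m_def[symmetric] n_def[symmetric] divide_simps abs_mult)
  also have "\<dots> \<le> (\<bar>\<alpha>\<^sup>2 - \<beta>\<^sup>2\<bar> * K) / ((\<kappa> * K) * (\<kappa> * K))"
    using m n \<kappa> K by (intro frac_le mn mult_mono) (auto intro!: mult_pos_pos)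
  also have "\<dots> = (\<bar>\<alpha>\<^sup>2 - \<beta>\<^sup>2\<bar> / \<kappa>\<^sup>2) * (1 / K)" using K \<kappa> by (simp add: field_simps power2_eq_square)
  finally show ?thesis by (simp add: K_def)
qed (simp add: solweight_def)

text \<open>The first two estimates make the reduced map preserve a ball of Lipschitz functions, the
  third makes it jointly continuous in the parameter and the function. All are linear in the size of
  the data, so small data give images in the unit ball.\<close>

theorem solop_bounds:
  assumes "\<kappa> > 0"
  obtains C where "C > 0"
    and "\<And>\<alpha> f M t. elliptic c1 c2 \<kappa> \<alpha> \<Longrightarrow> cper f \<Longrightarrow> (\<And>s. norm (f s) \<le> M) \<Longrightarrow> norm (solop c1 c2 \<alpha> f t) \<le> C * M"
    and "\<And>\<alpha> f M s t. elliptic c1 c2 \<kappa> \<alpha> \<Longrightarrow> cper f \<Longrightarrow> (\<And>s. norm (f s) \<le> M) \<Longrightarrow>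
       norm (solop c1 c2 \<alpha> f t - solop c1 c2 \<alpha> f s) \<le> C * M * \<bar>t - s\<bar>"
    and "\<And>\<alpha> \<beta> f g M D t. elliptic c1 c2 \<kappa> \<alpha> \<Longrightarrow> elliptic c1 c2 \<kappa> \<beta> \<Longrightarrow> cper f \<Longrightarrow> cper g \<Longrightarrow>
       (\<And>s. norm (f s) \<le> M) \<Longrightarrow> (\<And>s. norm (f s - g s) \<le> D) \<Longrightarrow>
       norm (solop c1 c2 \<alpha> f t - solop c1 c2 \<beta> g t) \<le> C * (M * \<bar>\<alpha>\<^sup>2 - \<beta>\<^sup>2\<bar> + D)"
proof -
  define S where "S = (\<Sum>k. 1 / (1 + (real k)\<^sup>2))"
  note sS = summable_inverse_1_plus_square
  have S0: "S > 0" unfolding S_def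
    by (rule suminf_pos[OF sS]) (auto intro!: divide_pos_pos add_pos_nonneg)
  obtain B where B: "B > 0" "\<And>l x. l < 4 \<Longrightarrow> norm (eig_proj l *v x) \<le> B * norm x" by (rule eig_proj_bound) auto
  obtain R where R: "R > 0" "\<And>\<alpha> x M t. cper x \<Longrightarrow> (\<And>s. norm (x s) \<le> M) \<Longrightarrow> norm (linrhs c1 c2 \<alpha> x t) \<le> R * M"
    by (rule linrhs_bound[of c1 c2]) auto
  have wsum: "(\<Sum>k. \<bar>w k\<bar>) \<le> c * S" if "\<And>k. \<bar>w k\<bar> \<le> c * (1 / (1 + (real k)\<^sup>2))" for w :: "nat \<Rightarrow> real" and c
  proof -
    have "(\<Sum>k. \<bar>w k\<bar>) \<le> (\<Sum>k. c * (1 / (1 + (real k)\<^sup>2)))"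
      by (rule suminf_le[OF that summable_comparison_test'[OF summable_mult[OF sS]] summable_mult[OF sS]])
        (use that in auto)
    also have "\<dots> = c * S" unfolding S_def by (rule suminf_mult[OF sS])
    finally show ?thesis .
  qed
  have eb: "norm (eig_proj l *v f s) \<le> B * M" if "l < 4" "\<And>s. norm (f s) \<le> M" for l s M and f :: "real \<Rightarrow> real ^ 8"
    using order_trans[OF B(2)[OF that(1)] mult_left_mono[OF that(2)]] B(1) by simp
  have fm: "norm (fmult w (\<lambda>s. eig_proj l *v f s) t) \<le> 4 * (B * M) * (c * S)"
    if w: "summable (\<lambda>k. \<bar>w k\<bar>)" "\<And>k. \<bar>w k\<bar> \<le> c * (1 / (1 + (real k)\<^sup>2))" and "l < 4" "cper f" and f: "\<And>s. norm (f s) \<le> M"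
    for w c l f M t
  proof -
    have "M \<ge> 0" using f[of 0] norm_ge_zero order_trans by blast
    have "norm (fmult w (\<lambda>s. eig_proj l *v f s) t) \<le> 4 * (B * M) * (\<Sum>k. \<bar>w k\<bar>)"
      by (rule norm_fmult_le[OF w(1) cper_linear[OF mv_bounded_linear \<open>cper f\<close>] eb[OF \<open>l < 4\<close>, where f = f, OF f]])
    also have "\<dots> \<le> 4 * (B * M) * (c * S)"
      using B(1) \<open>M \<ge> 0\<close> by (intro mult_left_mono wsum w) auto
    finally show ?thesis .
  qed
  \<comment> \<open>Four eigenspaces, each with the factor \<open>4\<close> of
    \<open>norm_fmult_le\<close>; \<open>B\<close> bounds the projections and
    \<open>S / \<kappa>\<close> the sum of the weights.\<close>
  define C1 where "C1 = 16 * B * S / \<kappa>"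
  have C1: "C1 > 0" using B S0 assms by (simp add: C1_def)
  have bound: "norm (solop c1 c2 \<alpha> f t) \<le> C1 * M" if "elliptic c1 c2 \<kappa> \<alpha>" "cper f" "\<And>s. norm (f s) \<le> M" for \<alpha> f M t
  proof -
    have "norm (solop c1 c2 \<alpha> f t) \<le> (\<Sum>l<(4::nat). 4 * (B * M) * ((1 / \<kappa>) * S))"
      unfolding solop_def
      by (rule sum_norm_le, rule fm) (use that solweight_summable[OF that(1)] solweight_bound[OF that(1)] in auto)
    then show ?thesis by (simp add: C1_def mult_ac)
  qed
  \<comment> \<open>The equation solved by \<open>solop\<close> bounds its second derivative:
    \<open>R * C1\<close> for the linear part, \<open>1 + 4 * B\<close> for
    \<open>f - kerproj f\<close>. The factor \<open>2 * pi\<close> passes from there to the first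
    derivative.\<close>
  define C2 where "C2 = 2 * pi * (R * C1 + 1 + 4 * B)"
  have C2: "C2 > 0" using R C1 B by (simp add: C2_def add_pos_pos)
  have lip: "norm (solop c1 c2 \<alpha> f t - solop c1 c2 \<alpha> f s) \<le> C2 * M * \<bar>t - s\<bar>"
    if ef: "elliptic c1 c2 \<kappa> \<alpha>" "cper f" and M: "\<And>s. norm (f s) \<le> M" for \<alpha> f M s t
  proof -
    obtain w' where C: "C2per (solop c1 c2 \<alpha> f) w' (\<lambda>t. linrhs c1 c2 \<alpha> (solop c1 c2 \<alpha> f) t + (f t - kerproj f t))"
      by (rule solop_solves[OF ef])
    have "norm (linrhs c1 c2 \<alpha> (solop c1 c2 \<alpha> f) t + (f t - kerproj f t)) \<le> R * (C1 * M) + (M + B * (4 * M))" for t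
    proof (intro norm_triangle_le add_mono order_trans[OF norm_triangle_ineq4])
      show "norm (linrhs c1 c2 \<alpha> (solop c1 c2 \<alpha> f) t) \<le> R * (C1 * M)"
        by (rule R(2)[OF solop_cper[OF ef] bound[OF ef M]])
      show "norm (f t) \<le> M" by (rule M)
      show "norm (kerproj f t) \<le> B * (4 * M)" unfolding kerproj_def
        by (rule order_trans[OF B(2) mult_left_mono[OF norm_harmonic_le[OF ef(2) M]]]) (use B in auto)
    qed
    then have "norm (w' t) \<le> 2 * pi * (R * (C1 * M) + (M + B * (4 * M)))" for t
      by (rule C2per_deriv_bound[OF C])
    then have "norm (w' t) \<le> C2 * M" for t by (simp add: C2_def algebra_simps)
    then show ?thesis using C by (intro norm_diff_le_if_deriv_bounded[of _ w']) (auto simp: C2per_def)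
  qed
  define C3 where "C3 = 16 * B * S / \<kappa>\<^sup>2 + C1"
  have C3: "C3 > 0" using B S0 assms C1 by (simp add: C3_def add_pos_pos)
  have diff: "norm (solop c1 c2 \<alpha> f t - solop c1 c2 \<beta> g t) \<le> C3 * (M * \<bar>\<alpha>\<^sup>2 - \<beta>\<^sup>2\<bar> + D)"
    if \<alpha>: "elliptic c1 c2 \<kappa> \<alpha>" and \<beta>: "elliptic c1 c2 \<kappa> \<beta>" and f: "cper f" and g: "cper g"
      and M: "\<And>s. norm (f s) \<le> M" and D: "\<And>s. norm (f s - g s) \<le> D" for \<alpha> \<beta> f g M D t
  proof -
    have MD: "M \<ge> 0" "D \<ge> 0" using M[of 0] D[of 0] norm_ge_zero order_trans by blast+
    have pc: "cper (\<lambda>s. eig_proj l *v f s)" "cper (\<lambda>s. eig_proj l *v g s)" for l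
      by (rule cper_linear[OF mv_bounded_linear f] cper_linear[OF mv_bounded_linear g])+
    have "solop c1 c2 \<alpha> f t - solop c1 c2 \<beta> f t
      = (\<Sum>l<4. fmult (\<lambda>k. solweight c1 c2 \<alpha> l k - solweight c1 c2 \<beta> l k) (\<lambda>s. eig_proj l *v f s) t)"
      unfolding solop_def sum_subtractf[symmetric]
      by (rule sum.cong) (auto intro!: fmult_diff_weight solweight_summable[OF \<alpha>] solweight_summable[OF \<beta>] pc)
    also have "norm \<dots> \<le> (\<Sum>l<(4::nat). 4 * (B * M) * ((\<bar>\<alpha>\<^sup>2 - \<beta>\<^sup>2\<bar> / \<kappa>\<^sup>2) * S))"
    proof (rule sum_norm_le, rule fm)
      fix l :: nat and k assume "l \<in> {..<4}"
      then have l: "l < 4" by simp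
      show "\<bar>solweight c1 c2 \<alpha> l k - solweight c1 c2 \<beta> l k\<bar> \<le> (\<bar>\<alpha>\<^sup>2 - \<beta>\<^sup>2\<bar> / \<kappa>\<^sup>2) * (1 / (1 + (real k)\<^sup>2))" for k
        by (rule solweight_diff[OF \<alpha> \<beta> l])
      then show "summable (\<lambda>k. \<bar>solweight c1 c2 \<alpha> l k - solweight c1 c2 \<beta> l k\<bar>)"
        by (intro summable_comparison_test'[OF summable_mult[OF sS, of "\<bar>\<alpha>\<^sup>2 - \<beta>\<^sup>2\<bar> / \<kappa>\<^sup>2"]]) auto
    qed (use f M in auto)
    finally have 1: "norm (solop c1 c2 \<alpha> f t - solop c1 c2 \<beta> f t) \<le> 16 * B * S / \<kappa>\<^sup>2 * (M * \<bar>\<alpha>\<^sup>2 - \<beta>\<^sup>2\<bar>)"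
      by (simp add: mult_ac)
    have "solop c1 c2 \<beta> f t - solop c1 c2 \<beta> g t = solop c1 c2 \<beta> (\<lambda>s. f s - g s) t"
      unfolding solop_def sum_subtractf[symmetric] matrix_vector_mult_diff_distrib
      by (rule sum.cong) (auto intro!: fmult_diff solweight_summable[OF \<beta>] pc)
    then have 2: "norm (solop c1 c2 \<beta> f t - solop c1 c2 \<beta> g t) \<le> C1 * D"
      using bound[OF \<beta> cper_diff[OF f g] D] by simp
    have "norm (solop c1 c2 \<alpha> f t - solop c1 c2 \<beta> g t)
        \<le> 16 * B * S / \<kappa>\<^sup>2 * (M * \<bar>\<alpha>\<^sup>2 - \<beta>\<^sup>2\<bar>) + C1 * D"
      using norm_triangle_ineq[of "solop c1 c2 \<alpha> f t - solop c1 c2 \<beta> f t" "solop c1 c2 \<beta> f t - solop c1 c2 \<beta> g t"] 1 2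
      by simp
    also have "\<dots> \<le> C3 * (M * \<bar>\<alpha>\<^sup>2 - \<beta>\<^sup>2\<bar>) + C3 * D"
      using MD C1 B S0 by (intro add_mono mult_right_mono) (auto simp: C3_def)
    finally show ?thesis by (simp add: algebra_simps)
  qed
  show thesis
  proof (rule that[of "C1 + C2 + C3"])
    show "C1 + C2 + C3 > 0" using C1 C2 C3 by simp
    fix \<alpha> M t s and f :: "real \<Rightarrow> real ^ 8" assume a: "elliptic c1 c2 \<kappa> \<alpha>" "cper f" "\<And>s. norm (f s) \<le> M"
    have "M \<ge> 0" using a(3)[of 0] norm_ge_zero order_trans by blast
    then have "C1 * M \<le> (C1 + C2 + C3) * M" "C2 * M * \<bar>t - s\<bar> \<le> (C1 + C2 + C3) * M * \<bar>t - s\<bar>"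
      using C1 C2 C3 by (intro mult_right_mono; simp)+
    then show "norm (solop c1 c2 \<alpha> f t) \<le> (C1 + C2 + C3) * M"
      "norm (solop c1 c2 \<alpha> f t - solop c1 c2 \<alpha> f s) \<le> (C1 + C2 + C3) * M * \<bar>t - s\<bar>"
      using bound[OF a, of t] lip[OF a, of t s] by simp_all
  next
    fix \<alpha> \<beta> M D t and f g :: "real \<Rightarrow> real ^ 8" assume a: "elliptic c1 c2 \<kappa> \<alpha>" "elliptic c1 c2 \<kappa> \<beta>" "cper f" "cper g"
      "\<And>s. norm (f s) \<le> M" "\<And>s. norm (f s - g s) \<le> D"
    have MD: "M \<ge> 0" "D \<ge> 0" using a(5,6)[of 0] norm_ge_zero order_trans by blast+
    have "C3 * (M * \<bar>\<alpha>\<^sup>2 - \<beta>\<^sup>2\<bar> + D) \<le> (C1 + C2 + C3) * (M * \<bar>\<alpha>\<^sup>2 - \<beta>\<^sup>2\<bar> + D)"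
      using C1 C2 MD by (intro mult_right_mono) auto
    then show "norm (solop c1 c2 \<alpha> f t - solop c1 c2 \<beta> g t) \<le> (C1 + C2 + C3) * (M * \<bar>\<alpha>\<^sup>2 - \<beta>\<^sup>2\<bar> + D)"
      using diff[OF a, of t] by simp
  qed
qed

subsection \<open>The critical parameter\<close>

locale cube_params =
  fixes c1 c2 \<alpha>o :: real
  assumes c1_neg: "c1 < 0" and c2_pos: "0 < c2" and c2_less: "c2 < 1.25" and lt2: "- c1 + 2 * c2 < 2"
    and mode2: "- c1 + 6 * c2 - 4 > (- c1 + 2 * c2 - 1) ^ 4"
    and \<alpha>o: "\<alpha>o = sqrt (- 2 * ln (- c1 + 2 * c2 - 1))"
begin

definition s where "s = - c1 + 2 * c2 - 1"

text \<open>As a fourth power is nonnegative, \<open>mode2\<close> gives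
  \<open>6 c2 > 4 + c1\<close>. Hence \<open>3 s > 1 - 2 c1 > 1\<close>, while
  \<open>6 c2 < 6 + 3 c1\<close> from \<open>lt2\<close> gives \<open>c1 > -1\<close>.\<close>

lemma s_bounds: "1 / 3 < s" "s < 1" and c1_gt: "- 1 < c1"
proof -
  have "(- c1 + 2 * c2 - 1) ^ 4 \<ge> 0" by (rule zero_le_even_power) simp
  then have "- c1 + 6 * c2 - 4 > 0" using mode2 by linarith
  then show "1 / 3 < s" "s < 1" "- 1 < c1" using c1_neg lt2 by (auto simp: s_def)
qed

lemma \<alpha>o_pos: "\<alpha>o > 0" and exp_\<alpha>o: "exp (- \<alpha>o\<^sup>2 / 2) = s"
proof -
  have "ln s < 0" using s_bounds by (subst ln_less_zero_iff) auto
  then show "\<alpha>o > 0" "exp (- \<alpha>o\<^sup>2 / 2) = s"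
    using s_bounds unfolding \<alpha>o s_def[symmetric] by simp_all
qed

lemma exp_\<alpha>o_2: "exp (- (\<alpha>o * 2)\<^sup>2 / 2) = s ^ 4"
proof -
  have "exp (- (\<alpha>o * 2)\<^sup>2 / 2) = exp (real 4 * (- \<alpha>o\<^sup>2 / 2))" by (simp add: power2_eq_square)
  also have "\<dots> = s ^ 4" by (simp only: exp_of_nat_mult exp_\<alpha>o)
  finally show ?thesis .
qed

lemma symb_11: "symb c1 c2 1 1 \<alpha> = exp (- \<alpha>\<^sup>2 / 2) - s"
  by (simp add: symb_def s_def)

lemma symb_11_zero_iff: "\<alpha> > 0 \<Longrightarrow> symb c1 c2 1 1 \<alpha> = 0 \<longleftrightarrow> \<alpha> = \<alpha>o"
  unfolding symb_11 exp_\<alpha>o[symmetric] using \<alpha>o_pos by (auto simp: power2_eq_iff)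

text \<open>By \<open>1 + c1 + s = 2 c2\<close>, the values for \<open>k = 1\<close> are
  \<open>2 c2 (1 - l)\<close>, zero only at \<open>l = 1\<close>. For \<open>k = 0\<close> they are
  \<open>1 + c1 > 0\<close> at \<open>l = 0\<close> and at most \<open>- s\<close> otherwise. For
  \<open>k = 2\<close> they are positive up to \<open>l = 2\<close>, as
  \<open>4 c2 < 4 + 2 c1\<close>, and negative at \<open>l = 3\<close>, which is the hypothesis
  \<open>mode2\<close>.\<close>

lemma symb_\<alpha>o_nonzero:
  assumes "k < 3" "l < 4" "(k, l) \<noteq> (1, 1)" shows "symb c1 c2 k l \<alpha>o \<noteq> 0"
proof -
  define p where "p = s ^ 4"
  have p: "p > 0" "4 + c1 - 6 * c2 + p < 0" using s_bounds mode2 by (auto simp: p_def s_def)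
  have val: "symb c1 c2 0 l \<alpha>o = c1 - 2 * real l * c2 + 1" "symb c1 c2 1 l \<alpha>o = 1 + c1 - 2 * real l * c2 + s"
    "symb c1 c2 2 l \<alpha>o = 4 + c1 - 2 * real l * c2 + p"
    using exp_\<alpha>o exp_\<alpha>o_2 by (simp_all add: symb_def p_def)
  have "k = 0 \<or> k = 1 \<or> k = 2" "l = 0 \<or> l = 1 \<or> l = 2 \<or> l = 3" using assms by linarith+
  moreover have "1 + c1 + s = 2 * c2" by (simp add: s_def)
  ultimately show ?thesis
    using assms(3) val p s_bounds c1_gt c1_neg c2_pos c2_less by (elim disjE) auto
qed

text \<open>At the worst case \<open>k = 3\<close>, \<open>l = 3\<close> the bounds
  \<open>c1 > -1\<close> and \<open>c2 < 5/4\<close> leave \<open>9 - 1 - 15/2 = 1/2\<close>, and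
  \<open>1/20\<close> is this value divided by \<open>1 + 3^2\<close>.\<close>

lemma symb_large:
  assumes "k \<ge> 3" "l < 4" shows "symb c1 c2 k l \<alpha> \<ge> (1 / 20) * (1 + (real k)\<^sup>2)"
proof -
  have lin: "1 / 20 * (1 + K) \<le> K + c1 - L + E" if "9 \<le> K" "L \<le> 15 / 2" "0 < E" for K L E :: real
  proof -
    have "1 / 20 * (1 + K) = 1 / 20 + K / 20" by (simp add: field_simps)
    then show ?thesis using that c1_gt by linarith
  qed
  have "real l * c2 \<le> 3 * (5 / 4)" using assms c2_pos c2_less by (intro mult_mono) auto
  then have "2 * real l * c2 \<le> 15 / 2" by simp
  moreover have "(real k)\<^sup>2 \<ge> 9" using assms power_mono[of 3 "real k" 2] by simp
  ultimately show ?thesis unfolding symb_def by (intro lin) auto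
qed

text \<open>Frequencies from \<open>3\<close> on are controlled for every \<alpha> by
  \<open>symb_large\<close>. The remaining modes are finitely many, nonzero at
  \<open>\<alpha>o\<close>, and stay away from zero nearby by continuity.\<close>

lemma elliptic_near:
  obtains \<delta> \<kappa> where "0 < \<delta>" "\<delta> < \<alpha>o" "\<And>\<alpha>. \<bar>\<alpha> - \<alpha>o\<bar> \<le> \<delta> \<Longrightarrow> elliptic c1 c2 \<kappa> \<alpha>"
proof -
  define I :: "(nat \<times> nat) set" where "I = ({..<3} \<times> {..<4}) - {(1, 1 :: nat)}"
  have "(0, 0) \<in> I" by (simp add: I_def)
  then have I: "finite I" "I \<noteq> {}" by (simp add: I_def, blast)
  define \<beta> where "\<beta> = Min ((\<lambda>(k, l). \<bar>symb c1 c2 k l \<alpha>o\<bar>) ` I)"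
  have "0 < (\<lambda>(k, l). \<bar>symb c1 c2 k l \<alpha>o\<bar>) p" if "p \<in> I" for p
    using that symb_\<alpha>o_nonzero[of "fst p" "snd p"] by (cases p) (simp add: I_def)
  then have \<beta>: "\<beta> > 0" unfolding \<beta>_def using I by (subst Min_gr_iff) blast+
  have \<beta>le: "\<beta> \<le> \<bar>symb c1 c2 k l \<alpha>o\<bar>" if "(k, l) \<in> I" for k l
    unfolding \<beta>_def using I that by (intro Min_le) auto
  have "\<forall>\<^sub>F \<alpha> in nhds \<alpha>o. \<forall>p\<in>I. \<bar>symb c1 c2 (fst p) (snd p) \<alpha>\<bar> > \<beta> / 2"
  proof (rule eventually_ball_finite[OF I(1)], rule ballI)
    fix p assume "p \<in> I"
    let ?h = "\<lambda>\<alpha>. \<bar>symb c1 c2 (fst p) (snd p) \<alpha>\<bar>"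
    have h: "\<beta> / 2 < ?h \<alpha>o" using \<beta>le[of "fst p" "snd p"] \<open>p \<in> I\<close> \<beta> by simp
    have "isCont ?h \<alpha>o" unfolding symb_def by (intro continuous_intros) auto
    then have "?h \<midarrow>\<alpha>o\<rightarrow> ?h \<alpha>o" by (simp add: isCont_def)
    from order_tendstoD(1)[OF this h] have "\<forall>\<^sub>F \<alpha> in nhds \<alpha>o. \<alpha> \<noteq> \<alpha>o \<longrightarrow> \<beta> / 2 < ?h \<alpha>"
      by (simp add: eventually_at_filter)
    then show "\<forall>\<^sub>F \<alpha> in nhds \<alpha>o. \<beta> / 2 < ?h \<alpha>" by (rule eventually_mono) (use h in blast)
  qed
  then obtain e where e: "e > 0" "\<And>\<alpha> k l. dist \<alpha> \<alpha>o < e \<Longrightarrow> (k, l) \<in> I \<Longrightarrow> \<bar>symb c1 c2 k l \<alpha>\<bar> > \<beta> / 2"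
    unfolding eventually_nhds_metric by force
  \<comment> \<open>For \<open>k \<le> 2\<close> the factor \<open>1 + k^2\<close> is at most
    \<open>5\<close>, so \<open>\<beta> / 10\<close> leaves the available
    \<open>\<beta> / 2\<close>; \<open>1 / 20\<close> is the constant of
    \<open>symb_large\<close>.\<close>
  define \<kappa> where "\<kappa> = min (\<beta> / 10) (1 / 20)"
  define \<delta> where "\<delta> = min (e / 2) (\<alpha>o / 2)"
  have "elliptic c1 c2 \<kappa> \<alpha>" if "\<bar>\<alpha> - \<alpha>o\<bar> \<le> \<delta>" for \<alpha>
    unfolding elliptic_def
  proof (intro conjI allI impI)
    show "\<kappa> > 0" using \<beta> by (simp add: \<kappa>_def)
    fix k l :: nat assume kl: "l < 4 \<and> (k, l) \<noteq> (1, 1)"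
    show "\<kappa> * (1 + (real k)\<^sup>2) \<le> \<bar>symb c1 c2 k l \<alpha>\<bar>"
    proof (cases "k \<ge> 3")
      case True
      have "\<kappa> * (1 + (real k)\<^sup>2) \<le> (1 / 20) * (1 + (real k)\<^sup>2)" by (intro mult_right_mono) (auto simp: \<kappa>_def)
      then show ?thesis using symb_large[OF True, of l \<alpha>] kl by simp
    next
      case False
      then have "(k, l) \<in> I" using kl by (auto simp: I_def)
      then have "\<bar>symb c1 c2 k l \<alpha>\<bar> > \<beta> / 2" using that e by (auto simp: \<delta>_def dist_real_def)
      moreover have "\<kappa> * (1 + (real k)\<^sup>2) \<le> (\<beta> / 10) * (1 + 2\<^sup>2)"
        using False \<beta> by (intro mult_mono add_mono power_mono) (auto simp: \<kappa>_def)
      ultimately show ?thesis by simp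
    qed
  qed
  moreover have "0 < \<delta>" "\<delta> < \<alpha>o" using e \<alpha>o_pos by (auto simp: \<delta>_def)
  ultimately show thesis using that by blast
qed

end

subsection \<open>Solutions as elements of the Sobolev space\<close>

lemma C1_has_L2_deriv:
  fixes u :: "real \<Rightarrow> 'a::euclidean_space"
  assumes d: "\<And>t. (u has_vector_derivative v t) (at t)" and c: "continuous_on UNIV v"
  shows "has_L2_deriv u v"
  unfolding has_L2_deriv_def
proof (intro conjI allI impI)
  have cc: "continuous_on {a..b} v" for a b by (rule continuous_on_subset[OF c]) simp
  show "v \<in> borel_measurable borel" by (rule borel_measurable_continuous_onI[OF c])
  fix a b :: real
  show "set_integrable lborel {a..b} (\<lambda>t. (norm (v t))\<^sup>2)"
    by (intro borel_integrable_atLeastAtMost' continuous_intros cc)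
  assume "a \<le> b"
  then have "(v has_integral (u b - u a)) {a..b}"
    by (rule fundamental_theorem_of_calculus) (auto intro: has_vector_derivative_at_within d)
  then show "u b - u a = (LBINT t:{a..b}. v t)"
    using set_borel_integral_eq_integral(2)[OF borel_integrable_atLeastAtMost'[OF cc]] by (simp add: integral_unique)
qed

lemma has_vector_derivative_Pair:
  assumes "(x has_vector_derivative a) (at t within S)" "(y has_vector_derivative b) (at t within S)"
  shows "((\<lambda>t. (x t, y t)) has_vector_derivative (a, b)) (at t within S)"
  using has_derivative_Pair[OF assms[unfolded has_vector_derivative_def]] by (simp add: has_vector_derivative_def)

definition h1_of :: "(real \<Rightarrow> real ^ 8) \<Rightarrow> (real \<Rightarrow> real ^ 8) \<Rightarrow> W" where
  "h1_of x y = Abs_h1 (\<lambda>t. (x t, y t))"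

lemma C2per_has_L2_deriv:
  assumes "C2per x y z" shows "has_L2_deriv (\<lambda>t. (x t, y t)) (\<lambda>t. (y t, z t))"
  using assms by (intro C1_has_L2_deriv has_vector_derivative_Pair continuous_intros)
    (auto simp: C2per_def intro: cper_cont)

lemma h1_fun_h1_of:
  assumes "C2per x y z" shows "h1_fun (h1_of x y) = (\<lambda>t. (x t, y t))"
  unfolding h1_of_def
  by (rule Abs_h1_inverse) (use assms C2per_has_L2_deriv[OF assms] in \<open>auto simp: C2per_def cper_def\<close>)

text \<open>\<open>h1_deriv\<close> is an arbitrary choice of weak derivative. All choices agree
  almost everywhere, so the norm may be computed from any known one, in particular the classical
  derivative.\<close>

lemma norm_h1_eq:
  assumes v: "has_L2_deriv (h1_fun u) v"
  shows "(norm u)\<^sup>2 = (LBINT t:{0..2 * pi}. h1_fun u t \<bullet> h1_fun u t + v t \<bullet> v t)"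
proof -
  have [measurable]: "h1_deriv u \<in> borel_measurable borel" "v \<in> borel_measurable borel" "h1_fun u \<in> borel_measurable borel"
    using has_L2_deriv_h1[of u] v by (auto simp: has_L2_deriv_def
      intro!: borel_measurable_continuous_onI has_L2_deriv_continuous[OF has_L2_deriv_h1])
  have "u \<bullet> u = (LBINT t:{0..2 * pi}. h1_fun u t \<bullet> h1_fun u t + v t \<bullet> v t)"
    unfolding inner_h1_def set_lebesgue_integral_def
    by (rule integral_cong_AE) (use h1_deriv_AE[OF v] in auto)
  then show ?thesis by (simp add: power2_norm_eq_inner)
qed

lemma norm_h1_le:
  fixes u :: "'a::euclidean_space h1"
  assumes v: "has_L2_deriv (h1_fun u) v" and A: "\<And>t. norm (h1_fun u t) \<le> A" "\<And>t. norm (v t) \<le> A"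
  shows "norm u \<le> 4 * A"
proof -
  have A0: "A \<ge> 0" using A(1)[of 0] norm_ge_zero order_trans by blast
  have sq: "w \<bullet> w \<le> A\<^sup>2" if "norm w \<le> A" for w :: 'a
    using that power_mono[of "norm w" A 2] by (simp add: power2_norm_eq_inner)
  have "(LBINT t:{0..2 * pi}. h1_fun u t \<bullet> h1_fun u t + v t \<bullet> v t) \<le> (LBINT t:{0..2 * pi}. 2 * A\<^sup>2)"
  proof (rule set_integral_mono)
    show "set_integrable lborel {0..2 * pi} (\<lambda>t. h1_fun u t \<bullet> h1_fun u t + v t \<bullet> v t)"
      by (rule has_L2_deriv_inner_integrable[OF v v])
    show "set_integrable lborel {0..2 * pi} (\<lambda>t. 2 * A\<^sup>2)"
      by (rule borel_integrable_atLeastAtMost') (rule continuous_on_const)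
    show "h1_fun u t \<bullet> h1_fun u t + v t \<bullet> v t \<le> 2 * A\<^sup>2" for t
      using add_mono[OF sq[OF A(1)[of t]] sq[OF A(2)[of t]]] by simp
  qed
  also have "\<dots> = 4 * pi * A\<^sup>2" by (simp add: set_lebesgue_integral_def)
  also have "\<dots> \<le> 16 * A\<^sup>2" using pi_less_4 by (intro mult_right_mono) auto
  finally have "(norm u)\<^sup>2 \<le> (4 * A)\<^sup>2" using norm_h1_eq[OF v] by (simp add: power_mult_distrib)
  then show ?thesis by (rule power2_le_imp_le) (use A0 in simp)
qed

text \<open>By homogeneity it is enough to treat \<open>norm u = 1\<close>, where some value of \<open>u\<close> has norm at most \<open>1\<close>.\<close>

theorem h1_sup_bound: "norm (h1_fun u t) \<le> (2 + 2 * pi) * norm (u :: 'a::euclidean_space h1)"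
proof (cases "u = 0")
  case True
  then show ?thesis by (simp add: zero_h1.rep_eq)
next
  case False
  define w where "w = (1 / norm u) *\<^sub>R u"
  have nw: "norm w = 1" using False by (simp add: w_def)
  have w: "h1_fun u t = norm u *\<^sub>R h1_fun w t" for t using False by (simp add: w_def scaleR_h1.rep_eq)
  define v where "v = h1_deriv w"
  have v: "has_L2_deriv (h1_fun w) v" unfolding v_def by (rule has_L2_deriv_h1)
  have sq: "norm z = sqrt (z \<bullet> z)" for z :: 'a by (rule norm_eq_sqrt_inner)
  have int: "set_integrable lborel {0..2 * pi} (\<lambda>t. h1_fun w t \<bullet> h1_fun w t + v t \<bullet> v t)"
    by (rule has_L2_deriv_inner_integrable[OF v v])
  have one: "(LBINT t:{0..2 * pi}. h1_fun w t \<bullet> h1_fun w t + v t \<bullet> v t) = 1"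
    using norm_h1_eq[OF v] nw by simp
  have ci: "set_integrable lborel {0..2 * pi} (\<lambda>t. 1 :: real)"
    by (rule borel_integrable_atLeastAtMost') (rule continuous_on_const)
  have ex: "\<exists>s\<in>{0..2 * pi}. norm (h1_fun w s) \<le> 1"
  proof (rule ccontr)
    assume "\<not> ?thesis"
    then have gt: "norm (h1_fun w s) > 1" if "s \<in> {0..2 * pi}" for s using that by force
    have "1 \<le> h1_fun w s \<bullet> h1_fun w s + v s \<bullet> v s" if "s \<in> {0..2 * pi}" for s
    proof -
      have "1 \<le> h1_fun w s \<bullet> h1_fun w s"
        using power_mono[of 1 "norm (h1_fun w s)" 2] gt[OF that] by (simp add: power2_norm_eq_inner)
      then show ?thesis using inner_ge_zero[of "v s"] by linarith
    qed
    then have "(LBINT t:{0..2 * pi}. 1) \<le> (LBINT t:{0..2 * pi}. h1_fun w t \<bullet> h1_fun w t + v t \<bullet> v t)"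
      by (intro set_integral_mono ci int)
    then show False using one pi_gt3 by (simp add: set_lebesgue_integral_def)
  qed
  then obtain s where s: "s \<in> {0..2 * pi}" "norm (h1_fun w s) \<le> 1" by blast
  \<comment> \<open>From \<open>|v| \<le> 1 + |v|^2\<close> the integral of \<open>|v|\<close> over
    a period is at most \<open>2 pi\<close> plus the squared norm, which is \<open>1\<close>.
    Together with a value of norm at most \<open>1\<close> this gives the constant
    \<open>2 + 2 pi\<close>.\<close>
  have L1: "(LBINT t:{a..b}. norm (v t)) \<le> 2 * pi + 1" if "0 \<le> a" "b \<le> 2 * pi" for a b
  proof -
    have "(LBINT t:{a..b}. norm (v t)) = (LBINT t. indicat_real {a..b} t *\<^sub>R norm (v t))"
      by (simp add: set_lebesgue_integral_def)
    also have "\<dots> \<le> (LBINT t. indicat_real {0..2 * pi} t *\<^sub>R (1 + (h1_fun w t \<bullet> h1_fun w t + v t \<bullet> v t)))"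
    proof (rule integral_mono)
      show "integrable lborel (\<lambda>t. indicat_real {a..b} t *\<^sub>R norm (v t))"
        using set_integrable_norm[OF has_L2_deriv_integrable[OF v, of a b]] by (simp add: set_integrable_def)
      show "integrable lborel (\<lambda>t. indicat_real {0..2 * pi} t *\<^sub>R (1 + (h1_fun w t \<bullet> h1_fun w t + v t \<bullet> v t)))"
        using set_integral_add(1)[OF ci int] by (simp add: set_integrable_def)
      fix t
      have "2 * norm (v t) \<le> (norm (v t))\<^sup>2 + 1"
        using zero_le_power2[of "norm (v t) - 1"] unfolding power2_diff by simp
      then have "norm (v t) \<le> 1 + (norm (v t))\<^sup>2" using norm_ge_zero[of "v t"] by linarith
      then have "norm (v t) \<le> 1 + (h1_fun w t \<bullet> h1_fun w t + v t \<bullet> v t)"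
        using inner_ge_zero[of "h1_fun w t"] unfolding power2_norm_eq_inner by linarith
      then show "indicat_real {a..b} t *\<^sub>R norm (v t)
          \<le> indicat_real {0..2 * pi} t *\<^sub>R (1 + (h1_fun w t \<bullet> h1_fun w t + v t \<bullet> v t))"
        using that by (auto simp: indicator_def)
    qed
    also have "\<dots> = (LBINT t:{0..2 * pi}. 1 + (h1_fun w t \<bullet> h1_fun w t + v t \<bullet> v t))"
      by (simp add: set_lebesgue_integral_def)
    also have "\<dots> = 2 * pi + 1"
    proof -
      have "(LBINT t:{0..2 * pi}. 1 :: real) = 2 * pi" by (simp add: set_lebesgue_integral_def)
      then show ?thesis by (simp only: set_integral_add(2)[OF ci int] one)
    qed
    finally show ?thesis .
  qed
  have diff: "norm (h1_fun w b - h1_fun w a) \<le> 2 * pi + 1" if "0 \<le> a" "a \<le> b" "b \<le> 2 * pi" for a b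
  proof -
    have "h1_fun w b - h1_fun w a = (LBINT t:{a..b}. v t)" using v that by (simp add: has_L2_deriv_def)
    also have "norm \<dots> \<le> (LBINT t:{a..b}. norm (v t))"
      by (rule set_integral_norm_bound[OF has_L2_deriv_integrable[OF v]])
    finally show ?thesis using L1[of a b] that by simp
  qed
  have bound: "norm (h1_fun w r) \<le> 2 + 2 * pi" if r: "r \<in> {0..2 * pi}" for r
  proof -
    have "norm (h1_fun w r - h1_fun w s) \<le> 2 * pi + 1"
      using diff[of r s] diff[of s r] r s(1) by (cases "r \<le> s") (auto simp: norm_minus_commute)
    then show ?thesis using s(2) norm_triangle_sub[of "h1_fun w r" "h1_fun w s"] by simp
  qed
  obtain n where n: "t + 2 * pi * of_int n \<in> {0..2 * pi}" by (rule reduce_mod_2pi)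
  have "cper (h1_fun w)"
    by (rule cperI[OF has_L2_deriv_continuous[OF v] h1_fun_periodic])
  then have "norm (h1_fun w t) \<le> 2 + 2 * pi" using bound[OF n] by (simp add: cper_int)
  then have "norm u * norm (h1_fun w t) \<le> norm u * (2 + 2 * pi)" by (rule mult_left_mono) simp
  then show ?thesis unfolding w by (simp add: mult.commute)
qed

text \<open>Convergence of the first derivatives is a consequence: \<open>C2per_deriv_bound\<close>,
  applied to the difference, controls them by the second derivatives. The constant
  \<open>K = 1 + 2 * pi\<close> collects both contributions.\<close>

lemma h1_of_tendsto:
  assumes X: "\<And>n. C2per (X n) (Y n) (Z n)" and x: "C2per x y z"
    and l: "uniform_limit UNIV X x sequentially" "uniform_limit UNIV Z z sequentially"
  shows "(\<lambda>n. h1_of (X n) (Y n)) \<longlonglongrightarrow> h1_of x y"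
proof (rule LIMSEQ_I)
  fix e :: real assume e: "e > 0"
  define K where "K = 1 + 2 * pi"
  have K: "K > 0" by (simp add: K_def add_pos_pos)
  define d where "d = e / (8 * K)"
  have d: "d > 0" using e K by (simp add: d_def)
  have "\<forall>\<^sub>F n in sequentially. (\<forall>t. dist (X n t) (x t) < d) \<and> (\<forall>t. dist (Z n t) (z t) < d)"
    using uniform_limitD[OF l(1) d] uniform_limitD[OF l(2) d] by (auto elim: eventually_elim2)
  then obtain N where N: "\<And>n t. n \<ge> N \<Longrightarrow> dist (X n t) (x t) < d" "\<And>n t. n \<ge> N \<Longrightarrow> dist (Z n t) (z t) < d"
    by (auto simp: eventually_sequentially)
  have "norm (h1_of (X n) (Y n) - h1_of x y) < e" if n: "n \<ge> N" for n
  proof -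
    have C: "C2per (\<lambda>t. X n t - x t) (\<lambda>t. Y n t - y t) (\<lambda>t. Z n t - z t)"
      using X[of n] x by (auto simp: C2per_def intro!: cper_diff has_vector_derivative_diff)
    have f: "h1_fun (h1_of (X n) (Y n) - h1_of x y) = (\<lambda>t. (X n t - x t, Y n t - y t))"
      by (simp add: minus_h1.rep_eq h1_fun_h1_of[OF X] h1_fun_h1_of[OF x])
    have a: "norm (X n t - x t) \<le> d" "norm (Z n t - z t) \<le> d" for t
      using N[OF n, of t] by (auto simp: dist_norm)
    have b: "norm (Y n t - y t) \<le> 2 * pi * d" for t by (rule C2per_deriv_bound[OF C a(2)])
    have "norm (h1_of (X n) (Y n) - h1_of x y) \<le> 4 * (d + 2 * pi * d)"
    proof (rule norm_h1_le)
      show "has_L2_deriv (h1_fun (h1_of (X n) (Y n) - h1_of x y)) (\<lambda>t. (Y n t - y t, Z n t - z t))"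
        unfolding f by (rule C2per_has_L2_deriv[OF C])
      fix t
      show "norm (h1_fun (h1_of (X n) (Y n) - h1_of x y) t) \<le> d + 2 * pi * d"
        unfolding f using norm_Pair_le[of "X n t - x t" "Y n t - y t"] a(1)[of t] b[of t] by linarith
      show "norm (Y n t - y t, Z n t - z t) \<le> d + 2 * pi * d"
        using norm_Pair_le[of "Y n t - y t" "Z n t - z t"] a(2)[of t] b[of t] by linarith
    qed
    also have "\<dots> = 4 * d * K" by (simp add: K_def algebra_simps)
    also have "\<dots> = e / 2" using K by (simp add: d_def)
    also have "\<dots> < e" using e by simp
    finally show ?thesis .
  qed
  then show "\<exists>N. \<forall>n\<ge>N. norm (h1_of (X n) (Y n) - h1_of x y) < e" by blast
qed

section \<open>Closedness and compactness of solution sets\<close>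

text \<open>The compact version on one period, extended to the line by reducing each argument modulo
  \<open>2 pi\<close>; periodicity makes the convergence uniform on the whole line.\<close>

lemma periodic_Arzela_Ascoli:
  fixes f :: "nat \<Rightarrow> real \<Rightarrow> 'a::euclidean_space"
  assumes c: "\<And>n. cper (f n)" and M: "\<And>n t. norm (f n t) \<le> M" and L: "\<And>n s t. norm (f n s - f n t) \<le> L * \<bar>s - t\<bar>"
  obtains k g where "strict_mono (k :: nat \<Rightarrow> nat)" "uniform_limit UNIV (\<lambda>n. f (k n)) g sequentially"
proof -
  have L0: "L \<ge> 0" using order_trans[OF norm_ge_zero L[of 0 1 0]] by simp
  obtain g k where k: "strict_mono (k :: nat \<Rightarrow> nat)"
    and g: "\<And>e. 0 < e \<Longrightarrow> \<exists>N. \<forall>n x. n \<ge> N \<and> x \<in> {0..2 * pi} \<longrightarrow> norm (f (k n) x - g x) < e"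
  proof (rule Arzela_Ascoli[of "{0..2 * pi}" f M])
    fix x e :: real assume "0 < e"
    have "norm (f n x - f n y) < e" if "norm (x - y) < e / (L + 1)" for n y
    proof -
      have "norm (f n x - f n y) \<le> L * \<bar>x - y\<bar>" by (rule L)
      also have "\<dots> \<le> (L + 1) * \<bar>x - y\<bar>" by (rule mult_right_mono) auto
      also have "\<dots> < e" using that L0 by (simp add: pos_less_divide_eq mult.commute)
      finally show ?thesis .
    qed
    then show "\<exists>d. 0 < d \<and> (\<forall>n y. y \<in> {0..2 * pi} \<and> norm (x - y) < d \<longrightarrow> norm (f n x - f n y) < e)"
      using \<open>0 < e\<close> L0 by (intro exI[of _ "e / (L + 1)"]) auto
  qed (use M in auto)
  define p where "p t = t + 2 * pi * of_int (SOME n. t + 2 * pi * of_int n \<in> {0..2 * pi})" for t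
  have p: "p t \<in> {0..2 * pi}" for t
    unfolding p_def by (rule someI_ex) (metis reduce_mod_2pi)
  have fp: "f n (p t) = f n t" for n t unfolding p_def by (rule cper_int[OF c])
  have "uniform_limit UNIV (\<lambda>n. f (k n)) (\<lambda>t. g (p t)) sequentially"
  proof (rule uniform_limitI)
    fix e :: real assume "e > 0"
    then obtain N where "\<forall>n x. n \<ge> N \<and> x \<in> {0..2 * pi} \<longrightarrow> norm (f (k n) x - g x) < e" using g by blast
    then have "\<forall>n\<ge>N. \<forall>t. dist (f (k n) t) (g (p t)) < e"
      using p fp by (metis dist_norm)
    then show "\<forall>\<^sub>F n in sequentially. \<forall>t\<in>UNIV. dist (f (k n) t) (g (p t)) < e"
      by (auto simp: eventually_sequentially)
  qed
  with k that show thesis by blast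
qed

text \<open>The Nemytskii (superposition) operator of \<open>q\<close>.\<close>

definition nem :: "(real \<Rightarrow> real) \<Rightarrow> (real \<Rightarrow> real ^ 8) \<Rightarrow> real \<Rightarrow> real ^ 8" where
  "nem q x t = (\<chi> i. q (x t $ i))"

lemma nem_cper:
  assumes "continuous_on UNIV q" "cper x" shows "cper (nem q x)"
  using assms(2) unfolding nem_def[abs_def]
  by (auto simp: cper_def intro!: continuous_on_vec_lambda continuous_on_compose2[OF assms(1)] continuous_intros)

lemma norm_vec8_le:
  assumes "\<And>i. \<bar>v $ i\<bar> \<le> b" shows "norm (v :: real ^ 8) \<le> 8 * b"
proof -
  have "norm v \<le> (\<Sum>i\<in>UNIV. \<bar>v $ i\<bar>)" by (rule norm_le_l1_cart)
  also have "\<dots> \<le> (\<Sum>i\<in>(UNIV :: 8 set). b)" by (intro sum_mono assms)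
  finally show ?thesis by simp
qed

definition solrhs :: "real \<Rightarrow> real \<Rightarrow> (real \<Rightarrow> real) \<Rightarrow> real \<Rightarrow> (real \<Rightarrow> real ^ 8) \<Rightarrow> real \<Rightarrow> real ^ 8" where
  "solrhs c1 c2 q \<alpha> x t = linrhs c1 c2 \<alpha> x t + nem q x t"

text \<open>This trades the first order system for the second order equation: the first component of
  the system says that \<open>y\<close> is the derivative of \<open>x\<close>, and elements of the
  Sobolev space that solve it are classical solutions.\<close>

lemma solutions_iff:
  assumes q: "continuous_on UNIV q"
  shows "(\<alpha>, u) \<in> solutions c1 c2 q \<longleftrightarrow> \<alpha> > 0 \<and> (\<exists>x y. u = h1_of x y \<and> C2per x y (solrhs c1 c2 q \<alpha> x))"
proof -
  have rhs: "system_rhs c1 c2 q \<alpha> w t = (snd (w t), solrhs c1 c2 q \<alpha> (\<lambda>t. fst (w t)) t)" if "\<alpha> > 0" for w t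
    using normal_conv_eq_gconv[OF that, of "\<lambda>t. fst (w t)" t]
    by (simp add: system_rhs_def solrhs_def linrhs_def nem_def)
  show ?thesis
  proof (intro iffI conjI)
    assume S: "(\<alpha>, u) \<in> solutions c1 c2 q"
    then show \<alpha>: "\<alpha> > 0" by (simp add: solutions_def)
    define x where "x t = fst (h1_fun u t)" for t
    define y where "y t = snd (h1_fun u t)" for t
    have d: "(h1_fun u has_vector_derivative (y t, solrhs c1 c2 q \<alpha> x t)) (at t)" for t
    proof -
      have "(h1_fun u has_vector_derivative system_rhs c1 c2 q \<alpha> (h1_fun u) t) (at t)"
        using S by (simp add: solutions_def is_solution_def)
      then show ?thesis unfolding rhs[OF \<alpha>] x_def[abs_def] y_def .
    qed
    have cu: "cper (h1_fun u)"
      by (rule cperI[OF has_L2_deriv_continuous[OF has_L2_deriv_h1] h1_fun_periodic])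
    have cx: "cper x" "cper y"
      unfolding x_def[abs_def] y_def[abs_def] by (intro cper_linear[OF _ cu] bounded_linear_fst bounded_linear_snd)+
    have "C2per x y (solrhs c1 c2 q \<alpha> x)"
      unfolding C2per_def
    proof (intro conjI allI cx)
      show "cper (solrhs c1 c2 q \<alpha> x)" unfolding solrhs_def[abs_def] by (intro cper_add linrhs_cper nem_cper q cx)
      show "(x has_vector_derivative y t) (at t)" "(y has_vector_derivative solrhs c1 c2 q \<alpha> x t) (at t)" for t
        using bounded_linear.has_vector_derivative[OF bounded_linear_fst d, of t]
          bounded_linear.has_vector_derivative[OF bounded_linear_snd d, of t]
        by (simp_all add: x_def[abs_def] y_def[abs_def])
    qed
    moreover have "u = h1_of x y"
      by (simp add: h1_of_def x_def y_def h1_fun_inverse)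
    ultimately show "\<exists>x y. u = h1_of x y \<and> C2per x y (solrhs c1 c2 q \<alpha> x)" by blast
  next
    assume "\<alpha> > 0 \<and> (\<exists>x y. u = h1_of x y \<and> C2per x y (solrhs c1 c2 q \<alpha> x))"
    then obtain x y where \<alpha>: "\<alpha> > 0" and u: "u = h1_of x y" and C: "C2per x y (solrhs c1 c2 q \<alpha> x)" by blast
    have f: "h1_fun u = (\<lambda>t. (x t, y t))" unfolding u by (rule h1_fun_h1_of[OF C])
    have "is_solution c1 c2 q \<alpha> (h1_fun u)"
      unfolding is_solution_def
    proof
      fix t
      show "(h1_fun u has_vector_derivative system_rhs c1 c2 q \<alpha> (h1_fun u) t) (at t)"
        unfolding rhs[OF \<alpha>] using C by (auto simp: f C2per_def intro!: has_vector_derivative_Pair)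
    qed
    with \<alpha> show "(\<alpha>, u) \<in> solutions c1 c2 q" by (simp add: solutions_def)
  qed
qed

lemma linrhs_diff: "cper x \<Longrightarrow> cper y \<Longrightarrow> linrhs c1 c2 \<alpha> x t - linrhs c1 c2 \<alpha> y t = linrhs c1 c2 \<alpha> (\<lambda>s. x s - y s) t"
  by (simp add: linrhs_def gconv_diff matrix_vector_mult_diff_distrib algebra_simps)

lemma nem_uniform_limit:
  assumes q: "continuous_on UNIV q" and x: "cper x" and l: "uniform_limit UNIV X x sequentially"
  shows "uniform_limit UNIV (\<lambda>n. nem q (X n)) (nem q x) sequentially"
proof (rule uniform_limitI)
  fix e :: real assume e: "e > 0"
  obtain M where M: "\<And>t. norm (x t) \<le> M" using cper_bounded[OF x] by blast
  have "uniformly_continuous_on {- (M + 1)..M + 1} q"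
    by (intro compact_uniformly_continuous continuous_on_subset[OF q]) auto
  then obtain d where d: "d > 0" "\<And>a b. a \<in> {- (M + 1)..M + 1} \<Longrightarrow> b \<in> {- (M + 1)..M + 1} \<Longrightarrow> dist a b < d \<Longrightarrow> dist (q a) (q b) < e / 16"
    unfolding uniformly_continuous_on_def using e by (metis zero_less_divide_iff zero_less_numeral)
  have "\<forall>\<^sub>F n in sequentially. \<forall>t\<in>UNIV. dist (X n t) (x t) < min d 1" by (rule uniform_limitD[OF l]) (use d in auto)
  then show "\<forall>\<^sub>F n in sequentially. \<forall>t\<in>UNIV. dist (nem q (X n) t) (nem q x t) < e"
  proof eventually_elim
    case (elim n)
    show ?case
    proof
      fix t
      have "\<bar>(nem q (X n) t - nem q x t) $ i\<bar> \<le> e / 16" for i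
      proof -
        have a: "\<bar>X n t $ i - x t $ i\<bar> < min d 1"
          using component_le_norm_cart[of "X n t - x t" i] elim[rule_format, of t] by (simp add: dist_norm)
        moreover have "\<bar>x t $ i\<bar> \<le> M" using component_le_norm_cart[of "x t" i] M[of t] by simp
        ultimately have "X n t $ i \<in> {- (M + 1)..M + 1}" "x t $ i \<in> {- (M + 1)..M + 1}"
          unfolding atLeastAtMost_iff by linarith+
        from d(2)[OF this] a show ?thesis by (simp add: nem_def dist_real_def)
      qed
      then have "norm (nem q (X n) t - nem q x t) \<le> 8 * (e / 16)" by (rule norm_vec8_le)
      then show "dist (nem q (X n) t) (nem q x t) < e" using e by (simp add: dist_norm)
    qed
  qed
qed

text \<open>The limit is taken in the Fourier coefficients, where the second derivative is
  multiplication by \<open>- k^2\<close>; derivatives of \<open>x\<close> need not be known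
  beforehand. The common Lipschitz constant controls the dependence of the convolution on the
  varying parameter.\<close>

theorem solution_limit:
  assumes q: "continuous_on UNIV q"
    and X: "\<And>n. C2per (X n) (Y n) (solrhs c1 c2 q (A n) (X n))"
    and l: "uniform_limit UNIV X x sequentially" and A: "A \<longlonglongrightarrow> \<alpha>"
    and L: "\<And>n s t. norm (X n s - X n t) \<le> L * \<bar>s - t\<bar>"
  obtains y where "C2per x y (solrhs c1 c2 q \<alpha> x)" "(\<lambda>n. h1_of (X n) (Y n)) \<longlonglongrightarrow> h1_of x y"
proof -
  have Xc: "cper (X n)" for n using X[of n] by (simp add: C2per_def)
  have x: "cper x" by (rule cper_uniform_limit[OF Xc l])
  have Lx: "norm (x s - x t) \<le> L * \<bar>s - t\<bar>" for s t
  proof (rule Lim_norm_ubound[OF trivial_limit_sequentially])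
    show "(\<lambda>n. X n s - X n t) \<longlonglongrightarrow> x s - x t"
      by (intro tendsto_diff tendsto_uniform_limitI[OF l]) auto
  qed (use L in auto)
  have L0: "L \<ge> 0" using order_trans[OF norm_ge_zero Lx[of 1 0]] by simp
  obtain R where R: "R > 0" "\<And>\<alpha> x M t. cper x \<Longrightarrow> (\<And>s. norm (x s) \<le> M) \<Longrightarrow> norm (linrhs c1 c2 \<alpha> x t) \<le> R * M"
    by (rule linrhs_bound[of c1 c2]) auto
  have "uniform_limit UNIV (\<lambda>n. linrhs c1 c2 (A n) (X n)) (linrhs c1 c2 \<alpha> x) sequentially"
  proof (rule uniform_limitI)
    fix e :: real assume e: "e > 0"
    define d where "d = e / (4 * R)"
    have d: "d > 0" using e R by (simp add: d_def)
    have "\<forall>\<^sub>F n in sequentially. \<forall>t\<in>UNIV. dist (X n t) (x t) < d" by (rule uniform_limitD[OF l d])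
    moreover have "\<forall>\<^sub>F n in sequentially. dist (A n) \<alpha> < e / (8 * (L + 1))"
      using A e L0 by (intro tendstoD) auto
    ultimately show "\<forall>\<^sub>F n in sequentially. \<forall>t\<in>UNIV. dist (linrhs c1 c2 (A n) (X n) t) (linrhs c1 c2 \<alpha> x t) < e"
    proof eventually_elim
      case (elim n)
      show ?case
      proof
        fix t
        have 1: "norm (linrhs c1 c2 (A n) (X n) t - linrhs c1 c2 (A n) x t) \<le> R * d"
          unfolding linrhs_diff[OF Xc x]
          by (rule R(2)) (use elim(1) in \<open>auto simp: dist_norm less_imp_le intro: cper_diff Xc x\<close>)
        have "norm (linrhs c1 c2 (A n) x t - linrhs c1 c2 \<alpha> x t) = norm (gconv (A n) x t - gconv \<alpha> x t)"
          by (simp add: linrhs_def)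
        also have "\<dots> \<le> 2 * L * \<bar>A n - \<alpha>\<bar>" by (rule gconv_lipschitz_parameter[OF x Lx])
        also have "\<dots> \<le> 2 * (L + 1) * (e / (8 * (L + 1)))"
          using elim(2) L0 by (intro mult_mono) (auto simp: dist_real_def)
        also have "\<dots> = e / 4" using L0 by (simp add: field_simps)
        finally have 2: "norm (linrhs c1 c2 (A n) x t - linrhs c1 c2 \<alpha> x t) \<le> e / 4" .
        have "R * d = e / 4" using R by (simp add: d_def)
        then show "dist (linrhs c1 c2 (A n) (X n) t) (linrhs c1 c2 \<alpha> x t) < e"
          using norm_triangle_ineq[of "linrhs c1 c2 (A n) (X n) t - linrhs c1 c2 (A n) x t" "linrhs c1 c2 (A n) x t - linrhs c1 c2 \<alpha> x t"] 1 2 e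
          by (simp add: dist_norm)
      qed
    qed
  qed
  then have lr: "uniform_limit UNIV (\<lambda>n. solrhs c1 c2 q (A n) (X n)) (solrhs c1 c2 q \<alpha> x) sequentially"
    unfolding solrhs_def[abs_def] by (rule uniform_limit_add[OF _ nem_uniform_limit[OF q x l]])
  have rc: "cper (solrhs c1 c2 q (A n) (X n))" for n using X[of n] by (simp add: C2per_def)
  have h: "harmonic k (solrhs c1 c2 q \<alpha> x) t = - ((real k)\<^sup>2 *\<^sub>R harmonic k x t)" for k t
  proof (rule LIMSEQ_unique[OF harmonic_uniform_limit[OF rc lr]])
    show "(\<lambda>n. harmonic k (solrhs c1 c2 q (A n) (X n)) t) \<longlonglongrightarrow> - ((real k)\<^sup>2 *\<^sub>R harmonic k x t)"
      unfolding harmonic_second_deriv[OF X] by (intro tendsto_intros harmonic_uniform_limit[OF Xc l])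
  qed
  obtain y where y: "C2per x y (solrhs c1 c2 q \<alpha> x)"
    by (rule C2per_from_harmonics[OF x cper_uniform_limit[OF rc lr] h])
  show thesis by (rule that[OF y h1_of_tendsto[OF X y l lr]])
qed

lemma solution_bounds:
  assumes q: "continuous_on UNIV q"
  obtains L where "\<And>\<alpha> x y t s. C2per x y (solrhs c1 c2 q \<alpha> x) \<Longrightarrow> (\<And>t. norm (x t) \<le> M) \<Longrightarrow> norm (x s - x t) \<le> L * \<bar>s - t\<bar>"
proof -
  obtain R where R: "R > 0" "\<And>\<alpha> x M t. cper x \<Longrightarrow> (\<And>s. norm (x s) \<le> M) \<Longrightarrow> norm (linrhs c1 c2 \<alpha> x t) \<le> R * M"
    by (rule linrhs_bound[of c1 c2]) auto
  have "compact (q ` {- M..M})" by (intro compact_continuous_image continuous_on_subset[OF q]) auto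
  then obtain b where b: "\<And>r. r \<in> {- M..M} \<Longrightarrow> \<bar>q r\<bar> \<le> b"
    using compact_imp_bounded bounded_iff by (metis imageI real_norm_def)
  show thesis
  proof
    fix \<alpha> x y t s assume C: "C2per x y (solrhs c1 c2 q \<alpha> x)" and M: "\<And>t. norm (x t) \<le> M"
    have "norm (solrhs c1 c2 q \<alpha> x t) \<le> R * M + 8 * b" for t
      unfolding solrhs_def
    proof (intro norm_triangle_le add_mono norm_vec8_le)
      show "norm (linrhs c1 c2 \<alpha> x t) \<le> R * M" by (rule R(2)[OF _ M]) (use C in \<open>simp add: C2per_def\<close>)
      show "\<bar>nem q x t $ i\<bar> \<le> b" for i
        using b[of "x t $ i"] component_le_norm_cart[of "x t" i] M[of t] by (simp add: nem_def abs_le_iff)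
    qed
    from C2per_deriv_bound[OF C this] have "norm (y t) \<le> 2 * pi * (R * M + 8 * b)" for t .
    then show "norm (x s - x t) \<le> 2 * pi * (R * M + 8 * b) * \<bar>s - t\<bar>"
      using C by (intro norm_diff_le_if_deriv_bounded[of x y]) (auto simp: C2per_def)
  qed
qed

text \<open>The Sobolev bound gives a sup bound, the equation improves it to a common Lipschitz
  bound, and Arzela-Ascoli with \<open>solution_limit\<close> yields convergence in the Sobolev
  norm. A positive \<open>a\<close> keeps the limiting parameter in the range where solutions are
  defined.\<close>

theorem compact_solutions:
  assumes q: "continuous_on UNIV q" and a: "0 < a"
  shows "compact {(\<alpha>, u) \<in> solutions c1 c2 q. \<alpha> \<in> {a..b} \<and> norm u \<le> r}"
  unfolding compact_eq_seq_compact_metric seq_compact_def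
proof (intro allI impI)
  fix p :: "nat \<Rightarrow> real \<times> W" assume p: "\<forall>n. p n \<in> {(\<alpha>, u) \<in> solutions c1 c2 q. \<alpha> \<in> {a..b} \<and> norm u \<le> r}"
  have "\<exists>x y. snd (p n) = h1_of x y \<and> C2per x y (solrhs c1 c2 q (fst (p n)) x)" for n
    using p[rule_format, of n] solutions_iff[OF q, of "fst (p n)" "snd (p n)" c1 c2] by (auto simp: split_beta)
  then obtain X Y where XY: "\<And>n. snd (p n) = h1_of (X n) (Y n)" "\<And>n. C2per (X n) (Y n) (solrhs c1 c2 q (fst (p n)) (X n))"
    by metis
  have "compact {a..b}" by simp
  then obtain \<alpha> k1 where k1: "\<alpha> \<in> {a..b}" "strict_mono k1" "((\<lambda>n. fst (p n)) \<circ> k1) \<longlonglongrightarrow> \<alpha>"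
    using p by (auto simp: split_beta intro: seq_compactE[OF compact_imp_seq_compact, of "{a..b}" "\<lambda>n. fst (p n)"])
  have M: "norm (X n t) \<le> (2 + 2 * pi) * r" for n t
  proof -
    have "norm (X n t) \<le> norm (h1_fun (snd (p n)) t)"
      unfolding XY(1) h1_fun_h1_of[OF XY(2)] by (rule norm_fst_le)
    also have "\<dots> \<le> (2 + 2 * pi) * norm (snd (p n))" by (rule h1_sup_bound)
    also have "\<dots> \<le> (2 + 2 * pi) * r" using p[rule_format, of n] by (intro mult_left_mono) (auto simp: split_beta)
    finally show ?thesis .
  qed
  obtain L where L: "\<And>\<alpha> x y t s. C2per x y (solrhs c1 c2 q \<alpha> x) \<Longrightarrow> (\<And>t. norm (x t) \<le> (2 + 2 * pi) * r) \<Longrightarrow> norm (x s - x t) \<le> L * \<bar>s - t\<bar>"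
    by (rule solution_bounds[OF q, of c1 c2 "(2 + 2 * pi) * r"]) blast
  obtain k2 x where k2: "strict_mono k2" "uniform_limit UNIV (\<lambda>n. X (k1 (k2 n))) x sequentially"
    by (rule periodic_Arzela_Ascoli[of "\<lambda>n. X (k1 n)" "(2 + 2 * pi) * r" L])
      (use M L[OF XY(2) M] XY(2) in \<open>auto simp: C2per_def\<close>)
  have A: "(\<lambda>n. fst (p (k1 (k2 n)))) \<longlonglongrightarrow> \<alpha>"
    using LIMSEQ_subseq_LIMSEQ[OF k1(3) k2(1)] by (simp add: o_def)
  obtain y where y: "C2per x y (solrhs c1 c2 q \<alpha> x)" "(\<lambda>n. h1_of (X (k1 (k2 n))) (Y (k1 (k2 n)))) \<longlonglongrightarrow> h1_of x y"
    by (rule solution_limit[OF q XY(2) k2(2) A L[OF XY(2) M]])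
  have S: "(\<alpha>, h1_of x y) \<in> solutions c1 c2 q"
    unfolding solutions_iff[OF q] using y(1) k1(1) a by auto
  have "norm (h1_of x y) \<le> r"
    by (rule Lim_norm_ubound[OF trivial_limit_sequentially y(2)])
      (use p in \<open>auto simp: XY(1)[symmetric] split_beta intro!: always_eventually\<close>)
  moreover have "(\<lambda>n. (fst (p (k1 (k2 n))), snd (p (k1 (k2 n))))) \<longlonglongrightarrow> (\<alpha>, h1_of x y)"
    unfolding XY(1) by (intro tendsto_Pair A y)
  ultimately show "\<exists>l\<in>{(\<alpha>, u) \<in> solutions c1 c2 q. \<alpha> \<in> {a..b} \<and> norm u \<le> r}. \<exists>k. strict_mono k \<and> (p \<circ> k) \<longlonglongrightarrow> l"
    using S k1(1) strict_mono_o[OF k1(2) k2(1)] by (intro bexI[of _ "(\<alpha>, h1_of x y)"] exI[of _ "k1 \<circ> k2"]) (auto simp: o_def)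
qed

lemma gconv_harmonic: "gconv \<alpha> (harmonic k f) t = exp (- (\<alpha> * real k)\<^sup>2 / 2) *\<^sub>R harmonic k f t"
proof -
  have "gconv \<alpha> (harmonic k f) = (\<lambda>t. exp (- (\<alpha> * real k)\<^sup>2 / 2) *\<^sub>R harmonic k f t)"
  proof (rule harmonic_eqI[OF gconv_cper[OF harmonic_cper] cper_scaleR[OF harmonic_cper]])
    show "harmonic j (gconv \<alpha> (harmonic k f)) t = harmonic j (\<lambda>t. exp (- (\<alpha> * real k)\<^sup>2 / 2) *\<^sub>R harmonic k f t) t" for j t
      by (cases "j = k") (simp_all add: harmonic_gconv harmonic_cper harmonic_scaleR harmonic_harmonic_neq)
  qed
  then show ?thesis by (rule fun_cong)
qed

subsection \<open>Critical parameters\<close>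

lemma coupling_first_coordinate:
  "cube_coupling *v (\<chi> i. complex_of_real (cube_vertex i $ 1)) = (- 2) *\<^sub>R (\<chi> i. complex_of_real (cube_vertex i $ 1))"
proof -
  have "(cube_coupling :: complex ^ 8 ^ 8) $ i $ k = complex_of_real (cube_coupling $ i $ k)" for i k
    by (simp add: cube_coupling_def)
  moreover have "(\<Sum>k\<in>UNIV. cube_coupling $ i $ k * cube_vertex k $ 1) = - 2 * cube_vertex i $ 1" for i
    using coupling_neighbours[rule_format, of i "\<lambda>a b c. a"] by simp
  ultimately show ?thesis
    by (simp add: vec_eq_iff matrix_vector_mult_def scaleR_conv_of_real flip: of_real_mult of_real_sum, simp)
qed

lemma smult_bounded_linear: "bounded_linear (\<lambda>z :: complex. z *s (v :: complex ^ 8))"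
  by (rule linear_conv_bounded_linear[THEN iffD1])
    (auto intro!: linearI simp: vec_eq_iff algebra_simps)

lemma exp_imaginary: "exp (\<i> * of_nat k * complex_of_real t) = cos (real k * t) *\<^sub>R 1 + sin (real k * t) *\<^sub>R \<i>"
  using cis_conv_exp[of "real k * t"] by (simp add: complex_eq_iff mult.assoc cis.ctr)

lemma exp_imaginary_deriv:
  "((\<lambda>t. exp (\<i> * of_nat k * complex_of_real t)) has_vector_derivative \<i> * of_nat k * exp (\<i> * of_nat k * complex_of_real t)) (at t)"
  unfolding exp_imaginary by (auto intro!: derivative_eq_intros simp: complex_eq_iff)

text \<open>The null solution is \<open>exp (i x) f\<close> with \<open>f\<close> the first
  coordinate of the vertices, an eigenvector of the coupling matrix for \<open>-2\<close>; its
  second component carries the factor \<open>i\<close> of the derivative.\<close>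

lemma criticalI:
  assumes "\<alpha> > 0" "symb c1 c2 1 1 \<alpha> = 0" shows "critical c1 c2 \<alpha>"
proof -
  let ?E = "\<lambda>t. exp (\<i> * of_nat 1 * complex_of_real t)"
  define f :: "complex ^ 8" where "f = (\<chi> i. complex_of_real (cube_vertex i $ 1))"
  define v where "v = (f, \<i> *s f)"
  have "f $ 1 \<noteq> 0" by (simp add: f_def cube_vertex_simps)
  then have "v \<noteq> 0" by (auto simp: v_def zero_prod_def vec_eq_iff)
  have E: "?E = harmonic 1 ?E"
    unfolding exp_imaginary using harmonic_1_cos_sin[of "1 :: complex" \<i>] by (simp add: fun_eq_iff del: One_nat_def)
  have g: "gconv \<alpha> ?E t = exp (- \<alpha>\<^sup>2 / 2) *\<^sub>R ?E t" for t
  proof -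
    have "gconv \<alpha> (harmonic 1 ?E) t = exp (- \<alpha>\<^sup>2 / 2) *\<^sub>R harmonic 1 ?E t"
      by (simp add: gconv_harmonic del: One_nat_def)
    then show ?thesis by (simp only: E[symmetric])
  qed
  have cE: "cper ?E" by (subst E) (rule harmonic_cper)
  have "is_solution c1 c2 (\<lambda>_. 0) \<alpha> (\<lambda>x. (?E x *s fst v, ?E x *s snd v))"
    unfolding is_solution_def
  proof
    fix x
    have d: "((\<lambda>x. ?E x *s w) has_vector_derivative (\<i> * ?E x) *s w) (at x)" for w :: "complex ^ 8"
      using bounded_linear.has_vector_derivative[OF smult_bounded_linear exp_imaginary_deriv[of 1 x]] by simp
    have "system_rhs c1 c2 (\<lambda>_. 0) \<alpha> (\<lambda>x. (?E x *s fst v, ?E x *s snd v)) x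
       = (?E x *s (\<i> *s f), c1 *\<^sub>R (?E x *s f) + c2 *\<^sub>R (cube_coupling *v (?E x *s f)) + gconv \<alpha> (\<lambda>t. ?E t *s f) x)"
      unfolding system_rhs_def fst_conv snd_conv normal_conv_eq_gconv[OF assms(1), of "\<lambda>t. ?E t *s fst v"]
      by (simp add: v_def vec_eq_iff)
    also have "\<dots> = (?E x *s (\<i> *s f), (c1 + c2 * (- 2) + exp (- \<alpha>\<^sup>2 / 2)) *\<^sub>R (?E x *s f))"
      unfolding gconv_linear[OF smult_bounded_linear cE] g vector_scalar_commute coupling_first_coordinate f_def
      by (simp add: vec_eq_iff scaleR_conv_of_real[where 'a = complex] algebra_simps)
    also have "c1 + c2 * (- 2) + exp (- \<alpha>\<^sup>2 / 2) = - 1" using assms(2) by (simp add: symb_def)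
    finally have "system_rhs c1 c2 (\<lambda>_. 0) \<alpha> (\<lambda>x. (?E x *s fst v, ?E x *s snd v)) x
       = ((\<i> * ?E x) *s fst v, (\<i> * ?E x) *s snd v)"
      by (simp add: v_def vec_eq_iff algebra_simps)
    then show "((\<lambda>x. (?E x *s fst v, ?E x *s snd v)) has_vector_derivative
        system_rhs c1 c2 (\<lambda>_. 0) \<alpha> (\<lambda>x. (?E x *s fst v, ?E x *s snd v)) x) (at x)"
      by (simp only: has_vector_derivative_Pair d)
  qed
  then show ?thesis unfolding critical_def using \<open>v \<noteq> 0\<close> by (intro exI[of _ 1] exI[of _ v] conjI) simp_all
qed

text \<open>The real part of a complex null solution solves the real linear equation. If no symbol
  vanishes, all its harmonics are zero, and with it the real part itself.\<close>

lemma not_criticalI: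
  assumes "\<alpha> > 0" "elliptic c1 c2 \<kappa> \<alpha>" "symb c1 c2 1 1 \<alpha> \<noteq> 0" shows "\<not> critical c1 c2 \<alpha>"
proof
  assume "critical c1 c2 \<alpha>"
  then obtain k :: nat and v where k: "1 \<le> k" and v: "v \<noteq> 0"
    and sol: "is_solution c1 c2 (\<lambda>_. 0) \<alpha> (\<lambda>x. (exp (\<i> * of_nat k * of_real x) *s fst v, exp (\<i> * of_nat k * of_real x) *s snd v))"
    unfolding critical_def by blast
  let ?E = "\<lambda>t. exp (\<i> * of_nat k * complex_of_real t)"
  define R :: "complex ^ 8 \<Rightarrow> real ^ 8" where "R z = (\<chi> i. Re (z $ i))" for z
  have R: "bounded_linear R"
    by (rule linear_conv_bounded_linear[THEN iffD1]) (auto intro!: linearI simp: R_def vec_eq_iff)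
  define z where "z t = ?E t *s fst v" for t
  define z' where "z' t = ?E t *s snd v" for t
  have cE: "cper ?E"
    unfolding exp_imaginary by (rule cperI) (auto intro!: continuous_intros simp: cos_sin_nat_periodic)
  have cz: "cper z" "cper z'"
    unfolding z_def[abs_def] z'_def[abs_def] by (rule cper_linear[OF smult_bounded_linear cE])+
  have d: "((\<lambda>t. (z t, z' t)) has_vector_derivative (z' t, c1 *\<^sub>R z t + c2 *\<^sub>R (cube_coupling *v z t) + gconv \<alpha> z t)) (at t)" for t
  proof -
    have "system_rhs c1 c2 (\<lambda>_. 0) \<alpha> (\<lambda>t. (z t, z' t)) t = (z' t, c1 *\<^sub>R z t + c2 *\<^sub>R (cube_coupling *v z t) + gconv \<alpha> z t)"
      unfolding system_rhs_def fst_conv snd_conv normal_conv_eq_gconv[OF assms(1), of z]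
      by (simp add: vec_eq_iff)
    moreover have "((\<lambda>t. (z t, z' t)) has_vector_derivative system_rhs c1 c2 (\<lambda>_. 0) \<alpha> (\<lambda>t. (z t, z' t)) t) (at t)"
      using sol unfolding is_solution_def z_def z'_def by (rule spec)
    ultimately show ?thesis by (simp only:)
  qed
  have d1: "(z has_vector_derivative z' t) (at t)"
    and d2: "(z' has_vector_derivative c1 *\<^sub>R z t + c2 *\<^sub>R (cube_coupling *v z t) + gconv \<alpha> z t) (at t)" for t
    using bounded_linear.has_vector_derivative[OF bounded_linear_fst d, of t]
      bounded_linear.has_vector_derivative[OF bounded_linear_snd d, of t] by simp_all
  define x where "x t = R (z t)" for t
  have RB: "R (cube_coupling *v w) = cube_coupling *v R w" for w
    by (simp add: R_def vec_eq_iff matrix_vector_mult_def cube_coupling_def if_distrib[of Re] if_distrib[of "\<lambda>c. c * _"] cong: if_cong)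
  have cx: "cper x" unfolding x_def[abs_def] by (rule cper_linear[OF R cz(1)])
  have "C2per x (\<lambda>t. R (z' t)) (\<lambda>t. linrhs c1 c2 \<alpha> x t + 0)"
    unfolding C2per_def
  proof (intro conjI allI cx cper_linear[OF R cz(2)])
    show "cper (\<lambda>t. linrhs c1 c2 \<alpha> x t + 0)" using linrhs_cper[OF cx] by simp
    fix t
    show "(x has_vector_derivative R (z' t)) (at t)"
      unfolding x_def[abs_def] by (rule bounded_linear.has_vector_derivative[OF R d1])
    have "R (c1 *\<^sub>R z t + c2 *\<^sub>R (cube_coupling *v z t) + gconv \<alpha> z t) = linrhs c1 c2 \<alpha> x t"
      using gconv_linear[OF R cz(1), of \<alpha> t] R
      by (simp add: linrhs_def x_def[abs_def] bounded_linear.linear linear_add linear_cmul RB)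
    then show "((\<lambda>t. R (z' t)) has_vector_derivative linrhs c1 c2 \<alpha> x t + 0) (at t)"
      using bounded_linear.has_vector_derivative[OF R d2, of t] by simp
  qed
  from solution_harmonics[OF this cper_const]
  have "symb c1 c2 j l \<alpha> *\<^sub>R (eig_proj l *v harmonic j x t) = 0" if "l < 4" for j l t
    using that by (simp add: harmonic_def fcos_def fsin_def)
  moreover have "symb c1 c2 j l \<alpha> \<noteq> 0" if "l < 4" for j l
    using elliptic_symb_nonzero[OF assms(2) that] assms(3) by (cases "(j, l) = (1, 1)") auto
  ultimately have x0: "x t = 0" for t
    by (intro eq_zero_if_eig_harmonics_zero[OF cx]) auto
  have "fst v $ i = 0" for i
  proof -
    have "Re (fst v $ i) = 0" using x0[of 0] by (simp add: x_def z_def R_def vec_eq_iff)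
    \<comment> \<open>A quarter period later the exponential equals \<open>i\<close>, so the real
      part of the solution there shows the imaginary part of \<open>v\<close>.\<close>
    moreover have "?E (pi / (2 * real k)) = \<i>" unfolding exp_imaginary using k by simp
    then have "Im (fst v $ i) = 0" using x0[of "pi / (2 * real k)"] by (simp add: x_def z_def R_def vec_eq_iff)
    ultimately show ?thesis by (simp add: complex_eq_iff)
  qed
  then have f0: "fst v = 0" by (simp add: vec_eq_iff)
  then have "z = (\<lambda>_. 0)" by (simp add: z_def fun_eq_iff)
  then have "z' 0 = 0" using vector_derivative_unique_at[OF d1[of 0]] has_vector_derivative_const by metis
  then have "snd v = 0" by (simp add: z'_def)
  with f0 v show False by (simp add: prod_eq_iff)
qed

subsection \<open>Small solutions\<close>

locale cube_system = cube_params +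
  fixes q :: "real \<Rightarrow> real"
  assumes q_cont: "continuous_on UNIV q" and q_0: "q 0 = 0" and q_deriv: "(q has_real_derivative 0) (at 0)"
begin

lemma q_small:
  assumes "\<eta> > 0" obtains d where "d > 0" "\<And>r. \<bar>r\<bar> \<le> d \<Longrightarrow> \<bar>q r\<bar> \<le> \<eta> * \<bar>r\<bar>"
proof -
  have "(\<lambda>h. q h / h) \<midarrow>0\<rightarrow> 0" using q_deriv q_0 by (simp add: DERIV_def)
  from LIM_D[OF this assms] obtain e where e: "e > 0" "\<And>h. h \<noteq> 0 \<Longrightarrow> \<bar>h\<bar> < e \<Longrightarrow> \<bar>q h / h\<bar> < \<eta>" by auto
  show thesis
  proof
    show "e / 2 > 0" using e by simp
    fix r :: real assume r: "\<bar>r\<bar> \<le> e / 2"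
    show "\<bar>q r\<bar> \<le> \<eta> * \<bar>r\<bar>"
      using e(2)[of r] r e(1) q_0 by (cases "r = 0") (auto simp: abs_divide pos_divide_less_eq)
  qed
qed

lemma nem_small:
  assumes "\<eta> > 0" obtains d where "d > 0" "\<And>x t. norm (x t) \<le> d \<Longrightarrow> norm (nem q x t) \<le> \<eta> * norm (x t)"
proof -
  obtain d where d: "d > 0" "\<And>r. \<bar>r\<bar> \<le> d \<Longrightarrow> \<bar>q r\<bar> \<le> \<eta> / 8 * \<bar>r\<bar>"
    by (rule q_small[of "\<eta> / 8"]) (use assms in auto)
  show thesis
  proof (rule that[OF d(1)])
    fix x :: "real \<Rightarrow> real ^ 8" and t assume x: "norm (x t) \<le> d"
    have "\<bar>nem q x t $ i\<bar> \<le> \<eta> / 8 * norm (x t)" for i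
    proof -
      have i: "\<bar>x t $ i\<bar> \<le> norm (x t)" by (rule component_le_norm_cart)
      then have "\<bar>q (x t $ i)\<bar> \<le> \<eta> / 8 * \<bar>x t $ i\<bar>" using d(2) x by simp
      also have "\<dots> \<le> \<eta> / 8 * norm (x t)" using i assms by (intro mult_left_mono) auto
      finally show ?thesis by (simp add: nem_def)
    qed
    from norm_vec8_le[OF this] show "norm (nem q x t) \<le> \<eta> * norm (x t)" by simp
  qed
qed

lemma linrhs_scaleR: "cper x \<Longrightarrow> linrhs c1 c2 \<alpha> (\<lambda>t. c *\<^sub>R x t) t = c *\<^sub>R linrhs c1 c2 \<alpha> x t"
  using gconv_linear[OF bounded_linear_scaleR_right, of x \<alpha> c t]
  by (simp add: linrhs_def matrix_vector_mult_scaleR algebra_simps)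

text \<open>Dividing by the sup norm leaves a nonlinear term that tends to \<open>0\<close>
  uniformly, because \<open>q\<close> is of smaller order than its argument. The normalized
  solutions are equi-Lipschitz, and the limit of a subsequence solves the linearized equation. It is
  nonzero because each normalized function attains norm \<open>1\<close>.\<close>

theorem small_solution_limit:
  assumes X: "\<And>n. C2per (X n) (Y n) (solrhs c1 c2 q (A n) (X n))" and nz: "\<And>n. \<exists>t. X n t \<noteq> 0"
    and E: "\<And>n t. norm (X n t) \<le> E n" "E \<longlonglongrightarrow> 0" and A: "A \<longlonglongrightarrow> \<alpha>"
  obtains k c v where "strict_mono (k :: nat \<Rightarrow> nat)" "\<And>n. c n > (0 :: real)" "cper v" "\<exists>t. v t \<noteq> 0"
    "uniform_limit UNIV (\<lambda>n t. c n *\<^sub>R X (k n) t) v sequentially"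
    "\<And>l j t. l < 4 \<Longrightarrow> symb c1 c2 j l \<alpha> *\<^sub>R (eig_proj l *v harmonic j v t) = 0"
proof -
  have Xc: "cper (X n)" for n using X[of n] by (simp add: C2per_def)
  have "\<exists>T. \<forall>t. norm (X n t) \<le> norm (X n T)" for n
  proof -
    have "\<exists>T\<in>{0..2 * pi}. \<forall>t\<in>{0..2 * pi}. norm (X n t) \<le> norm (X n T)"
      by (rule continuous_attains_sup) (auto intro!: continuous_intros cper_cont[OF Xc])
    then obtain T where T: "\<And>t. t \<in> {0..2 * pi} \<Longrightarrow> norm (X n t) \<le> norm (X n T)" by blast
    have "norm (X n t) \<le> norm (X n T)" for t
    proof -
      obtain m where "t + 2 * pi * of_int m \<in> {0..2 * pi}" by (rule reduce_mod_2pi)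
      then show ?thesis using T cper_int[OF Xc] by metis
    qed
    then show ?thesis by blast
  qed
  then obtain T where T: "\<And>n t. norm (X n t) \<le> norm (X n (T n))" by metis
  define c where "c n = 1 / norm (X n (T n))" for n
  have c: "c n > 0" for n
  proof -
    obtain t where "X n t \<noteq> 0" using nz by blast
    then have "0 < norm (X n t)" by simp
    also have "\<dots> \<le> norm (X n (T n))" by (rule T)
    finally show ?thesis by (simp add: c_def)
  qed
  define V where "V n t = c n *\<^sub>R X n t" for n t
  define G where "G n t = c n *\<^sub>R nem q (X n) t" for n t
  have Vc: "cper (V n)" for n unfolding V_def[abs_def] by (rule cper_scaleR[OF Xc])
  have Gc: "cper (G n)" for n unfolding G_def[abs_def] by (intro cper_scaleR nem_cper q_cont Xc)
  have V: "C2per (V n) (\<lambda>t. c n *\<^sub>R Y n t) (\<lambda>t. linrhs c1 c2 (A n) (V n) t + G n t)" for n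
  proof -
    have "(\<lambda>t. linrhs c1 c2 (A n) (V n) t + G n t) = (\<lambda>t. c n *\<^sub>R solrhs c1 c2 q (A n) (X n) t)"
      by (simp add: V_def[abs_def] G_def linrhs_scaleR Xc solrhs_def scaleR_add_right)
    then show ?thesis
      using X[of n] unfolding V_def[abs_def]
      by (auto simp: C2per_def intro!: cper_scaleR bounded_linear.has_vector_derivative[OF bounded_linear_scaleR_right])
  qed
  have V1: "norm (V n t) \<le> 1" "norm (V n (T n)) = 1" for n t
    using T[of n t] c[of n] by (auto simp: V_def c_def divide_le_eq_1)
  have G: "\<forall>\<^sub>F n in sequentially. \<forall>t. norm (G n t) \<le> \<eta>" if "\<eta> > 0" for \<eta>
  proof -
    obtain d where d: "d > 0" "\<And>x t. norm (x t) \<le> d \<Longrightarrow> norm (nem q x t) \<le> \<eta> * norm (x t)"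
      by (rule nem_small[OF \<open>\<eta> > 0\<close>]) blast
    have "\<forall>\<^sub>F n in sequentially. E n < d" using E(2) d(1) by (rule order_tendstoD)
    then show ?thesis
    proof eventually_elim
      case (elim n)
      show ?case
      proof
        fix t
        have "norm (nem q (X n) t) \<le> \<eta> * norm (X n t)" using E(1)[of n t] elim by (intro d(2)) simp
        then have "c n * norm (nem q (X n) t) \<le> c n * (\<eta> * norm (X n t))" using c[of n] by (intro mult_left_mono) auto
        also have "\<dots> = \<eta> * norm (V n t)" using c[of n] by (simp add: V_def)
        also have "\<dots> \<le> \<eta> * 1" using V1(1) that by (intro mult_left_mono) auto
        finally show "norm (G n t) \<le> \<eta>" using c[of n] by (simp add: G_def)
      qed
    qed
  qed
  \<comment> \<open>Dropping the terms before \<open>m\<close> makes the bound on the nonlinear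
    part, and so the Lipschitz constant, valid for the whole sequence.\<close>
  obtain m where m: "\<And>n t. n \<ge> m \<Longrightarrow> norm (G n t) \<le> 1"
    using G[of 1] by (auto simp: eventually_sequentially)
  obtain R where R: "R > 0" "\<And>\<alpha> x M t. cper x \<Longrightarrow> (\<And>s. norm (x s) \<le> M) \<Longrightarrow> norm (linrhs c1 c2 \<alpha> x t) \<le> R * M"
    by (rule linrhs_bound[of c1 c2]) auto
  have L: "norm (V (n + m) s - V (n + m) t) \<le> 2 * pi * (R * 1 + 1) * \<bar>s - t\<bar>" for n s t
  proof -
    have "norm (linrhs c1 c2 (A (n + m)) (V (n + m)) t + G (n + m) t) \<le> R * 1 + 1" for t
      by (intro norm_triangle_le add_mono R(2) Vc V1 m) simp
    from C2per_deriv_bound[OF V this] show ?thesis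
      using V[of "n + m"] by (intro norm_diff_le_if_deriv_bounded) (auto simp: C2per_def)
  qed
  obtain k v where k: "strict_mono k" and v: "uniform_limit UNIV (\<lambda>n. V (k n + m)) v sequentially"
    by (rule periodic_Arzela_Ascoli[of "\<lambda>n. V (n + m)" 1 "2 * pi * (R * 1 + 1)", OF Vc V1(1) L])
  have vc: "cper v" by (rule cper_uniform_limit[OF Vc v])
  have km: "strict_mono (\<lambda>n. k n + m)" using k by (simp add: strict_mono_def)
  have v0: "\<exists>t. v t \<noteq> 0"
  proof (rule ccontr)
    assume "\<not> ?thesis"
    then have "\<forall>\<^sub>F n in sequentially. \<forall>t\<in>UNIV. norm (V (k n + m) t) < 1"
      using uniform_limitD[OF v, of 1] by simp
    then obtain n where "norm (V (k n + m) t) < 1" for t by (auto simp: eventually_sequentially)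
    then show False using V1(2)[of "k n + m"] by (metis less_irrefl)
  qed
  have h: "symb c1 c2 j l \<alpha> *\<^sub>R (eig_proj l *v harmonic j v t) = 0" if l: "l < 4" for l j t
  proof -
    have Gl: "uniform_limit UNIV (\<lambda>n. G (k n + m)) (\<lambda>_. 0) sequentially"
    proof (rule uniform_limitI)
      fix e :: real assume "e > 0"
      then have "\<forall>\<^sub>F n in sequentially. \<forall>t. norm (G n t) \<le> e / 2" by (intro G) simp
      then have "\<forall>\<^sub>F n in sequentially. \<forall>t. norm (G (k n + m) t) \<le> e / 2"
        using eventually_subseq[OF km] by (simp add: eventually_compose_filterlim filterlim_subseq[OF km])
      then show "\<forall>\<^sub>F n in sequentially. \<forall>t\<in>UNIV. dist (G (k n + m) t) 0 < e"
      proof eventually_elim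
        case (elim n)
        show ?case
        proof
          fix t
          have "norm (G (k n + m) t) \<le> e / 2" using elim by blast
          then show "dist (G (k n + m) t) 0 < e" using \<open>e > 0\<close> by simp
        qed
      qed
    qed
    have Ak: "(\<lambda>n. A (k n + m)) \<longlonglongrightarrow> \<alpha>" using LIMSEQ_subseq_LIMSEQ[OF A km] by (simp add: o_def)
    have "(\<lambda>n. symb c1 c2 j l (A (k n + m)) *\<^sub>R (eig_proj l *v harmonic j (V (k n + m)) t))
        \<longlonglongrightarrow> symb c1 c2 j l \<alpha> *\<^sub>R (eig_proj l *v harmonic j v t)"
      unfolding symb_def
      by (intro tendsto_intros Ak bounded_linear.tendsto[OF mv_bounded_linear] harmonic_uniform_limit[OF Vc v]) auto
    moreover have "(\<lambda>n. - (eig_proj l *v harmonic j (G (k n + m)) t)) \<longlonglongrightarrow> - (eig_proj l *v harmonic j (\<lambda>_. 0) t)"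
      by (intro tendsto_intros bounded_linear.tendsto[OF mv_bounded_linear] harmonic_uniform_limit[OF Gc Gl])
    ultimately have "symb c1 c2 j l \<alpha> *\<^sub>R (eig_proj l *v harmonic j v t) = - (eig_proj l *v harmonic j (\<lambda>_. 0) t)"
      unfolding solution_harmonics[OF V Gc l] by (rule LIMSEQ_unique)
    then show ?thesis by (simp add: harmonic_def fcos_def fsin_def)
  qed
  show thesis
    by (rule that[of "\<lambda>n. k n + m" "\<lambda>n. c (k n + m)" v, OF km c vc v0 v[unfolded V_def[abs_def]] h])
qed

text \<open>Nontriviality passes to the first component because the second is its derivative; the
  sup bound for Sobolev functions turns convergence in norm into uniform smallness.\<close>

lemma null_direction:
  assumes sol: "\<And>n. (A n, U n) \<in> solutions c1 c2 q" and nz: "\<And>n. U n \<noteq> 0"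
    and lim: "A \<longlonglongrightarrow> \<alpha>" "U \<longlonglongrightarrow> 0"
  obtains k c v where "cper v" "\<exists>t. v t \<noteq> 0" "\<And>t. (\<lambda>n. c n *\<^sub>R fst (h1_fun (U (k n :: nat)) t)) \<longlonglongrightarrow> v t"
    "\<And>l j t. l < 4 \<Longrightarrow> symb c1 c2 j l \<alpha> *\<^sub>R (eig_proj l *v harmonic j v t) = 0"
proof -
  have "\<exists>x y. U n = h1_of x y \<and> C2per x y (solrhs c1 c2 q (A n) x)" for n
    using sol[of n] unfolding solutions_iff[OF q_cont] by blast
  then obtain X Y where XY: "\<And>n. U n = h1_of (X n) (Y n)" "\<And>n. C2per (X n) (Y n) (solrhs c1 c2 q (A n) (X n))"
    by metis
  have fU: "h1_fun (U n) = (\<lambda>t. (X n t, Y n t))" for n by (simp only: XY(1) h1_fun_h1_of[OF XY(2)])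
  have X0: "\<exists>t. X n t \<noteq> 0" for n
  proof (rule ccontr)
    assume "\<not> ?thesis"
    then have x0: "X n = (\<lambda>_. 0)" by auto
    have d: "(X n has_vector_derivative Y n t) (at t)" for t using XY(2)[of n] by (simp add: C2per_def)
    have "Y n t = 0" for t using vector_derivative_unique_at[OF d[of t], of 0] by (simp add: x0)
    then have "h1_fun (U n) = h1_fun 0" unfolding fU by (simp add: x0 zero_h1.rep_eq fun_eq_iff zero_prod_def)
    then show False using nz[of n] by (simp add: h1_fun_inject)
  qed
  have E: "norm (X n t) \<le> (2 + 2 * pi) * norm (U n)" for n t
  proof -
    have "norm (X n t) \<le> norm (h1_fun (U n) t)" unfolding fU by (rule norm_fst_le)
    also have "\<dots> \<le> (2 + 2 * pi) * norm (U n)" by (rule h1_sup_bound)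
    finally show ?thesis .
  qed
  have E0: "(\<lambda>n. (2 + 2 * pi) * norm (U n)) \<longlonglongrightarrow> 0"
    by (intro tendsto_mult_right_zero tendsto_norm_zero lim)
  obtain k c v where v: "cper v" "\<exists>t. v t \<noteq> 0" "uniform_limit UNIV (\<lambda>n t. c n *\<^sub>R X (k n) t) v sequentially"
    "\<And>l j t. l < 4 \<Longrightarrow> symb c1 c2 j l \<alpha> *\<^sub>R (eig_proj l *v harmonic j v t) = 0"
    by (rule small_solution_limit[OF XY(2) X0 E E0 lim(1)]) blast
  have "(\<lambda>n. c n *\<^sub>R fst (h1_fun (U (k n)) t)) \<longlonglongrightarrow> v t" for t
    using tendsto_uniform_limitI[OF v(3), of t] by (simp add: fU)
  then show thesis using that[of v c k] v by blast
qed

text \<open>Otherwise a sequence of solutions shrinking to \<open>0\<close> would leave a nonzero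
  null direction of a linear operator whose symbols are all nonzero.\<close>

lemma no_small_solutions:
  assumes ell: "elliptic c1 c2 \<kappa> \<alpha>" and nz: "symb c1 c2 1 1 \<alpha> \<noteq> 0"
  obtains r where "r > 0" "\<And>u. (\<alpha>, u) \<in> solutions c1 c2 q \<Longrightarrow> \<not> (0 < norm u \<and> norm u \<le> r)"
proof -
  have "\<exists>r>0. \<forall>u. (\<alpha>, u) \<in> solutions c1 c2 q \<longrightarrow> \<not> (0 < norm u \<and> norm u \<le> r)"
  proof (rule ccontr)
    assume "\<not> ?thesis"
    then have "\<exists>u. (\<alpha>, u) \<in> solutions c1 c2 q \<and> 0 < norm u \<and> norm u \<le> 1 / real (Suc n)" for n
      by (metis zero_less_divide_1_iff of_nat_0_less_iff zero_less_Suc)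
    then obtain U where U: "\<And>n. (\<alpha>, U n) \<in> solutions c1 c2 q" "\<And>n. 0 < norm (U n)" "\<And>n. norm (U n) \<le> 1 / real (Suc n)"
      by metis
    have "(\<lambda>n. 1 / real (Suc n)) \<longlonglongrightarrow> 0"
      using LIMSEQ_inverse_real_of_nat by (simp add: inverse_eq_divide)
    then have lim: "U \<longlonglongrightarrow> 0" by (rule Lim_null_comparison[rotated]) (simp add: U(3) del: of_nat_Suc)
    have nzU: "U n \<noteq> 0" for n using U(2)[of n] by auto
    obtain v where v: "cper v" "\<exists>t. v t \<noteq> 0" "\<And>l j t. l < 4 \<Longrightarrow> symb c1 c2 j l \<alpha> *\<^sub>R (eig_proj l *v harmonic j v t) = 0"
      by (rule null_direction[OF U(1) nzU tendsto_const lim]) blast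
    have "symb c1 c2 j l \<alpha> \<noteq> 0" if "l < 4" for j l
      using elliptic_symb_nonzero[OF ell that] nz by (cases "(j, l) = (1, 1)") auto
    then have "v t = 0" for t using v(3) by (intro eq_zero_if_eig_harmonics_zero[OF v(1)]) auto
    then show False using v(2) by blast
  qed
  then show thesis using that by blast
qed

text \<open>A statement about all admissible neighbourhoods could be vacuous; this excludes it. The
  width is that of \<open>elliptic_near\<close>, and the radius has to serve only the two end
  parameters.\<close>

theorem admissible_exists: "\<exists>\<rho> r. admissible c1 c2 q \<alpha>o \<rho> r"
proof -
  obtain \<delta> \<kappa> where \<delta>: "0 < \<delta>" "\<delta> < \<alpha>o" and ell: "\<And>\<alpha>. \<bar>\<alpha> - \<alpha>o\<bar> \<le> \<delta> \<Longrightarrow> elliptic c1 c2 \<kappa> \<alpha>"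
    by (rule elliptic_near) blast
  have crit: "critical c1 c2 \<alpha> \<longleftrightarrow> \<alpha> = \<alpha>o" if "\<bar>\<alpha> - \<alpha>o\<bar> \<le> \<delta>" for \<alpha>
  proof -
    have "\<alpha> > 0" using that \<delta> by linarith
    then show ?thesis using criticalI[of \<alpha> c1 c2] not_criticalI[OF _ ell[OF that]] symb_11_zero_iff by blast
  qed
  have small: "\<exists>r>0. \<forall>u. (\<alpha>, u) \<in> solutions c1 c2 q \<longrightarrow> \<not> (0 < norm u \<and> norm u \<le> r)"
    if "\<bar>\<alpha> - \<alpha>o\<bar> \<le> \<delta>" "\<alpha> \<noteq> \<alpha>o" for \<alpha>
  proof -
    have "\<alpha> > 0" using that \<delta> by linarith
    then have "symb c1 c2 1 1 \<alpha> \<noteq> 0" using symb_11_zero_iff that(2) by blast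
    from no_small_solutions[OF ell[OF that(1)] this] show ?thesis by blast
  qed
  obtain r1 where r1: "r1 > 0" "\<And>u. (\<alpha>o - \<delta>, u) \<in> solutions c1 c2 q \<Longrightarrow> \<not> (0 < norm u \<and> norm u \<le> r1)"
    using small[of "\<alpha>o - \<delta>"] \<delta> by auto
  obtain r2 where r2: "r2 > 0" "\<And>u. (\<alpha>o + \<delta>, u) \<in> solutions c1 c2 q \<Longrightarrow> \<not> (0 < norm u \<and> norm u \<le> r2)"
    using small[of "\<alpha>o + \<delta>"] \<delta> by auto
  have "admissible c1 c2 q \<alpha>o \<delta> (min r1 r2)"
    unfolding admissible_def
  proof (intro conjI allI impI ballI)
    fix \<alpha> u assume a: "\<bar>\<alpha> - \<alpha>o\<bar> = \<delta> \<and> (\<alpha>, u) \<in> solutions c1 c2 q"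
    then have "\<alpha> = \<alpha>o - \<delta> \<or> \<alpha> = \<alpha>o + \<delta>" by linarith
    then have "\<not> (0 < norm u \<and> norm u \<le> r1) \<or> \<not> (0 < norm u \<and> norm u \<le> r2)"
      using a r1(2) r2(2) by blast
    then show "\<not> (0 < norm u \<and> norm u \<le> min r1 r2)" by auto
  next
    fix \<alpha> assume "\<alpha> \<in> {\<alpha>o - \<delta>..\<alpha>o + \<delta>}"
    then show "critical c1 c2 \<alpha> \<longleftrightarrow> \<alpha> = \<alpha>o" by (intro crit) auto
  qed (use \<delta> r1 r2 in auto)
  then show ?thesis by blast
qed

end

subsection \<open>Rotations of the cube\<close>

lemma cube_vertex_inj: "cube_vertex i = cube_vertex j \<longleftrightarrow> i = j"
  using cube_dot_eq_3 by (metis cube_dot_def)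

lemma cube_vertex_surj:
  assumes "\<And>a. x $ a \<in> {-1, 1}" shows "\<exists>j. cube_vertex j = x"
proof -
  have "x $ 1 = -1 \<or> x $ 1 = 1" "x $ 2 = -1 \<or> x $ 2 = 1" "x $ 3 = -1 \<or> x $ 3 = 1"
    using assms by auto
  then have "x \<in> cube_vertex ` {1, 2, 3, 4, 5, 6, 7, 8}"
    by (auto simp: cube_vertex_simps vec_eq_iff forall_3)
  then show ?thesis by blast
qed

lemma mat3_eqI:
  fixes A B :: "real ^ 3 ^ 3"
  assumes "A *v cube_vertex 1 = B *v cube_vertex 1" "A *v cube_vertex 2 = B *v cube_vertex 2" "A *v cube_vertex 3 = B *v cube_vertex 3"
  shows "A = B"
proof -
  have "A $ i $ 1 = B $ i $ 1 \<and> A $ i $ 2 = B $ i $ 2 \<and> A $ i $ 3 = B $ i $ 3" for i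
    using assms[unfolded vec_eq_iff, rule_format, of i]
    by (simp add: matrix_vector_mult_def sum_3 cube_vertex_simps)
  then show ?thesis by (simp add: vec_eq_iff forall_3)
qed

text \<open>The choice is unique: three of the vertices already form a basis of
  \<open>real ^ 3\<close>, see \<open>mat3_eqI\<close>.\<close>

definition cmat :: "(8 \<Rightarrow> 8) \<Rightarrow> real ^ 3 ^ 3" where
  "cmat \<gamma> = (SOME A. rotation_matrix A \<and> (\<forall>i. A *v cube_vertex i = cube_vertex (\<gamma> i)))"

lemma cube_groupI: "rotation_matrix A \<Longrightarrow> (\<And>i. A *v cube_vertex i = cube_vertex (\<gamma> i)) \<Longrightarrow> \<gamma> \<in> carrier cube_group"
  by (auto simp: cube_group_def)

lemma
  assumes "\<gamma> \<in> carrier cube_group"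
  shows cmat_rotation: "rotation_matrix (cmat \<gamma>)" and cmat_vertex: "cmat \<gamma> *v cube_vertex i = cube_vertex (\<gamma> i)"
proof -
  have "\<exists>A. rotation_matrix A \<and> (\<forall>i. A *v cube_vertex i = cube_vertex (\<gamma> i))"
    using assms by (simp add: cube_group_def)
  from someI_ex[OF this] show "rotation_matrix (cmat \<gamma>)" "cmat \<gamma> *v cube_vertex i = cube_vertex (\<gamma> i)"
    by (auto simp: cmat_def)
qed

lemma cmat_eqI: "\<gamma> \<in> carrier cube_group \<Longrightarrow> (\<And>i. A *v cube_vertex i = cube_vertex (\<gamma> i)) \<Longrightarrow> cmat \<gamma> = A"
  by (rule mat3_eqI) (simp_all add: cmat_vertex)

lemma cmat_inject:
  assumes "\<gamma> \<in> carrier cube_group" "\<delta> \<in> carrier cube_group" "cmat \<gamma> = cmat \<delta>" shows "\<gamma> = \<delta>"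
proof
  show "\<gamma> i = \<delta> i" for i using cmat_vertex[OF assms(1), of i] cmat_vertex[OF assms(2), of i] assms(3)
    by (simp add: cube_vertex_inj)
qed

lemma rotation_transpose:
  assumes "rotation_matrix (A :: real ^ 3 ^ 3)"
  shows "rotation_matrix (transpose A)" "transpose A ** A = mat 1" "A ** transpose A = mat 1"
  using assms by (auto simp: rotation_matrix_def orthogonal_matrix_def)

lemma cube_group_bij:
  assumes "\<gamma> \<in> carrier cube_group" shows "bij \<gamma>"
proof -
  have "inj \<gamma>"
  proof (rule injI)
    fix i j assume "\<gamma> i = \<gamma> j"
    then have "transpose (cmat \<gamma>) *v (cmat \<gamma> *v cube_vertex i) = transpose (cmat \<gamma>) *v (cmat \<gamma> *v cube_vertex j)"
      by (simp add: cmat_vertex[OF assms])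
    then show "i = j"
      by (simp add: matrix_vector_mul_assoc rotation_transpose[OF cmat_rotation[OF assms]] cube_vertex_inj)
  qed
  then show ?thesis by (simp add: bij_def finite_UNIV_inj_surj)
qed

lemma cube_group_simps: "mult cube_group = (\<circ>)" "one cube_group = id"
  by (simp_all add: cube_group_def)

lemma cube_group_id: "id \<in> carrier cube_group"
  by (rule cube_groupI[of "mat 1"]) (simp_all add: rotation_matrix_def orthogonal_matrix_id)

lemma cube_group_comp:
  assumes "\<gamma> \<in> carrier cube_group" "\<delta> \<in> carrier cube_group"
  shows "\<gamma> \<circ> \<delta> \<in> carrier cube_group" "cmat (\<gamma> \<circ> \<delta>) = cmat \<gamma> ** cmat \<delta>"
proof -
  have *: "(cmat \<gamma> ** cmat \<delta>) *v cube_vertex i = cube_vertex ((\<gamma> \<circ> \<delta>) i)" for i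
    using assms by (simp add: cmat_vertex flip: matrix_vector_mul_assoc)
  show "\<gamma> \<circ> \<delta> \<in> carrier cube_group"
    by (rule cube_groupI[OF _ *])
      (use assms[THEN cmat_rotation] in \<open>auto simp: rotation_matrix_def orthogonal_matrix_mul det_mul\<close>)
  then show "cmat (\<gamma> \<circ> \<delta>) = cmat \<gamma> ** cmat \<delta>" by (rule cmat_eqI[OF _ *])
qed

lemma cmat_id: "cmat id = mat 1"
  by (rule cmat_eqI[OF cube_group_id]) simp

lemma cube_group_inv_into:
  assumes "\<gamma> \<in> carrier cube_group"
  shows "inv_into UNIV \<gamma> \<in> carrier cube_group" "cmat (inv_into UNIV \<gamma>) = transpose (cmat \<gamma>)"
proof -
  have *: "transpose (cmat \<gamma>) *v cube_vertex i = cube_vertex (inv_into UNIV \<gamma> i)" for i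
  proof -
    have "cube_vertex i = cmat \<gamma> *v cube_vertex (inv_into UNIV \<gamma> i)"
      using cube_group_bij[OF assms] by (simp add: cmat_vertex[OF assms] bij_is_surj surj_f_inv_f)
    then show ?thesis
      by (simp add: matrix_vector_mul_assoc rotation_transpose[OF cmat_rotation[OF assms]])
  qed
  show "inv_into UNIV \<gamma> \<in> carrier cube_group"
    by (rule cube_groupI[OF _ *]) (simp add: rotation_transpose cmat_rotation[OF assms])
  then show "cmat (inv_into UNIV \<gamma>) = transpose (cmat \<gamma>)" by (rule cmat_eqI[OF _ *])
qed

lemma cube_group_group: "group cube_group"
proof (rule groupI)
  fix \<gamma> assume "\<gamma> \<in> carrier cube_group"
  then show "\<exists>\<delta>\<in>carrier cube_group. \<delta> \<otimes>\<^bsub>cube_group\<^esub> \<gamma> = \<one>\<^bsub>cube_group\<^esub>"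
    using cube_group_inv_into[of \<gamma>] cube_group_bij[of \<gamma>]
    by (intro bexI[of _ "inv_into UNIV \<gamma>"]) (auto simp: cube_group_simps bij_is_inj)
qed (auto simp: cube_group_simps cube_group_id cube_group_comp comp_assoc)

interpretation cg: group cube_group by (rule cube_group_group)

lemma cube_group_inv: "\<gamma> \<in> carrier cube_group \<Longrightarrow> inv\<^bsub>cube_group\<^esub> \<gamma> = inv_into UNIV \<gamma>"
  using cube_group_inv_into[of \<gamma>] cube_group_bij[of \<gamma>]
  by (intro cg.inv_equality) (auto simp: cube_group_simps bij_is_inj)

lemma cmat_inv: "\<gamma> \<in> carrier cube_group \<Longrightarrow> cmat (inv\<^bsub>cube_group\<^esub> \<gamma>) = transpose (cmat \<gamma>)"
  by (simp add: cube_group_inv cube_group_inv_into)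

lemma cmat_mult: "\<gamma> \<in> carrier cube_group \<Longrightarrow> \<delta> \<in> carrier cube_group \<Longrightarrow> cmat (\<gamma> \<otimes>\<^bsub>cube_group\<^esub> \<delta>) = cmat \<gamma> ** cmat \<delta>"
  by (simp add: cube_group_simps cube_group_comp)

lemma cmat_one: "cmat \<one>\<^bsub>cube_group\<^esub> = mat 1"
  by (simp add: cube_group_simps cmat_id)

lemma cube_dot_invariant: "\<gamma> \<in> carrier cube_group \<Longrightarrow> cube_dot (\<gamma> i) (\<gamma> j) = cube_dot i j"
  using orthogonal_transformation_matrix[of "(*v) (cmat \<gamma>)"] cmat_rotation[of \<gamma>]
  by (simp add: cube_dot_def rotation_matrix_def orthogonal_transformation_def matrix_of_matrix_vector_mul flip: cmat_vertex)

subsection \<open>Subgroups of the rotation group\<close>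

definition induces :: "(8 \<Rightarrow> 8) \<Rightarrow> (nat \<Rightarrow> nat) \<Rightarrow> bool" where
  "induces \<gamma> \<sigma> \<longleftrightarrow> (\<forall>n\<in>{1..4}. \<gamma> ` cube_diagonal n = cube_diagonal (\<sigma> n))"

lemma induces_comp:
  "induces \<gamma> \<sigma> \<Longrightarrow> induces \<delta> \<tau> \<Longrightarrow> \<tau> permutes {1..4} \<Longrightarrow> induces (\<gamma> \<circ> \<delta>) (\<sigma> \<circ> \<tau>)"
  unfolding induces_def by (metis comp_apply image_comp permutes_in_image)

lemma induces_inv:
  assumes "induces \<gamma> \<sigma>" "\<gamma> \<in> carrier cube_group" "\<sigma> permutes {1..4}"
  shows "induces (inv_into UNIV \<gamma>) (inv_into UNIV \<sigma>)"
  unfolding induces_def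
proof
  fix n :: nat assume "n \<in> {1..4}"
  define m where "m = inv_into UNIV \<sigma> n"
  have m: "m \<in> {1..4}" "\<sigma> m = n"
    using assms(3) \<open>n \<in> {1..4}\<close> permutes_in_image[OF permutes_inv[OF assms(3)], of n]
    by (auto simp: m_def permutes_inverses simp del: atLeastAtMost_iff)
  have "inv_into UNIV \<gamma> ` cube_diagonal n = inv_into UNIV \<gamma> ` \<gamma> ` cube_diagonal m"
    using assms(1) m by (simp add: induces_def)
  also have "\<dots> = cube_diagonal m"
    using cube_group_bij[OF assms(2)] by (simp add: image_comp bij_is_inj)
  finally show "inv_into UNIV \<gamma> ` cube_diagonal n = cube_diagonal (inv_into UNIV \<sigma> n)" by (simp add: m_def)
qed

lemma image_cube_diagonal_iff:
  assumes "\<gamma> \<in> carrier cube_group"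
  shows "\<gamma> ` cube_diagonal n = cube_diagonal m \<longleftrightarrow>
    cmat \<gamma> *v cube_vertex (of_nat n) = cube_vertex (of_nat m) \<or> cmat \<gamma> *v cube_vertex (of_nat n) = - cube_vertex (of_nat m)"
    (is "?l \<longleftrightarrow> ?r")
proof
  assume ?l
  moreover have "of_nat n \<in> cube_diagonal n" by (simp add: cube_diagonal_def)
  ultimately have "\<gamma> (of_nat n) \<in> cube_diagonal m" by blast
  then show ?r by (simp add: cmat_vertex[OF assms] cube_diagonal_def)
next
  assume r: ?r
  let ?A = "cmat \<gamma>"
  have A: "?A *v x = ?A *v y \<longleftrightarrow> x = y" for x y
  proof
    assume "?A *v x = ?A *v y"
    then have "transpose ?A *v (?A *v x) = transpose ?A *v (?A *v y)" by simp
    then show "x = y" by (simp add: matrix_vector_mul_assoc rotation_transpose[OF cmat_rotation[OF assms]])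
  qed simp
  have neg: "?A *v (- x) = - (?A *v x)" for x by (rule linear_neg[OF matrix_vector_mul_linear])
  have iff: "\<gamma> i \<in> cube_diagonal m \<longleftrightarrow> i \<in> cube_diagonal n" for i
  proof -
    have "\<gamma> i \<in> cube_diagonal m \<longleftrightarrow> ?A *v cube_vertex i = ?A *v cube_vertex (of_nat n) \<or> ?A *v cube_vertex i = ?A *v (- cube_vertex (of_nat n))"
      using r unfolding neg by (auto simp: cube_diagonal_def cmat_vertex[OF assms])
    then show ?thesis unfolding A by (simp add: cube_diagonal_def)
  qed
  show ?l
  proof
    show "\<gamma> ` cube_diagonal n \<subseteq> cube_diagonal m" using iff by blast
    show "cube_diagonal m \<subseteq> \<gamma> ` cube_diagonal n"
    proof
      fix j assume "j \<in> cube_diagonal m"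
      moreover obtain i where "j = \<gamma> i" using surjD[OF bij_is_surj[OF cube_group_bij[OF assms]]] by blast
      ultimately show "j \<in> \<gamma> ` cube_diagonal n" using iff by blast
    qed
  qed
qed

lemma forall_1_4: "(\<forall>n\<in>{1..4::nat}. P n) \<longleftrightarrow> P 1 \<and> P 2 \<and> P 3 \<and> P 4"
proof -
  have "{1..4::nat} = {1, 2, 3, 4}" by auto
  then show ?thesis by simp
qed

text \<open>Two such rotations agree on each of the four vertices up to a sign. Scalar products
  between non-orthogonal vertices are preserved, so the signs at three independent vertices
  coincide; as the dimension is odd, determinant \<open>1\<close> makes the common sign
  positive.\<close>

lemma induces_unique:
  assumes \<gamma>: "\<gamma> \<in> carrier cube_group" "induces \<gamma> \<sigma>" and \<delta>: "\<delta> \<in> carrier cube_group" "induces \<delta> \<sigma>"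
  shows "\<gamma> = \<delta>"
proof -
  let ?V = "\<lambda>n. cube_vertex (of_nat n)"
  have "\<exists>s. (s = 1 \<or> s = -1) \<and> cmat \<gamma> *v ?V n = s *\<^sub>R (cmat \<delta> *v ?V n)" if "n \<in> {1..4}" for n
    using that \<gamma>(2) \<delta>(2) unfolding induces_def image_cube_diagonal_iff[OF \<gamma>(1)] image_cube_diagonal_iff[OF \<delta>(1)]
    by (metis add.inverse_inverse scaleR_minus1_left scaleR_one)
  then obtain s where s: "\<And>n. n \<in> {1..4} \<Longrightarrow> s n = 1 \<or> s n = -1"
    "\<And>n. n \<in> {1..4} \<Longrightarrow> cmat \<gamma> *v ?V n = s n *\<^sub>R (cmat \<delta> *v ?V n)" by metis
  have same: "s n = s 1" if n: "n \<in> {1..4}" "cube_dot 1 (of_nat n) \<noteq> 0" for n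
  proof -
    have d: "cube_vertex (\<gamma> 1) \<bullet> cube_vertex (\<gamma> (of_nat n)) = cube_dot 1 (of_nat n)"
      "cube_vertex (\<delta> 1) \<bullet> cube_vertex (\<delta> (of_nat n)) = cube_dot 1 (of_nat n)"
      using cube_dot_invariant[OF \<gamma>(1), of 1 "of_nat n"] cube_dot_invariant[OF \<delta>(1), of 1 "of_nat n"]
      by (simp_all add: cube_dot_def)
    have "cube_dot 1 (of_nat n) = (s n * s 1) * cube_dot 1 (of_nat n)"
      using s(2)[of 1] s(2)[OF n(1)] d by (simp add: cmat_vertex[OF \<gamma>(1)] cmat_vertex[OF \<delta>(1)])
    then have "s n * s 1 = 1" using n(2) by simp
    then show ?thesis using s(1)[of 1] s(1)[OF n(1)] by auto
  qed
  have "s 2 = s 1" "s 3 = s 1"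
    by (rule same; simp add: cube_dot_def inner_real3 cube_vertex_simps)+
  then have "cmat \<gamma> = s 1 *\<^sub>R cmat \<delta>"
    using s(2)[of 1] s(2)[of 2] s(2)[of 3]
    by (intro mat3_eqI) (simp_all add: scaleR_matrix_vector_assoc[symmetric])
  moreover from this have "det (cmat \<gamma>) = s 1 ^ 3 * det (cmat \<delta>)" by (simp add: det_3 power3_eq_cube algebra_simps)
  then have "s 1 = 1"
    using s(1)[of 1] cmat_rotation[OF \<gamma>(1)] cmat_rotation[OF \<delta>(1)] by (auto simp: rotation_matrix_def)
  ultimately show ?thesis using cmat_inject[OF \<gamma>(1) \<delta>(1)] by simp
qed

text \<open>Subgroups of the cube group are specified through permutations of the diagonals.
  Matching generators are propagated through the generated groups by induction, and
  \<open>induces_unique\<close> turns the correspondence into an equality, so no group has to be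
  enumerated.\<close>

theorem cube_subgroup_eq_generate:
  assumes P: "P \<subseteq> carrier (sym_group 4)" and P': "P' \<subseteq> carrier cube_group"
    and 1: "\<And>\<sigma>. \<sigma> \<in> P \<Longrightarrow> \<exists>\<gamma>\<in>P'. induces \<gamma> \<sigma>" and 2: "\<And>\<gamma>. \<gamma> \<in> P' \<Longrightarrow> \<exists>\<sigma>\<in>P. induces \<gamma> \<sigma>"
  shows "cube_subgroup P = generate cube_group P'"
proof -
  interpret sg: group "sym_group 4" by (rule sym_group_is_group)
  have perm: "\<sigma> permutes {1..4}" if "\<sigma> \<in> generate (sym_group 4) P" for \<sigma>
    using sg.generate_in_carrier[OF P that] by (simp add: sym_group_carrier)
  have car: "\<gamma> \<in> carrier cube_group" if "\<gamma> \<in> generate cube_group P'" for \<gamma>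
    by (rule cg.generate_in_carrier[OF P' that])
  have one: "induces id id" by (simp add: induces_def)
  have A: "\<exists>\<gamma>\<in>generate cube_group P'. induces \<gamma> \<sigma>" if "\<sigma> \<in> generate (sym_group 4) P" for \<sigma>
    using that
  proof (induction rule: generate.induct)
    case one
    show ?case using \<open>induces id id\<close> generate.one[of cube_group P'] unfolding sym_group_one cube_group_simps by blast
  next
    case (incl \<sigma>)
    then show ?case using 1 by (blast intro: generate.incl)
  next
    case (inv \<sigma>)
    then obtain \<gamma> where \<gamma>: "\<gamma> \<in> P'" "induces \<gamma> \<sigma>" using 1 by blast
    have "\<sigma> \<in> carrier (sym_group 4)" using inv P by blast
    then show ?case using \<gamma> P' induces_inv[of \<gamma> \<sigma>] generate.inv[OF \<gamma>(1), of cube_group]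
      by (intro bexI[of _ "inv\<^bsub>cube_group\<^esub> \<gamma>"]) (auto simp: cube_group_inv subsetD sym_group_carrier)
  next
    case (eng \<sigma> \<tau>)
    then obtain \<gamma> \<delta> where "\<gamma> \<in> generate cube_group P'" "induces \<gamma> \<sigma>" "\<delta> \<in> generate cube_group P'" "induces \<delta> \<tau>" by blast
    then show ?case using induces_comp[of \<gamma> \<sigma> \<delta> \<tau>] perm[OF eng(2)] generate.eng[of \<gamma> cube_group P' \<delta>]
      unfolding sym_group_mult cube_group_simps by blast
  qed
  have B: "\<exists>\<sigma>\<in>generate (sym_group 4) P. induces \<gamma> \<sigma>" if "\<gamma> \<in> generate cube_group P'" for \<gamma>
    using that
  proof (induction rule: generate.induct)
    case one
    show ?case using \<open>induces id id\<close> generate.one[of "sym_group 4" P] unfolding sym_group_one cube_group_simps by blast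
  next
    case (incl \<gamma>)
    then show ?case using 2 by (blast intro: generate.incl)
  next
    case (inv \<gamma>)
    then obtain \<sigma> where \<sigma>: "\<sigma> \<in> P" "induces \<gamma> \<sigma>" using 2 by blast
    have s: "\<sigma> \<in> carrier (sym_group 4)" using \<sigma> P by blast
    then show ?case using \<sigma> P' inv induces_inv[of \<gamma> \<sigma>] generate.inv[OF \<sigma>(1), of "sym_group 4"]
      by (intro bexI[of _ "inv\<^bsub>sym_group 4\<^esub> \<sigma>"]) (auto simp: cube_group_inv subsetD sym_group_carrier)
  next
    case (eng \<gamma> \<delta>)
    then obtain \<sigma> \<tau> where "\<sigma> \<in> generate (sym_group 4) P" "induces \<gamma> \<sigma>" "\<tau> \<in> generate (sym_group 4) P" "induces \<delta> \<tau>" by blast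
    then show ?case using induces_comp[of \<gamma> \<sigma> \<delta> \<tau>] perm[of \<tau>] generate.eng[of \<sigma> "sym_group 4" P \<tau>]
      unfolding sym_group_mult cube_group_simps by blast
  qed
  have eq: "cube_subgroup P = {\<gamma> \<in> carrier cube_group. \<exists>\<sigma>\<in>generate (sym_group 4) P. induces \<gamma> \<sigma>}"
    by (simp add: cube_subgroup_def induces_def)
  show ?thesis
  proof
    show "cube_subgroup P \<subseteq> generate cube_group P'"
    proof
      fix \<gamma> assume "\<gamma> \<in> cube_subgroup P"
      then obtain \<sigma> where \<gamma>: "\<gamma> \<in> carrier cube_group" "\<sigma> \<in> generate (sym_group 4) P" "induces \<gamma> \<sigma>" by (auto simp: eq)
      obtain \<delta> where "\<delta> \<in> generate cube_group P'" "induces \<delta> \<sigma>" using A[OF \<gamma>(2)] by blast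
      then show "\<gamma> \<in> generate cube_group P'" using induces_unique[OF \<gamma>(1,3) car] by metis
    qed
    show "generate cube_group P' \<subseteq> cube_subgroup P" using B car by (auto simp: eq)
  qed
qed

definition mat3 :: "real \<Rightarrow> real \<Rightarrow> real \<Rightarrow> real \<Rightarrow> real \<Rightarrow> real \<Rightarrow> real \<Rightarrow> real \<Rightarrow> real \<Rightarrow> real ^ 3 ^ 3" where
  "mat3 a b c d e f g h i = vector [vector [a, b, c], vector [d, e, f], vector [g, h, i]]"

lemma mat3_mult_vec: "mat3 a b c d e f g h i *v x =
    vector [a * x $ 1 + b * x $ 2 + c * x $ 3, d * x $ 1 + e * x $ 2 + f * x $ 3, g * x $ 1 + h * x $ 2 + i * x $ 3]"
  by (simp add: mat3_def vec_eq_iff forall_3 matrix_vector_mult_def sum_3)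

definition vperm :: "real ^ 3 ^ 3 \<Rightarrow> 8 \<Rightarrow> 8" where
  "vperm A i = (SOME j. cube_vertex j = A *v cube_vertex i)"

lemma vperm:
  assumes "rotation_matrix A" "\<forall>i a. (A *v cube_vertex i) $ a \<in> {-1, 1}"
  shows "vperm A \<in> carrier cube_group" "cmat (vperm A) = A"
proof -
  have *: "A *v cube_vertex i = cube_vertex (vperm A i)" for i
    using someI_ex[OF cube_vertex_surj[of "A *v cube_vertex i"]] assms(2) by (simp add: vperm_def)
  show "vperm A \<in> carrier cube_group" by (rule cube_groupI[OF assms(1) *])
  then show "cmat (vperm A) = A" by (rule cmat_eqI[OF _ *])
qed

lemma rotation_mat3I:
  assumes "A = mat3 a b c d e f g h i"
    "a * a + d * d + g * g = 1" "b * b + e * e + h * h = 1" "c * c + f * f + i * i = 1"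
    "a * b + d * e + g * h = 0" "a * c + d * f + g * i = 0" "b * c + e * f + h * i = 0"
    "a * (e * i - f * h) - b * (d * i - f * g) + c * (d * h - e * g) = 1"
  shows "rotation_matrix A"
proof -
  have "transpose A ** A = mat 1"
    using assms(2-7)
    by (simp add: assms(1) mat3_def vec_eq_iff forall_3 matrix_matrix_mult_def transpose_def sum_3 mat_def mult.commute)
  moreover have "det A = 1" using assms(8) by (simp add: assms(1) mat3_def det_3 algebra_simps)
  ultimately show ?thesis by (simp add: rotation_matrix_def orthogonal_matrix)
qed

text \<open>\<open>rz_mat\<close> and \<open>rx_mat\<close> are quarter turns about the third and
  first axis, \<open>cy_mat\<close> is the third-turn that permutes the axes cyclically. The others
  are half turns, about \<open>(1, 1, 0)\<close> for \<open>sw_mat\<close>, \<open>(0, 1, 1)\<close>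
  for \<open>ed_mat\<close> and \<open>(0, 1, -1)\<close> for \<open>ee_mat\<close>. The first four
  listed induce the prescribed generators on the diagonals, \<open>cy_mat\<close> and
  \<open>rx_mat\<close> serve to conjugate.\<close>

definition "rz_mat = mat3 0 (-1) 0 1 0 0 0 0 1"
definition "sw_mat = mat3 0 1 0 1 0 0 0 0 (-1)"
definition "ed_mat = mat3 (-1) 0 0 0 0 1 0 1 0"
definition "ee_mat = mat3 (-1) 0 0 0 0 (-1) 0 (-1) 0"
definition "cy_mat = mat3 0 0 1 1 0 0 0 1 0"
definition "rx_mat = mat3 1 0 0 0 0 (-1) 0 1 0"

lemmas cube_mats = rz_mat_def sw_mat_def ed_mat_def ee_mat_def cy_mat_def rx_mat_def

lemma cube_mats_in_group:
  shows "vperm rz_mat \<in> carrier cube_group" "cmat (vperm rz_mat) = rz_mat"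
    and "vperm sw_mat \<in> carrier cube_group" "cmat (vperm sw_mat) = sw_mat"
    and "vperm ed_mat \<in> carrier cube_group" "cmat (vperm ed_mat) = ed_mat"
    and "vperm ee_mat \<in> carrier cube_group" "cmat (vperm ee_mat) = ee_mat"
    and "vperm cy_mat \<in> carrier cube_group" "cmat (vperm cy_mat) = cy_mat"
    and "vperm rx_mat \<in> carrier cube_group" "cmat (vperm rx_mat) = rx_mat"
  by (intro vperm; (rule rotation_mat3I, unfold cube_mats, rule refl; simp)?;
      simp add: forall_8 forall_3 cube_mats mat3_mult_vec cube_vertex_simps)+

lemma perm_in_sym: "Transposition.transpose a b \<in> carrier (sym_group 4)" if "a \<in> {1..4}" "b \<in> {1..4}" for a b :: nat
  using that by (simp add: sym_group_carrier permutes_swap_id)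

lemma cycle_in_sym: "cycle_of_list [1, 2, 3, 4] \<in> carrier (sym_group 4)"
proof -
  have "set [1, 2, 3, 4] = {1..4::nat}" by auto
  then show ?thesis using cycle_permutes[of "[1, 2, 3, 4::nat]"] by (simp only: sym_group_carrier)
qed

lemma cube_mats_induce:
  "induces (vperm rz_mat) (cycle_of_list [1, 2, 3, 4])"
  "induces (vperm sw_mat) (Transposition.transpose 1 3)"
  "induces (vperm ed_mat) (Transposition.transpose 1 2)"
  "induces (vperm ee_mat) (Transposition.transpose 3 4)"
  unfolding induces_def forall_1_4
  by (simp_all add: image_cube_diagonal_iff cube_mats_in_group)
    (simp_all add: cube_mats mat3_mult_vec cube_vertex_simps vec_eq_iff forall_3 Transposition.transpose_def)

lemma cube_subgroups:
  "S4_Z1 = generate cube_group {}"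
  "S4_D1 = generate cube_group {vperm ed_mat}"
  "S4_Z4 = generate cube_group {vperm rz_mat}"
  "S4_D2 = generate cube_group {vperm ed_mat, vperm ee_mat}"
  "S4_D4 = generate cube_group {vperm rz_mat, vperm sw_mat}"
  unfolding S4_Z1_def S4_D1_def S4_Z4_def S4_D2_def S4_D4_def
  by (rule cube_subgroup_eq_generate;
      use cube_mats_induce cube_mats_in_group in \<open>auto simp: cycle_in_sym[unfolded One_nat_def] perm_in_sym[unfolded One_nat_def] simp del: cycle_of_list.simps\<close>)+

subsection \<open>The group action\<close>

lemma permute_vertices_linear: "bounded_linear (permute_vertices \<gamma>)"
  by (rule linear_conv_bounded_linear[THEN iffD1]) (auto intro!: linearI simp: permute_vertices_def vec_eq_iff)

text \<open>The entries of the projections depend only on scalar products of vertices, which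
  rotations preserve.\<close>

lemma eig_proj_permute:
  assumes "\<gamma> \<in> carrier cube_group"
  shows "eig_proj l *v permute_vertices \<gamma> x = permute_vertices \<gamma> (eig_proj l *v x)"
proof (rule vec_eq_iff[THEN iffD2], rule allI)
  fix i
  have b: "bij \<gamma>" by (rule cube_group_bij[OF assms])
  have "(eig_proj l *v permute_vertices \<gamma> x) $ i = (\<Sum>j\<in>UNIV. proj_entry l (cube_dot i j) * x $ inv_into UNIV \<gamma> j)"
    by (simp add: matrix_vector_mult_def eig_proj_def permute_vertices_def)
  also have "\<dots> = (\<Sum>j\<in>UNIV. proj_entry l (cube_dot i (\<gamma> j)) * x $ j)"
    by (subst sum.reindex_bij_betw[OF b, symmetric]) (simp add: bij_is_inj[OF b])
  also have "\<dots> = (\<Sum>j\<in>UNIV. proj_entry l (cube_dot (inv_into UNIV \<gamma> i) j) * x $ j)"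
  proof (rule sum.cong[OF refl])
    fix j
    have "cube_dot i (\<gamma> j) = cube_dot (inv_into UNIV \<gamma> i) j"
      using cube_dot_invariant[OF assms, of "inv_into UNIV \<gamma> i" j] by (simp add: surj_f_inv_f[OF bij_is_surj[OF b]])
    then show "proj_entry l (cube_dot i (\<gamma> j)) * x $ j = proj_entry l (cube_dot (inv_into UNIV \<gamma> i) j) * x $ j" by simp
  qed
  also have "\<dots> = permute_vertices \<gamma> (eig_proj l *v x) $ i"
    by (simp add: matrix_vector_mult_def eig_proj_def permute_vertices_def)
  finally show "(eig_proj l *v permute_vertices \<gamma> x) $ i = permute_vertices \<gamma> (eig_proj l *v x) $ i" .
qed

text \<open>On this eigenspace the permutation action becomes the rotation itself, so fixed vectors
  can be found by linear algebra in \<open>real ^ 3\<close>.\<close>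

lemma permute_vertex_fun:
  assumes "\<gamma> \<in> carrier cube_group"
  shows "permute_vertices \<gamma> (vertex_fun a) = vertex_fun (cmat \<gamma> *v a)"
proof -
  have "cube_vertex (inv_into UNIV \<gamma> i) \<bullet> a = cube_vertex i \<bullet> (cmat \<gamma> *v a)" for i
  proof -
    have "cube_vertex (inv_into UNIV \<gamma> i) = transpose (cmat \<gamma>) *v cube_vertex i"
      using cmat_vertex[OF cube_group_inv_into(1)[OF assms], of i] by (simp add: cube_group_inv_into(2)[OF assms])
    then show ?thesis by (simp add: dot_lmul_matrix transpose_matrix_vector)
  qed
  then show ?thesis by (simp add: permute_vertices_def vertex_fun_def vec_eq_iff)
qed

text \<open>The change of time through which \<open>O(2)\<close> acts on first components. The sign
  that a reflection puts on the second component needs no separate treatment: it is produced by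
  differentiation.\<close>

definition circ :: "real ^ 2 ^ 2 \<Rightarrow> real \<Rightarrow> real" where
  "circ k t = (if det k = 1 then t + angle2 k else - (t + angle2 k))"

definition act_fun :: "(8 \<Rightarrow> 8) \<times> (real ^ 2 ^ 2) \<Rightarrow> (real \<Rightarrow> real ^ 8) \<Rightarrow> real \<Rightarrow> real ^ 8" where
  "act_fun g x t = permute_vertices (fst g) (x (circ (snd g) t))"

lemma circ_cper:
  assumes "cper x" shows "cper (\<lambda>t. x (circ k t))"
proof (rule cperI)
  show "continuous_on UNIV (\<lambda>t. x (circ k t))"
    unfolding circ_def by (cases "det k = 1") (auto intro!: cper_cont_comp[OF assms] continuous_intros)
  fix t
  have "x (t + 2 * pi + angle2 k) = x (t + angle2 k)" "x (- (t + 2 * pi + angle2 k)) = x (- (t + angle2 k))"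
    using cper_int[OF assms, of "t + angle2 k" 1] cper_int[OF assms, of "- (t + angle2 k)" "-1"]
    by (simp_all add: algebra_simps)
  then show "x (circ k (t + 2 * pi)) = x (circ k t)" by (simp add: circ_def)
qed

lemma act_fun_cper: "cper x \<Longrightarrow> cper (act_fun g x)"
  unfolding act_fun_def[abs_def] by (intro cper_linear[OF permute_vertices_linear] circ_cper)

lemma harmonic_circ:
  assumes "cper x" shows "harmonic k (\<lambda>t. x (circ A t)) t = harmonic k x (circ A t)"
proof (cases "det A = 1")
  case True
  then show ?thesis by (simp add: circ_def harmonic_shift[OF assms])
next
  case False
  have "cper (\<lambda>t. x (- t))"
  proof (rule cperI)
    show "continuous_on UNIV (\<lambda>t. x (- t))" by (intro cper_cont_comp[OF assms] continuous_intros)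
    show "x (- (t + 2 * pi)) = x (- t)" for t using cper_int[OF assms, of "- t" "-1"] by (simp add: algebra_simps)
  qed
  from harmonic_shift[OF this, of k "angle2 A" t] show ?thesis
    using False by (simp add: circ_def harmonic_reflect[OF assms])
qed

lemma harmonic_act_fun: "cper x \<Longrightarrow> harmonic k (act_fun g x) t = act_fun g (harmonic k x) t"
  unfolding act_fun_def[abs_def] by (simp add: harmonic_linear[OF permute_vertices_linear circ_cper] harmonic_circ)

lemma kerproj_act_fun:
  assumes "fst g \<in> carrier cube_group" "cper x" shows "kerproj (act_fun g x) = act_fun g (kerproj x)"
  by (rule ext) (simp add: kerproj_def harmonic_act_fun[OF assms(2)] act_fun_def eig_proj_permute[OF assms(1)])

lemma act_fun_add: "act_fun g (\<lambda>t. x t + y t) = (\<lambda>t. act_fun g x t + act_fun g y t)"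
  and act_fun_scaleR: "act_fun g (\<lambda>t. c *\<^sub>R x t) = (\<lambda>t. c *\<^sub>R act_fun g x t)"
  by (simp_all add: act_fun_def fun_eq_iff permute_vertices_def vec_eq_iff)

lemma solop_act_fun:
  assumes ell: "elliptic c1 c2 \<kappa> \<alpha>" and f: "cper f" and g: "fst g \<in> carrier cube_group"
  shows "solop c1 c2 \<alpha> (act_fun g f) = act_fun g (solop c1 c2 \<alpha> f)"
proof (rule harmonic_eqI)
  have fg: "cper (act_fun g f)" by (rule act_fun_cper[OF f])
  have sc: "cper (solop c1 c2 \<alpha> f)" by (rule solop_cper[OF ell f])
  show "cper (solop c1 c2 \<alpha> (act_fun g f))" by (rule solop_cper[OF ell fg])
  show "cper (act_fun g (solop c1 c2 \<alpha> f))" by (rule act_fun_cper[OF sc])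
  fix k t
  interpret P: bounded_linear "permute_vertices (fst g)" by (rule permute_vertices_linear)
  have "harmonic k (solop c1 c2 \<alpha> (act_fun g f)) t = (\<Sum>l<4. solweight c1 c2 \<alpha> l k *\<^sub>R (eig_proj l *v act_fun g (harmonic k f) t))"
    unfolding harmonic_solop[OF ell fg] harmonic_act_fun[OF f] ..
  also have "\<dots> = act_fun g (harmonic k (solop c1 c2 \<alpha> f)) t"
    by (simp add: act_fun_def harmonic_solop[OF ell f] eig_proj_permute[OF g] P.sum P.scaleR)
  finally show "harmonic k (solop c1 c2 \<alpha> (act_fun g f)) t = harmonic k (act_fun g (solop c1 c2 \<alpha> f)) t"
    unfolding harmonic_act_fun[OF sc] .
qed

section \<open>Symmetric functions and fixed-point spaces\<close>

definition symf :: "((8 \<Rightarrow> 8) \<times> (real ^ 2 ^ 2)) set \<Rightarrow> (real \<Rightarrow> real ^ 8) \<Rightarrow> bool" where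
  "symf H x \<longleftrightarrow> (\<forall>g\<in>H. act_fun g x = x)"

lemma symf_add: "symf H x \<Longrightarrow> symf H y \<Longrightarrow> symf H (\<lambda>t. x t + y t)"
  and symf_scaleR: "symf H x \<Longrightarrow> symf H (\<lambda>t. c *\<^sub>R x t)"
  by (simp_all add: symf_def act_fun_add act_fun_scaleR)

lemma symf_limit:
  assumes "\<And>n. symf H (f n)" "\<And>t. (\<lambda>n. f n t) \<longlonglongrightarrow> x t" shows "symf H x"
  unfolding symf_def
proof (intro ballI ext)
  fix g t assume "g \<in> H"
  then have "act_fun g (f n) t = f n t" for n using assms(1) by (simp add: symf_def)
  moreover have "(\<lambda>n. act_fun g (f n) t) \<longlonglongrightarrow> act_fun g x t"
    unfolding act_fun_def by (intro bounded_linear.tendsto[OF permute_vertices_linear] assms(2))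
  ultimately show "act_fun g x t = x t" using assms(2)[of t] LIMSEQ_unique by fastforce
qed

lemma fst_h1_fun_act: "(\<lambda>t. fst (h1_fun (act g u) t)) = act_fun g (\<lambda>t. fst (h1_fun u t))"
  by (rule ext) (simp add: act.rep_eq act_fun_def circ_def circle_act_def Let_def)

lemma symf_if_fixed: "u \<in> fixed_points H \<Longrightarrow> symf H (\<lambda>t. fst (h1_fun u t))"
  unfolding symf_def fixed_points_def by (auto simp: fst_h1_fun_act[symmetric])

text \<open>Differentiating the invariance of \<open>x\<close> along the time change gives that of
  \<open>y\<close>, up to the derivative \<sigma> of the time change; this is exactly the sign in
  the action of a reflection.\<close>

lemma fixed_points_h1_of:
  assumes C: "C2per x y z" and S: "symf H x" shows "h1_of x y \<in> fixed_points H"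
  unfolding fixed_points_def
proof (intro CollectI ballI)
  fix g assume g: "g \<in> H"
  let ?P = "permute_vertices (fst g)"
  define \<sigma> :: real where "\<sigma> = (if det (snd g) = 1 then 1 else -1)"
  have x: "?P (x (circ (snd g) t)) = x t" for t
    using S g unfolding symf_def by (auto simp: act_fun_def dest!: fun_cong)
  have xd: "(x has_vector_derivative y t) (at t)" for t using C by (simp add: C2per_def)
  have "(circ (snd g) has_vector_derivative \<sigma>) (at t)" for t
    unfolding circ_def[abs_def] \<sigma>_def by (cases "det (snd g) = 1") (auto intro!: derivative_eq_intros)
  from vector_diff_chain_at[OF this xd]
  have "((\<lambda>t. x (circ (snd g) t)) has_vector_derivative \<sigma> *\<^sub>R y (circ (snd g) t)) (at t)" for t
    by (simp add: o_def)
  from bounded_linear.has_vector_derivative[OF permute_vertices_linear this, of "fst g"]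
  have "(x has_vector_derivative ?P (\<sigma> *\<^sub>R y (circ (snd g) t))) (at t)" for t by (simp add: x)
  then have y: "?P (\<sigma> *\<^sub>R y (circ (snd g) t)) = y t" for t
    using vector_derivative_unique_at xd by blast
  have "h1_fun (act g (h1_of x y)) t = h1_fun (h1_of x y) t" for t
    using x[of t] y[of t]
    by (cases "det (snd g) = 1")
      (simp_all add: act.rep_eq h1_fun_h1_of[OF C] circle_act_def Let_def circ_def \<sigma>_def)
  then show "act g (h1_of x y) = h1_of x y" by (simp add: h1_fun_inject[symmetric] fun_eq_iff)
qed

lemma h1_fun_tendsto:
  assumes "u \<longlonglongrightarrow> (w :: 'a::euclidean_space h1)" shows "(\<lambda>n. h1_fun (u n) t) \<longlonglongrightarrow> h1_fun w t"
proof -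
  have "(\<lambda>n. (2 + 2 * pi) * norm (u n - w)) \<longlonglongrightarrow> 0"
    by (intro tendsto_mult_right_zero tendsto_norm_zero) (use assms in \<open>simp add: LIM_zero_iff\<close>)
  then have "(\<lambda>n. h1_fun (u n - w) t) \<longlonglongrightarrow> 0"
    by (rule Lim_null_comparison[rotated]) (simp add: h1_sup_bound)
  then show ?thesis by (simp add: minus_h1.rep_eq LIM_zero_iff)
qed

lemma closed_fixed_points: "closed (fixed_points H)"
  unfolding closed_sequential_limits
proof (intro allI impI)
  fix u w assume u: "(\<forall>n. u n \<in> fixed_points H) \<and> u \<longlonglongrightarrow> w"
  have "act g w = w" if "g \<in> H" for g
  proof -
    have "h1_fun (act g w) t = h1_fun w t" for t
    proof -
      let ?P = "permute_vertices (fst g)"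
      have eq: "act g (u n) = u n" for n using u that by (auto simp: fixed_points_def)
      have "(\<lambda>n. h1_fun (act g (u n)) t) \<longlonglongrightarrow> h1_fun (act g w) t"
        using u unfolding act.rep_eq circle_act_def Let_def map_prod_def split_beta
        by (cases "det (snd g) = 1")
          (auto intro!: tendsto_intros bounded_linear.tendsto[OF permute_vertices_linear] h1_fun_tendsto)
      then have "(\<lambda>n. h1_fun (u n) t) \<longlonglongrightarrow> h1_fun (act g w) t" unfolding eq .
      then show ?thesis using h1_fun_tendsto[of u w t] u LIMSEQ_unique by blast
    qed
    then show ?thesis by (simp add: h1_fun_inject[symmetric] fun_eq_iff)
  qed
  then show "w \<in> fixed_points H" by (simp add: fixed_points_def)
qed

lemma is_branch_subset:
  assumes "is_branch c1 c2 q \<alpha>o \<rho> r F C" "closed F" shows "C \<subseteq> UNIV \<times> F"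
proof -
  have "C \<subseteq> closure {(\<alpha>, u) \<in> bif_nbhd \<alpha>o \<rho> r \<inter> solutions c1 c2 q. u \<noteq> 0 \<and> u \<in> F}"
    using assms(1) in_components_subset by (auto simp: is_branch_def)
  also have "\<dots> \<subseteq> UNIV \<times> F"
    by (intro closure_minimal closed_Times assms(2)) auto
  finally show ?thesis .
qed


subsection \<open>The rescaled nonlinearity\<close>

text \<open>At \<open>\<epsilon> * r = 0\<close> the quotient is \<open>q 0 / 0 = 0\<close>, which is the value \<open>q'(0)\<close> of its continuous extension.\<close>

definition quot :: "(real \<Rightarrow> real) \<Rightarrow> real \<Rightarrow> real \<Rightarrow> real" where
  "quot q \<epsilon> r = r * (q (\<epsilon> * r) / (\<epsilon> * r))"

definition scnem :: "(real \<Rightarrow> real) \<Rightarrow> real \<Rightarrow> (real \<Rightarrow> real ^ 8) \<Rightarrow> real \<Rightarrow> real ^ 8" where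
  "scnem q \<epsilon> y t = (\<chi> i. quot q \<epsilon> (y t $ i))"

lemma scnem_act_fun: "scnem q \<epsilon> (act_fun g y) = act_fun g (scnem q \<epsilon> y)"
  by (rule ext) (simp add: scnem_def act_fun_def permute_vertices_def vec_eq_iff)

lemma scnem_0: "scnem q 0 y = (\<lambda>_. 0)"
  by (rule ext) (simp add: scnem_def quot_def vec_eq_iff)

context cube_system
begin

text \<open>The quotient \<open>q s / s\<close> with value \<open>0\<close> at \<open>0\<close> is
  continuous at \<open>0\<close> because \<open>q'(0) = 0\<close>. So the rescaled nonlinearity is
  continuous jointly in amplitude and argument, down to amplitude \<open>0\<close>.\<close>

lemma quot_cont: "continuous_on UNIV (\<lambda>p. quot q (fst p) (snd p))"
proof -
  have "isCont (\<lambda>s. q s / s) s" for s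
  proof (cases "s = 0")
    case True
    then show ?thesis using q_deriv q_0 by (simp add: isCont_def DERIV_def)
  next
    case False
    moreover have "isCont q s" using q_cont by (simp add: continuous_on_eq_continuous_at)
    ultimately show ?thesis by (intro continuous_intros) auto
  qed
  then have h: "continuous_on UNIV (\<lambda>s. q s / s)" by (simp add: continuous_at_imp_continuous_on)
  show ?thesis unfolding quot_def
    by (intro continuous_on_mult continuous_on_compose2[OF h] continuous_intros) auto
qed

lemma nem_eq_scnem: "nem q (\<lambda>t. \<epsilon> *\<^sub>R y t) = (\<lambda>t. \<epsilon> *\<^sub>R scnem q \<epsilon> y t)"
  by (rule ext) (auto simp: nem_def scnem_def quot_def vec_eq_iff q_0)

lemma scnem_cper:
  assumes "cper y" shows "cper (scnem q \<epsilon> y)"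
proof (rule cperI)
  have "continuous_on UNIV (\<lambda>t. quot q \<epsilon> (y t $ i))" for i
    using continuous_on_compose2[OF quot_cont, of UNIV "\<lambda>t. (\<epsilon>, y t $ i)"]
    by (simp add: continuous_on_Pair continuous_on_component cper_cont[OF assms])
  then show "continuous_on UNIV (scnem q \<epsilon> y)"
    unfolding scnem_def[abs_def] by (intro continuous_on_vec_lambda)
  show "scnem q \<epsilon> y (t + 2 * pi) = scnem q \<epsilon> y t" for t using assms by (simp add: scnem_def cper_def)
qed

lemma scnem_uniform_limit:
  assumes \<epsilon>: "\<And>n. \<epsilon> n \<in> {0..E}" "\<epsilon> \<longlonglongrightarrow> e" and l: "uniform_limit UNIV Y y sequentially"
    and M: "\<And>n t. norm (Y n t) \<le> M" "\<And>t. norm (y t) \<le> M"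
  shows "uniform_limit UNIV (\<lambda>n. scnem q (\<epsilon> n) (Y n)) (scnem q e y) sequentially"
proof (rule uniform_limitI)
  fix \<eta> :: real assume "\<eta> > 0"
  have e: "e \<in> {0..E}" by (rule closed_sequentially[OF _ \<epsilon>]) simp
  have "uniformly_continuous_on ({0..E} \<times> {- M..M}) (\<lambda>p. quot q (fst p) (snd p))"
    by (intro compact_uniformly_continuous continuous_on_subset[OF quot_cont] compact_Times) auto
  then obtain d where d: "d > 0" "\<And>p p'. p \<in> {0..E} \<times> {- M..M} \<Longrightarrow> p' \<in> {0..E} \<times> {- M..M} \<Longrightarrow> dist p' p < d \<Longrightarrow>
      dist (quot q (fst p') (snd p')) (quot q (fst p) (snd p)) < \<eta> / 16"
    using \<open>\<eta> > 0\<close> unfolding uniformly_continuous_on_def by (metis zero_less_divide_iff zero_less_numeral)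
  have "\<forall>\<^sub>F n in sequentially. dist (\<epsilon> n) e < d / 2" using \<epsilon>(2) d(1) by (intro tendstoD) auto
  moreover have "\<forall>\<^sub>F n in sequentially. \<forall>t\<in>UNIV. dist (Y n t) (y t) < d / 2" using l d(1) by (intro uniform_limitD) auto
  ultimately show "\<forall>\<^sub>F n in sequentially. \<forall>t\<in>UNIV. dist (scnem q (\<epsilon> n) (Y n) t) (scnem q e y t) < \<eta>"
  proof eventually_elim
    case (elim n)
    show ?case
    proof
      fix t
      have "\<bar>(scnem q (\<epsilon> n) (Y n) t - scnem q e y t) $ i\<bar> \<le> \<eta> / 16" for i
      proof -
        have r: "Y n t $ i \<in> {- M..M}" "y t $ i \<in> {- M..M}"
          using component_le_norm_cart[of "Y n t" i] M(1)[of n t] component_le_norm_cart[of "y t" i] M(2)[of t]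
          by (auto simp: abs_le_iff)
        have "\<bar>Y n t $ i - y t $ i\<bar> \<le> dist (Y n t) (y t)"
          using component_le_norm_cart[of "Y n t - y t" i] by (simp add: dist_norm)
        then have "dist (Y n t $ i) (y t $ i) \<le> dist (Y n t) (y t)" by (simp add: dist_real_def)
        moreover have "dist (Y n t) (y t) < d / 2" using elim(2) by simp
        ultimately have "dist (\<epsilon> n) e + dist (Y n t $ i) (y t $ i) < d" using elim(1) by linarith
        moreover have "dist (\<epsilon> n, Y n t $ i) (e, y t $ i) \<le> dist (\<epsilon> n) e + dist (Y n t $ i) (y t $ i)"
          unfolding dist_Pair_Pair by (rule sqrt_sum_squares_le_sum) auto
        ultimately have "dist (\<epsilon> n, Y n t $ i) (e, y t $ i) < d" by linarith
        from d(2)[OF _ _ this] show ?thesis using r \<epsilon>(1)[of n] e by (simp add: scnem_def dist_real_def)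
      qed
      from norm_vec8_le[OF this] show "dist (scnem q (\<epsilon> n) (Y n) t) (scnem q e y t) < \<eta>"
        using \<open>\<eta> > 0\<close> by (simp add: dist_norm)
    qed
  qed
qed

lemma scnem_small:
  assumes "\<eta> > 0" obtains d where "d > 0"
    "\<And>\<epsilon> y t. \<epsilon> \<ge> 0 \<Longrightarrow> norm (y t) \<le> M \<Longrightarrow> \<epsilon> * M \<le> d \<Longrightarrow> norm (scnem q \<epsilon> y t) \<le> \<eta> * M"
proof -
  obtain d where d: "d > 0" "\<And>r. \<bar>r\<bar> \<le> d \<Longrightarrow> \<bar>q r\<bar> \<le> \<eta> / 8 * \<bar>r\<bar>"
    by (rule q_small[of "\<eta> / 8"]) (use assms in auto)
  show thesis
  proof (rule that[OF d(1)])
    fix \<epsilon> t and y :: "real \<Rightarrow> real ^ 8" assume \<epsilon>: "\<epsilon> \<ge> 0" "norm (y t) \<le> M" "\<epsilon> * M \<le> d"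
    have "\<bar>scnem q \<epsilon> y t $ i\<bar> \<le> \<eta> / 8 * M" for i
    proof -
      define r where "r = y t $ i"
      have r: "\<bar>r\<bar> \<le> M" using component_le_norm_cart[of "y t" i] \<epsilon>(2) by (simp add: r_def)
      then have "\<bar>\<epsilon> * r\<bar> \<le> d" using mult_left_mono[OF r \<epsilon>(1)] \<epsilon> by (simp add: abs_mult)
      then have "\<bar>q (\<epsilon> * r)\<bar> \<le> \<eta> / 8 * \<bar>\<epsilon> * r\<bar>" by (rule d(2))
      then have "\<bar>q (\<epsilon> * r) / (\<epsilon> * r)\<bar> \<le> \<eta> / 8"
        using assms by (cases "\<epsilon> * r = 0") (auto simp: abs_divide divide_le_eq simp del: mult_eq_0_iff)
      then have "\<bar>r\<bar> * \<bar>q (\<epsilon> * r) / (\<epsilon> * r)\<bar> \<le> M * (\<eta> / 8)" using r by (intro mult_mono) auto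
      moreover have "\<bar>scnem q \<epsilon> y t $ i\<bar> = \<bar>r\<bar> * \<bar>q (\<epsilon> * r) / (\<epsilon> * r)\<bar>"
        by (simp only: scnem_def vec_lambda_beta quot_def r_def abs_mult)
      ultimately show ?thesis by (simp only: mult.commute[of M])
    qed
    from norm_vec8_le[OF this] show "norm (scnem q \<epsilon> y t) \<le> \<eta> * M" by simp
  qed
qed

text \<open>The continuum is controlled in the sup norm, the neighbourhood of the bifurcation point
  in the Sobolev norm. For solutions the equation bounds the latter by the former.\<close>

lemma small_norm:
  assumes "r > 0"
  obtains d where "d > 0" "\<And>\<alpha> x y. C2per x y (solrhs c1 c2 q \<alpha> x) \<Longrightarrow> (\<And>t. norm (x t) \<le> d) \<Longrightarrow> norm (h1_of x y) < r"
proof -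
  obtain R where R: "R > 0" "\<And>\<alpha> x M t. cper x \<Longrightarrow> (\<And>s. norm (x s) \<le> M) \<Longrightarrow> norm (linrhs c1 c2 \<alpha> x t) \<le> R * M"
    by (rule linrhs_bound[of c1 c2]) auto
  obtain d1 where d1: "d1 > 0" "\<And>x t. norm (x t) \<le> d1 \<Longrightarrow> norm (nem q x t) \<le> 1 * norm (x t)"
    by (rule nem_small[of 1]) auto
  define K where "K = 1 + (2 * pi + 1) * (R + 1)"
  have K: "K > 0" using R(1) by (auto simp: K_def intro!: add_pos_pos mult_pos_pos)
  show thesis
  proof (rule that)
    show d0: "0 < min d1 (r / (8 * K))" using d1 assms K by simp
    fix \<alpha> x y assume C: "C2per x y (solrhs c1 c2 q \<alpha> x)" and x: "\<And>t. norm (x t) \<le> min d1 (r / (8 * K))"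
    define d where "d = min d1 (r / (8 * K))"
    have xd: "norm (x t) \<le> d" for t using x by (simp add: d_def)
    have "norm (solrhs c1 c2 q \<alpha> x t) \<le> R * d + d" for t
      unfolding solrhs_def
    proof (intro norm_triangle_le add_mono)
      show "norm (linrhs c1 c2 \<alpha> x t) \<le> R * d" by (rule R(2)[OF _ xd]) (use C in \<open>simp add: C2per_def\<close>)
      have "norm (x t) \<le> d1" using x[of t] by simp
      from d1(2)[of x t, OF this] show "norm (nem q x t) \<le> d" using xd[of t] by simp
    qed
    then have z: "norm (solrhs c1 c2 q \<alpha> x t) \<le> (R + 1) * d" for t by (simp add: distrib_right)
    have y: "norm (y t) \<le> 2 * pi * ((R + 1) * d)" for t by (rule C2per_deriv_bound[OF C z])
    have dd: "0 < d" "d \<le> r / (8 * K)" using d0 by (simp_all add: d_def)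
    have Kd: "K * d = d + 2 * pi * ((R + 1) * d) + (R + 1) * d" by (simp add: K_def algebra_simps)
    have "norm (h1_of x y) \<le> 4 * (K * d)"
    proof (rule norm_h1_le)
      show "has_L2_deriv (h1_fun (h1_of x y)) (\<lambda>t. (y t, solrhs c1 c2 q \<alpha> x t))"
        unfolding h1_fun_h1_of[OF C] by (rule C2per_has_L2_deriv[OF C])
      have pos: "0 \<le> (R + 1) * d" "0 \<le> 2 * pi * ((R + 1) * d)" using dd(1) R(1) by simp_all
      fix t
      have "norm (x t, y t) \<le> norm (x t) + norm (y t)" by (rule norm_Pair_le)
      then show "norm (h1_fun (h1_of x y) t) \<le> K * d"
        unfolding h1_fun_h1_of[OF C] Kd using xd[of t] y[of t] pos by linarith
      have "norm (y t, solrhs c1 c2 q \<alpha> x t) \<le> norm (y t) + norm (solrhs c1 c2 q \<alpha> x t)" by (rule norm_Pair_le)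
      then show "norm (y t, solrhs c1 c2 q \<alpha> x t) \<le> K * d"
        unfolding Kd using z[of t] y[of t] dd(1) by linarith
    qed
    also have "4 * (K * d) \<le> r / 2" using dd K by (simp add: field_simps)
    finally show "norm (h1_of x y) < r" using assms by simp
  qed
qed

end

subsection \<open>Continua of symmetric solutions\<close>

text \<open>The compact convex set for Schauder's theorem, in the sup norm: compact by
  Arzela-Ascoli, and invariant under the reduced map once its data are small. The symmetry is built
  in, so that the fixed points found are symmetric.\<close>

definition lipschitz_ball :: "((8 \<Rightarrow> 8) \<times> (real ^ 2 ^ 2)) set \<Rightarrow> (real \<Rightarrow>\<^sub>C (real ^ 8)) set" where
  "lipschitz_ball H = {z. cper (apply_bcontfun z) \<and> (\<forall>t. norm (apply_bcontfun z t) \<le> 1) \<and>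
     (\<forall>s t. norm (apply_bcontfun z s - apply_bcontfun z t) \<le> \<bar>s - t\<bar>) \<and> symf H (apply_bcontfun z)}"

lemma lipschitz_ball_compact: "compact (lipschitz_ball H)"
  unfolding compact_eq_seq_compact_metric seq_compact_def
proof (intro allI impI)
  fix p :: "nat \<Rightarrow> real \<Rightarrow>\<^sub>C (real ^ 8)" assume p: "\<forall>n. p n \<in> lipschitz_ball H"
  have pp: "cper (apply_bcontfun (p n))" "norm (apply_bcontfun (p n) t) \<le> 1"
    "norm (apply_bcontfun (p n) s - apply_bcontfun (p n) t) \<le> 1 * \<bar>s - t\<bar>" "symf H (apply_bcontfun (p n))" for n s t
    using p by (auto simp: lipschitz_ball_def)
  obtain k g where k: "strict_mono (k :: nat \<Rightarrow> nat)" and g: "uniform_limit UNIV (\<lambda>n. apply_bcontfun (p (k n))) g sequentially"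
    by (rule periodic_Arzela_Ascoli[of "\<lambda>n. apply_bcontfun (p n)" 1 1, OF pp(1,2,3)])
  have gt: "(\<lambda>n. apply_bcontfun (p (k n)) t) \<longlonglongrightarrow> g t" for t
    by (rule tendsto_uniform_limitI[OF g]) simp
  have gc: "cper g" by (rule cper_uniform_limit[OF pp(1) g])
  have g1: "norm (g t) \<le> 1" for t
    by (rule Lim_norm_ubound[OF trivial_limit_sequentially gt]) (simp add: pp)
  have gl: "norm (g s - g t) \<le> \<bar>s - t\<bar>" for s t
    by (rule Lim_norm_ubound[OF trivial_limit_sequentially tendsto_diff[OF gt gt]]) (use pp(3) in simp)
  have gs: "symf H g" by (rule symf_limit[OF pp(4) gt])
  have "g \<in> bcontfun" by (rule bcontfun_normI[OF cper_cont[OF gc] g1])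
  then obtain z where z: "g = apply_bcontfun z" by (rule bcontfunE)
  have "(p \<circ> k) \<longlonglongrightarrow> z" using g uniform_limit_tendsto_bcontfun[of "p \<circ> k" z] by (simp add: z o_def)
  moreover have "z \<in> lipschitz_ball H" using gc g1 gl gs by (simp add: lipschitz_ball_def z)
  ultimately show "\<exists>l\<in>lipschitz_ball H. \<exists>k. strict_mono k \<and> (p \<circ> k) \<longlonglongrightarrow> l" using k by blast
qed

lemma lipschitz_ball_convex: "convex (lipschitz_ball H)"
proof (rule convexI)
  fix x y :: "real \<Rightarrow>\<^sub>C (real ^ 8)" and u v :: real
  assume xy: "x \<in> lipschitz_ball H" "y \<in> lipschitz_ball H" and uv: "0 \<le> u" "0 \<le> v" "u + v = 1"
  have comb: "norm (u *\<^sub>R a + v *\<^sub>R b) \<le> c" if "norm a \<le> c" "norm b \<le> c" for a b :: "real ^ 8" and c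
  proof -
    have "norm (u *\<^sub>R a + v *\<^sub>R b) \<le> u * norm a + v * norm b" using uv by (intro norm_triangle_le) simp
    also have "\<dots> \<le> u * c + v * c" using that uv by (intro add_mono mult_left_mono) auto
    also have "\<dots> = (u + v) * c" by (simp only: distrib_right)
    finally show ?thesis by (simp add: uv(3))
  qed
  have ap: "apply_bcontfun (u *\<^sub>R x + v *\<^sub>R y) = (\<lambda>t. u *\<^sub>R apply_bcontfun x t + v *\<^sub>R apply_bcontfun y t)"
    by (simp add: plus_bcontfun.rep_eq scaleR_bcontfun.rep_eq fun_eq_iff)
  have lip: "norm (u *\<^sub>R apply_bcontfun x s + v *\<^sub>R apply_bcontfun y s - (u *\<^sub>R apply_bcontfun x t + v *\<^sub>R apply_bcontfun y t)) \<le> \<bar>s - t\<bar>" for s t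
  proof -
    have "u *\<^sub>R apply_bcontfun x s + v *\<^sub>R apply_bcontfun y s - (u *\<^sub>R apply_bcontfun x t + v *\<^sub>R apply_bcontfun y t)
        = u *\<^sub>R (apply_bcontfun x s - apply_bcontfun x t) + v *\<^sub>R (apply_bcontfun y s - apply_bcontfun y t)"
      by (simp add: scaleR_diff_right)
    then show ?thesis using comb xy by (simp add: lipschitz_ball_def)
  qed
  show "u *\<^sub>R x + v *\<^sub>R y \<in> lipschitz_ball H"
    unfolding lipschitz_ball_def mem_Collect_eq ap
    using xy lip by (auto simp: lipschitz_ball_def intro!: cper_add cper_scaleR symf_add symf_scaleR comb)
qed

lemma lipschitz_ball_0: "0 \<in> lipschitz_ball H"
proof -
  have "act_fun g (\<lambda>_. 0) = (\<lambda>_. 0)" for g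
    by (rule ext) (simp add: act_fun_def permute_vertices_def vec_eq_iff)
  then show ?thesis by (simp add: lipschitz_ball_def zero_bcontfun.rep_eq cper_const symf_def)
qed

lemma uniform_limitI_le:
  assumes "\<And>e. e > 0 \<Longrightarrow> \<forall>\<^sub>F n in sequentially. \<forall>t. norm (f n t - g t) \<le> e"
  shows "uniform_limit UNIV f (g :: real \<Rightarrow> 'a::real_normed_vector) sequentially"
proof (rule uniform_limitI)
  fix e :: real assume "e > 0"
  then have "\<forall>\<^sub>F n in sequentially. \<forall>t. norm (f n t - g t) \<le> e / 2" by (intro assms) simp
  then show "\<forall>\<^sub>F n in sequentially. \<forall>t\<in>UNIV. dist (f n t) (g t) < e"
  proof eventually_elim
    case (elim n)
    show ?case
    proof
      fix t
      have "norm (f n t - g t) \<le> e / 2" using elim by blast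
      then show "dist (f n t) (g t) < e" using \<open>e > 0\<close> by (simp add: dist_norm)
    qed
  qed
qed

text \<open>All that the construction of a branch asks of a subgroup: the fixed part of the kernel
  is the line through \<open>e\<close>. The twelve subgroups enter only through these
  conditions.\<close>

locale symmetric_direction = cube_system +
  fixes H :: "((8 \<Rightarrow> 8) \<times> (real ^ 2 ^ 2)) set" and e :: "real \<Rightarrow> real ^ 8"
  assumes H: "g \<in> H \<Longrightarrow> fst g \<in> carrier cube_group"
    and kerproj_e: "kerproj e = e" and e_nz: "\<exists>t. e t \<noteq> 0" and symf_e: "symf H e"
    and one_dim: "kerproj x = x \<Longrightarrow> symf H x \<Longrightarrow> \<exists>c. x = (\<lambda>t. c *\<^sub>R e t)"
begin

lemma e_cper: "cper e"
  using kerproj_cper[of e] by (simp add: kerproj_e)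

lemma harmonic_e: "harmonic 1 e = e"
  using harmonic_kerproj[of 1 e] by (simp add: kerproj_e fun_eq_iff)

lemma e_C2per: obtains e' where "C2per e e' (\<lambda>t. - e t)"
  using harmonic_C2per[of 1 e] unfolding harmonic_e by simp

lemma linrhs_e: "linrhs c1 c2 \<alpha> e t = (symb c1 c2 1 1 \<alpha> - 1) *\<^sub>R e t"
proof -
  have "cube_coupling *v e t = (- 2) *\<^sub>R e t"
    using coupling_eig_vec[of 1 "harmonic 1 e t"] kerproj_e by (simp add: kerproj_def fun_eq_iff)
  moreover have "gconv \<alpha> e t = exp (- \<alpha>\<^sup>2 / 2) *\<^sub>R e t"
    using gconv_harmonic[of \<alpha> 1 e t] unfolding harmonic_e by simp
  ultimately show ?thesis by (simp add: linrhs_def symb_def algebra_simps)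
qed

lemma symf_scnem: "symf H y \<Longrightarrow> symf H (scnem q \<epsilon> y)"
  by (auto simp: symf_def scnem_act_fun[symmetric])

lemma symf_solop: "elliptic c1 c2 \<kappa> \<alpha> \<Longrightarrow> cper f \<Longrightarrow> symf H f \<Longrightarrow> symf H (solop c1 c2 \<alpha> f)"
  using H by (auto simp: symf_def solop_act_fun[symmetric])

lemma symf_kerproj: "cper f \<Longrightarrow> symf H f \<Longrightarrow> symf H (kerproj f)"
  using H by (auto simp: symf_def kerproj_act_fun[symmetric])

text \<open>\<open>solop\<close> solves the equation up to the kernel part
  \<open>kerproj g = l e\<close>. Since \<open>linrhs e = - e - l e\<close> when the critical symbol
  equals \<open>- l\<close>, the kernel direction itself supplies the missing term.\<close>

lemma solution_from_fixpoint:
  assumes ell: "elliptic c1 c2 \<kappa> \<alpha>" and g: "cper g" and z: "z = solop c1 c2 \<alpha> g"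
    and l: "kerproj g = (\<lambda>t. l *\<^sub>R e t)" "symb c1 c2 1 1 \<alpha> = - l" and nl: "g = scnem q \<epsilon> (\<lambda>t. e t + z t)"
  defines "x \<equiv> \<lambda>t. \<epsilon> *\<^sub>R (e t + z t)"
  obtains x' where "C2per x x' (solrhs c1 c2 q \<alpha> x)" "kerproj x = (\<lambda>t. \<epsilon> *\<^sub>R e t)"
proof -
  obtain w where w: "C2per z w (\<lambda>t. linrhs c1 c2 \<alpha> z t + (g t - kerproj g t))"
    unfolding z by (rule solop_solves[OF ell g])
  obtain e' where e': "C2per e e' (\<lambda>t. - e t)" by (rule e_C2per)
  have zc: "cper z" unfolding z by (rule solop_cper[OF ell g])
  have yc: "cper (\<lambda>t. e t + z t)" by (intro cper_add e_cper zc)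
  have xc: "cper x" unfolding x_def by (intro cper_scaleR yc)
  have rhs: "solrhs c1 c2 q \<alpha> x = (\<lambda>t. \<epsilon> *\<^sub>R (- e t + (linrhs c1 c2 \<alpha> z t + (g t - kerproj g t))))"
  proof
    fix t
    have "linrhs c1 c2 \<alpha> (\<lambda>t. e t + z t) t = linrhs c1 c2 \<alpha> e t + linrhs c1 c2 \<alpha> z t"
      by (simp add: linrhs_def gconv_add e_cper zc matrix_vector_right_distrib algebra_simps)
    also have "linrhs c1 c2 \<alpha> e t = - e t - l *\<^sub>R e t" unfolding linrhs_e l(2) by (simp add: algebra_simps)
    finally have "linrhs c1 c2 \<alpha> x t = \<epsilon> *\<^sub>R (- e t - l *\<^sub>R e t + linrhs c1 c2 \<alpha> z t)"
      unfolding x_def by (simp only: linrhs_scaleR[OF yc])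
    moreover have "nem q x t = \<epsilon> *\<^sub>R g t" unfolding x_def nem_eq_scnem nl[symmetric] ..
    ultimately show "solrhs c1 c2 q \<alpha> x t = \<epsilon> *\<^sub>R (- e t + (linrhs c1 c2 \<alpha> z t + (g t - kerproj g t)))"
      by (simp add: solrhs_def l(1) algebra_simps)
  qed
  have "C2per x (\<lambda>t. \<epsilon> *\<^sub>R (e' t + w t)) (solrhs c1 c2 q \<alpha> x)"
    unfolding rhs unfolding x_def C2per_def
    by (intro conjI allI cper_scaleR cper_add linrhs_cper cper_diff kerproj_cper g zc e_cper has_vector_derivative_add
        bounded_linear.has_vector_derivative[OF bounded_linear_scaleR_right])
      (use e' w in \<open>simp_all add: C2per_def\<close>)
  moreover have "kerproj x = (\<lambda>t. \<epsilon> *\<^sub>R e t)"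
  proof
    fix t
    have "kerproj z t = 0" unfolding z by (simp add: kerproj_solop[OF ell g])
    moreover have "kerproj x t = \<epsilon> *\<^sub>R (kerproj e t + kerproj z t)"
      unfolding x_def kerproj_def
      by (simp add: harmonic_scaleR[OF yc] harmonic_add[OF e_cper zc] matrix_vector_mult_scaleR matrix_vector_right_distrib)
    ultimately show "kerproj x t = \<epsilon> *\<^sub>R e t" by (simp add: kerproj_e)
  qed
  ultimately show thesis by (rule that)
qed

text \<open>The inverse of the critical symbol, from \<open>exp (- \<alpha>^2 / 2) = s - y\<close>;
  at \<open>y = 0\<close> it is the formula for \<open>\<alpha>o\<close>.\<close>

lemma parameter_function:
  assumes "\<delta> > 0"
  obtains \<mu> af where "\<mu> > 0" "continuous_on {- \<mu>..\<mu>} af" "af 0 = \<alpha>o"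
    "\<And>y. \<bar>y\<bar> \<le> \<mu> \<Longrightarrow> \<bar>af y - \<alpha>o\<bar> \<le> \<delta> \<and> symb c1 c2 1 1 (af y) = - y"
proof -
  define af where "af y = sqrt (- 2 * ln (s - y))" for y
  have ct: "isCont af y" if "y < s" for y
    unfolding af_def[abs_def] using that by (intro continuous_intros) auto
  have af0: "af 0 = \<alpha>o" by (simp add: af_def \<alpha>o s_def)
  have "af \<midarrow>0\<rightarrow> \<alpha>o" using ct[of 0] s_bounds by (simp add: isCont_def af0)
  from LIM_D[OF this assms] obtain m where m: "m > 0" "\<And>y. y \<noteq> 0 \<Longrightarrow> \<bar>y\<bar> < m \<Longrightarrow> \<bar>af y - \<alpha>o\<bar> < \<delta>" by auto
  \<comment> \<open>The first entry keeps the parameter close to \<open>\<alpha>o\<close>, the other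
    two keep \<open>s - y\<close> strictly between \<open>0\<close> and \<open>1\<close>, so that
    the logarithm is negative.\<close>
  define \<mu> where "\<mu> = min (m / 2) (min (s / 2) ((1 - s) / 2))"
  show thesis
  proof (rule that[of \<mu> af])
    show mu: "\<mu> > 0" using m(1) s_bounds by (simp add: \<mu>_def)
    show "continuous_on {- \<mu>..\<mu>} af"
      by (intro continuous_at_imp_continuous_on ballI ct) (use s_bounds in \<open>auto simp: \<mu>_def\<close>)
    show "af 0 = \<alpha>o" by (rule af0)
    fix y assume y: "\<bar>y\<bar> \<le> \<mu>"
    have "\<bar>y\<bar> < m" using y m(1) by (simp add: \<mu>_def min_def split: if_splits)
    then have 1: "\<bar>af y - \<alpha>o\<bar> \<le> \<delta>" using m(2)[of y] assms by (cases "y = 0") (auto simp: af0)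
    have sy: "0 < s - y" "s - y < 1" using y s_bounds by (auto simp: \<mu>_def)
    then have "ln (s - y) < 0" by (subst ln_less_zero_iff) auto
    then have "exp (- (af y)\<^sup>2 / 2) = s - y" using sy by (simp add: af_def)
    then show "\<bar>af y - \<alpha>o\<bar> \<le> \<delta> \<and> symb c1 c2 1 1 (af y) = - y" using 1 unfolding symb_11 by simp
  qed
qed

definition xfun :: "real \<Rightarrow> (real \<Rightarrow>\<^sub>C (real ^ 8)) \<Rightarrow> real \<Rightarrow> real ^ 8" where
  "xfun \<epsilon> z t = \<epsilon> *\<^sub>R (e t + apply_bcontfun z t)"

text \<open>
  Lyapunov-Schmidt reduction as a fixed point problem on a compact convex set: the amplitude along
  the kernel direction \<open>e\<close> is the homotopy parameter, and the parameter \<open>\<alpha>\<close> is adjusted so that the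
  kernel component of the nonlinear equation holds.
\<close>

lemma continuum:
  assumes "\<delta>1 > 0" "d2 > 0"
  obtains C0 \<epsilon>0 L where "compact C0" "connected C0" "(0, \<alpha>o, 0) \<in> C0" "\<exists>p. (1, p) \<in> C0" "\<epsilon>0 > 0"
    "\<And>\<tau> \<alpha> z. (\<tau>, \<alpha>, z) \<in> C0 \<Longrightarrow> 0 \<le> \<tau> \<and> \<bar>\<alpha> - \<alpha>o\<bar> \<le> \<delta>1"
    "\<And>\<alpha> z. (0, \<alpha>, z) \<in> C0 \<Longrightarrow> \<alpha> = \<alpha>o \<and> z = 0"
    "\<And>\<tau> \<alpha> z. (\<tau>, \<alpha>, z) \<in> C0 \<Longrightarrow> \<exists>x'. C2per (xfun (\<tau> * \<epsilon>0) z) x' (solrhs c1 c2 q \<alpha> (xfun (\<tau> * \<epsilon>0) z))"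
    "\<And>\<tau> \<alpha> z. (\<tau>, \<alpha>, z) \<in> C0 \<Longrightarrow> kerproj (xfun (\<tau> * \<epsilon>0) z) = (\<lambda>t. (\<tau> * \<epsilon>0) *\<^sub>R e t)"
    "\<And>\<tau> \<alpha> z. (\<tau>, \<alpha>, z) \<in> C0 \<Longrightarrow> symf H (xfun (\<tau> * \<epsilon>0) z)"
    "\<And>\<tau> \<alpha> z t. (\<tau>, \<alpha>, z) \<in> C0 \<Longrightarrow> norm (xfun (\<tau> * \<epsilon>0) z t) \<le> d2"
    "\<And>\<tau> \<alpha> z t s. (\<tau>, \<alpha>, z) \<in> C0 \<Longrightarrow> norm (xfun (\<tau> * \<epsilon>0) z s - xfun (\<tau> * \<epsilon>0) z t) \<le> L * \<bar>s - t\<bar>"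
proof -
  obtain \<delta> \<kappa> where \<delta>: "0 < \<delta>" "\<delta> < \<alpha>o" and ell0: "\<And>\<alpha>. \<bar>\<alpha> - \<alpha>o\<bar> \<le> \<delta> \<Longrightarrow> elliptic c1 c2 \<kappa> \<alpha>"
    by (rule elliptic_near) blast
  define \<delta>' where "\<delta>' = min \<delta> \<delta>1"
  have \<delta>': "\<delta>' > 0" using \<delta> assms by (simp add: \<delta>'_def)
  have ell: "elliptic c1 c2 \<kappa> \<alpha>" if "\<bar>\<alpha> - \<alpha>o\<bar> \<le> \<delta>'" for \<alpha> using that by (intro ell0) (simp add: \<delta>'_def)
  have \<kappa>: "\<kappa> > 0" using ell0[of \<alpha>o] \<delta>(1) by (simp add: elliptic_def)
  obtain \<mu> af where \<mu>: "\<mu> > 0" and afc: "continuous_on {- \<mu>..\<mu>} af" and af0: "af 0 = \<alpha>o"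
    and af: "\<And>y. \<bar>y\<bar> \<le> \<mu> \<Longrightarrow> \<bar>af y - \<alpha>o\<bar> \<le> \<delta>' \<and> symb c1 c2 1 1 (af y) = - y"
    by (rule parameter_function[OF \<delta>']) blast
  obtain C where C: "C > 0"
    and C1: "\<And>\<alpha> f M t. elliptic c1 c2 \<kappa> \<alpha> \<Longrightarrow> cper f \<Longrightarrow> (\<And>s. norm (f s) \<le> M) \<Longrightarrow> norm (solop c1 c2 \<alpha> f t) \<le> C * M"
    and C2: "\<And>\<alpha> f M s t. elliptic c1 c2 \<kappa> \<alpha> \<Longrightarrow> cper f \<Longrightarrow> (\<And>s. norm (f s) \<le> M) \<Longrightarrow>
       norm (solop c1 c2 \<alpha> f t - solop c1 c2 \<alpha> f s) \<le> C * M * \<bar>t - s\<bar>"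
    and C3: "\<And>\<alpha> \<beta> f g M D t. elliptic c1 c2 \<kappa> \<alpha> \<Longrightarrow> elliptic c1 c2 \<kappa> \<beta> \<Longrightarrow> cper f \<Longrightarrow> cper g \<Longrightarrow>
       (\<And>s. norm (f s) \<le> M) \<Longrightarrow> (\<And>s. norm (f s - g s) \<le> D) \<Longrightarrow>
       norm (solop c1 c2 \<alpha> f t - solop c1 c2 \<beta> g t) \<le> C * (M * \<bar>\<alpha>\<^sup>2 - \<beta>\<^sup>2\<bar> + D)"
    by (rule solop_bounds[OF \<kappa>, where ?c1.0 = c1 and ?c2.0 = c2]) (rule that; blast)
  obtain B where B: "B > 0" "\<And>l x. l < 4 \<Longrightarrow> norm (eig_proj l *v x) \<le> B * norm x" by (rule eig_proj_bound) blast
  obtain t0 where "e t0 \<noteq> 0" using e_nz by blast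
  then obtain i0 where E0: "e t0 $ i0 \<noteq> 0" by (auto simp: vec_eq_iff)
  obtain Me where Me: "\<And>t. norm (e t) \<le> Me" "Me > 0" by (rule cper_bounded[OF e_cper]) blast
  obtain e' where e': "C2per e e' (\<lambda>t. - e t)" by (rule e_C2per)
  have Le: "norm (e s - e t) \<le> 2 * pi * Me * \<bar>s - t\<bar>" for s t
    using C2per_deriv_bound[OF e', of Me] Me e'
    by (intro norm_diff_le_if_deriv_bounded[of e e']) (auto simp: C2per_def)
  define M where "M = Me + 1"
  have M: "M > 0" using Me by (simp add: M_def)
  define m where "m = min (1 / C) (\<mu> * \<bar>e t0 $ i0\<bar> / (4 * B))"
  have m: "m > 0" "C * m \<le> 1" "B * (4 * m) \<le> \<mu> * \<bar>e t0 $ i0\<bar>"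
    using C B(1) \<mu> E0 by (auto simp: m_def min_def field_simps)
  obtain d where d: "d > 0" "\<And>\<epsilon> y t. \<epsilon> \<ge> 0 \<Longrightarrow> norm (y t) \<le> M \<Longrightarrow> \<epsilon> * M \<le> d \<Longrightarrow> norm (scnem q \<epsilon> y t) \<le> m / M * M"
    by (rule scnem_small[of "m / M" M]) (use m(1) M in simp, blast)
  \<comment> \<open>The first entry makes the nonlinearity at most \<open>m\<close>, the second
    keeps the solutions below the prescribed size \<open>d2\<close>.\<close>
  define \<epsilon>0 where "\<epsilon>0 = min (d / M) (d2 / M)"
  have \<epsilon>0: "\<epsilon>0 > 0" using d(1) assms M by (simp add: \<epsilon>0_def)
  have \<epsilon>: "0 \<le> \<tau> * \<epsilon>0" "\<tau> * \<epsilon>0 \<le> \<epsilon>0" "\<tau> * \<epsilon>0 * M \<le> d" "\<tau> * \<epsilon>0 * M \<le> d2" if "\<tau> \<in> {0..1}" for \<tau>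
  proof -
    show 1: "0 \<le> \<tau> * \<epsilon>0" "\<tau> * \<epsilon>0 \<le> \<epsilon>0" using that \<epsilon>0 by (auto simp: mult_left_le_one_le)
    have "\<epsilon>0 * M \<le> d" "\<epsilon>0 * M \<le> d2" using M by (auto simp: \<epsilon>0_def min_def field_simps)
    then show "\<tau> * \<epsilon>0 * M \<le> d" "\<tau> * \<epsilon>0 * M \<le> d2" using mult_right_mono[OF 1(2), of M] M by linarith+
  qed
  define K where "K = {\<alpha>o - \<delta>'..\<alpha>o + \<delta>'} \<times> lipschitz_ball H"
  define G where "G \<tau> z = scnem q (\<tau> * \<epsilon>0) (\<lambda>t. e t + apply_bcontfun z t)" for \<tau> z
  \<comment> \<open>For symmetric \<open>g\<close> the kernel part is a multiple of
    \<open>e\<close>; the multiple is read off at one time and one coordinate where \<open>e\<close>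
    does not vanish.\<close>
  define amp where "amp g = kerproj g t0 $ i0 / e t0 $ i0" for g
  define F where "F p = (af (amp (G (fst p) (snd (snd p)))),
      Bcontfun (solop c1 c2 (fst (snd p)) (G (fst p) (snd (snd p)))))" for p
  have zb: "cper (apply_bcontfun z)" "norm (apply_bcontfun z t) \<le> 1"
    "norm (apply_bcontfun z s - apply_bcontfun z t) \<le> \<bar>s - t\<bar>" "symf H (apply_bcontfun z)"
    if "z \<in> lipschitz_ball H" for z s t using that by (auto simp: lipschitz_ball_def)
  have yc: "cper (\<lambda>t. e t + apply_bcontfun z t)" if "z \<in> lipschitz_ball H" for z
    by (intro cper_add e_cper zb that)
  have yM: "norm (e t + apply_bcontfun z t) \<le> M" if "z \<in> lipschitz_ball H" for z t
    unfolding M_def by (intro norm_triangle_le add_mono Me zb that)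
  have Gc: "cper (G \<tau> z)" if "z \<in> lipschitz_ball H" for \<tau> z
    unfolding G_def by (intro scnem_cper yc that)
  have Gm: "norm (G \<tau> z t) \<le> m" if "z \<in> lipschitz_ball H" "\<tau> \<in> {0..1}" for \<tau> z t
    using d(2)[where y = "\<lambda>t. e t + apply_bcontfun z t", OF \<epsilon>(1)[OF that(2)] yM[OF that(1)] \<epsilon>(3)[OF that(2)], of t] M by (simp add: G_def)
  have Gs: "symf H (G \<tau> z)" if "z \<in> lipschitz_ball H" for \<tau> z
    unfolding G_def by (intro symf_scnem symf_add symf_e zb that)
  have amp_le: "\<bar>amp g\<bar> \<le> \<mu>" if g: "cper g" "\<And>t. norm (g t) \<le> m" for g
  proof -
    have "\<bar>kerproj g t0 $ i0\<bar> \<le> norm (kerproj g t0)" by (rule component_le_norm_cart)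
    also have "\<dots> \<le> B * norm (harmonic 1 g t0)" unfolding kerproj_def by (rule B(2)) simp
    also have "\<dots> \<le> B * (4 * m)" using norm_harmonic_le[OF g] B(1) by (intro mult_left_mono) auto
    also have "\<dots> \<le> \<mu> * \<bar>e t0 $ i0\<bar>" by (rule m)
    finally show ?thesis using E0 by (simp add: amp_def abs_divide divide_le_eq)
  qed
  have kp: "kerproj g = (\<lambda>t. amp g *\<^sub>R e t)" if g: "cper g" "symf H g" for g
  proof -
    obtain c where c: "kerproj g = (\<lambda>t. c *\<^sub>R e t)"
      using one_dim[OF kerproj_idem symf_kerproj[OF g]] by blast
    then have "amp g = c" using E0 by (simp add: amp_def)
    then show ?thesis using c by simp
  qed
  have S: "Bcontfun (solop c1 c2 \<alpha> (G \<tau> z)) \<in> lipschitz_ball H"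
    "apply_bcontfun (Bcontfun (solop c1 c2 \<alpha> (G \<tau> z))) = solop c1 c2 \<alpha> (G \<tau> z)"
    if a: "\<bar>\<alpha> - \<alpha>o\<bar> \<le> \<delta>'" and z: "z \<in> lipschitz_ball H" and t: "\<tau> \<in> {0..1}" for \<alpha> \<tau> z
  proof -
    note G = ell[OF a] Gc[OF z, of \<tau>]
    have Gn: "norm (G \<tau> z s) \<le> m" for s by (rule Gm[OF z t])
    have 1: "norm (solop c1 c2 \<alpha> (G \<tau> z) s) \<le> 1" for s using C1[OF G Gn] m(2) by (rule order_trans)
    have 2: "norm (solop c1 c2 \<alpha> (G \<tau> z) s - solop c1 c2 \<alpha> (G \<tau> z) u) \<le> \<bar>s - u\<bar>" for s u
    proof -
      have "norm (solop c1 c2 \<alpha> (G \<tau> z) s - solop c1 c2 \<alpha> (G \<tau> z) u) \<le> C * m * \<bar>s - u\<bar>" by (rule C2[OF G Gn])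
      also have "\<dots> \<le> 1 * \<bar>s - u\<bar>" using m(2) by (rule mult_right_mono) simp
      finally show ?thesis by simp
    qed
    have c: "cper (solop c1 c2 \<alpha> (G \<tau> z))" by (rule solop_cper[OF G])
    show *: "apply_bcontfun (Bcontfun (solop c1 c2 \<alpha> (G \<tau> z))) = solop c1 c2 \<alpha> (G \<tau> z)"
      by (rule Bcontfun_inverse) (rule bcontfun_normI[OF cper_cont[OF c] 1])
    show "Bcontfun (solop c1 c2 \<alpha> (G \<tau> z)) \<in> lipschitz_ball H"
      unfolding lipschitz_ball_def mem_Collect_eq * using 1 2 c symf_solop[OF G Gs[OF z]] by blast
  qed
  have afG: "\<bar>amp (G \<tau> z)\<bar> \<le> \<mu>" if "z \<in> lipschitz_ball H" "\<tau> \<in> {0..1}" for \<tau> z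
    by (rule amp_le[OF Gc[OF that(1)] Gm[OF that]])
  have K_iff: "p \<in> K \<longleftrightarrow> \<bar>fst p - \<alpha>o\<bar> \<le> \<delta>' \<and> snd p \<in> lipschitz_ball H" for p
    by (auto simp: K_def mem_Times_iff abs_le_iff)
  have into: "F ` ({0..1} \<times> K) \<subseteq> K"
  proof (rule image_subsetI)
    fix p :: "real \<times> real \<times> (real \<Rightarrow>\<^sub>C (real ^ 8))" assume "p \<in> {0..1} \<times> K"
    then have "fst p \<in> {0..1}" "\<bar>fst (snd p) - \<alpha>o\<bar> \<le> \<delta>'" "snd (snd p) \<in> lipschitz_ball H"
      unfolding mem_Times_iff K_iff by blast+
    then show "F p \<in> K" unfolding K_iff F_def using S(1) af[OF afG] by simp
  qed
  have G0: "G 0 z = (\<lambda>_. 0)" for z by (simp add: G_def scnem_0)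
  \<comment> \<open>At amplitude \<open>0\<close> the nonlinearity disappears and the map is
    constant, which supplies the unique fixed point that \<open>fixpoint_continuum\<close> starts
    from.\<close>
  have F0: "F (0, x) = (\<alpha>o, 0)" if "x \<in> K" for x
  proof -
    have x: "\<bar>fst x - \<alpha>o\<bar> \<le> \<delta>'" "snd x \<in> lipschitz_ball H" using that unfolding K_iff by blast+
    have "amp (\<lambda>_. 0) = 0" by (simp add: amp_def kerproj_def harmonic_def fcos_def fsin_def)
    moreover have "Bcontfun (solop c1 c2 (fst x) (G 0 (snd x))) = 0"
    proof (rule bcontfun_eqI)
      fix t
      have "norm (solop c1 c2 (fst x) (\<lambda>_. 0) t) \<le> C * 0" by (rule C1[OF ell[OF x(1)] cper_const]) simp
      then show "apply_bcontfun (Bcontfun (solop c1 c2 (fst x) (G 0 (snd x)))) t = apply_bcontfun 0 t"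
        using S(2)[OF x, of 0] by (simp add: G0)
    qed
    ultimately show ?thesis by (simp add: F_def G0 af0)
  qed
  have cont: "continuous_on ({0..1} \<times> K) F"
    unfolding continuous_on_sequentially
  proof (intro allI ballI impI)
    fix P and p :: "real \<times> real \<times> (real \<Rightarrow>\<^sub>C (real ^ 8))"
    assume p: "p \<in> {0..1} \<times> K" and "(\<forall>n. P n \<in> {0..1} \<times> K) \<and> P \<longlonglongrightarrow> p"
    then have P: "\<And>n. P n \<in> {0..1} \<times> K" "P \<longlonglongrightarrow> p" by blast+
    define T where "T n = fst (P n)" for n
    define A where "A n = fst (snd (P n))" for n
    define Z where "Z n = snd (snd (P n))" for n
    define \<tau> where "\<tau> = fst p"
    define \<alpha> where "\<alpha> = fst (snd p)"
    define z where "z = snd (snd p)"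
    have lim: "T \<longlonglongrightarrow> \<tau>" "A \<longlonglongrightarrow> \<alpha>" "Z \<longlonglongrightarrow> z"
      unfolding T_def[abs_def] A_def[abs_def] Z_def[abs_def] \<tau>_def \<alpha>_def z_def by (intro tendsto_fst tendsto_snd P(2))+
    have inn: "T n \<in> {0..1}" "\<bar>A n - \<alpha>o\<bar> \<le> \<delta>'" "Z n \<in> lipschitz_ball H" for n
      using P(1)[of n] unfolding mem_Times_iff K_iff T_def A_def Z_def by blast+
    have inl: "\<tau> \<in> {0..1}" "\<bar>\<alpha> - \<alpha>o\<bar> \<le> \<delta>'" "z \<in> lipschitz_ball H"
      using p unfolding mem_Times_iff K_iff \<tau>_def \<alpha>_def z_def by blast+
    have gl: "uniform_limit UNIV (\<lambda>n. G (T n) (Z n)) (G \<tau> z) sequentially"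
      unfolding G_def
    proof (rule scnem_uniform_limit[where E = \<epsilon>0 and M = M])
      show "T n * \<epsilon>0 \<in> {0..\<epsilon>0}" for n using \<epsilon>[OF inn(1)] by simp
      show "(\<lambda>n. T n * \<epsilon>0) \<longlonglongrightarrow> \<tau> * \<epsilon>0" by (intro tendsto_intros lim)
      show "uniform_limit UNIV (\<lambda>n t. e t + apply_bcontfun (Z n) t) (\<lambda>t. e t + apply_bcontfun z t) sequentially"
        by (intro uniform_limit_add uniform_limit_const tendsto_bcontfun_uniform_limit lim)
      show "norm (e t + apply_bcontfun (Z n) t) \<le> M" "norm (e t + apply_bcontfun z t) \<le> M" for n t by (intro yM inn inl)+
    qed
    have l: "(\<lambda>n. amp (G (T n) (Z n))) \<longlonglongrightarrow> amp (G \<tau> z)"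
      unfolding amp_def kerproj_def
      by (intro tendsto_intros E0 bounded_linear.tendsto[OF mv_bounded_linear] harmonic_uniform_limit[OF Gc[OF inn(3)] gl])
    have 1: "(\<lambda>n. af (amp (G (T n) (Z n)))) \<longlonglongrightarrow> af (amp (G \<tau> z))"
      by (rule continuous_on_tendsto_compose[OF afc l])
        (use afG[OF inl(3,1)] afG[OF inn(3,1)] in \<open>auto simp: abs_le_iff minus_le_iff intro!: always_eventually\<close>)
    have "uniform_limit UNIV (\<lambda>n. solop c1 c2 (A n) (G (T n) (Z n))) (solop c1 c2 \<alpha> (G \<tau> z)) sequentially"
    proof (rule uniform_limitI_le)
      fix \<eta> :: real assume \<eta>: "\<eta> > 0"
      define D where "D = \<eta> / (2 * C)"
      have D: "D > 0" "C * (D + D) = \<eta>" using \<eta> C by (simp_all add: D_def)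
      have "(\<lambda>n. m * \<bar>(A n)\<^sup>2 - \<alpha>\<^sup>2\<bar>) \<longlonglongrightarrow> m * \<bar>\<alpha>\<^sup>2 - \<alpha>\<^sup>2\<bar>" by (intro tendsto_intros lim)
      then have "\<forall>\<^sub>F n in sequentially. m * \<bar>(A n)\<^sup>2 - \<alpha>\<^sup>2\<bar> < D" by (rule order_tendstoD) (simp add: D)
      moreover have "\<forall>\<^sub>F n in sequentially. \<forall>t\<in>UNIV. dist (G (T n) (Z n) t) (G \<tau> z t) < D" by (rule uniform_limitD[OF gl D(1)])
      ultimately show "\<forall>\<^sub>F n in sequentially. \<forall>t. norm (solop c1 c2 (A n) (G (T n) (Z n)) t - solop c1 c2 \<alpha> (G \<tau> z) t) \<le> \<eta>"
      proof eventually_elim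
        case (elim n)
        show ?case
        proof
          fix t
          have "norm (G (T n) (Z n) s - G \<tau> z s) \<le> D" for s using elim(2) by (simp add: dist_norm less_imp_le)
          then have "norm (solop c1 c2 (A n) (G (T n) (Z n)) t - solop c1 c2 \<alpha> (G \<tau> z) t) \<le> C * (m * \<bar>(A n)\<^sup>2 - \<alpha>\<^sup>2\<bar> + D)"
            by (intro C3 ell inn inl Gc Gm)
          also have "\<dots> \<le> C * (D + D)" using elim(1) C by (intro mult_left_mono) auto
          finally show "norm (solop c1 c2 (A n) (G (T n) (Z n)) t - solop c1 c2 \<alpha> (G \<tau> z) t) \<le> \<eta>" by (simp only: D)
        qed
      qed
    qed
    then have "(\<lambda>n. Bcontfun (solop c1 c2 (A n) (G (T n) (Z n)))) \<longlonglongrightarrow> Bcontfun (solop c1 c2 \<alpha> (G \<tau> z))"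
      by (intro uniform_limit_tendsto_bcontfun) (simp only: S(2)[OF inn(2,3,1)] S(2)[OF inl(2,3,1)])
    then show "(F \<circ> P) \<longlonglongrightarrow> F p"
      unfolding F_def o_def T_def[symmetric] A_def[symmetric] Z_def[symmetric] \<tau>_def[symmetric] \<alpha>_def[symmetric] z_def[symmetric]
      by (intro tendsto_Pair 1)
  qed
  have p0: "(\<alpha>o, 0) \<in> K" using \<delta>' lipschitz_ball_0 by (simp add: K_iff)
  have p1: "F (0, x) = x \<longleftrightarrow> x = (\<alpha>o, 0)" if "x \<in> K" for x using F0[OF that] by auto
  have K: "compact K" "convex K" unfolding K_def
    by (intro compact_Times compact_Icc lipschitz_ball_compact convex_Times convex_closed_interval lipschitz_ball_convex)+
  obtain C0 where C0: "C0 \<subseteq> {(t, x) \<in> {0..1} \<times> K. F (t, x) = x}" "compact C0" "connected C0" "(0, (\<alpha>o, 0)) \<in> C0" "\<exists>x. (1, x) \<in> C0"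
    by (rule fixpoint_continuum[OF K cont into p0 p1]) blast
  have C0D: "\<tau> \<in> {0..1}" "\<bar>\<alpha> - \<alpha>o\<bar> \<le> \<delta>'" "z \<in> lipschitz_ball H" "af (amp (G \<tau> z)) = \<alpha>" "z = Bcontfun (solop c1 c2 \<alpha> (G \<tau> z))"
    if "(\<tau>, \<alpha>, z) \<in> C0" for \<tau> \<alpha> z
    using that C0(1) by (auto simp: K_iff F_def)
  have sol: "(\<exists>x'. C2per (xfun (\<tau> * \<epsilon>0) z) x' (solrhs c1 c2 q \<alpha> (xfun (\<tau> * \<epsilon>0) z))) \<and> kerproj (xfun (\<tau> * \<epsilon>0) z) = (\<lambda>t. (\<tau> * \<epsilon>0) *\<^sub>R e t)"
    if p: "(\<tau>, \<alpha>, z) \<in> C0" for \<tau> \<alpha> z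
  proof -
    note p = C0D[OF p]
    have zeq: "apply_bcontfun z = solop c1 c2 \<alpha> (G \<tau> z)" using S(2)[OF p(2,3,1)] p(5) by simp
    have sy: "symb c1 c2 1 1 \<alpha> = - amp (G \<tau> z)" using af[OF afG[OF p(3,1)]] unfolding p(4) by blast
    obtain x' where "C2per (xfun (\<tau> * \<epsilon>0) z) x' (solrhs c1 c2 q \<alpha> (xfun (\<tau> * \<epsilon>0) z))"
      "kerproj (xfun (\<tau> * \<epsilon>0) z) = (\<lambda>t. (\<tau> * \<epsilon>0) *\<^sub>R e t)"
      using solution_from_fixpoint[OF ell[OF p(2)] Gc[OF p(3)] zeq kp[OF Gc[OF p(3)] Gs[OF p(3)]] sy G_def]
      unfolding xfun_def[abs_def] by blast
    then show ?thesis by blast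
  qed
  show thesis
  proof (rule that[of C0 \<epsilon>0 "\<epsilon>0 * (2 * pi * Me + 1)"])
    fix \<tau> \<alpha> z s t assume p: "(\<tau>, \<alpha>, z) \<in> C0"
    note q = C0D[OF p]
    show "0 \<le> \<tau> \<and> \<bar>\<alpha> - \<alpha>o\<bar> \<le> \<delta>1" using q(1,2) by (simp add: \<delta>'_def)
    show "\<exists>x'. C2per (xfun (\<tau> * \<epsilon>0) z) x' (solrhs c1 c2 q \<alpha> (xfun (\<tau> * \<epsilon>0) z))"
      "kerproj (xfun (\<tau> * \<epsilon>0) z) = (\<lambda>t. (\<tau> * \<epsilon>0) *\<^sub>R e t)" using sol[OF p] by blast+
    show "symf H (xfun (\<tau> * \<epsilon>0) z)" unfolding xfun_def[abs_def] by (intro symf_scaleR symf_add symf_e zb q(3))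
    have "norm (xfun (\<tau> * \<epsilon>0) z t) \<le> \<tau> * \<epsilon>0 * M"
      unfolding xfun_def norm_scaleR using \<epsilon>(1)[OF q(1)] yM[OF q(3)] by (simp add: mult_left_mono del: zero_le_mult_iff)
    then show "norm (xfun (\<tau> * \<epsilon>0) z t) \<le> d2" using \<epsilon>(4)[OF q(1)] by (rule order_trans)
    have "norm ((e s - e t) + (apply_bcontfun z s - apply_bcontfun z t)) \<le> 2 * pi * Me * \<bar>s - t\<bar> + \<bar>s - t\<bar>"
      by (intro norm_triangle_le add_mono Le zb q(3))
    then have l: "norm ((e s + apply_bcontfun z s) - (e t + apply_bcontfun z t)) \<le> (2 * pi * Me + 1) * \<bar>s - t\<bar>"
      by (simp add: algebra_simps)
    have "norm (xfun (\<tau> * \<epsilon>0) z s - xfun (\<tau> * \<epsilon>0) z t) = \<tau> * \<epsilon>0 * norm ((e s + apply_bcontfun z s) - (e t + apply_bcontfun z t))"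
      unfolding xfun_def scaleR_diff_right[symmetric] norm_scaleR using \<epsilon>(1)[OF q(1)] by (simp del: zero_le_mult_iff)
    also have "\<dots> \<le> \<epsilon>0 * ((2 * pi * Me + 1) * \<bar>s - t\<bar>)" using \<epsilon>[OF q(1)] \<epsilon>0 l by (intro mult_mono) auto
    finally show "norm (xfun (\<tau> * \<epsilon>0) z s - xfun (\<tau> * \<epsilon>0) z t) \<le> \<epsilon>0 * (2 * pi * Me + 1) * \<bar>s - t\<bar>" by (simp only: mult.assoc)
  next
    fix \<alpha> z assume "(0, \<alpha>, z) \<in> C0"
    then show "\<alpha> = \<alpha>o \<and> z = 0" using C0(1) F0[of "(\<alpha>, z)"] by auto
  qed (use C0 \<epsilon>0 in auto)
qed

text \<open>The continuum is mapped continuously into the solution set. Positive amplitude forces a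
  nonzero kernel part, so its image is a connected set that contains \<open>(\<alpha>o, 0)\<close>
  and nontrivial solutions, and the component around it is the branch. The set \<open>F\<close> may
  be larger than the fixed-point space, so that \<open>F = UNIV\<close> yields the bifurcation
  point. The extra sequence records solutions of known symmetry on the branch tending to
  \<open>0\<close>, which later identify its direction.\<close>

theorem symmetric_branch:
  assumes \<rho>: "0 < \<rho>" "\<rho> < \<alpha>o" "0 < r" and F: "fixed_points H \<subseteq> F"
  obtains C A U where "is_branch c1 c2 q \<alpha>o \<rho> r F C" "\<And>n :: nat. (A n, U n) \<in> C"
    "\<And>n. (A n, U n) \<in> solutions c1 c2 q" "\<And>n. U n \<noteq> 0" "\<And>n. U n \<in> fixed_points H" "A \<longlonglongrightarrow> \<alpha>o" "U \<longlonglongrightarrow> 0"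
proof -
  obtain d2 where d2: "d2 > 0" "\<And>\<alpha> x y. C2per x y (solrhs c1 c2 q \<alpha> x) \<Longrightarrow> (\<And>t. norm (x t) \<le> d2) \<Longrightarrow> norm (h1_of x y) < r"
    by (rule small_norm[OF \<rho>(3)]) blast
  have \<rho>2: "\<rho> / 2 > 0" using \<rho> by simp
  obtain C0 \<epsilon>0 L where C0: "compact C0" "connected C0" "(0, \<alpha>o, 0) \<in> C0" "\<exists>p. (1, p) \<in> C0" "\<epsilon>0 > 0"
    and range: "\<And>\<tau> \<alpha> z. (\<tau>, \<alpha>, z) \<in> C0 \<Longrightarrow> 0 \<le> \<tau> \<and> \<bar>\<alpha> - \<alpha>o\<bar> \<le> \<rho> / 2"
    and zero: "\<And>\<alpha> z. (0, \<alpha>, z) \<in> C0 \<Longrightarrow> \<alpha> = \<alpha>o \<and> z = 0"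
    and sol: "\<And>\<tau> \<alpha> z. (\<tau>, \<alpha>, z) \<in> C0 \<Longrightarrow> \<exists>x'. C2per (xfun (\<tau> * \<epsilon>0) z) x' (solrhs c1 c2 q \<alpha> (xfun (\<tau> * \<epsilon>0) z))"
    and kp: "\<And>\<tau> \<alpha> z. (\<tau>, \<alpha>, z) \<in> C0 \<Longrightarrow> kerproj (xfun (\<tau> * \<epsilon>0) z) = (\<lambda>t. (\<tau> * \<epsilon>0) *\<^sub>R e t)"
    and sym: "\<And>\<tau> \<alpha> z. (\<tau>, \<alpha>, z) \<in> C0 \<Longrightarrow> symf H (xfun (\<tau> * \<epsilon>0) z)"
    and small: "\<And>\<tau> \<alpha> z t. (\<tau>, \<alpha>, z) \<in> C0 \<Longrightarrow> norm (xfun (\<tau> * \<epsilon>0) z t) \<le> d2"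
    and lip: "\<And>\<tau> \<alpha> z t s. (\<tau>, \<alpha>, z) \<in> C0 \<Longrightarrow> norm (xfun (\<tau> * \<epsilon>0) z s - xfun (\<tau> * \<epsilon>0) z t) \<le> L * \<bar>s - t\<bar>"
    by (rule continuum[OF \<rho>2 d2(1)]) blast
  define X where "X p = xfun (fst p * \<epsilon>0) (snd (snd p))" for p :: "real \<times> real \<times> (real \<Rightarrow>\<^sub>C (real ^ 8))"
  \<comment> \<open>A derivative determined by \<open>X p\<close> itself, so that the map from the
    continuum to solutions involves no choice.\<close>
  define Y where "Y p t = vector_derivative (X p) (at t)" for p t
  define \<Phi> where "\<Phi> p = (fst (snd p), h1_of (X p) (Y p))" for p
  define N where "N = {(\<alpha>, u) \<in> bif_nbhd \<alpha>o \<rho> r \<inter> solutions c1 c2 q. u \<noteq> 0 \<and> u \<in> F}"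
  have split: "p = (fst p, fst (snd p), snd (snd p))" for p :: "real \<times> real \<times> (real \<Rightarrow>\<^sub>C (real ^ 8))" by simp
  have Yeq: "Y p = y" if "C2per (X p) y z" for p y z
    unfolding Y_def[abs_def] using that by (auto simp: C2per_def intro: vector_derivative_at)
  have C2: "C2per (X p) (Y p) (solrhs c1 c2 q (fst (snd p)) (X p))" if p: "p \<in> C0" for p
  proof -
    obtain y where "C2per (X p) y (solrhs c1 c2 q (fst (snd p)) (X p))"
      using sol[of "fst p" "fst (snd p)" "snd (snd p)"] p unfolding X_def by auto
    then show ?thesis using Yeq by simp
  qed
  have fixed: "h1_of (X p) (Y p) \<in> fixed_points H" if "p \<in> C0" for p
    using fixed_points_h1_of[OF C2[OF that]] sym[of "fst p" "fst (snd p)" "snd (snd p)"] that by (simp add: X_def)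
  have S: "\<Phi> p \<in> solutions c1 c2 q" if "p \<in> C0" for p
  proof -
    have "\<bar>fst (snd p) - \<alpha>o\<bar> \<le> \<rho> / 2" using range[of "fst p" "fst (snd p)" "snd (snd p)"] that by simp
    then have "fst (snd p) > 0" using \<rho> by linarith
    then show ?thesis using C2[OF that] unfolding \<Phi>_def solutions_iff[OF q_cont] by blast
  qed
  have nz: "h1_of (X p) (Y p) \<noteq> 0" if "p \<in> C0" "fst p > 0" for p
  proof
    assume "h1_of (X p) (Y p) = 0"
    then have "(\<lambda>t. (X p t, Y p t)) = h1_fun 0" using h1_fun_h1_of[OF C2[OF that(1)]] by simp
    then have "X p t = 0" for t by (auto simp: zero_h1.rep_eq fun_eq_iff zero_prod_def)
    then have "kerproj (X p) t = 0" for t by (simp add: kerproj_def harmonic_def fcos_def fsin_def)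
    moreover have "kerproj (X p) = (\<lambda>t. (fst p * \<epsilon>0) *\<^sub>R e t)"
      using kp[of "fst p" "fst (snd p)" "snd (snd p)"] that by (simp add: X_def)
    ultimately show False using e_nz that(2) C0(5) by auto
  qed
  have N: "\<Phi> p \<in> N" if "p \<in> C0" "fst p > 0" for p
  proof -
    have "\<bar>fst (snd p) - \<alpha>o\<bar> < \<rho>" using range[of "fst p" "fst (snd p)" "snd (snd p)"] that \<rho> by simp
    moreover have "norm (h1_of (X p) (Y p)) < r"
      using d2(2)[OF C2[OF that(1)]] small[of "fst p" "fst (snd p)" "snd (snd p)"] that by (simp add: X_def)
    moreover have "(fst (snd p), h1_of (X p) (Y p)) \<in> solutions c1 c2 q" using S[OF that(1)] by (simp add: \<Phi>_def)
    ultimately show ?thesis using nz[OF that] fixed[OF that(1)] F by (auto simp: N_def \<Phi>_def bif_nbhd_def)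
  qed
  have cont: "(\<lambda>n. \<Phi> (P n)) \<longlonglongrightarrow> \<Phi> p" if P: "\<And>n. P n \<in> C0" "p \<in> C0" "P \<longlonglongrightarrow> p" for P p
  proof -
    have lim: "(\<lambda>n. fst (P n)) \<longlonglongrightarrow> fst p" "(\<lambda>n. fst (snd (P n))) \<longlonglongrightarrow> fst (snd p)" "(\<lambda>n. snd (snd (P n))) \<longlonglongrightarrow> snd (snd p)"
      by (intro tendsto_fst tendsto_snd P(3))+
    have inner: "uniform_limit UNIV (\<lambda>n t. e t + apply_bcontfun (snd (snd (P n))) t) (\<lambda>t. e t + apply_bcontfun (snd (snd p)) t) sequentially"
      by (intro uniform_limit_add uniform_limit_const tendsto_bcontfun_uniform_limit lim)
    have xl: "uniform_limit UNIV (\<lambda>n. X (P n)) (X p) sequentially"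
      unfolding X_def xfun_def[abs_def]
    proof (rule bounded_bilinear.bounded_uniform_limit[OF bounded_bilinear_scaleR _ inner])
      show "uniform_limit UNIV (\<lambda>n t. fst (P n) * \<epsilon>0) (\<lambda>t. fst p * \<epsilon>0) sequentially"
        using tendsto_mult_right[OF lim(1), of \<epsilon>0] by (auto simp: uniform_limit_iff tendsto_iff)
      show "bounded ((\<lambda>t. fst p * \<epsilon>0) ` UNIV)" by simp
      obtain M where M: "\<And>t. norm (e t) \<le> M" by (rule cper_bounded[OF e_cper]) blast
      have "norm (e t + apply_bcontfun (snd (snd p)) t) \<le> M + norm (snd (snd p))" for t
        by (intro norm_triangle_le add_mono M norm_bounded)
      then show "bounded ((\<lambda>t. e t + apply_bcontfun (snd (snd p)) t) ` UNIV)" by (auto intro!: boundedI)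
    qed
    have lip': "norm (X (P n) s - X (P n) t) \<le> L * \<bar>s - t\<bar>" for n s t
      using lip[of "fst (P n)" "fst (snd (P n))" "snd (snd (P n))" s t] P(1)[of n] by (simp add: X_def)
    obtain y where y: "C2per (X p) y (solrhs c1 c2 q (fst (snd p)) (X p))" "(\<lambda>n. h1_of (X (P n)) (Y (P n))) \<longlonglongrightarrow> h1_of (X p) y"
      by (rule solution_limit[OF q_cont C2[OF P(1)] xl lim(2) lip'])
    show ?thesis unfolding \<Phi>_def using y(2) lim(2) by (intro tendsto_Pair) (simp_all add: Yeq[OF y(1)])
  qed
  have contC0: "continuous_on C0 \<Phi>"
    unfolding continuous_on_sequentially o_def using cont by blast
  let ?p0 = "(0, \<alpha>o, 0) :: real \<times> real \<times> (real \<Rightarrow>\<^sub>C (real ^ 8))"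
  have \<Phi>0: "\<Phi> ?p0 = (\<alpha>o, 0)"
  proof -
    have X0: "X ?p0 = (\<lambda>_. 0)" by (simp add: X_def xfun_def fun_eq_iff)
    have "Y ?p0 = (\<lambda>_. 0)" unfolding Y_def[abs_def] X0 by simp
    then have "h1_fun (h1_of (X ?p0) (Y ?p0)) = h1_fun 0"
      using h1_fun_h1_of[OF C2[OF C0(3)]] by (simp add: X0 zero_h1.rep_eq zero_prod_def)
    then show ?thesis by (simp add: \<Phi>_def h1_fun_inject)
  qed
  have pos: "fst p > 0" if "p \<in> C0" "p \<noteq> ?p0" for p
    using that range[of "fst p" "fst (snd p)" "snd (snd p)"] zero[of "fst (snd p)" "snd (snd p)"] split[of p]
    by (metis less_eq_real_def)
  obtain p1 where p1: "p1 \<in> C0" "fst p1 = 1" using C0(4) by auto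
  \<comment> \<open>A connected set with more than one point has no isolated points, so the base
    point is a limit of points of positive amplitude.\<close>
  have "C0 \<noteq> {x}" for x using p1 C0(3) by (metis fst_conv singletonD zero_neq_one)
  then have "?p0 islimpt C0" by (rule connected_imp_perfect[OF C0(2,3)])
  then obtain P where P: "\<And>n. P n \<in> C0 - {?p0}" "P \<longlonglongrightarrow> ?p0" unfolding islimpt_sequential by blast
  have P0: "P n \<in> C0" "fst (P n) > 0" for n using P(1)[of n] pos[of "P n"] by auto
  have lim: "(\<lambda>n. \<Phi> (P n)) \<longlonglongrightarrow> (\<alpha>o, 0)" using cont[OF P0(1) C0(3) P(2)] unfolding \<Phi>0 .
  have cl0: "(\<alpha>o, 0) \<in> closure N"
    unfolding closure_sequential using N[OF P0] lim by (intro exI[of _ "\<lambda>n. \<Phi> (P n)"] conjI) auto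
  have sub: "\<Phi> ` C0 \<subseteq> closure N"
  proof (rule image_subsetI)
    fix p assume p: "p \<in> C0"
    show "\<Phi> p \<in> closure N"
    proof (cases "p = ?p0")
      case True
      then show ?thesis using cl0 \<Phi>0 by simp
    next
      case False
      then show ?thesis using N[OF p pos[OF p]] closure_subset by blast
    qed
  qed
  define C where "C = connected_component_set (closure N) (\<alpha>o, 0)"
  have "connected (\<Phi> ` C0)" by (rule connected_continuous_image[OF contC0 C0(2)])
  then have C0C: "\<Phi> ` C0 \<subseteq> C"
    unfolding C_def using sub \<Phi>0 C0(3) by (intro connected_component_maximal) force+
  have cK: "compact {(\<alpha>, u) \<in> solutions c1 c2 q. \<alpha> \<in> {\<alpha>o - \<rho>..\<alpha>o + \<rho>} \<and> norm u \<le> r}" (is "compact ?K")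
    by (rule compact_solutions[OF q_cont]) (use \<rho> in simp)
  have NK: "closure N \<subseteq> ?K"
    by (rule closure_minimal[OF _ compact_imp_closed[OF cK]]) (auto simp: N_def bif_nbhd_def abs_less_iff)
  have CN: "C \<subseteq> closure N" unfolding C_def by (rule connected_component_subset)
  have "closed C" unfolding C_def by (rule closed_connected_component[OF closed_closure])
  then have "compact (?K \<inter> C)" by (rule compact_Int_closed[OF cK])
  moreover have "?K \<inter> C = C" using NK CN by blast
  ultimately have "compact C" by simp
  moreover have "C \<in> components (closure N)" using cl0 by (auto simp: C_def components_def)
  moreover have "(\<alpha>o, 0) \<in> C" using C0C C0(3) \<Phi>0 by (metis image_subset_iff)
  moreover have "\<exists>(\<alpha>, u)\<in>C. u \<noteq> 0"
    using C0C p1 nz[of p1] by (intro bexI[of _ "\<Phi> p1"]) (auto simp: \<Phi>_def)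
  ultimately have br: "is_branch c1 c2 q \<alpha>o \<rho> r F C" unfolding is_branch_def N_def by blast
  show thesis
  proof (rule that[OF br, of "\<lambda>n. fst (\<Phi> (P n))" "\<lambda>n. snd (\<Phi> (P n))"])
    show "(fst (\<Phi> (P n)), snd (\<Phi> (P n))) \<in> C" for n using C0C P0(1) by auto
    show "(fst (\<Phi> (P n)), snd (\<Phi> (P n))) \<in> solutions c1 c2 q" for n using S[OF P0(1)] by simp
    show "snd (\<Phi> (P n)) \<noteq> 0" "snd (\<Phi> (P n)) \<in> fixed_points H" for n
      using nz[OF P0] fixed[OF P0(1)] by (simp_all add: \<Phi>_def)
    show "(\<lambda>n. fst (\<Phi> (P n))) \<longlonglongrightarrow> \<alpha>o" "(\<lambda>n. snd (\<Phi> (P n))) \<longlonglongrightarrow> 0"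
      using tendsto_fst[OF lim] tendsto_snd[OF lim] by simp_all
  qed
qed

end

subsection \<open>Separating branches by their tangent directions\<close>

context cube_system
begin

lemma kernel_direction:
  assumes sol: "\<And>n. (A n, U n) \<in> solutions c1 c2 q" and nz: "\<And>n. U n \<noteq> 0"
    and lim: "A \<longlonglongrightarrow> \<alpha>o" "U \<longlonglongrightarrow> 0"
  obtains k c v where "kerproj v = v" "\<exists>t. v t \<noteq> 0" "\<And>t. (\<lambda>n. c n *\<^sub>R fst (h1_fun (U (k n :: nat)) t)) \<longlonglongrightarrow> v t"
proof -
  obtain k c v where v: "cper v" "\<exists>t. v t \<noteq> 0" "\<And>t. (\<lambda>n. c n *\<^sub>R fst (h1_fun (U (k n :: nat)) t)) \<longlonglongrightarrow> v t"
    "\<And>l j t. l < 4 \<Longrightarrow> symb c1 c2 j l \<alpha>o *\<^sub>R (eig_proj l *v harmonic j v t) = 0"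
    by (rule null_direction[OF sol nz lim]) blast
  obtain \<delta> \<kappa> where "0 < \<delta>" and ell: "\<And>\<alpha>. \<bar>\<alpha> - \<alpha>o\<bar> \<le> \<delta> \<Longrightarrow> elliptic c1 c2 \<kappa> \<alpha>"
    by (rule elliptic_near) blast
  then have "elliptic c1 c2 \<kappa> \<alpha>o" by (intro ell) simp
  then have "eig_proj l *v harmonic j v t = 0" if "l < 4" "(j, l) \<noteq> (1, 1)" for l j t
    using v(4)[OF that(1), of j t] elliptic_symb_nonzero[OF _ that] by simp
  from eq_kerproj_if_eig_harmonics_zero[OF v(1) this] have "kerproj v = v" by simp
  then show thesis using that[of v c k] v(2,3) by blast
qed

text \<open>Along the sequence on \<open>Cj\<close> the normalized solutions tend to a kernel
  element fixed by \<open>Hj\<close>, hence a multiple of \<open>ej\<close>. If \<open>Cj\<close> is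
  a time change of \<open>Ci\<close>, undoing it on the same sequence gives a limit fixed by
  \<open>Hi\<close>, a multiple of \<open>ei\<close>. So \<open>ej\<close> is \<open>ei\<close> up
  to a scalar and a time change.\<close>

lemma branches_distinct:
  assumes i: "symmetric_direction c1 c2 \<alpha>o q Hi ei" and j: "symmetric_direction c1 c2 \<alpha>o q Hj ej"
    and Ci: "Ci \<subseteq> UNIV \<times> fixed_points Hi" and eq: "Cj = map_prod id (act (id, M)) ` Ci"
    and seq: "\<And>n. (A n, U n) \<in> Cj" "\<And>n. (A n, U n) \<in> solutions c1 c2 q" "\<And>n. U n \<noteq> 0"
      "\<And>n. U n \<in> fixed_points Hj" "A \<longlonglongrightarrow> \<alpha>o" "U \<longlonglongrightarrow> 0"
  obtains c f where "\<And>t. ej t = c *\<^sub>R ei (f t)"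
proof -
  obtain k c v where v: "kerproj v = v" "\<exists>t. v t \<noteq> 0" "\<And>t. (\<lambda>n. c n *\<^sub>R fst (h1_fun (U (k n :: nat)) t)) \<longlonglongrightarrow> v t"
    by (rule kernel_direction[OF seq(2,3,5,6)]) blast
  have vc: "cper v" using kerproj_cper[of v] by (simp add: v(1))
  have "symf Hj v"
    by (rule symf_limit[where f = "\<lambda>n t. c n *\<^sub>R fst (h1_fun (U (k n)) t)"]) (intro symf_scaleR symf_if_fixed seq(4), rule v(3))
  then obtain cj where cj: "v = (\<lambda>t. cj *\<^sub>R ej t)" using symmetric_direction.one_dim[OF j v(1)] by blast
  have "\<exists>u. u \<in> fixed_points Hi \<and> U n = act (id, M) u" for n
  proof -
    have "(A n, U n) \<in> map_prod id (act (id, M)) ` Ci" using seq(1) unfolding eq .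
    then show ?thesis using Ci by auto
  qed
  then obtain u where u: "\<And>n. u n \<in> fixed_points Hi" "\<And>n. U n = act (id, M) (u n)" by metis
  have Uu: "fst (h1_fun (U n) t) = fst (h1_fun (u n) (circ M t))" for n t
    using fun_cong[OF fst_h1_fun_act[of "(id, M)" "u n"], of t]
    by (simp add: u(2) act_fun_def permute_vertices_def)
  \<comment> \<open>The inverse of the time change \<open>circ M\<close>; for a reflection it is the
    same map.\<close>
  define g where "g t = (if det M = 1 then t - angle2 M else - (t + angle2 M))" for t
  have g: "circ M (g t) = t" "g (circ M t) = t" for t by (simp_all add: g_def circ_def)
  define v' where "v' t = v (g t)" for t
  have v': "(\<lambda>n. c n *\<^sub>R fst (h1_fun (u (k n)) t)) \<longlonglongrightarrow> v' t" for t
    using v(3)[of "g t"] by (simp add: Uu g v'_def)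
  have "symf Hi v'"
    by (rule symf_limit[where f = "\<lambda>n t. c n *\<^sub>R fst (h1_fun (u (k n)) t)"]) (intro symf_scaleR symf_if_fixed u(1), rule v')
  moreover have "kerproj v' = v'"
  proof
    fix t
    have "harmonic 1 v' t = harmonic 1 v (g t)"
    proof (cases "det M = 1")
      case True
      then show ?thesis using harmonic_shift[OF vc, of 1 "- angle2 M" t] by (simp add: v'_def[abs_def] g_def)
    next
      case False
      then have "g = circ M" by (simp add: g_def circ_def fun_eq_iff)
      then show ?thesis using harmonic_circ[OF vc, of 1 M t] by (simp add: v'_def[abs_def])
    qed
    then show "kerproj v' t = v' t" using fun_cong[OF v(1), of "g t"] by (simp add: kerproj_def v'_def)
  qed
  ultimately obtain ci where ci: "v' = (\<lambda>t. ci *\<^sub>R ei t)" using symmetric_direction.one_dim[OF i] by blast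
  have "cj \<noteq> 0" using v(2) by (auto simp: cj)
  have "cj *\<^sub>R ej t = ci *\<^sub>R ei (circ M t)" for t
    using fun_cong[OF ci, of "circ M t"] fun_cong[OF cj, of t] by (simp add: v'_def g)
  then have "(1 / cj) *\<^sub>R (cj *\<^sub>R ej t) = (1 / cj) *\<^sub>R (ci *\<^sub>R ei (circ M t))" for t by simp
  then have "ej t = (ci / cj) *\<^sub>R ei (circ M t)" for t using \<open>cj \<noteq> 0\<close> by simp
  then show thesis by (rule that)
qed

end

subsection \<open>Kernel directions\<close>

lemma O2_simps: "carrier O2 = {A. orthogonal_matrix A}" "mult O2 = (**)" "one O2 = mat 1"
  by (simp_all add: O2_def)

lemma O2_group: "group O2"
proof (rule groupI)
  fix k assume "k \<in> carrier O2"
  then show "\<exists>l\<in>carrier O2. l \<otimes>\<^bsub>O2\<^esub> k = \<one>\<^bsub>O2\<^esub>"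
    by (intro bexI[of _ "transpose k"]) (auto simp: O2_simps orthogonal_matrix_def)
qed (auto simp: O2_simps orthogonal_matrix_mul orthogonal_matrix_id matrix_mul_assoc)

interpretation o2: group O2 by (rule O2_group)

lemma O2_entries:
  assumes "k \<in> carrier O2"
  shows "(k $ 1 $ 1)\<^sup>2 + (k $ 2 $ 1)\<^sup>2 = 1"
    "det k = 1 \<and> k $ 1 $ 2 = - k $ 2 $ 1 \<and> k $ 2 $ 2 = k $ 1 $ 1 \<or> det k \<noteq> 1 \<and> k $ 1 $ 2 = k $ 2 $ 1 \<and> k $ 2 $ 2 = - k $ 1 $ 1"
proof -
  define a b c d where "a = k $ 1 $ 1" and "b = k $ 1 $ 2" and "c = k $ 2 $ 1" and "d = k $ 2 $ 2"
  have "transpose k ** k = mat 1" using assms by (simp add: O2_simps orthogonal_matrix)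
  then have e: "a * a + c * c = 1" "a * b + c * d = 0"
    by (simp_all add: vec_eq_iff forall_2 matrix_matrix_mult_def transpose_def sum_2 mat_def a_def b_def c_def d_def)
  have D: "det k = a * d - b * c" by (simp add: det_2 a_def b_def c_def d_def)
  have "a * det k = d" "c * det k = - b" 
    using e unfolding D by algebra+
  moreover have "det k = 1 \<or> det k = -1" using assms by (simp add: O2_simps det_orthogonal_matrix)
  ultimately show "(k $ 1 $ 1)\<^sup>2 + (k $ 2 $ 1)\<^sup>2 = 1"
    "det k = 1 \<and> k $ 1 $ 2 = - k $ 2 $ 1 \<and> k $ 2 $ 2 = k $ 1 $ 1 \<or> det k \<noteq> 1 \<and> k $ 1 $ 2 = k $ 2 $ 1 \<and> k $ 2 $ 2 = - k $ 1 $ 1"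
    using e(1) by (auto simp: power2_eq_square a_def b_def c_def d_def)
qed

lemma angle2_cos_sin:
  assumes "k \<in> carrier O2" shows "cos (angle2 k) = k $ 1 $ 1" "sin (angle2 k) = k $ 2 $ 1"
proof -
  let ?z = "Complex (k $ 1 $ 1) (k $ 2 $ 1)"
  have "cmod ?z = 1" using O2_entries(1)[OF assms] by (simp add: complex_norm)
  then have "cis (angle2 k) = ?z" unfolding angle2_def by (subst cis_Arg) (auto simp: sgn_div_norm)
  then show "cos (angle2 k) = k $ 1 $ 1" "sin (angle2 k) = k $ 2 $ 1" by (simp_all add: complex_eq_iff)
qed

text \<open>The minus sign is chosen so that a matrix in \<open>O(2)\<close> acts on the pair
  \<open>(a, b)\<close> in the standard way: the kernel becomes the tensor product of
  \<open>real ^ 3\<close> and \<open>real ^ 2\<close>.\<close>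

definition kfun :: "real ^ 3 \<Rightarrow> real ^ 3 \<Rightarrow> real \<Rightarrow> real ^ 8" where
  "kfun a b t = vertex_fun (cos t *\<^sub>R a - sin t *\<^sub>R b)"

lemma kerproj_kfun: "kerproj (kfun a b) = kfun a b"
  using kerproj_vertex_fun[of a "- b"] by (simp add: kfun_def[abs_def])

lemma kerproj_imp_kfun:
  assumes "kerproj x = x" obtains a b where "x = kfun a b"
proof -
  obtain a b where "kerproj x = (\<lambda>t. vertex_fun (cos t *\<^sub>R a + sin t *\<^sub>R b))" by (rule kerproj_form)
  then have "x = kfun a (- b)" by (simp add: assms kfun_def fun_eq_iff)
  then show thesis by (rule that)
qed

lemma kfun_inject: "kfun a b = kfun a' b' \<longleftrightarrow> a = a' \<and> b = b'"
proof
  assume "kfun a b = kfun a' b'"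
  from fun_cong[OF this, of 0] fun_cong[OF this, of "pi / 2"] show "a = a' \<and> b = b'"
    by (simp add: kfun_def vertex_fun_inj)
qed simp

lemma kfun_scaleR: "c *\<^sub>R kfun a b t = kfun (c *\<^sub>R a) (c *\<^sub>R b) t"
  by (simp add: kfun_def linear_cmul[OF vertex_fun_linear, symmetric] scaleR_diff_right mult.commute)

text \<open>The condition that the group element fixes \<open>kfun a b\<close>, in terms of matrices
  only.\<close>

definition fixdir :: "(8 \<Rightarrow> 8) \<times> (real ^ 2 ^ 2) \<Rightarrow> real ^ 3 \<Rightarrow> real ^ 3 \<Rightarrow> bool" where
  "fixdir g a b \<longleftrightarrow> cmat (fst g) *v (snd g $ 1 $ 1 *\<^sub>R a + snd g $ 1 $ 2 *\<^sub>R b) = a \<and>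
     cmat (fst g) *v (snd g $ 2 $ 1 *\<^sub>R a + snd g $ 2 $ 2 *\<^sub>R b) = b"

lemma act_kfun:
  assumes "\<gamma> \<in> carrier cube_group" "k \<in> carrier O2"
  shows "act_fun (\<gamma>, k) (kfun a b) =
    kfun (cmat \<gamma> *v (k $ 1 $ 1 *\<^sub>R a + k $ 1 $ 2 *\<^sub>R b)) (cmat \<gamma> *v (k $ 2 $ 1 *\<^sub>R a + k $ 2 $ 2 *\<^sub>R b))"
proof
  fix t
  have c: "cos (circ k t) = cos t * k $ 1 $ 1 - sin t * k $ 2 $ 1"
    by (cases "det k = 1")
      (simp_all only: circ_def if_True if_False simp_thms cos_minus cos_add angle2_cos_sin[OF assms(2)])
  have s: "sin (circ k t) = (if det k = 1 then 1 else -1) * (sin t * k $ 1 $ 1 + cos t * k $ 2 $ 1)"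
    by (cases "det k = 1")
      (simp_all only: circ_def if_True if_False simp_thms sin_minus sin_add angle2_cos_sin[OF assms(2)] mult_minus1 mult_1_left)
  have "cos (circ k t) *\<^sub>R a - sin (circ k t) *\<^sub>R b
      = cos t *\<^sub>R (k $ 1 $ 1 *\<^sub>R a + k $ 1 $ 2 *\<^sub>R b) - sin t *\<^sub>R (k $ 2 $ 1 *\<^sub>R a + k $ 2 $ 2 *\<^sub>R b)"
    using O2_entries(2)[OF assms(2)]
    unfolding c s by (auto simp: vec_eq_iff algebra_simps)
  then show "act_fun (\<gamma>, k) (kfun a b) t = kfun (cmat \<gamma> *v (k $ 1 $ 1 *\<^sub>R a + k $ 1 $ 2 *\<^sub>R b)) (cmat \<gamma> *v (k $ 2 $ 1 *\<^sub>R a + k $ 2 $ 2 *\<^sub>R b)) t"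
    by (simp add: act_fun_def kfun_def permute_vertex_fun[OF assms(1)] matrix_vector_mult_diff_distrib matrix_vector_mult_scaleR)
qed

lemma symf_kfun:
  assumes "H \<subseteq> carrier S4xO2" shows "symf H (kfun a b) \<longleftrightarrow> (\<forall>g\<in>H. fixdir g a b)"
proof -
  have "act_fun g (kfun a b) = kfun a b \<longleftrightarrow> fixdir g a b" if "g \<in> H" for g
  proof -
    have "fst g \<in> carrier cube_group" "snd g \<in> carrier O2" using assms that by auto
    from act_kfun[OF this, of a b] show ?thesis by (simp add: kfun_inject fixdir_def)
  qed
  then show ?thesis by (simp add: symf_def)
qed

lemma (in cube_system) symmetric_directionI:
  assumes H: "H \<subseteq> carrier S4xO2" and fd: "\<And>g. g \<in> H \<Longrightarrow> fixdir g a0 b0" and a0: "a0 \<noteq> 0"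
    and one: "\<And>a b. (\<And>g. g \<in> H \<Longrightarrow> fixdir g a b) \<Longrightarrow> \<exists>c. a = c *\<^sub>R a0 \<and> b = c *\<^sub>R b0"
  shows "symmetric_direction c1 c2 \<alpha>o q H (kfun a0 b0)"
proof
  show "fst g \<in> carrier cube_group" if "g \<in> H" for g using H that by auto
  show "kerproj (kfun a0 b0) = kfun a0 b0" by (rule kerproj_kfun)
  have "vertex_fun a0 \<noteq> vertex_fun 0" using a0 by (simp add: vertex_fun_inj)
  then have "kfun a0 b0 0 \<noteq> 0" by (simp add: kfun_def linear_0[OF vertex_fun_linear])
  then show "\<exists>t. kfun a0 b0 t \<noteq> 0" by blast
  show "symf H (kfun a0 b0)" using fd by (simp add: symf_kfun[OF H])
  fix x assume x: "kerproj x = x" "symf H x"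
  obtain a b where ab: "x = kfun a b" by (rule kerproj_imp_kfun[OF x(1)])
  then obtain c where "a = c *\<^sub>R a0 \<and> b = c *\<^sub>R b0" using one x(2) unfolding ab symf_kfun[OF H] by blast
  then have "x = (\<lambda>t. c *\<^sub>R kfun a0 b0 t)" by (simp add: ab kfun_scaleR fun_eq_iff)
  then show "\<exists>c. x = (\<lambda>t. c *\<^sub>R kfun a0 b0 t)" by blast
qed

lemma fixdir_conj:
  assumes "\<gamma> \<in> carrier cube_group" "h \<in> carrier cube_group"
  shows "fixdir (\<gamma> \<otimes>\<^bsub>cube_group\<^esub> h \<otimes>\<^bsub>cube_group\<^esub> inv\<^bsub>cube_group\<^esub> \<gamma>, k) (cmat \<gamma> *v a) (cmat \<gamma> *v b) \<longleftrightarrow> fixdir (h, k) a b"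
proof -
  note C = rotation_transpose[OF cmat_rotation[OF assms(1)]]
  have inj: "cmat \<gamma> *v x = cmat \<gamma> *v y \<longleftrightarrow> x = y" for x y
  proof
    assume "cmat \<gamma> *v x = cmat \<gamma> *v y"
    then have "transpose (cmat \<gamma>) *v (cmat \<gamma> *v x) = transpose (cmat \<gamma>) *v (cmat \<gamma> *v y)" by simp
    then show "x = y" by (simp add: matrix_vector_mul_assoc C)
  qed simp
  have "cmat (\<gamma> \<otimes>\<^bsub>cube_group\<^esub> h \<otimes>\<^bsub>cube_group\<^esub> inv\<^bsub>cube_group\<^esub> \<gamma>) = cmat \<gamma> ** cmat h ** transpose (cmat \<gamma>)"
    using assms by (simp add: cmat_mult cmat_inv)
  moreover have "(cmat \<gamma> ** cmat h ** transpose (cmat \<gamma>)) *v (p *\<^sub>R (cmat \<gamma> *v a) + r *\<^sub>R (cmat \<gamma> *v b))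
      = cmat \<gamma> *v (cmat h *v (p *\<^sub>R a + r *\<^sub>R b))" for p r
  proof -
    have "p *\<^sub>R (cmat \<gamma> *v a) + r *\<^sub>R (cmat \<gamma> *v b) = cmat \<gamma> *v (p *\<^sub>R a + r *\<^sub>R b)"
      by (simp add: matrix_vector_right_distrib matrix_vector_mult_scaleR)
    moreover have "cmat \<gamma> ** cmat h ** transpose (cmat \<gamma>) ** cmat \<gamma> = cmat \<gamma> ** cmat h"
      by (simp add: matrix_mul_assoc[symmetric] C)
    ultimately show ?thesis by (simp only: matrix_vector_mul_assoc)
  qed
  ultimately show ?thesis by (simp add: fixdir_def inj)
qed

lemma conjugate_amalgam:
  assumes "X \<subseteq> carrier S4xO2" "\<gamma> \<in> carrier cube_group"
  shows "(\<gamma>, mat 1) <#\<^bsub>S4xO2\<^esub> X #>\<^bsub>S4xO2\<^esub> inv\<^bsub>S4xO2\<^esub> (\<gamma>, mat 1)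
    = (\<lambda>(h, k). (\<gamma> \<otimes>\<^bsub>cube_group\<^esub> h \<otimes>\<^bsub>cube_group\<^esub> inv\<^bsub>cube_group\<^esub> \<gamma>, k)) ` X"
proof -
  have "inv\<^bsub>S4xO2\<^esub> (\<gamma>, mat 1) = (inv\<^bsub>cube_group\<^esub> \<gamma>, inv\<^bsub>O2\<^esub> mat 1)"
    using assms(2) by (simp add: inv_DirProd[OF cube_group_group O2_group] O2_simps orthogonal_matrix_id)
  also have "inv\<^bsub>O2\<^esub> mat 1 = mat 1" using o2.inv_one by (simp add: O2_simps)
  finally show ?thesis
    by (force simp: l_coset_def r_coset_def O2_simps split_beta)
qed

text \<open>One subgroup and \<open>n\<close> rotations suffice for a family: conjugation moves the
  fixed direction \<open>(a0, b0)\<close> by the rotation and stays within the class. Changes of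
  time preserve the span of the two vectors in \<open>real ^ 3\<close>, so branches differ as soon
  as a vector \<open>w\<close> is orthogonal to one of the rotated spans and not to the
  other.\<close>

theorem (in cube_system) at_least_branches_conjugates:
  assumes sub: "H0 \<subseteq> carrier cube_group" "K \<subseteq> carrier O2"
    and \<phi>: "\<phi> \<in> epi (cube_group\<lparr>carrier := H0\<rparr>) L" "kernel (cube_group\<lparr>carrier := H0\<rparr>) L \<phi> = Z"
    and \<psi>: "\<psi> \<in> epi (O2\<lparr>carrier := K\<rparr>) L" "kernel (O2\<lparr>carrier := K\<rparr>) L \<psi> = N"
    and fd: "\<And>h k. h \<in> H0 \<Longrightarrow> k \<in> K \<Longrightarrow> \<phi> h = \<psi> k \<Longrightarrow> fixdir (h, k) a0 b0" and a0: "a0 \<noteq> 0"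
    and one: "\<And>a b. (\<And>h k. h \<in> H0 \<Longrightarrow> k \<in> K \<Longrightarrow> \<phi> h = \<psi> k \<Longrightarrow> fixdir (h, k) a b) \<Longrightarrow> \<exists>c. a = c *\<^sub>R a0 \<and> b = c *\<^sub>R b0"
    and \<gamma>: "\<And>i. \<gamma> i \<in> carrier cube_group"
    and distinct: "\<And>i j. i < n \<Longrightarrow> j < n \<Longrightarrow> i \<noteq> j \<Longrightarrow> \<exists>w. w \<bullet> (cmat (\<gamma> i) *v a0) = 0 \<and> w \<bullet> (cmat (\<gamma> i) *v b0) = 0 \<and>
        \<not> (w \<bullet> (cmat (\<gamma> j) *v a0) = 0 \<and> w \<bullet> (cmat (\<gamma> j) *v b0) = 0)"
    and \<rho>: "0 < \<rho>" "\<rho> < \<alpha>o" "0 < r"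
  shows "bifurcation_point c1 c2 q \<alpha>o \<rho> r \<and>
    at_least_branches c1 c2 q \<alpha>o \<rho> r n (amalgamated_class H0 Z L K N)"
proof -
  define X where "X = {(h, k) \<in> H0 \<times> K. \<phi> h = \<psi> k}"
  have X: "X \<subseteq> carrier S4xO2" using sub by (auto simp: X_def)
  define H where "H i = (\<gamma> i, mat 1) <#\<^bsub>S4xO2\<^esub> X #>\<^bsub>S4xO2\<^esub> inv\<^bsub>S4xO2\<^esub> (\<gamma> i, mat 1)" for i
  have H: "H i = (\<lambda>(h, k). (\<gamma> i \<otimes>\<^bsub>cube_group\<^esub> h \<otimes>\<^bsub>cube_group\<^esub> inv\<^bsub>cube_group\<^esub> \<gamma> i, k)) ` X" for i
    unfolding H_def by (rule conjugate_amalgam[OF X \<gamma>])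
  have H_mem: "(\<gamma> i \<otimes>\<^bsub>cube_group\<^esub> h \<otimes>\<^bsub>cube_group\<^esub> inv\<^bsub>cube_group\<^esub> \<gamma> i, k) \<in> H i" if "h \<in> H0" "k \<in> K" "\<phi> h = \<psi> k" for i h k
    unfolding H using that by (force simp: X_def)
  have H_class: "H i \<in> amalgamated_class H0 Z L K N" for i
  proof -
    have "(\<gamma> i, mat 1) \<in> carrier S4xO2" using \<gamma> by (simp add: O2_simps orthogonal_matrix_id)
    then show ?thesis unfolding H_def X_def amalgamated_class_def using \<phi> \<psi> by blast
  qed
  define e where "e i = kfun (cmat (\<gamma> i) *v a0) (cmat (\<gamma> i) *v b0)" for i
  have dir: "symmetric_direction c1 c2 \<alpha>o q (H i) (e i)" for i
    unfolding e_def
  proof (rule symmetric_directionI)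
    note C = rotation_transpose[OF cmat_rotation[OF \<gamma>[of i]]]
    show "H i \<subseteq> carrier S4xO2" unfolding H using X \<gamma> by (auto simp: split_beta)
    show "fixdir g (cmat (\<gamma> i) *v a0) (cmat (\<gamma> i) *v b0)" if g: "g \<in> H i" for g
    proof -
      obtain h k where hk: "g = (\<gamma> i \<otimes>\<^bsub>cube_group\<^esub> h \<otimes>\<^bsub>cube_group\<^esub> inv\<^bsub>cube_group\<^esub> \<gamma> i, k)" "h \<in> H0" "k \<in> K" "\<phi> h = \<psi> k"
        using g unfolding H X_def by auto
      have "h \<in> carrier cube_group" using hk(2) sub(1) by blast
      then show ?thesis using fixdir_conj[OF \<gamma>, of h i k a0 b0] fd[OF hk(2-4)] unfolding hk(1) by blast
    qed
    show "cmat (\<gamma> i) *v a0 \<noteq> 0"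
    proof
      assume "cmat (\<gamma> i) *v a0 = 0"
      then have "transpose (cmat (\<gamma> i)) *v (cmat (\<gamma> i) *v a0) = 0" by simp
      then show False using a0 by (simp add: matrix_vector_mul_assoc C)
    qed
    fix a b assume ab: "\<And>g. g \<in> H i \<Longrightarrow> fixdir g a b"
    define a' b' where "a' = transpose (cmat (\<gamma> i)) *v a" and "b' = transpose (cmat (\<gamma> i)) *v b"
    have eq: "a = cmat (\<gamma> i) *v a'" "b = cmat (\<gamma> i) *v b'"
      by (simp_all only: a'_def b'_def matrix_vector_mul_assoc C matrix_vector_mul_lid)
    have "fixdir (h, k) a' b'" if "h \<in> H0" "k \<in> K" "\<phi> h = \<psi> k" for h k
      using ab[OF H_mem[OF that]] fixdir_conj[OF \<gamma>, of h i k a' b'] that(1) sub(1) unfolding eq by blast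
    then obtain c where "a' = c *\<^sub>R a0 \<and> b' = c *\<^sub>R b0" using one by blast
    then show "\<exists>c. a = c *\<^sub>R (cmat (\<gamma> i) *v a0) \<and> b = c *\<^sub>R (cmat (\<gamma> i) *v b0)"
      by (auto simp: eq matrix_vector_mult_scaleR)
  qed
  have bif: "bifurcation_point c1 c2 q \<alpha>o \<rho> r"
    unfolding bifurcation_point_def
    by (rule symmetric_direction.symmetric_branch[OF dir[of 0] \<rho> subset_UNIV]) blast
  define good where "good i C \<longleftrightarrow> is_branch c1 c2 q \<alpha>o \<rho> r (fixed_points (H i)) C \<and>
    (\<exists>A U. (\<forall>n :: nat. (A n, U n) \<in> C \<and> (A n, U n) \<in> solutions c1 c2 q \<and> U n \<noteq> 0 \<and> U n \<in> fixed_points (H i)) \<and> A \<longlonglongrightarrow> \<alpha>o \<and> U \<longlonglongrightarrow> 0)" for i C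
  have "\<exists>C. good i C" for i
    unfolding good_def
    by (rule symmetric_direction.symmetric_branch[OF dir[of i] \<rho> subset_refl]) blast
  then obtain C where C: "\<And>i. good i (C i)" by metis
  have "at_least_branches c1 c2 q \<alpha>o \<rho> r n (amalgamated_class H0 Z L K N)"
    unfolding at_least_branches_def
  proof (intro exI[of _ C] conjI allI impI)
    show "\<exists>Ha\<in>amalgamated_class H0 Z L K N. is_branch c1 c2 q \<alpha>o \<rho> r (fixed_points Ha) (C i)" for i
      using C[of i] H_class[of i] unfolding good_def by blast
    fix i j assume ij: "i < n" "j < n" "i \<noteq> j"
    show "\<not> (\<exists>A\<in>carrier O2. C j = map_prod id (act (id, A)) ` C i)"
    proof
      assume "\<exists>A\<in>carrier O2. C j = map_prod id (act (id, A)) ` C i"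
      then obtain M where M: "C j = map_prod id (act (id, M)) ` C i" by blast
      obtain A U where AU: "\<And>n :: nat. (A n, U n) \<in> C j" "\<And>n. (A n, U n) \<in> solutions c1 c2 q" "\<And>n. U n \<noteq> 0"
        "\<And>n. U n \<in> fixed_points (H j)" "A \<longlonglongrightarrow> \<alpha>o" "U \<longlonglongrightarrow> 0" using C[of j] unfolding good_def by blast
      have "C i \<subseteq> UNIV \<times> fixed_points (H i)"
        using C[of i] is_branch_subset closed_fixed_points unfolding good_def by blast
      then obtain c f where ef: "\<And>t. e j t = c *\<^sub>R e i (f t)"
        using branches_distinct[OF dir dir _ M AU] by blast
      obtain w where w: "w \<bullet> (cmat (\<gamma> i) *v a0) = 0" "w \<bullet> (cmat (\<gamma> i) *v b0) = 0"
        "\<not> (w \<bullet> (cmat (\<gamma> j) *v a0) = 0 \<and> w \<bullet> (cmat (\<gamma> j) *v b0) = 0)" using distinct[OF ij] by blast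
      \<comment> \<open>All values of \<open>e j\<close> would be multiples of values of
        \<open>e i\<close>, hence orthogonal to \<open>w\<close>; the times \<open>0\<close> and
        \<open>pi / 2\<close> isolate the two spanning vectors.\<close>
      have "w \<bullet> (cos t *\<^sub>R (cmat (\<gamma> j) *v a0) - sin t *\<^sub>R (cmat (\<gamma> j) *v b0)) = 0" for t
      proof -
        have "vertex_fun (cos t *\<^sub>R (cmat (\<gamma> j) *v a0) - sin t *\<^sub>R (cmat (\<gamma> j) *v b0))
          = vertex_fun (c *\<^sub>R (cos (f t) *\<^sub>R (cmat (\<gamma> i) *v a0) - sin (f t) *\<^sub>R (cmat (\<gamma> i) *v b0)))"
          using ef[of t] by (simp add: e_def kfun_def linear_cmul[OF vertex_fun_linear])
        then show ?thesis by (simp add: vertex_fun_inj inner_diff_right w)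
      qed
      from this[of 0] this[of "pi / 2"] show False using w(3) by simp
    qed
  qed
  with bif show ?thesis by blast
qed

section \<open>Groups with two generators and sign characters\<close>

text \<open>Conjugation by the involution \<open>s\<close> preserves the subgroup generated by
  \<open>r\<close>, so the whole group is that subgroup together with its coset of
  \<open>s\<close>.\<close>

lemma (in group) generate_two:
  assumes rs: "r \<in> carrier G" "s \<in> carrier G" "s \<otimes> s = \<one>" "s \<otimes> r \<otimes> s \<in> {r, inv r}"
    and x: "x \<in> generate G {r, s}"
  shows "x \<in> generate G {r} \<or> x \<otimes> s \<in> generate G {r}"
proof -
  let ?R = "generate G {r}"
  have R: "subgroup ?R G" by (rule generate_is_subgroup) (use rs in simp)
  note Rc = subgroup.mem_carrier[OF R]
  have inv_s: "inv s = s" using rs(2,3) by (simp add: inv_equality)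
  have ss: "s \<otimes> (s \<otimes> y) = y" if "y \<in> carrier G" for y
    using that rs by (simp add: m_assoc[symmetric])
  have sr: "s \<otimes> r \<otimes> s \<in> ?R" using rs(4) generate.incl[of r "{r}"] generate.inv[of r "{r}"] by auto
  have conj: "s \<otimes> y \<otimes> s \<in> ?R" if "y \<in> ?R" for y
    using that
  proof (induction rule: generate.induct)
    case one
    show ?case using rs generate.one by simp
  next
    case (incl h)
    then show ?case using sr by simp
  next
    case (inv h)
    have "inv (s \<otimes> r \<otimes> s) = s \<otimes> inv r \<otimes> s" using rs by (simp add: inv_mult_group inv_s m_assoc)
    then show ?case using subgroup.m_inv_closed[OF R sr] inv by simp
  next
    case (eng h1 h2)
    have "s \<otimes> (h1 \<otimes> h2) \<otimes> s = (s \<otimes> h1 \<otimes> s) \<otimes> (s \<otimes> h2 \<otimes> s)"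
      using rs(2) Rc[OF eng(1)] Rc[OF eng(2)] by (simp add: m_assoc ss)
    then show ?case using subgroup.m_closed[OF R eng(3,4)] by simp
  qed
  have car: "y \<in> carrier G" if "y \<in> generate G {r, s}" for y
    by (rule generate_in_carrier[OF _ that]) (use rs in simp)
  show ?thesis using x
  proof (induction rule: generate.induct)
    case one
    show ?case using generate.one by blast
  next
    case (incl h)
    then show ?case using rs(3) generate.one[of G "{r}"] generate.incl[of r "{r}" G] by auto
  next
    case (inv h)
    then show ?case using rs(3) generate.one[of G "{r}"] generate.inv[of r "{r}" G] inv_s by auto
  next
    case (eng x y)
    note c = car[OF eng(1)] car[OF eng(2)] rs(2)
    have 1: "x \<otimes> y \<otimes> s = x \<otimes> (y \<otimes> s)" "x \<otimes> y \<otimes> s = (x \<otimes> s) \<otimes> (s \<otimes> y \<otimes> s)"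
      "x \<otimes> y = (x \<otimes> s) \<otimes> (s \<otimes> (y \<otimes> s) \<otimes> s)"
      using c by (simp_all add: m_assoc ss rs(3))
    show ?case
      using eng(3,4) subgroup.m_closed[OF R] conj 1 by metis
  qed
qed

text \<open>Outside the subgroup of \<open>r\<close> an element becomes a member after
  multiplication by \<open>s\<close>, hence has sign \<open>-1\<close>. Therefore the kernel of the
  sign is exactly that subgroup.\<close>

lemma (in group) sign_epi_kernel:
  fixes sg :: "'a \<Rightarrow> real"
  assumes rs: "r \<in> P" "s \<in> P" "s \<otimes> s = \<one>" "s \<otimes> r \<otimes> s \<in> {r, inv r}" and P: "subgroup P G"
    and mult: "\<And>x y. x \<in> P \<Longrightarrow> y \<in> P \<Longrightarrow> sg (x \<otimes> y) = sg x * sg y"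
    and sign: "\<And>x. x \<in> P \<Longrightarrow> sg x = 1 \<or> sg x = -1" and sg: "sg r = 1" "sg s = -1"
  defines "f \<equiv> \<lambda>x. if sg x = 1 then 0 else 1 :: int"
  shows "f \<in> epi (G\<lparr>carrier := generate G {r, s}\<rparr>) (integer_mod_group 2)"
    and "kernel (G\<lparr>carrier := generate G {r, s}\<rparr>) (integer_mod_group 2) f = generate G {r}"
proof -
  have rsc: "r \<in> carrier G" "s \<in> carrier G" using rs(1,2) subgroup.mem_carrier[OF P] by auto
  have sub: "generate G {r, s} \<subseteq> P" by (rule generate_subgroup_incl[OF _ P]) (use rs in simp)
  have Rsub: "generate G {r} \<subseteq> generate G {r, s}" by (rule mono_generate) simp
  have one: "sg \<one> = 1" using mult[of \<one> \<one>] sign[of \<one>] subgroup.one_closed[OF P] by auto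
  have R1: "sg x = 1" if "x \<in> generate G {r}" for x
    using that
  proof (induction rule: generate.induct)
    case one
    show ?case by (rule \<open>sg \<one> = 1\<close>)
  next
    case (incl h)
    then show ?case using sg by simp
  next
    case (inv h)
    have "sg r * sg (inv r) = 1" using mult[OF rs(1) subgroup.m_inv_closed[OF P rs(1)]] rsc one by simp
    then show ?case using inv sg by simp
  next
    case (eng x y)
    then show ?case using mult Rsub sub by (metis mult_1 subsetD)
  qed
  have gen: "x \<in> generate G {r}" if "x \<in> generate G {r, s}" "sg x = 1" for x
  proof (rule ccontr)
    assume "x \<notin> generate G {r}"
    then have "sg (x \<otimes> s) = 1" using generate_two[OF rsc rs(3,4) that(1)] R1 by blast
    then show False using mult[of x s] that sub rs(2) sg by auto
  qed
  have "f (x \<otimes> y) = (f x + f y) mod 2" if "x \<in> P" "y \<in> P" for x y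
    using mult[OF that] sign[OF that(1)] sign[OF that(2)] by (auto simp: f_def)
  then have hom: "f \<in> hom (G\<lparr>carrier := generate G {r, s}\<rparr>) (integer_mod_group 2)"
    using sub by (intro homI) (auto simp: carrier_integer_mod_group f_def subsetD)
  have "f \<one> = 0" "f s = 1" by (simp_all add: f_def one sg)
  moreover have "\<one> \<in> generate G {r, s}" "s \<in> generate G {r, s}" by (auto intro: generate.one generate.incl)
  moreover have "{0..<2 :: int} = {0, 1}" by auto
  ultimately have "carrier (integer_mod_group 2) \<subseteq> f ` generate G {r, s}"
    by (auto simp: carrier_integer_mod_group image_iff intro: bexI[of _ \<one>] bexI[of _ s])
  then show "f \<in> epi (G\<lparr>carrier := generate G {r, s}\<rparr>) (integer_mod_group 2)"
    using hom by (simp add: epi_iff_subset)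
  show "kernel (G\<lparr>carrier := generate G {r, s}\<rparr>) (integer_mod_group 2) f = generate G {r}"
    using gen R1 Rsub by (auto simp: kernel_def f_def split: if_splits)
qed

subsection \<open>The three families of subgroups\<close>

lemma mat3_entries:
  "mat3 a b c d e f g h i $ 1 $ 1 = a" "mat3 a b c d e f g h i $ 1 $ 2 = b" "mat3 a b c d e f g h i $ 1 $ 3 = c"
  "mat3 a b c d e f g h i $ 2 $ 1 = d" "mat3 a b c d e f g h i $ 2 $ 2 = e" "mat3 a b c d e f g h i $ 2 $ 3 = f"
  "mat3 a b c d e f g h i $ 3 $ 1 = g" "mat3 a b c d e f g h i $ 3 $ 2 = h" "mat3 a b c d e f g h i $ 3 $ 3 = i"
  by (simp_all add: mat3_def)

lemmas mat3_simps = vec_eq_iff forall_3 matrix_matrix_mult_def sum_3 mat3_entries transpose_def mat_def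

lemma mat3_mult: "mat3 a b c d e f g h i ** mat3 a' b' c' d' e' f' g' h' i' =
    mat3 (a * a' + b * d' + c * g') (a * b' + b * e' + c * h') (a * c' + b * f' + c * i')
      (d * a' + e * d' + f * g') (d * b' + e * e' + f * h') (d * c' + e * f' + f * i')
      (g * a' + h * d' + i * g') (g * b' + h * e' + i * h') (g * c' + h * f' + i * i')"
  and mat3_transpose: "transpose (mat3 a b c d e f g h i) = mat3 a d g b e h c f i"
  and mat3_one: "mat 1 = mat3 1 0 0 0 1 0 0 0 1"
  by (simp_all add: mat3_simps)

lemma cube_mat_relations:
  "sw_mat ** sw_mat = mat 1" "ee_mat ** ee_mat = mat 1"
  "sw_mat ** rz_mat ** sw_mat = transpose rz_mat" "ee_mat ** ed_mat ** ee_mat = ed_mat"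
  unfolding cube_mats by (simp_all add: mat3_mult mat3_transpose mat3_one)

lemma cube_perm_relations:
  defines "rz \<equiv> vperm rz_mat" and "sw \<equiv> vperm sw_mat" and "ed \<equiv> vperm ed_mat" and "ee \<equiv> vperm ee_mat"
  shows "sw \<otimes>\<^bsub>cube_group\<^esub> sw = \<one>\<^bsub>cube_group\<^esub>" "ee \<otimes>\<^bsub>cube_group\<^esub> ee = \<one>\<^bsub>cube_group\<^esub>"
    "sw \<otimes>\<^bsub>cube_group\<^esub> rz \<otimes>\<^bsub>cube_group\<^esub> sw \<in> {rz, inv\<^bsub>cube_group\<^esub> rz}"
    "ee \<otimes>\<^bsub>cube_group\<^esub> ed \<otimes>\<^bsub>cube_group\<^esub> ee \<in> {ed, inv\<^bsub>cube_group\<^esub> ed}"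
proof -
  note c = cube_mats_in_group[folded rz_def sw_def ed_def ee_def]
  show "sw \<otimes>\<^bsub>cube_group\<^esub> sw = \<one>\<^bsub>cube_group\<^esub>" "ee \<otimes>\<^bsub>cube_group\<^esub> ee = \<one>\<^bsub>cube_group\<^esub>"
    by (rule cmat_inject; simp add: c cmat_mult cmat_one cube_mat_relations)+
  have "sw \<otimes>\<^bsub>cube_group\<^esub> rz \<otimes>\<^bsub>cube_group\<^esub> sw = inv\<^bsub>cube_group\<^esub> rz" "ee \<otimes>\<^bsub>cube_group\<^esub> ed \<otimes>\<^bsub>cube_group\<^esub> ee = ed"
    by (rule cmat_inject; simp add: c cmat_mult cmat_inv cube_mat_relations)+
  then show "sw \<otimes>\<^bsub>cube_group\<^esub> rz \<otimes>\<^bsub>cube_group\<^esub> sw \<in> {rz, inv\<^bsub>cube_group\<^esub> rz}"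
    "ee \<otimes>\<^bsub>cube_group\<^esub> ed \<otimes>\<^bsub>cube_group\<^esub> ee \<in> {ed, inv\<^bsub>cube_group\<^esub> ed}" by simp_all
qed

lemma subgroup_cubeI:
  assumes "P \<subseteq> carrier cube_group" "\<one>\<^bsub>cube_group\<^esub> \<in> P"
    "\<And>x y. x \<in> P \<Longrightarrow> y \<in> P \<Longrightarrow> x \<otimes>\<^bsub>cube_group\<^esub> y \<in> P" "\<And>x. x \<in> P \<Longrightarrow> inv\<^bsub>cube_group\<^esub> x \<in> P"
  shows "subgroup P cube_group"
  using assms by (intro subgroup.intro) auto

text \<open>The rotations of the cube that preserve the line through \<open>w\<close>; whether they
  keep or reverse it is the sign character that defines the two families over
  \<open>integer_mod_group 2\<close>.\<close>

definition line_group :: "real ^ 3 \<Rightarrow> (8 \<Rightarrow> 8) set" where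
  "line_group w = {\<gamma> \<in> carrier cube_group. cmat \<gamma> *v w = w \<or> cmat \<gamma> *v w = - w}"

definition line_sign :: "real ^ 3 \<Rightarrow> (8 \<Rightarrow> 8) \<Rightarrow> real" where
  "line_sign w \<gamma> = (if cmat \<gamma> *v w = w then 1 else -1)"

lemma matrix_vector_neg: "(A :: real ^ 'n ^ 'm) *v (- x) = - (A *v x)"
  by (rule linear_neg[OF matrix_vector_mul_linear])

lemma line_group_subgroup: "subgroup (line_group w) cube_group"
proof (rule subgroup_cubeI)
  show "\<one>\<^bsub>cube_group\<^esub> \<in> line_group w" by (simp add: line_group_def cmat_one)
  show "x \<otimes>\<^bsub>cube_group\<^esub> y \<in> line_group w" if "x \<in> line_group w" "y \<in> line_group w" for x y
    using that by (auto simp: line_group_def cmat_mult matrix_vector_mul_assoc[symmetric] matrix_vector_neg)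
  show "inv\<^bsub>cube_group\<^esub> x \<in> line_group w" if "x \<in> line_group w" for x
  proof -
    have x: "x \<in> carrier cube_group" using that by (simp add: line_group_def)
    have bk: "cmat (inv\<^bsub>cube_group\<^esub> x) *v (cmat x *v w) = w"
      by (simp only: cmat_inv[OF x] matrix_vector_mul_assoc rotation_transpose[OF cmat_rotation[OF x]] matrix_vector_mul_lid)
    have "cmat (inv\<^bsub>cube_group\<^esub> x) *v w = w \<or> cmat (inv\<^bsub>cube_group\<^esub> x) *v w = - w"
    proof (cases "cmat x *v w = w")
      case True
      then show ?thesis using bk by simp
    next
      case False
      then have "cmat x *v w = - w" using that by (simp add: line_group_def)
      then have "- (cmat (inv\<^bsub>cube_group\<^esub> x) *v w) = w" using bk by (simp only: matrix_vector_neg)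
      then show ?thesis by (metis minus_minus)
    qed
    then show ?thesis using x by (simp add: line_group_def)
  qed
qed (auto simp: line_group_def)

lemma line_sign_apply: "\<gamma> \<in> line_group w \<Longrightarrow> cmat \<gamma> *v w = line_sign w \<gamma> *\<^sub>R w"
  by (auto simp: line_group_def line_sign_def)

lemma line_sign_mult:
  assumes "x \<in> line_group w" "y \<in> line_group w" "w \<noteq> 0"
  shows "line_sign w (x \<otimes>\<^bsub>cube_group\<^esub> y) = line_sign w x * line_sign w y"
proof -
  have "x \<otimes>\<^bsub>cube_group\<^esub> y \<in> line_group w" using subgroup.m_closed[OF line_group_subgroup] assms by blast
  then have "line_sign w (x \<otimes>\<^bsub>cube_group\<^esub> y) *\<^sub>R w = cmat (x \<otimes>\<^bsub>cube_group\<^esub> y) *v w" by (simp add: line_sign_apply)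
  also have "\<dots> = cmat x *v (cmat y *v w)"
    using assms by (simp add: line_group_def cmat_mult matrix_vector_mul_assoc)
  also have "\<dots> = (line_sign w x * line_sign w y) *\<^sub>R w"
    using assms by (simp add: line_sign_apply matrix_vector_mult_scaleR mult.commute)
  finally show ?thesis using assms(3) by simp
qed

definition sign_hom :: "('a \<Rightarrow> real) \<Rightarrow> 'a \<Rightarrow> int" where
  "sign_hom sg x = (if sg x = 1 then 0 else 1)"

text \<open>Applied twice: with an edge axis and two half turns this is the epimorphism from
  \<open>S4_D2\<close> with kernel \<open>S4_D1\<close>, with a face axis, a quarter turn and a half
  turn the one from \<open>S4_D4\<close> with kernel \<open>S4_Z4\<close>.\<close>

lemma line_sign_epi:
  assumes "r \<in> carrier cube_group" "s \<in> carrier cube_group" "cmat r *v w = w" "cmat s *v w = - w" "w \<noteq> 0"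
    and rel: "s \<otimes>\<^bsub>cube_group\<^esub> s = \<one>\<^bsub>cube_group\<^esub>" "s \<otimes>\<^bsub>cube_group\<^esub> r \<otimes>\<^bsub>cube_group\<^esub> s \<in> {r, inv\<^bsub>cube_group\<^esub> r}"
  shows "sign_hom (line_sign w) \<in> epi (cube_group\<lparr>carrier := generate cube_group {r, s}\<rparr>) (integer_mod_group 2)"
    and "kernel (cube_group\<lparr>carrier := generate cube_group {r, s}\<rparr>) (integer_mod_group 2) (sign_hom (line_sign w)) = generate cube_group {r}"
    and "generate cube_group {r, s} \<subseteq> line_group w"
proof -
  have P: "r \<in> line_group w" "s \<in> line_group w" using assms by (simp_all add: line_group_def)
  have "- w \<noteq> w" using assms(5) by (auto simp: vec_eq_iff)
  then have s: "line_sign w r = 1" "line_sign w s = -1" using assms by (simp_all add: line_sign_def)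
  note * = group.sign_epi_kernel[OF cube_group_group P rel line_group_subgroup, of "line_sign w", OF line_sign_mult[OF _ _ assms(5)] _ s]
  show "sign_hom (line_sign w) \<in> epi (cube_group\<lparr>carrier := generate cube_group {r, s}\<rparr>) (integer_mod_group 2)"
    unfolding sign_hom_def[abs_def] by (rule *(1)) (auto simp: line_sign_def)
  show "kernel (cube_group\<lparr>carrier := generate cube_group {r, s}\<rparr>) (integer_mod_group 2) (sign_hom (line_sign w)) = generate cube_group {r}"
    unfolding sign_hom_def[abs_def] by (rule *(2)) (auto simp: line_sign_def)
  show "generate cube_group {r, s} \<subseteq> line_group w" 
    by (rule cg.generate_subgroup_incl[OF _ line_group_subgroup]) (use P in simp)
qed

lemma mat2_simps: "rot2 \<theta> $ 1 $ 1 = cos \<theta>" "rot2 \<theta> $ 1 $ 2 = - sin \<theta>" "rot2 \<theta> $ 2 $ 1 = sin \<theta>" "rot2 \<theta> $ 2 $ 2 = cos \<theta>"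
  "refl2 $ 1 $ 1 = 1" "refl2 $ 1 $ 2 = 0" "refl2 $ 2 $ 1 = 0" "refl2 $ 2 $ 2 = -1"
  by (simp_all add: rot2_def refl2_def)

lemmas mat2_eq = vec_eq_iff forall_2 matrix_matrix_mult_def sum_2 mat2_simps transpose_def mat_def

lemma rot2_in_O2: "rot2 \<theta> \<in> carrier O2" and refl2_in_O2: "refl2 \<in> carrier O2"
  by (simp_all add: O2_simps orthogonal_matrix mat2_eq power2_eq_square[symmetric] mult.commute)

definition diag_group :: "(real ^ 2 ^ 2) set" where
  "diag_group = {k \<in> carrier O2. k $ 1 $ 2 = 0 \<and> k $ 2 $ 1 = 0}"

lemma O2_inv: "k \<in> carrier O2 \<Longrightarrow> inv\<^bsub>O2\<^esub> k = transpose k"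
  by (rule o2.inv_equality) (auto simp: O2_simps orthogonal_matrix_def)

lemma diag_group_subgroup: "subgroup diag_group O2"
proof (rule subgroup.intro)
  show "x \<otimes>\<^bsub>O2\<^esub> y \<in> diag_group" if "x \<in> diag_group" "y \<in> diag_group" for x y
  proof -
    have "x \<otimes>\<^bsub>O2\<^esub> y \<in> carrier O2" using that by (intro o2.m_closed) (auto simp: diag_group_def)
    moreover have "(x \<otimes>\<^bsub>O2\<^esub> y) $ 1 $ 2 = 0" "(x \<otimes>\<^bsub>O2\<^esub> y) $ 2 $ 1 = 0"
      using that by (simp_all add: diag_group_def O2_simps matrix_matrix_mult_def sum_2)
    ultimately show ?thesis by (simp add: diag_group_def)
  qed
  show "inv\<^bsub>O2\<^esub> x \<in> diag_group" if "x \<in> diag_group" for x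
  proof -
    have "x \<in> carrier O2" using that by (simp add: diag_group_def)
    then show ?thesis using that o2.inv_closed[of x] by (auto simp: diag_group_def O2_inv transpose_def)
  qed
  show "\<one>\<^bsub>O2\<^esub> \<in> diag_group"
    by (simp add: diag_group_def O2_simps orthogonal_matrix_id, simp add: mat_def)
qed (auto simp: diag_group_def)

text \<open>On diagonal matrices the upper left entry is a sign character, \<open>1\<close> on the
  reflection and \<open>-1\<close> on \<open>rot2 pi\<close>. A full turn is the identity, so
  \<open>O2_D 1\<close> is generated by the reflection alone.\<close>

lemma O2_D2_epi:
  "sign_hom (\<lambda>k. k $ 1 $ 1) \<in> epi (O2\<lparr>carrier := O2_D 2\<rparr>) (integer_mod_group 2)"
  "kernel (O2\<lparr>carrier := O2_D 2\<rparr>) (integer_mod_group 2) (sign_hom (\<lambda>k. k $ 1 $ 1)) = O2_D 1"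
  "O2_D 2 \<subseteq> diag_group"
proof -
  have D2: "O2_D 2 = generate O2 {refl2, rot2 pi}" by (simp add: O2_D_def insert_commute)
  have rot1: "rot2 (2 * pi) = \<one>\<^bsub>O2\<^esub>" by (simp add: mat2_eq O2_simps)
  have D1: "O2_D 1 = generate O2 {refl2}"
  proof
    have "{\<one>\<^bsub>O2\<^esub>, refl2} \<subseteq> generate O2 {refl2}" by (auto intro: generate.one generate.incl)
    then show "O2_D 1 \<subseteq> generate O2 {refl2}"
      unfolding O2_D_def using o2.generate_subgroup_incl[OF _ o2.generate_is_subgroup[of "{refl2}"]] refl2_in_O2
      by (simp add: rot1)
    show "generate O2 {refl2} \<subseteq> O2_D 1" unfolding O2_D_def by (rule o2.mono_generate) simp
  qed
  have P: "refl2 \<in> diag_group" "rot2 pi \<in> diag_group"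
    by (simp_all add: diag_group_def rot2_in_O2 refl2_in_O2 mat2_simps)
  have rel: "rot2 pi \<otimes>\<^bsub>O2\<^esub> rot2 pi = \<one>\<^bsub>O2\<^esub>" "rot2 pi \<otimes>\<^bsub>O2\<^esub> refl2 \<otimes>\<^bsub>O2\<^esub> rot2 pi \<in> {refl2, inv\<^bsub>O2\<^esub> refl2}"
    by (simp_all add: O2_simps mat2_eq)
  have mult: "(x \<otimes>\<^bsub>O2\<^esub> y) $ 1 $ 1 = x $ 1 $ 1 * y $ 1 $ 1" if "x \<in> diag_group" "y \<in> diag_group" for x y
    using that by (simp add: diag_group_def O2_simps matrix_matrix_mult_def sum_2)
  have sign: "x $ 1 $ 1 = 1 \<or> x $ 1 $ 1 = -1" if "x \<in> diag_group" for x
    using that O2_entries(1)[of x] by (auto simp: diag_group_def power2_eq_1_iff)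
  have v: "refl2 $ 1 $ 1 = 1" "rot2 pi $ 1 $ 1 = -1" by (simp_all add: mat2_simps)
  note * = group.sign_epi_kernel[OF O2_group P rel diag_group_subgroup, of "\<lambda>k. k $ 1 $ 1", OF mult sign v]
  show "sign_hom (\<lambda>k. k $ 1 $ 1) \<in> epi (O2\<lparr>carrier := O2_D 2\<rparr>) (integer_mod_group 2)"
    unfolding sign_hom_def[abs_def] D2 by (rule *(1))
  show "kernel (O2\<lparr>carrier := O2_D 2\<rparr>) (integer_mod_group 2) (sign_hom (\<lambda>k. k $ 1 $ 1)) = O2_D 1"
    unfolding sign_hom_def[abs_def] D2 D1 by (rule *(2))
  show "O2_D 2 \<subseteq> diag_group" unfolding D2
    by (rule o2.generate_subgroup_incl[OF _ diag_group_subgroup]) (use P in simp)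
qed

lemma line_fixdir:
  assumes "h \<in> line_group w" "k \<in> diag_group" "sign_hom (line_sign w) h = sign_hom (\<lambda>k. k $ 1 $ 1) k"
  shows "fixdir (h, k) w 0"
proof -
  have k: "k $ 2 $ 1 = 0" "k $ 1 $ 1 = 1 \<or> k $ 1 $ 1 = -1"
    using assms(2) O2_entries(1)[of k] by (auto simp: diag_group_def power2_eq_1_iff)
  moreover have "line_sign w h = 1 \<or> line_sign w h = -1" by (simp add: line_sign_def)
  ultimately have "line_sign w h = k $ 1 $ 1" using assms(3) by (auto simp: sign_hom_def split: if_splits)
  then show ?thesis using k line_sign_apply[OF assms(1)] by (auto simp: fixdir_def matrix_vector_mult_scaleR matrix_vector_neg)
qed

text \<open>Two elements of the subgroup decide: the identity paired with the reflection forces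
  \<open>b = 0\<close>, and \<open>r\<close> paired with the identity puts \<open>a\<close> on the
  axis of \<open>r\<close>.\<close>

lemma line_one_dim:
  assumes ab: "\<And>h k. h \<in> generate cube_group {r, s} \<Longrightarrow> k \<in> O2_D 2 \<Longrightarrow>
      sign_hom (line_sign w) h = sign_hom (\<lambda>k. k $ 1 $ 1) k \<Longrightarrow> fixdir (h, k) a b"
    and r: "cmat r *v w = w"
  shows "b = 0" "cmat r *v a = a"
proof -
  have "refl2 \<in> O2_D 2" "\<one>\<^bsub>O2\<^esub> \<in> O2_D 2" unfolding O2_D_def by (auto intro: generate.one generate.incl)
  moreover have "\<one>\<^bsub>cube_group\<^esub> \<in> generate cube_group {r, s}" "r \<in> generate cube_group {r, s}"
    by (auto intro: generate.one generate.incl)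
  moreover have "sign_hom (line_sign w) \<one>\<^bsub>cube_group\<^esub> = sign_hom (\<lambda>k. k $ 1 $ 1) refl2"
    by (simp add: sign_hom_def line_sign_def cmat_one mat2_simps)
  moreover have "sign_hom (line_sign w) r = sign_hom (\<lambda>k. k $ 1 $ 1) \<one>\<^bsub>O2\<^esub>"
    by (simp add: sign_hom_def line_sign_def r O2_simps mat_def)
  ultimately have f: "fixdir (\<one>\<^bsub>cube_group\<^esub>, refl2) a b" "fixdir (r, \<one>\<^bsub>O2\<^esub>) a b" by (auto intro: ab)
  have "- b = b" using f(1) by (simp add: fixdir_def cmat_one mat2_simps)
  then show "b = 0" by (auto simp: vec_eq_iff)
  show "cmat r *v a = a" using f(2) by (simp add: fixdir_def O2_simps mat_def)
qed

text \<open>For a rotation that preserves the third axis this is its action on the plane orthogonal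
  to that axis; it realizes the dihedral group of order \<open>8\<close> inside
  \<open>O(2)\<close>.\<close>

definition block2 :: "real ^ 3 ^ 3 \<Rightarrow> real ^ 2 ^ 2" where
  "block2 A = vector [vector [A $ 1 $ 1, A $ 1 $ 2], vector [A $ 2 $ 1, A $ 2 $ 2]]"

lemma block2_simps: "block2 A $ 1 $ 1 = A $ 1 $ 1" "block2 A $ 1 $ 2 = A $ 1 $ 2" "block2 A $ 2 $ 1 = A $ 2 $ 1" "block2 A $ 2 $ 2 = A $ 2 $ 2"
  by (simp_all add: block2_def)

definition axis_group :: "(8 \<Rightarrow> 8) set" where
  "axis_group = {\<gamma> \<in> carrier cube_group. cmat \<gamma> $ 1 $ 3 = 0 \<and> cmat \<gamma> $ 2 $ 3 = 0 \<and> cmat \<gamma> $ 3 $ 1 = 0 \<and> cmat \<gamma> $ 3 $ 2 = 0}"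

lemma axis_group_subgroup: "subgroup axis_group cube_group"
proof (rule subgroup_cubeI)
  show "\<one>\<^bsub>cube_group\<^esub> \<in> axis_group" by (simp add: axis_group_def cmat_one mat_def)
  show "x \<otimes>\<^bsub>cube_group\<^esub> y \<in> axis_group" if "x \<in> axis_group" "y \<in> axis_group" for x y
    using that by (auto simp: axis_group_def cmat_mult matrix_matrix_mult_def sum_3)
  show "inv\<^bsub>cube_group\<^esub> x \<in> axis_group" if "x \<in> axis_group" for x
    using that by (auto simp: axis_group_def cmat_inv transpose_def)
qed (auto simp: axis_group_def)

lemma axis_group_rows:
  assumes "\<gamma> \<in> axis_group"
  defines "A \<equiv> cmat \<gamma>"
  shows "A $ 1 $ 1 * A $ 1 $ 1 + A $ 1 $ 2 * A $ 1 $ 2 = 1" "A $ 2 $ 1 * A $ 2 $ 1 + A $ 2 $ 2 * A $ 2 $ 2 = 1"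
    "A $ 1 $ 1 * A $ 2 $ 1 + A $ 1 $ 2 * A $ 2 $ 2 = 0"
proof -
  have "\<gamma> \<in> carrier cube_group" "A $ 1 $ 3 = 0" "A $ 2 $ 3 = 0" using assms by (auto simp: axis_group_def)
  moreover from this have "A ** transpose A = mat 1" unfolding A_def by (intro rotation_transpose cmat_rotation)
  ultimately show "A $ 1 $ 1 * A $ 1 $ 1 + A $ 1 $ 2 * A $ 1 $ 2 = 1" "A $ 2 $ 1 * A $ 2 $ 1 + A $ 2 $ 2 * A $ 2 $ 2 = 1"
    "A $ 1 $ 1 * A $ 2 $ 1 + A $ 1 $ 2 * A $ 2 $ 2 = 0"
    by (simp_all add: mat3_simps)
qed

lemma block2_hom: "group_hom (cube_group\<lparr>carrier := axis_group\<rparr>) O2 (\<lambda>\<gamma>. block2 (cmat \<gamma>))"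
proof (rule group_hom.intro)
  show "group (cube_group\<lparr>carrier := axis_group\<rparr>)" by (rule cg.subgroup_imp_group[OF axis_group_subgroup])
  show "group O2" by (rule O2_group)
  have "block2 (cmat x) \<in> carrier O2" if "x \<in> axis_group" for x
  proof -
    have "block2 (cmat x) ** transpose (block2 (cmat x)) = mat 1"
      using axis_group_rows[OF that]
      by (simp add: vec_eq_iff forall_2 matrix_matrix_mult_def sum_2 transpose_def mat_def block2_simps mult.commute)
    then show ?thesis by (simp add: O2_simps orthogonal_matrix_def matrix_left_right_inverse)
  qed
  moreover have "block2 (cmat (x \<otimes>\<^bsub>cube_group\<^esub> y)) = block2 (cmat x) \<otimes>\<^bsub>O2\<^esub> block2 (cmat y)"
    if "x \<in> axis_group" "y \<in> axis_group" for x y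
    using that by (simp add: axis_group_def cmat_mult O2_simps vec_eq_iff forall_2 matrix_matrix_mult_def sum_2 sum_3 block2_simps)
  ultimately show "group_hom_axioms (cube_group\<lparr>carrier := axis_group\<rparr>) O2 (\<lambda>\<gamma>. block2 (cmat \<gamma>))"
    by (intro group_hom_axioms.intro homI) simp_all
qed

lemma S4_D4_axis: "S4_D4 \<subseteq> axis_group"
  unfolding cube_subgroups
  by (rule cg.generate_subgroup_incl[OF _ axis_group_subgroup])
    (simp add: axis_group_def cube_mats_in_group, simp add: cube_mats mat3_entries)

lemma block2_generators: "block2 rz_mat = rot2 (pi / 2)" "block2 sw_mat = rot2 (pi / 2) \<otimes>\<^bsub>O2\<^esub> refl2"
  by (simp_all add: cube_mats vec_eq_iff forall_2 block2_simps mat3_entries mat2_simps O2_simps matrix_matrix_mult_def sum_2)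

lemma block2_image: "(\<lambda>\<gamma>. block2 (cmat \<gamma>)) ` S4_D4 = O2_D 4"
proof -
  interpret h: group_hom "cube_group\<lparr>carrier := axis_group\<rparr>" O2 "\<lambda>\<gamma>. block2 (cmat \<gamma>)" by (rule block2_hom)
  let ?r = "rot2 (pi / 2)" and ?s = "rot2 (pi / 2) \<otimes>\<^bsub>O2\<^esub> refl2"
  have gens: "{vperm rz_mat, vperm sw_mat} \<subseteq> axis_group"
    using S4_D4_axis unfolding cube_subgroups by (auto intro: generate.incl)
  have "generate O2 ((\<lambda>\<gamma>. block2 (cmat \<gamma>)) ` {vperm rz_mat, vperm sw_mat})
    = (\<lambda>\<gamma>. block2 (cmat \<gamma>)) ` generate (cube_group\<lparr>carrier := axis_group\<rparr>) {vperm rz_mat, vperm sw_mat}"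
    by (rule h.generate_img[symmetric] h.generate_img) (use gens in simp)
  then have "(\<lambda>\<gamma>. block2 (cmat \<gamma>)) ` S4_D4 = generate O2 {?r, ?s}"
    by (simp add: cg.generate_consistent[OF gens axis_group_subgroup] cube_subgroups cube_mats_in_group block2_generators)
  also have "\<dots> = generate O2 {?r, refl2}"
  proof
    have in1: "?r \<in> generate O2 {?r, refl2}" "refl2 \<in> generate O2 {?r, refl2}" by (auto intro: generate.incl)
    have in2: "?r \<in> generate O2 {?r, ?s}" "?s \<in> generate O2 {?r, ?s}" by (auto intro: generate.incl)
    \<comment> \<open>Recovers the plane reflection from the images of the two generators, so both
      pairs generate the same dihedral group.\<close>
    have eq: "refl2 = ?s \<otimes>\<^bsub>O2\<^esub> ?r" by (simp add: O2_simps mat2_eq)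
    show "generate O2 {?r, ?s} \<subseteq> generate O2 {?r, refl2}"
      using in1 generate.eng[OF in1]
      by (intro o2.generate_subgroup_incl o2.generate_is_subgroup) (auto simp: rot2_in_O2 refl2_in_O2)
    have "refl2 \<in> generate O2 {?r, ?s}" using generate.eng[OF in2(2,1)] unfolding eq[symmetric] .
    then show "generate O2 {?r, refl2} \<subseteq> generate O2 {?r, ?s}"
      using in2 by (intro o2.generate_subgroup_incl o2.generate_is_subgroup) (auto simp: rot2_in_O2 refl2_in_O2)
  qed
  also have "\<dots> = O2_D 4" by (simp add: O2_D_def)
  finally show ?thesis .
qed

text \<open>If the block is the identity, the third diagonal entry equals the determinant, which is
  \<open>1\<close>; so the kernel is trivial. Surjectivity is \<open>block2_image\<close>.\<close>

lemma block2_epi: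
  "(\<lambda>\<gamma>. block2 (cmat \<gamma>)) \<in> epi (cube_group\<lparr>carrier := S4_D4\<rparr>) (O2\<lparr>carrier := O2_D 4\<rparr>)"
  "kernel (cube_group\<lparr>carrier := S4_D4\<rparr>) (O2\<lparr>carrier := O2_D 4\<rparr>) (\<lambda>\<gamma>. block2 (cmat \<gamma>)) = S4_Z1"
proof -
  interpret h: group_hom "cube_group\<lparr>carrier := axis_group\<rparr>" O2 "\<lambda>\<gamma>. block2 (cmat \<gamma>)" by (rule block2_hom)
  have mult: "block2 (cmat (x \<otimes>\<^bsub>cube_group\<^esub> y)) = block2 (cmat x) \<otimes>\<^bsub>O2\<^esub> block2 (cmat y)"
    if "x \<in> S4_D4" "y \<in> S4_D4" for x y
    using h.hom_mult[of x y] that S4_D4_axis by auto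
  show "(\<lambda>\<gamma>. block2 (cmat \<gamma>)) \<in> epi (cube_group\<lparr>carrier := S4_D4\<rparr>) (O2\<lparr>carrier := O2_D 4\<rparr>)"
    unfolding epi_def using block2_image mult by (auto simp: hom_def)
  have Z1: "S4_Z1 = {\<one>\<^bsub>cube_group\<^esub>}" by (simp add: cube_subgroups(1) cg.generate_empty)
  have ker: "\<gamma> = \<one>\<^bsub>cube_group\<^esub>" if "\<gamma> \<in> S4_D4" "block2 (cmat \<gamma>) = mat 1" for \<gamma>
  proof -
    have \<gamma>: "\<gamma> \<in> carrier cube_group" and z: "cmat \<gamma> $ 1 $ 3 = 0" "cmat \<gamma> $ 2 $ 3 = 0" "cmat \<gamma> $ 3 $ 1 = 0" "cmat \<gamma> $ 3 $ 2 = 0"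
      using S4_D4_axis that(1) by (auto simp: axis_group_def)
    have b: "cmat \<gamma> $ 1 $ 1 = 1" "cmat \<gamma> $ 1 $ 2 = 0" "cmat \<gamma> $ 2 $ 1 = 0" "cmat \<gamma> $ 2 $ 2 = 1"
      using that(2) by (simp_all add: vec_eq_iff forall_2 block2_simps mat_def)
    have "det (cmat \<gamma>) = 1" using cmat_rotation[OF \<gamma>] by (simp add: rotation_matrix_def)
    then have "cmat \<gamma> $ 3 $ 3 = 1" by (simp add: det_3 b z)
    then have "cmat \<gamma> = mat 1" using b z by (simp add: vec_eq_iff forall_3 mat_def)
    then show ?thesis by (intro cmat_inject[OF \<gamma>]) (simp_all add: cmat_one)
  qed
  have "\<one>\<^bsub>cube_group\<^esub> \<in> S4_D4" unfolding cube_subgroups by (rule generate.one)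
  moreover have "block2 (cmat \<one>\<^bsub>cube_group\<^esub>) = mat 1"
    unfolding cmat_one by (simp add: vec_eq_iff forall_2 block2_simps mat_def)
  ultimately have "{\<gamma> \<in> S4_D4. block2 (cmat \<gamma>) = mat 1} = {\<one>\<^bsub>cube_group\<^esub>}" using ker by blast
  then show "kernel (cube_group\<lparr>carrier := S4_D4\<rparr>) (O2\<lparr>carrier := O2_D 4\<rparr>) (\<lambda>\<gamma>. block2 (cmat \<gamma>)) = S4_Z1"
    by (simp add: kernel_def Z1 O2_simps)
qed

lemma id_epi: "id \<in> epi (O2\<lparr>carrier := K\<rparr>) (O2\<lparr>carrier := K\<rparr>)"
  by (auto simp: epi_def hom_def)

lemma id_kernel: "kernel (O2\<lparr>carrier := O2_D 4\<rparr>) (O2\<lparr>carrier := O2_D 4\<rparr>) id = O2_Z 1"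
proof -
  have "rot2 (2 * pi) = \<one>\<^bsub>O2\<^esub>" by (simp add: mat2_eq O2_simps)
  then have "O2_Z 1 = {\<one>\<^bsub>O2\<^esub>}" by (simp add: O2_Z_def o2.generate_one)
  moreover have "\<one>\<^bsub>O2\<^esub> \<in> O2_D 4" unfolding O2_D_def by (rule generate.one)
  ultimately show ?thesis by (auto simp: kernel_def)
qed

definition "ev1 = (vector [1, 0, 0] :: real ^ 3)"
definition "ev2 = (vector [0, 1, 0] :: real ^ 3)"
definition "ev3 = (vector [0, 0, 1] :: real ^ 3)"
definition "ev23 = (vector [0, 1, 1] :: real ^ 3)"

lemmas evs = ev1_def ev2_def ev3_def ev23_def

text \<open>As a tensor, \<open>(ev1, ev2)\<close> is the identity matrix of the plane, and an
  orthogonal matrix acting on both factors fixes it.\<close>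

lemma block2_fixdir:
  assumes "h \<in> axis_group" shows "fixdir (h, block2 (cmat h)) ev1 ev2"
proof -
  have "cmat h $ 3 $ 1 = 0" "cmat h $ 3 $ 2 = 0" using assms by (auto simp: axis_group_def)
  then show ?thesis using axis_group_rows[OF assms]
    by (simp add: fixdir_def evs block2_simps vec_eq_iff forall_3 matrix_vector_mult_def sum_3 mult.commute)
qed

lemma block2_one_dim:
  assumes ab: "\<And>h. h \<in> S4_D4 \<Longrightarrow> fixdir (h, block2 (cmat h)) a b"
  shows "\<exists>c. a = c *\<^sub>R ev1 \<and> b = c *\<^sub>R ev2"
proof -
  have "fixdir (vperm rz_mat, block2 rz_mat) a b" "fixdir (vperm sw_mat, block2 sw_mat) a b"
    using ab[of "vperm rz_mat"] ab[of "vperm sw_mat"] unfolding cube_subgroups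
    by (auto simp: cube_mats_in_group intro: generate.incl)
  then have "rz_mat *v (rz_mat $ 1 $ 1 *\<^sub>R a + rz_mat $ 1 $ 2 *\<^sub>R b) = a" "rz_mat *v (rz_mat $ 2 $ 1 *\<^sub>R a + rz_mat $ 2 $ 2 *\<^sub>R b) = b"
    "sw_mat *v (sw_mat $ 1 $ 1 *\<^sub>R a + sw_mat $ 1 $ 2 *\<^sub>R b) = a"
    by (simp_all add: fixdir_def cube_mats_in_group block2_simps)
  note e = this[unfolded vec_eq_iff forall_3 cube_mats]
  have "b $ 2 = a $ 1 \<and> - b $ 1 = a $ 2 \<and> - b $ 3 = a $ 3"
    using e(1) by (simp add: mat3_entries mat3_mult_vec)
  moreover have "- a $ 2 = b $ 1 \<and> a $ 1 = b $ 2 \<and> a $ 3 = b $ 3"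
    using e(2) by (simp add: mat3_entries mat3_mult_vec)
  moreover have "b $ 2 = a $ 1 \<and> b $ 1 = a $ 2 \<and> - b $ 3 = a $ 3"
    using e(3) by (simp add: mat3_entries mat3_mult_vec)
  ultimately have "b $ 2 = a $ 1" "a $ 2 = 0" "a $ 3 = 0" "b $ 1 = 0" "b $ 3 = 0" by linarith+
  then have "a = a $ 1 *\<^sub>R ev1 \<and> b = a $ 1 *\<^sub>R ev2"
    by (simp add: evs vec_eq_iff[of a] vec_eq_iff[of b] forall_3)
  then show ?thesis by blast
qed

section \<open>Conjugates and the count of branches\<close>

text \<open>The cyclic rotation runs through the three coordinate axes; the optional quarter turn
  \<open>rx_mat\<close> exchanges the two edge axes orthogonal to the first axis. Together they
  reach all six edge axes, and the first three elements reach all three face axes.\<close>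

definition conj_elem :: "nat \<Rightarrow> 8 \<Rightarrow> 8" where
  "conj_elem i = (if i mod 3 = 0 then \<one>\<^bsub>cube_group\<^esub> else if i mod 3 = 1 then vperm cy_mat
      else vperm cy_mat \<otimes>\<^bsub>cube_group\<^esub> vperm cy_mat)
    \<otimes>\<^bsub>cube_group\<^esub> (if i < 3 then \<one>\<^bsub>cube_group\<^esub> else vperm rx_mat)"

lemma conj_elem_in_group: "conj_elem i \<in> carrier cube_group"
  by (simp add: conj_elem_def cube_mats_in_group)

lemma conj_elem_apply:
  "cmat (conj_elem 0) *v x = x"
  "cmat (conj_elem 1) *v x = vector [x $ 3, x $ 1, x $ 2]"
  "cmat (conj_elem 2) *v x = vector [x $ 2, x $ 3, x $ 1]"
  "cmat (conj_elem 3) *v x = vector [x $ 1, - x $ 3, x $ 2]"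
  "cmat (conj_elem 4) *v x = vector [x $ 2, x $ 1, - x $ 3]"
  "cmat (conj_elem 5) *v x = vector [- x $ 3, x $ 2, x $ 1]"
  by (simp_all add: conj_elem_def cube_mats_in_group cmat_mult cmat_one matrix_vector_mul_assoc[symmetric])
    (simp_all add: cube_mats mat3_mult_vec vec_eq_iff forall_3)

lemma distinct_axes:
  assumes "i < 3" "j < 3" "i \<noteq> j"
  shows "\<exists>w. w \<bullet> (cmat (conj_elem i) *v ev1) = 0 \<and> w \<bullet> (cmat (conj_elem i) *v ev2) = 0 \<and>
      \<not> (w \<bullet> (cmat (conj_elem j) *v ev1) = 0 \<and> w \<bullet> (cmat (conj_elem j) *v ev2) = 0)"
    and "\<exists>w. w \<bullet> (cmat (conj_elem i) *v ev3) = 0 \<and> w \<bullet> (cmat (conj_elem i) *v 0) = 0 \<and>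
      \<not> (w \<bullet> (cmat (conj_elem j) *v ev3) = 0 \<and> w \<bullet> (cmat (conj_elem j) *v 0) = 0)"
proof -
  have "i = 0 \<or> i = 1 \<or> i = 2" "j = 0 \<or> j = 1 \<or> j = 2" using assms by auto
  \<comment> \<open>The witness is a rotated third axis: for planes the normal of the plane of
    \<open>i\<close>, for lines the axis of \<open>j\<close> itself.\<close>
  then have "(cmat (conj_elem i) *v ev3) \<bullet> (cmat (conj_elem i) *v ev1) = 0 \<and> (cmat (conj_elem i) *v ev3) \<bullet> (cmat (conj_elem i) *v ev2) = 0 \<and>
      \<not> ((cmat (conj_elem i) *v ev3) \<bullet> (cmat (conj_elem j) *v ev1) = 0 \<and> (cmat (conj_elem i) *v ev3) \<bullet> (cmat (conj_elem j) *v ev2) = 0)"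
    and "(cmat (conj_elem j) *v ev3) \<bullet> (cmat (conj_elem i) *v ev3) = 0 \<and> (cmat (conj_elem j) *v ev3) \<bullet> (cmat (conj_elem i) *v 0) = 0 \<and>
      \<not> ((cmat (conj_elem j) *v ev3) \<bullet> (cmat (conj_elem j) *v ev3) = 0 \<and> (cmat (conj_elem j) *v ev3) \<bullet> (cmat (conj_elem j) *v 0) = 0)"
    using assms(3) by (auto simp: conj_elem_apply[unfolded One_nat_def] evs inner_real3)
  then show "\<exists>w. w \<bullet> (cmat (conj_elem i) *v ev1) = 0 \<and> w \<bullet> (cmat (conj_elem i) *v ev2) = 0 \<and>
      \<not> (w \<bullet> (cmat (conj_elem j) *v ev1) = 0 \<and> w \<bullet> (cmat (conj_elem j) *v ev2) = 0)"
    and "\<exists>w. w \<bullet> (cmat (conj_elem i) *v ev3) = 0 \<and> w \<bullet> (cmat (conj_elem i) *v 0) = 0 \<and>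
      \<not> (w \<bullet> (cmat (conj_elem j) *v ev3) = 0 \<and> w \<bullet> (cmat (conj_elem j) *v 0) = 0)"
    by blast+
qed

text \<open>The witness is the part of \<open>wj\<close> orthogonal to \<open>wi\<close>. It is not
  orthogonal to \<open>wj\<close> because the two axes are not parallel, that is, Cauchy-Schwarz is
  strict; the \<open>4\<close> is the product of their squared lengths.\<close>

lemma distinct_edges:
  assumes "i < 6" "j < 6" "i \<noteq> j"
  shows "\<exists>w. w \<bullet> (cmat (conj_elem i) *v ev23) = 0 \<and> w \<bullet> (cmat (conj_elem i) *v 0) = 0 \<and>
      \<not> (w \<bullet> (cmat (conj_elem j) *v ev23) = 0 \<and> w \<bullet> (cmat (conj_elem j) *v 0) = 0)"
proof -
  define wi where "wi = cmat (conj_elem i) *v ev23"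
  define wj where "wj = cmat (conj_elem j) *v ev23"
  have "i = 0 \<or> i = 1 \<or> i = 2 \<or> i = 3 \<or> i = 4 \<or> i = 5" "j = 0 \<or> j = 1 \<or> j = 2 \<or> j = 3 \<or> j = 4 \<or> j = 5"
    using assms by auto
  then have "wi \<bullet> wi = 2 \<and> wj \<bullet> wj = 2 \<and> (wj \<bullet> wi)\<^sup>2 < 4"
    using assms(3) unfolding wi_def wj_def by (auto simp: conj_elem_apply[unfolded One_nat_def] evs inner_real3)
  then have "(wj - (wj \<bullet> wi / 2) *\<^sub>R wi) \<bullet> wi = 0" "(wj - (wj \<bullet> wi / 2) *\<^sub>R wi) \<bullet> wj \<noteq> 0"
    by (auto simp: inner_diff_left inner_commute[of wi wj] power2_eq_square)
  then show ?thesis unfolding wi_def wj_def by auto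
qed

text \<open>The neighbourhood in the claim is any admissible one, hence the universal
  quantification; the first conjunct shows that it is not vacuous for any \<open>q\<close>.\<close>

theorem theorem5p2:
  fixes c1 c2 \<alpha>o :: real and q :: "real \<Rightarrow> real"
  assumes "continuous_on UNIV q" "q 0 = 0" "(q has_real_derivative 0) (at 0)"
    and "-1.25 < c1" "c1 < 0" "0 < c2" "c2 < 1.25" "- c1 + 2 * c2 < 2"
    and "- c1 + 6 * c2 - 4 > (- c1 + 2 * c2 - 1) ^ 4"
    and "\<alpha>o = sqrt (- 2 * ln (- c1 + 2 * c2 - 1))"
  shows "(\<exists>\<rho> r. admissible c1 c2 q \<alpha>o \<rho> r) \<and>
    (\<forall>\<rho> r. admissible c1 c2 q \<alpha>o \<rho> r \<longrightarrow>
      bifurcation_point c1 c2 q \<alpha>o \<rho> r \<and>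
      at_least_branches c1 c2 q \<alpha>o \<rho> r 3
        (amalgamated_class S4_D4 S4_Z1 (O2\<lparr>carrier := O2_D 4\<rparr>) (O2_D 4) (O2_Z 1)) \<and>
      at_least_branches c1 c2 q \<alpha>o \<rho> r 6
        (amalgamated_class S4_D2 S4_D1 (integer_mod_group 2) (O2_D 2) (O2_D 1)) \<and>
      at_least_branches c1 c2 q \<alpha>o \<rho> r 3
        (amalgamated_class S4_D4 S4_Z4 (integer_mod_group 2) (O2_D 2) (O2_D 1)))"
proof -
  interpret cube_system c1 c2 \<alpha>o q by unfold_locales (use assms in auto)
  have D4c: "S4_D4 \<subseteq> carrier cube_group" using S4_D4_axis by (auto simp: axis_group_def)
  have D2c: "O2_D 2 \<subseteq> carrier O2" using O2_D2_epi(3) by (auto simp: diag_group_def)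
  have O4c: "O2_D 4 \<subseteq> carrier O2"
    unfolding O2_D_def by (rule o2.generate_incl) (simp add: rot2_in_O2 refl2_in_O2)
  have ev0: "ev1 \<noteq> 0" "ev3 \<noteq> 0" "ev23 \<noteq> 0" by (simp_all add: evs vec_eq_iff forall_3)
  note rz = cube_mats_in_group(1,2) and sw = cube_mats_in_group(3,4) and ed = cube_mats_in_group(5,6) and ee = cube_mats_in_group(7,8)
  have vals: "cmat (vperm rz_mat) *v ev3 = ev3" "cmat (vperm sw_mat) *v ev3 = - ev3"
    "cmat (vperm ed_mat) *v ev23 = ev23" "cmat (vperm ee_mat) *v ev23 = - ev23"
    unfolding rz(2) sw(2) ed(2) ee(2) unfolding cube_mats by (simp_all add: mat3_mult_vec evs vec_eq_iff forall_3)
  note edge = line_sign_epi[OF ed(1) ee(1) vals(3,4) ev0(3) cube_perm_relations(2,4), folded cube_subgroups]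
  note face = line_sign_epi[OF rz(1) sw(1) vals(1,2) ev0(2) cube_perm_relations(1,3), folded cube_subgroups]
  have "bifurcation_point c1 c2 q \<alpha>o \<rho> r \<and>
      at_least_branches c1 c2 q \<alpha>o \<rho> r 3
        (amalgamated_class S4_D4 S4_Z1 (O2\<lparr>carrier := O2_D 4\<rparr>) (O2_D 4) (O2_Z 1)) \<and>
      at_least_branches c1 c2 q \<alpha>o \<rho> r 6
        (amalgamated_class S4_D2 S4_D1 (integer_mod_group 2) (O2_D 2) (O2_D 1)) \<and>
      at_least_branches c1 c2 q \<alpha>o \<rho> r 3
        (amalgamated_class S4_D4 S4_Z4 (integer_mod_group 2) (O2_D 2) (O2_D 1))"
    if "admissible c1 c2 q \<alpha>o \<rho> r" for \<rho> r
  proof -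
    have \<rho>: "0 < \<rho>" "\<rho> < \<alpha>o" "0 < r" using that by (auto simp: admissible_def)
    have "bifurcation_point c1 c2 q \<alpha>o \<rho> r \<and>
      at_least_branches c1 c2 q \<alpha>o \<rho> r 3
        (amalgamated_class S4_D4 S4_Z1 (O2\<lparr>carrier := O2_D 4\<rparr>) (O2_D 4) (O2_Z 1))"
    \<comment> \<open>The quotient is realized as \<open>O2_D 4\<close> itself: \<open>id\<close>
      serves on the side of \<open>O(2)\<close>, so the subgroup consists of the rotations paired
      with their own plane blocks.\<close>
    proof (rule at_least_branches_conjugates[where \<phi> = "\<lambda>\<gamma>. block2 (cmat \<gamma>)" and \<psi> = id
          and ?a0.0 = ev1 and ?b0.0 = ev2 and \<gamma> = conj_elem])
      show "fixdir (h, k) ev1 ev2" if "h \<in> S4_D4" "k \<in> O2_D 4" "block2 (cmat h) = id k" for h k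
        using block2_fixdir[of h] S4_D4_axis that by auto
      show "\<exists>c. a = c *\<^sub>R ev1 \<and> b = c *\<^sub>R ev2"
        if ab: "\<And>h k. h \<in> S4_D4 \<Longrightarrow> k \<in> O2_D 4 \<Longrightarrow> block2 (cmat h) = id k \<Longrightarrow> fixdir (h, k) a b" for a b
        using block2_image by (intro block2_one_dim ab) auto
    qed (rule D4c O4c block2_epi id_epi id_kernel ev0 conj_elem_in_group distinct_axes(1) \<rho>; (assumption+)?)+
    moreover have "bifurcation_point c1 c2 q \<alpha>o \<rho> r \<and>
      at_least_branches c1 c2 q \<alpha>o \<rho> r 6
        (amalgamated_class S4_D2 S4_D1 (integer_mod_group 2) (O2_D 2) (O2_D 1))"
    proof (rule at_least_branches_conjugates[where \<phi> = "sign_hom (line_sign ev23)" and \<psi> = "sign_hom (\<lambda>k. k $ 1 $ 1)"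
          and ?a0.0 = ev23 and ?b0.0 = 0 and \<gamma> = conj_elem])
      show "S4_D2 \<subseteq> carrier cube_group" using edge(3) by (auto simp: line_group_def)
      show "fixdir (h, k) ev23 0" if "h \<in> S4_D2" "k \<in> O2_D 2" "sign_hom (line_sign ev23) h = sign_hom (\<lambda>k. k $ 1 $ 1) k" for h k
        using that edge(3) O2_D2_epi(3) by (intro line_fixdir) auto
      show "\<exists>c. a = c *\<^sub>R ev23 \<and> b = c *\<^sub>R 0"
        if ab: "\<And>h k. h \<in> S4_D2 \<Longrightarrow> k \<in> O2_D 2 \<Longrightarrow> sign_hom (line_sign ev23) h = sign_hom (\<lambda>k. k $ 1 $ 1) k \<Longrightarrow> fixdir (h, k) a b" for a b
      proof -
        have "b = 0" "ed_mat *v a = a" using line_one_dim[OF ab[unfolded cube_subgroups] vals(3)] by (simp_all add: ed)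
        from this(2) have "(ed_mat *v a) $ 1 = a $ 1" "(ed_mat *v a) $ 2 = a $ 2" by simp_all
        then have "a $ 1 = 0" "a $ 3 = a $ 2" by (simp_all add: cube_mats mat3_mult_vec)
        then have "a = a $ 2 *\<^sub>R ev23 \<and> b = a $ 2 *\<^sub>R 0"
          using \<open>b = 0\<close> by (simp add: evs vec_eq_iff[of a] forall_3)
        then show ?thesis by blast
      qed
    qed (rule D2c edge O2_D2_epi ev0 conj_elem_in_group distinct_edges \<rho>; (assumption+)?)+
    moreover have "bifurcation_point c1 c2 q \<alpha>o \<rho> r \<and>
      at_least_branches c1 c2 q \<alpha>o \<rho> r 3
        (amalgamated_class S4_D4 S4_Z4 (integer_mod_group 2) (O2_D 2) (O2_D 1))"
    proof (rule at_least_branches_conjugates[where \<phi> = "sign_hom (line_sign ev3)" and \<psi> = "sign_hom (\<lambda>k. k $ 1 $ 1)"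
          and ?a0.0 = ev3 and ?b0.0 = 0 and \<gamma> = conj_elem])
      show "fixdir (h, k) ev3 0" if "h \<in> S4_D4" "k \<in> O2_D 2" "sign_hom (line_sign ev3) h = sign_hom (\<lambda>k. k $ 1 $ 1) k" for h k
        using that face(3) O2_D2_epi(3) by (intro line_fixdir) auto
      show "\<exists>c. a = c *\<^sub>R ev3 \<and> b = c *\<^sub>R 0"
        if ab: "\<And>h k. h \<in> S4_D4 \<Longrightarrow> k \<in> O2_D 2 \<Longrightarrow> sign_hom (line_sign ev3) h = sign_hom (\<lambda>k. k $ 1 $ 1) k \<Longrightarrow> fixdir (h, k) a b" for a b
      proof -
        have "b = 0" "rz_mat *v a = a" using line_one_dim[OF ab[unfolded cube_subgroups] vals(1)] by (simp_all add: rz)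
        from this(2) have "(rz_mat *v a) $ 1 = a $ 1" "(rz_mat *v a) $ 2 = a $ 2" by simp_all
        then have "- a $ 2 = a $ 1" "a $ 1 = a $ 2" by (simp_all add: cube_mats mat3_mult_vec)
        then have "a $ 1 = 0" "a $ 2 = 0" by linarith+
        then have "a = a $ 3 *\<^sub>R ev3 \<and> b = a $ 3 *\<^sub>R 0"
          using \<open>b = 0\<close> by (simp add: evs vec_eq_iff[of a] forall_3)
        then show ?thesis by blast
      qed
    qed (rule D4c D2c face O2_D2_epi ev0 conj_elem_in_group distinct_axes(2) \<rho>; (assumption+)?)+
    ultimately show ?thesis by blast
  qed
  then show ?thesis using admissible_exists by blast
qed

end
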